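(* For every simple matroid $M$ on a finite ground set, the Chow ring $R = \underline{\mathrm{CH}}(M)$ has a rational Poincaré series; that is, the formal power series $\mathrm{P}^R_{\mathbb{Q}}(t) = \sum_{i \ge 0} \dim_{\mathbb{Q}} \mathrm{Tor}^R_i(\mathbb{Q},\mathbb{Q})\, t^i$ is (the expansion of) a rational function of $t$.
   Context: Let $M$ be a simple matroid (no loops, no parallel elements) on a finite set $E$. The Chow ring of $M$ is the quotient ring $$\underline{\mathrm{CH}}(M) = \mathbb{Q}[x_F \mid F \text{ a nonempty flat of } M]\,/\,(\underline{I}_M + \underline{J}_M),$$ where $\underline{I}_M = \left(\sum_{F \ni i} x_F \mid i \in E\right)$ (for each $i$, the sum is over all flats $F$ containing $i$) and $\underline{J}_M = (x_F x_G \mid F, G \text{ incomparable nonempty flats of } M)$. It is graded with every $x_F$ in degree $1$, and $\mathbb{Q}$ is regarded as an $R$-module via $\mathbb{Q} = R/R_+$, where $R_+$ is the ideal generated by the elements of positive degree. *)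

theory Defs
  imports
    "Jordan_Normal_Form.VS_Connect"
    "HOL-Algebra.QuotRing"
    "HOL-Library.Poly_Mapping"
    "HOL-Computational_Algebra.Polynomial_FPS"
begin

section \<open>Matroids\<close>

locale matroid =
  fixes E :: "'a set" and indep :: "'a set \<Rightarrow> bool"
  assumes finite_ground: "finite E"
    and indep_subset_ground: "indep X \<Longrightarrow> X \<subseteq> E"
    and indep_empty: "indep {}"
    and indep_subset: "indep X \<Longrightarrow> Y \<subseteq> X \<Longrightarrow> indep Y"
    and indep_augment: "indep X \<Longrightarrow> indep Y \<Longrightarrow> card X < card Y \<Longrightarrow>
      \<exists>y \<in> Y - X. indep (insert y X)"

definition matroid_loop :: "'a set \<Rightarrow> ('a set \<Rightarrow> bool) \<Rightarrow> 'a \<Rightarrow> bool"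
  where "matroid_loop E indep e \<longleftrightarrow> e \<in> E \<and> \<not> indep {e}"

definition matroid_parallel :: "'a set \<Rightarrow> ('a set \<Rightarrow> bool) \<Rightarrow> 'a \<Rightarrow> 'a \<Rightarrow> bool"
  where "matroid_parallel E indep e f \<longleftrightarrow> e \<in> E \<and> f \<in> E \<and> e \<noteq> f \<and>
    \<not> matroid_loop E indep e \<and> \<not> matroid_loop E indep f \<and> \<not> indep {e, f}"

locale simple_matroid = matroid +
  assumes no_loops: "\<not> matroid_loop E indep e"
    and no_parallel: "\<not> matroid_parallel E indep e f"

definition matroid_rank :: "('a set \<Rightarrow> bool) \<Rightarrow> 'a set \<Rightarrow> nat"
  where "matroid_rank indep X = Max (card ` {Y. Y \<subseteq> X \<and> indep Y})"

definition flat :: "'a set \<Rightarrow> ('a set \<Rightarrow> bool) \<Rightarrow> 'a set \<Rightarrow> bool"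
  where "flat E indep F \<longleftrightarrow>
    F \<subseteq> E \<and> (\<forall>e \<in> E - F. matroid_rank indep F < matroid_rank indep (insert e F))"

definition nonempty_flats :: "'a set \<Rightarrow> ('a set \<Rightarrow> bool) \<Rightarrow> 'a set set"
  where "nonempty_flats E indep = {F. flat E indep F \<and> F \<noteq> {}}"


section \<open>Polynomial rings\<close>

text \<open>A polynomial is a finitely supported function from monomials to coefficients, a monomial
  a finitely supported function from variables to exponents. The type provides the ring
  operations; \<open>poly_ring V\<close> is the subring of polynomials in the variables from \<open>V\<close>.\<close>

type_synonym ('v, 'k) mvpoly = "('v \<Rightarrow>\<^sub>0 nat) \<Rightarrow>\<^sub>0 'k"

definition poly_ring :: "'v set \<Rightarrow> ('v, 'k :: comm_ring_1) mvpoly ring"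
  where "poly_ring V =
    \<lparr>carrier = {p. \<forall>m \<in> Poly_Mapping.keys p. Poly_Mapping.keys m \<subseteq> V},
     monoid.mult = (*), one = 1, zero = 0, add = (+)\<rparr>"

definition pvar :: "'v \<Rightarrow> ('v, 'k :: comm_ring_1) mvpoly"
  where "pvar v = Poly_Mapping.single (Poly_Mapping.single v 1) 1"

definition pconst :: "'k :: comm_ring_1 \<Rightarrow> ('v, 'k) mvpoly"
  where "pconst c = Poly_Mapping.single 0 c"

definition homogeneous :: "nat \<Rightarrow> ('v, 'k :: comm_ring_1) mvpoly \<Rightarrow> bool"
  where "homogeneous d p \<longleftrightarrow>
    (\<forall>m \<in> Poly_Mapping.keys p. (\<Sum>v \<in> Poly_Mapping.keys m. Poly_Mapping.lookup m v) = d)"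


section \<open>The Chow ring\<close>

abbreviation chow_poly_ring :: "'a set \<Rightarrow> ('a set \<Rightarrow> bool) \<Rightarrow> ('a set, rat) mvpoly ring"
  where "chow_poly_ring E indep \<equiv> poly_ring (nonempty_flats E indep)"

definition chow_I :: "'a set \<Rightarrow> ('a set \<Rightarrow> bool) \<Rightarrow> ('a set, rat) mvpoly set"
  where "chow_I E indep = Idl\<^bsub>chow_poly_ring E indep\<^esub>
    {\<Sum>F \<in> {F \<in> nonempty_flats E indep. i \<in> F}. pvar F | i. i \<in> E}"

definition chow_J :: "'a set \<Rightarrow> ('a set \<Rightarrow> bool) \<Rightarrow> ('a set, rat) mvpoly set"
  where "chow_J E indep = Idl\<^bsub>chow_poly_ring E indep\<^esub>
    {pvar F * pvar G | F G. F \<in> nonempty_flats E indep \<and> G \<in> nonempty_flats E indep \<and>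
       \<not> F \<subseteq> G \<and> \<not> G \<subseteq> F}"

definition chow_ideal :: "'a set \<Rightarrow> ('a set \<Rightarrow> bool) \<Rightarrow> ('a set, rat) mvpoly set"
  where "chow_ideal E indep = chow_I E indep <+>\<^bsub>chow_poly_ring E indep\<^esub> chow_J E indep"

definition chow_ring :: "'a set \<Rightarrow> ('a set \<Rightarrow> bool) \<Rightarrow> ('a set, rat) mvpoly set ring"
  where "chow_ring E indep = chow_poly_ring E indep Quot chow_ideal E indep"

definition chow_proj ::
    "'a set \<Rightarrow> ('a set \<Rightarrow> bool) \<Rightarrow> ('a set, rat) mvpoly \<Rightarrow> ('a set, rat) mvpoly set"
  where "chow_proj E indep p = chow_ideal E indep +>\<^bsub>chow_poly_ring E indep\<^esub> p"

text \<open>The homogeneous elements of degree \<open>d\<close> of the Chow ring are the classes of the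
  homogeneous polynomials of degree \<open>d\<close>.\<close>

definition chow_irrelevant :: "'a set \<Rightarrow> ('a set \<Rightarrow> bool) \<Rightarrow> ('a set, rat) mvpoly set set"
  where "chow_irrelevant E indep = Idl\<^bsub>chow_ring E indep\<^esub>
    {chow_proj E indep p | p d.
       p \<in> carrier (chow_poly_ring E indep) \<and> homogeneous d p \<and> 0 < d}"

definition chow_scalar :: "'a set \<Rightarrow> ('a set \<Rightarrow> bool) \<Rightarrow> rat \<Rightarrow> ('a set, rat) mvpoly set"
  where "chow_scalar E indep c = chow_proj E indep (pconst c)"


section \<open>Modules\<close>

text \<open>Module records extend ring records; following the convention of the VectorSpace entry, the
  irrelevant fields \<open>mult\<close> and \<open>one\<close> are filled with zero.\<close>

text \<open>The quotient ring \<open>R / I\<close> as an \<open>R\<close>-module.\<close>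

definition quot_ring_module :: "('r, 'm) ring_scheme \<Rightarrow> 'r set \<Rightarrow> ('r, 'r set) module"
  where "quot_ring_module R I =
    \<lparr>carrier = carrier (R Quot I), monoid.mult = (\<lambda>_ _. \<zero>\<^bsub>R Quot I\<^esub>), one = \<zero>\<^bsub>R Quot I\<^esub>,
     zero = \<zero>\<^bsub>R Quot I\<^esub>, add = add (R Quot I),
     module.smult = (\<lambda>r X. (I +>\<^bsub>R\<^esub> r) \<otimes>\<^bsub>R Quot I\<^esub> X)\<rparr>"

definition quot_module :: "('r, 'b, 'm) module_scheme \<Rightarrow> 'b set \<Rightarrow> ('r, 'b set) module"
  where "quot_module M N =
    \<lparr>carrier = a_rcosets\<^bsub>M\<^esub> N, monoid.mult = (\<lambda>_ _. N), one = N, zero = N,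
     add = (\<lambda>X Y. X <+>\<^bsub>M\<^esub> Y),
     module.smult = (\<lambda>r X. \<Union>x \<in> X. N +>\<^bsub>M\<^esub> (r \<odot>\<^bsub>M\<^esub> x))\<rparr>"

text \<open>The free module on \<open>X\<close>; its elements take the value zero outside \<open>X\<close>.\<close>

definition free_module :: "('r, 'm) ring_scheme \<Rightarrow> 'x set \<Rightarrow> ('r, 'x \<Rightarrow> 'r) module"
  where "free_module R X =
    \<lparr>carrier = {f. (\<forall>x \<in> X. f x \<in> carrier R) \<and> (\<forall>x. x \<notin> X \<longrightarrow> f x = \<zero>\<^bsub>R\<^esub>) \<and>
                   finite {x. f x \<noteq> \<zero>\<^bsub>R\<^esub>}},
     monoid.mult = (\<lambda>_ _ _. \<zero>\<^bsub>R\<^esub>), one = (\<lambda>_. \<zero>\<^bsub>R\<^esub>), zero = (\<lambda>_. \<zero>\<^bsub>R\<^esub>),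
     add = (\<lambda>f g x. f x \<oplus>\<^bsub>R\<^esub> g x),
     module.smult = (\<lambda>r f x. r \<otimes>\<^bsub>R\<^esub> f x)\<rparr>"

definition free_basis :: "('r, 'm) ring_scheme \<Rightarrow> 'x \<Rightarrow> 'x \<Rightarrow> 'r"
  where "free_basis R x = (\<lambda>y. if y = x then \<one>\<^bsub>R\<^esub> else \<zero>\<^bsub>R\<^esub>)"

definition restrict_scalars ::
    "('k \<Rightarrow> 'r) \<Rightarrow> ('r, 'b, 'm) module_scheme \<Rightarrow> ('k, 'b) module"
  where "restrict_scalars \<phi> M =
    \<lparr>carrier = carrier M, monoid.mult = monoid.mult M, one = one M, zero = zero M, add = add M,
     module.smult = (\<lambda>c x. \<phi> c \<odot>\<^bsub>M\<^esub> x)\<rparr>"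


section \<open>Tensor products\<close>

definition tensor_relations ::
    "('r, 'm) ring_scheme \<Rightarrow> ('r, 'a, 'm1) module_scheme \<Rightarrow> ('r, 'b, 'm2) module_scheme \<Rightarrow>
     ('a \<times> 'b \<Rightarrow> 'r) set"
  where "tensor_relations R A B =
    (let F = free_module R (carrier A \<times> carrier B); e = (\<lambda>a b. free_basis R (a, b)) in
      {e (a \<oplus>\<^bsub>A\<^esub> a') b \<ominus>\<^bsub>F\<^esub> (e a b \<oplus>\<^bsub>F\<^esub> e a' b) | a a' b.
         a \<in> carrier A \<and> a' \<in> carrier A \<and> b \<in> carrier B} \<union>
      {e a (b \<oplus>\<^bsub>B\<^esub> b') \<ominus>\<^bsub>F\<^esub> (e a b \<oplus>\<^bsub>F\<^esub> e a b') | a b b'.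
         a \<in> carrier A \<and> b \<in> carrier B \<and> b' \<in> carrier B} \<union>
      {e (r \<odot>\<^bsub>A\<^esub> a) b \<ominus>\<^bsub>F\<^esub> r \<odot>\<^bsub>F\<^esub> e a b | r a b.
         r \<in> carrier R \<and> a \<in> carrier A \<and> b \<in> carrier B} \<union>
      {e a (r \<odot>\<^bsub>B\<^esub> b) \<ominus>\<^bsub>F\<^esub> r \<odot>\<^bsub>F\<^esub> e a b | r a b.
         r \<in> carrier R \<and> a \<in> carrier A \<and> b \<in> carrier B})"

definition tensor_kernel ::
    "('r, 'm) ring_scheme \<Rightarrow> ('r, 'a, 'm1) module_scheme \<Rightarrow> ('r, 'b, 'm2) module_scheme \<Rightarrow>
     ('a \<times> 'b \<Rightarrow> 'r) set"
  where "tensor_kernel R A B =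
    LinearCombinations.module.span R (free_module R (carrier A \<times> carrier B)) (tensor_relations R A B)"

definition tensor ::
    "('r, 'm) ring_scheme \<Rightarrow> ('r, 'a, 'm1) module_scheme \<Rightarrow> ('r, 'b, 'm2) module_scheme \<Rightarrow>
     ('r, ('a \<times> 'b \<Rightarrow> 'r) set) module"
  where "tensor R A B =
    quot_module (free_module R (carrier A \<times> carrier B)) (tensor_kernel R A B)"

text \<open>For \<open>f : A \<rightarrow> A'\<close>, the map \<open>f \<otimes> id : A \<otimes> B \<rightarrow> A' \<otimes> B\<close>, sending the class of
  \<open>\<Sum> u(a, b) (a, b)\<close> to the class of \<open>\<Sum> u(a, b) (f a, b)\<close>.\<close>

definition tensor_map ::
    "('r, 'm) ring_scheme \<Rightarrow> ('r, 'a, 'm1) module_scheme \<Rightarrow> ('r, 'b, 'm2) module_scheme \<Rightarrow>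
     ('c \<Rightarrow> 'a) \<Rightarrow> ('c \<times> 'b \<Rightarrow> 'r) set \<Rightarrow> ('a \<times> 'b \<Rightarrow> 'r) set"
  where "tensor_map R A' B f X =
    (let F = free_module R (carrier A' \<times> carrier B) in
      \<Union>u \<in> X. tensor_kernel R A' B +>\<^bsub>F\<^esub>
        (\<Oplus>\<^bsub>F\<^esub>p \<in> {p. u p \<noteq> \<zero>\<^bsub>R\<^esub>}. u p \<odot>\<^bsub>F\<^esub> free_basis R (f (fst p), snd p)))"


section \<open>Homology and Tor\<close>

text \<open>A chain complex concentrated in degrees \<open>i \<ge> 0\<close> is given by modules \<open>C i\<close> and
  differentials \<open>d i : C (i + 1) \<rightarrow> C i\<close>; the differential leaving \<open>C 0\<close> is zero.\<close>

definition cycles ::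
    "(nat \<Rightarrow> ('r, 'b, 'm) module_scheme) \<Rightarrow> (nat \<Rightarrow> 'b \<Rightarrow> 'b) \<Rightarrow> nat \<Rightarrow> 'b set"
  where "cycles C d i =
    (case i of 0 \<Rightarrow> carrier (C 0) | Suc j \<Rightarrow> a_kernel (C (Suc j)) (C j) (d j))"

definition homology ::
    "(nat \<Rightarrow> ('r, 'b, 'm) module_scheme) \<Rightarrow> (nat \<Rightarrow> 'b \<Rightarrow> 'b) \<Rightarrow> nat \<Rightarrow> ('r, 'b set) module"
  where "homology C d i =
    quot_module ((C i)\<lparr>carrier := cycles C d i\<rparr>) (d i ` carrier (C (Suc i)))"

definition free_resolution ::
    "('r, 'm) ring_scheme \<Rightarrow> ('r, 'a, 'm1) module_scheme \<Rightarrow>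
     (nat \<Rightarrow> 'x set) \<Rightarrow> (nat \<Rightarrow> ('x \<Rightarrow> 'r) \<Rightarrow> ('x \<Rightarrow> 'r)) \<Rightarrow> (('x \<Rightarrow> 'r) \<Rightarrow> 'a) \<Rightarrow> bool"
  where "free_resolution R A X d \<epsilon> \<longleftrightarrow>
    (let F = (\<lambda>i. free_module R (X i)) in
      (\<forall>i. d i \<in> LinearCombinations.module_hom R (F (Suc i)) (F i)) \<and>
      \<epsilon> \<in> LinearCombinations.module_hom R (F 0) A \<and>
      \<epsilon> ` carrier (F 0) = carrier A \<and>
      a_kernel (F 0) A \<epsilon> = d 0 ` carrier (F 1) \<and>
      (\<forall>i. a_kernel (F (Suc i)) (F i) (d i) = d (Suc i) ` carrier (F (Suc (Suc i)))))"

text \<open>\<open>Tor\<^sub>i(A, B)\<close> is the homology of \<open>F \<otimes> B\<close> for a chosen free resolution \<open>F\<close> of \<open>A\<close>.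
  The bases of the resolution are taken in the type \<open>('r + 'a) list\<close>, which is large enough for
  every module \<open>A\<close> over every ring \<open>R\<close>: \<open>A\<close> and all free modules on subsets of this type have at
  most as many elements as this infinite type, so all successive kernels can be covered. Up to
  isomorphism the result does not depend on the choice.\<close>

definition chosen_resolution ::
    "('r, 'm) ring_scheme \<Rightarrow> ('r, 'a, 'm1) module_scheme \<Rightarrow>
     (nat \<Rightarrow> ('r + 'a) list set) \<times>
     (nat \<Rightarrow> (('r + 'a) list \<Rightarrow> 'r) \<Rightarrow> (('r + 'a) list \<Rightarrow> 'r))"
  where "chosen_resolution R A = (SOME (X, d). \<exists>\<epsilon>. free_resolution R A X d \<epsilon>)"

definition Tor ::
    "('r, 'm) ring_scheme \<Rightarrow> ('r, 'a, 'm1) module_scheme \<Rightarrow> ('r, 'b, 'm2) module_scheme \<Rightarrow>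
     nat \<Rightarrow> ('r, ((('r + 'a) list \<Rightarrow> 'r) \<times> 'b \<Rightarrow> 'r) set set) module"
  where "Tor R A B =
    (let (X, d) = chosen_resolution R A; F = (\<lambda>i. free_module R (X i)) in
      homology (\<lambda>i. tensor R (F i) B) (\<lambda>i. tensor_map R (F i) B (d i)))"


section \<open>Poincare series\<close>

text \<open>The coefficients are the dimensions over the rationals of the modules \<open>Tor\<^sub>i(K, K)\<close>, where
  \<open>\<phi>\<close> is the structure map making \<open>R\<close> an algebra over the rationals. The dimension is a natural
  number, hence meaningful only if these modules are finite-dimensional; for the Chow ring they
  are, since it is itself finite-dimensional.\<close>

definition poincare_series ::
    "('r, 'm) ring_scheme \<Rightarrow> (rat \<Rightarrow> 'r) \<Rightarrow> ('r, 'a, 'm1) module_scheme \<Rightarrow> rat fps"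
  where "poincare_series R \<phi> K =
    Abs_fps (\<lambda>i. of_nat (vectorspace.dim class_ring (restrict_scalars \<phi> (Tor R K K i))))"

definition rational_fps :: "'k :: field fps \<Rightarrow> bool"
  where "rational_fps P \<longleftrightarrow>
    (\<exists>p q. poly.coeff q 0 \<noteq> 0 \<and> P = fps_of_poly p / fps_of_poly q)"

definition chow_residue_field ::
    "'a set \<Rightarrow> ('a set \<Rightarrow> bool) \<Rightarrow>
     (('a set, rat) mvpoly set, ('a set, rat) mvpoly set set) module"
  where "chow_residue_field E indep =
    quot_ring_module (chow_ring E indep) (chow_irrelevant E indep)"

end

theory Submission
  imports Defs "HOL-Library.Countable"
begin

text \<open>There are finitely many ideals \<open>I(G, W)\<close> of the Chow ring, indexed by pairs of flats
  \<open>W \<subseteq> G\<close>: the ideal \<open>I(G, W)\<close> is generated by the variables of the flats not contained in \<open>G\<close> and of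
  the flats covered by \<open>G\<close> that contain \<open>W\<close>. Each of them is generated by a list of variables with
  linear quotients: the colon ideal of the variables before \<open>x\<^sub>K\<close> by \<open>x\<^sub>K\<close> is again of the form
  \<open>I(K, W')\<close>. That the colon ideal is not larger holds because \<open>x\<^sub>K\<close> embeds the ring of the
  interval below \<open>K\<close>, which is shown by adjoining the variables one by one, from the top of the lattice
  downwards, each step being a free extension like the cohomology of a blow-up.

  The maximal ideal is \<open>I(\<emptyset>, \<emptyset>)\<close>. Splicing the colon ideals together as in Schreyer's theorem yields
  a resolution of \<open>\<rat>\<close> whose matrices have linear entries, hence a minimal one. Its bases consist of the
  paths in a finite directed graph with the ideals as vertices, and the number of paths of given
  length satisfies a linear recurrence.\<close>

section \<open>Ideals and polynomials\<close>

text \<open>The obstacle is that the quotient by the variables listed before \<open>K\<close> no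
  longer has rank differences as its exponents: all listed flats of rank above \<open>k\<close>, and
  some of rank \<open>k\<close>, have disappeared. Injectivity of multiplication by
  \<open>x_K\<close> is therefore proved for abstract finite posets with an exponent function
  \<open>d\<close>, of which only a triangle inequality and a form of semimodularity are kept; both
  survive the deletions that occur. The second component \<open>W\<close> of a label records how far
  the listing of the flats of one rank had advanced. The listing runs along a flag of flats, so that
  every flat \<open>K'\<close> that contains \<open>W\<close> and is covered by \<open>K\<close>
  also lies below a flat listed earlier; comparing two linear relations then gives
  \<open>x_K' x_K = 0\<close>. Linearity of the resolution needs no theory of graded modules: as all
  generators have degree one, projecting to the degrees one and two turns an arbitrary lift into one
  with linear entries.\<close>

lemma poly_mapping_sum_monomials:
  "(\<Sum>m\<in>Poly_Mapping.keys p. Poly_Mapping.single m (Poly_Mapping.lookup p m)) = p"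
  by (rule poly_mapping_eqI) (auto simp: lookup_sum lookup_single when_def in_keys_iff)

text \<open>Ideals of a whole type, without carrier sets. The polynomial algebra is done in this
  form; \<open>genideal_poly_ring\<close> later translates it to the record-based rings.\<close>

inductive_set idl :: "'b::comm_ring_1 set \<Rightarrow> 'b set" for G where
  idl_zero: "0 \<in> idl G"
| idl_step: "g \<in> G \<Longrightarrow> p \<in> idl G \<Longrightarrow> q * g + p \<in> idl G"

lemma idl_base: "g \<in> G \<Longrightarrow> g \<in> idl G"
  using idl_step[of g G 0 1] by (simp add: idl_zero)

lemma idl_add: "p \<in> idl G \<Longrightarrow> q \<in> idl G \<Longrightarrow> p + q \<in> idl G"
  by (induction p rule: idl.induct) (auto simp: add.assoc intro: idl_step)

lemma idl_mult: "p \<in> idl G \<Longrightarrow> r * p \<in> idl G"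
proof (induction p rule: idl.induct)
  case (idl_step g p q)
  then show ?case using idl.idl_step[of g G "r * p" "r * q"] by (simp add: algebra_simps)
qed (simp add: idl_zero)

lemma idl_mult_right: "p \<in> idl G \<Longrightarrow> p * r \<in> idl G"
  using idl_mult[of p G r] by (simp add: mult.commute)

lemma idl_uminus: "p \<in> idl G \<Longrightarrow> - p \<in> idl G"
  using idl_mult[of p G "-1"] by simp

lemma idl_diff: "p \<in> idl G \<Longrightarrow> q \<in> idl G \<Longrightarrow> p - q \<in> idl G"
  using idl_add[of p G "- q"] by (simp add: idl_uminus)

lemma idl_sum: "(\<And>i. i \<in> A \<Longrightarrow> f i \<in> idl G) \<Longrightarrow> sum f A \<in> idl G"
  by (induction A rule: infinite_finite_induct) (auto simp: idl_zero idl_add)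

lemma idl_least:
  assumes "p \<in> idl G" "\<And>g. g \<in> G \<Longrightarrow> g \<in> M" "0 \<in> M"
    "\<And>a b. a \<in> M \<Longrightarrow> b \<in> M \<Longrightarrow> a + b \<in> M" "\<And>a r. a \<in> M \<Longrightarrow> r * a \<in> M"
  shows "p \<in> M"
  using assms(1) by (induction rule: idl.induct) (auto intro: assms)

lemma idl_subset:
  assumes "\<And>g. g \<in> G \<Longrightarrow> g \<in> idl H" "p \<in> idl G" shows "p \<in> idl H"
  using idl_least[OF assms(2,1)] idl_zero idl_add idl_mult by blast

lemma idl_mono: "G \<subseteq> H \<Longrightarrow> p \<in> idl G \<Longrightarrow> p \<in> idl H"
  using idl_subset idl_base by (metis subsetD)

lemma idl_hom:
  assumes "comm_ring_hom h" "\<And>g. g \<in> G \<Longrightarrow> h g \<in> idl H" "p \<in> idl G"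
  shows "h p \<in> idl H"
proof -
  interpret comm_ring_hom h by fact
  show ?thesis using assms(3)
    by (induction rule: idl.induct) (auto simp: hom_distribs idl_zero intro!: idl_add idl_mult assms(2))
qed

lemma idl_times:
  assumes "\<And>g. g \<in> G \<Longrightarrow> u * g \<in> idl H" "p \<in> idl G"
  shows "u * p \<in> idl H"
  using assms(2)
proof (induction rule: idl.induct)
  case (idl_step g p q)
  have "u * (q * g + p) = q * (u * g) + u * p" by (simp add: algebra_simps)
  then show ?case using idl_step idl_add idl_mult assms(1) by metis
qed (simp add: idl_zero)

lemma idl_cong_mem: "p - q \<in> idl G \<Longrightarrow> q \<in> idl G \<Longrightarrow> p \<in> idl G"
  using idl_add[of "p - q" G q] by simp

lemma idl_cong_mem': "p - q \<in> idl G \<Longrightarrow> p \<in> idl G \<Longrightarrow> q \<in> idl G"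
  using idl_diff[of "p" G "p - q"] by simp

text \<open>Congruence after multiplication by \<open>u\<close> is weaker than congruence of
  \<open>a\<close> and \<open>b\<close>, but it still passes to powers. In this way powers of a sum
  over an up-set are rewritten once a variable stands in front of them.\<close>

lemma idl_cong_power:
  assumes "u * a - u * b \<in> idl G"
  shows "u * a ^ n - u * b ^ n \<in> idl G"
proof (induction n)
  case (Suc n)
  have "u * a ^ Suc n - u * b ^ Suc n = a * (u * a ^ n - u * b ^ n) + b ^ n * (u * a - u * b)"
    by (simp add: algebra_simps)
  then show ?case using Suc assms by (metis idl_add idl_mult)
qed (simp add: idl_zero)

lemma idl_absorb:
  assumes "\<And>h. h \<in> H \<Longrightarrow> h \<in> idl G" shows "idl (G \<union> H) = idl G"
  using idl_subset[of "G \<union> H" G] idl_mono[of G "G \<union> H"] assms idl_base[of _ G] by blast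

lemma idl_union_cong:
  assumes "idl G = idl G'" shows "idl (G \<union> H) = idl (G' \<union> H)"
proof -
  have "p \<in> idl (G' \<union> H)" if "idl G = idl G'" "p \<in> idl (G \<union> H)" for p and G G' :: "'a set"
    using that(2) idl_mono[of G' "G' \<union> H"] that(1)
    by (auto elim!: idl_subset[rotated] intro: idl_base)
  then show ?thesis using assms by blast
qed


section \<open>Evaluation homomorphisms of multivariate polynomials\<close>

definition mon_eval :: "('v \<Rightarrow> 'b::comm_ring_1) \<Rightarrow> ('v \<Rightarrow>\<^sub>0 nat) \<Rightarrow> 'b"
  where "mon_eval s m = (\<Prod>v\<in>Poly_Mapping.keys m. s v ^ Poly_Mapping.lookup m v)"

definition mv_eval :: "('k::comm_ring_1 \<Rightarrow> 'b::comm_ring_1) \<Rightarrow> ('v \<Rightarrow> 'b) \<Rightarrow> ('v, 'k) mvpoly \<Rightarrow> 'b"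
  where "mv_eval c s p = (\<Sum>m\<in>Poly_Mapping.keys p. c (Poly_Mapping.lookup p m) * mon_eval s m)"

lemma mon_eval_superset:
  "finite A \<Longrightarrow> Poly_Mapping.keys m \<subseteq> A \<Longrightarrow> mon_eval s m = (\<Prod>v\<in>A. s v ^ Poly_Mapping.lookup m v)"
  unfolding mon_eval_def by (rule prod.mono_neutral_left) (auto simp: in_keys_iff)

lemma mon_eval_zero [simp]: "mon_eval s 0 = 1"
  by (simp add: mon_eval_def)

lemma mon_eval_add: "mon_eval s (m + n) = mon_eval s m * mon_eval s n"
proof -
  let ?A = "Poly_Mapping.keys m \<union> Poly_Mapping.keys n"
  have "mon_eval s (m + n) = (\<Prod>v\<in>?A. s v ^ Poly_Mapping.lookup (m + n) v)"
    using Poly_Mapping.keys_add[of m n] by (intro mon_eval_superset) auto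
  moreover have "mon_eval s m = (\<Prod>v\<in>?A. s v ^ Poly_Mapping.lookup m v)"
    "mon_eval s n = (\<Prod>v\<in>?A. s v ^ Poly_Mapping.lookup n v)"
    by (auto intro!: mon_eval_superset)
  ultimately show ?thesis by (simp add: lookup_add power_add prod.distrib)
qed

lemma mon_eval_single: "mon_eval s (Poly_Mapping.single v n) = s v ^ n"
  by (simp add: mon_eval_def)

context
  fixes c :: "'k::comm_ring_1 \<Rightarrow> 'b::comm_ring_1"
  assumes c: "comm_ring_hom c"
begin

interpretation c: comm_ring_hom c by (rule c)

lemma mv_eval_superset:
  "finite A \<Longrightarrow> Poly_Mapping.keys p \<subseteq> A \<Longrightarrow>
   mv_eval c s p = (\<Sum>m\<in>A. c (Poly_Mapping.lookup p m) * mon_eval s m)"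
  unfolding mv_eval_def by (rule sum.mono_neutral_left) (auto simp: in_keys_iff)

lemma mv_eval_add: "mv_eval c s (p + q) = mv_eval c s p + mv_eval c s q"
proof -
  let ?A = "Poly_Mapping.keys p \<union> Poly_Mapping.keys q"
  have "mv_eval c s (p + q) = (\<Sum>m\<in>?A. c (Poly_Mapping.lookup (p + q) m) * mon_eval s m)"
    using Poly_Mapping.keys_add[of p q] by (intro mv_eval_superset) auto
  moreover have "mv_eval c s p = (\<Sum>m\<in>?A. c (Poly_Mapping.lookup p m) * mon_eval s m)"
    "mv_eval c s q = (\<Sum>m\<in>?A. c (Poly_Mapping.lookup q m) * mon_eval s m)"
    by (auto intro!: mv_eval_superset)
  ultimately show ?thesis
    by (simp add: lookup_add hom_distribs algebra_simps sum.distrib)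
qed

lemma mv_eval_zero: "mv_eval c s 0 = 0"
  by (simp add: mv_eval_def)

lemma mv_eval_sum: "mv_eval c s (sum f A) = (\<Sum>i\<in>A. mv_eval c s (f i))"
  by (induction A rule: infinite_finite_induct) (auto simp: mv_eval_add mv_eval_zero)

lemma mv_eval_single: "mv_eval c s (Poly_Mapping.single m a) = c a * mon_eval s m"
  by (cases "a = 0") (auto simp: mv_eval_def)

lemma mv_eval_mult: "mv_eval c s (p * q) = mv_eval c s p * mv_eval c s q"
proof -
  have 1: "mv_eval c s (Poly_Mapping.single m a * q) = mv_eval c s (Poly_Mapping.single m a) * mv_eval c s q" for m a
  proof -
    have q: "q = (\<Sum>n\<in>Poly_Mapping.keys q. Poly_Mapping.single n (Poly_Mapping.lookup q n))"
      by (simp add: poly_mapping_sum_monomials)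
    have "mv_eval c s (Poly_Mapping.single m a * (\<Sum>n\<in>Poly_Mapping.keys q. Poly_Mapping.single n (Poly_Mapping.lookup q n)))
      = mv_eval c s (Poly_Mapping.single m a) * mv_eval c s (\<Sum>n\<in>Poly_Mapping.keys q. Poly_Mapping.single n (Poly_Mapping.lookup q n))"
      by (simp add: sum_distrib_left mult_single mv_eval_sum mv_eval_single mon_eval_add hom_distribs algebra_simps)
    then show ?thesis using q by simp
  qed
  have p: "p = (\<Sum>n\<in>Poly_Mapping.keys p. Poly_Mapping.single n (Poly_Mapping.lookup p n))"
    by (simp add: poly_mapping_sum_monomials)
  have "mv_eval c s ((\<Sum>n\<in>Poly_Mapping.keys p. Poly_Mapping.single n (Poly_Mapping.lookup p n)) * q)
      = mv_eval c s (\<Sum>n\<in>Poly_Mapping.keys p. Poly_Mapping.single n (Poly_Mapping.lookup p n)) * mv_eval c s q"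
    by (simp add: sum_distrib_right mv_eval_sum 1)
  then show ?thesis using p by simp
qed

lemma mv_eval_pconst: "mv_eval c s (pconst a) = c a"
  by (simp add: pconst_def mv_eval_single)

lemma mv_eval_pvar: "mv_eval c s (pvar v) = s v"
  by (simp add: pvar_def mv_eval_single mon_eval_single)

lemma mv_eval_one: "mv_eval c s 1 = 1"
  using mv_eval_pconst[of s 1] by (simp add: pconst_def)

lemma mv_eval_hom: "comm_ring_hom (mv_eval c s)"
  by unfold_locales (auto simp: mv_eval_add mv_eval_mult mv_eval_zero mv_eval_one)

end

lemma pconst_add: "pconst (a + b) = pconst a + pconst b"
  by (simp add: pconst_def single_add)

lemma pconst_mult: "pconst (a * b) = pconst a * pconst b"
  by (simp add: pconst_def mult_single)

lemma pconst_hom: "comm_ring_hom (pconst :: 'k::comm_ring_1 \<Rightarrow> ('v, 'k) mvpoly)"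
  by unfold_locales (auto simp: pconst_add pconst_mult, auto simp: pconst_def)

section \<open>Polynomials in a given set of variables, and substitutions\<close>

definition polys :: "'v set \<Rightarrow> ('v, 'k::comm_ring_1) mvpoly set"
  where "polys S = {p. \<forall>m\<in>Poly_Mapping.keys p. Poly_Mapping.keys m \<subseteq> S}"

lemma pvar_power: "pvar v ^ n = (Poly_Mapping.single (Poly_Mapping.single v n) 1 :: ('v, 'k::comm_ring_1) mvpoly)"
  by (induction n) (auto simp: pvar_def mult_single single_add[symmetric] simp flip: single_one)

lemma mon_eval_pvar: "mon_eval pvar m = (Poly_Mapping.single m 1 :: ('v, 'k::comm_ring_1) mvpoly)"
proof -
  have *: "(\<Prod>v\<in>A. (Poly_Mapping.single (Poly_Mapping.single v (f v)) 1 :: ('v, 'k) mvpoly))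
    = Poly_Mapping.single (\<Sum>v\<in>A. Poly_Mapping.single v (f v)) 1" for A and f :: "'v \<Rightarrow> nat"
    by (induction A rule: infinite_finite_induct) (auto simp: mult_single)
  show ?thesis
    by (simp add: mon_eval_def pvar_power * poly_mapping_sum_monomials)
qed

lemma single_decomp: "Poly_Mapping.single m a = pconst a * mon_eval pvar m"
  by (simp add: mon_eval_pvar pconst_def mult_single)

lemma polys_UNIV [simp]: "p \<in> polys UNIV"
  by (simp add: polys_def)

lemma polys_pconst [simp]: "pconst a \<in> polys S"
  by (auto simp: polys_def pconst_def)

lemma polys_zero [simp]: "0 \<in> polys S"
  by (auto simp: polys_def)

lemma polys_one [simp]: "1 \<in> polys S"
  using polys_pconst[of 1 S] by (simp add: pconst_def)

lemma polys_pvar: "v \<in> S \<Longrightarrow> pvar v \<in> polys S"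
  by (auto simp: polys_def pvar_def)

lemma polys_add: "p \<in> polys S \<Longrightarrow> q \<in> polys S \<Longrightarrow> p + q \<in> polys S"
  using Poly_Mapping.keys_add[of p q] unfolding polys_def by blast

lemma polys_mult: "p \<in> polys S \<Longrightarrow> q \<in> polys S \<Longrightarrow> p * q \<in> polys S"
  unfolding polys_def
  by (auto dest!: subsetD[OF keys_mult] subsetD[OF Poly_Mapping.keys_add])

lemma polys_uminus: "p \<in> polys S \<Longrightarrow> - p \<in> polys S"
  by (auto simp: polys_def)

lemma polys_diff: "p \<in> polys S \<Longrightarrow> q \<in> polys S \<Longrightarrow> p - q \<in> polys S"
  using polys_add[of p S "- q"] polys_uminus[of q S] by simp

lemma polys_power: "p \<in> polys S \<Longrightarrow> p ^ n \<in> polys S"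
  by (induction n) (auto intro: polys_mult)

lemma polys_sum: "(\<And>i. i \<in> A \<Longrightarrow> f i \<in> polys S) \<Longrightarrow> sum f A \<in> polys S"
  by (induction A rule: infinite_finite_induct) (auto intro: polys_add)

lemma polys_prod: "(\<And>i. i \<in> A \<Longrightarrow> f i \<in> polys S) \<Longrightarrow> prod f A \<in> polys S"
  by (induction A rule: infinite_finite_induct) (auto intro: polys_mult)

lemma polys_mono: "S \<subseteq> T \<Longrightarrow> p \<in> polys S \<Longrightarrow> p \<in> polys T"
  by (auto simp: polys_def)

lemma polys_induct [consumes 1, case_names const var add mult]:
  assumes p: "p \<in> polys S" and const: "\<And>a. P (pconst a)" and var: "\<And>v. v \<in> S \<Longrightarrow> P (pvar v)"
    and add: "\<And>p q. p \<in> polys S \<Longrightarrow> q \<in> polys S \<Longrightarrow> P p \<Longrightarrow> P q \<Longrightarrow> P (p + q)" and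
    mult: "\<And>p q. p \<in> polys S \<Longrightarrow> q \<in> polys S \<Longrightarrow> P p \<Longrightarrow> P q \<Longrightarrow> P (p * q)"
  shows "P p"
proof -
  have one: "P 1" using const[of 1] by (auto simp: pconst_def)
  have pw: "P (pvar v ^ n)" if "v \<in> S" for v n
    using that by (induction n) (auto simp: one intro: mult var polys_pvar polys_power)
  have pr: "P (\<Prod>v\<in>A. pvar v ^ f v)" if "finite A" "A \<subseteq> S" for A f
    using that
    by (induction A rule: finite_induct)
      (auto simp: one intro!: mult pw polys_pvar polys_power polys_prod)
  have s: "P (Poly_Mapping.single m a)" if "Poly_Mapping.keys m \<subseteq> S" for m a
    using that unfolding single_decomp mon_eval_def
    by (auto intro!: mult const pr polys_prod polys_power polys_pvar)
  have sp: "Poly_Mapping.single m a \<in> polys S" if "Poly_Mapping.keys m \<subseteq> S" for m and a :: 'b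
    using that by (auto simp: polys_def)
  have z: "P 0" using const[of 0] by (auto simp: pconst_def)
  have "P (\<Sum>m\<in>A. Poly_Mapping.single m (Poly_Mapping.lookup p m))"
    if "finite A" "A \<subseteq> Poly_Mapping.keys p" for A
    using that
  proof (induction A rule: finite_induct)
    case (insert m A)
    then have k: "Poly_Mapping.keys n \<subseteq> S" if "n \<in> insert m A" for n using p that by (auto simp: polys_def)
    then show ?case using insert by (auto intro!: add s sp polys_sum)
  qed (simp add: z)
  from this[of "Poly_Mapping.keys p"] show ?thesis by (simp add: poly_mapping_sum_monomials)
qed

lemma comm_ring_homs_eq_on_polys:
  assumes f: "comm_ring_hom f" and g: "comm_ring_hom g"
    and "p \<in> polys S" "\<And>a. f (pconst a) = g (pconst a)" "\<And>v. v \<in> S \<Longrightarrow> f (pvar v) = g (pvar v)"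
  shows "f p = g p"
proof -
  interpret f: comm_ring_hom f by fact
  interpret g: comm_ring_hom g by fact
  show ?thesis using assms(3)
    by (induction rule: polys_induct) (auto simp: assms hom_distribs)
qed

text \<open>The retraction onto \<open>polys S\<close> that sets all other variables to zero. It
  realizes the quotient by a set of variables, and it turns coefficients in arbitrary variables into
  coefficients in \<open>polys S\<close>.\<close>

definition restr :: "'v set \<Rightarrow> ('v, 'k::comm_ring_1) mvpoly \<Rightarrow> ('v, 'k) mvpoly"
  where "restr S = mv_eval pconst (\<lambda>v. if v \<in> S then pvar v else 0)"

lemma restr_hom: "comm_ring_hom (restr S)"
  unfolding restr_def by (rule mv_eval_hom[OF pconst_hom])

lemma restr_pvar: "restr S (pvar v) = (if v \<in> S then pvar v else 0)"
  unfolding restr_def by (simp add: mv_eval_pvar[OF pconst_hom])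

lemma restr_pconst: "restr S (pconst a) = pconst a"
  unfolding restr_def by (simp add: mv_eval_pconst[OF pconst_hom])

lemma id_hom: "comm_ring_hom (\<lambda>x :: 'b::comm_ring_1. x)"
  by unfold_locales auto

lemma restr_id: "p \<in> polys S \<Longrightarrow> restr S p = p"
  by (rule comm_ring_homs_eq_on_polys[OF restr_hom id_hom]) (auto simp: restr_pconst restr_pvar)

lemma restr_in_polys: "restr S p \<in> polys (S \<inter> U)" if "p \<in> polys U"
proof -
  interpret comm_ring_hom "restr S" by (rule restr_hom)
  show ?thesis using that
    by (induction rule: polys_induct)
      (auto simp: restr_pconst restr_pvar hom_distribs intro: polys_add polys_mult polys_pvar)
qed

lemma restr_diff: "p \<in> polys U \<Longrightarrow> p - restr S p \<in> idl (pvar ` (U - S))"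
proof (induction rule: polys_induct)
  interpret comm_ring_hom "restr S" by (rule restr_hom)
  { case (const a) then show ?case by (simp add: restr_pconst idl_zero) }
  { case (var v) then show ?case by (auto simp: restr_pvar idl_zero intro: idl_base) }
  { case (add p q)
    have "p + q - restr S (p + q) = (p - restr S p) + (q - restr S q)" by (simp add: hom_distribs)
    then show ?case using add idl_add by metis }
  { case (mult p q)
    have "p * q - restr S (p * q) = q * (p - restr S p) + restr S p * (q - restr S q)"
      by (simp add: hom_distribs algebra_simps)
    then show ?case using mult idl_add idl_mult by metis }
qed

text \<open>The constant coefficient is the value at the origin, hence multiplicative.\<close>

lemma lookup_zero_hom: "comm_ring_hom (\<lambda>p :: ('v, 'k::comm_ring_1) mvpoly. Poly_Mapping.lookup p 0)"
proof -
  have e: "Poly_Mapping.lookup p 0 = mv_eval (\<lambda>a. a) (\<lambda>_. 0) p" for p :: "('v, 'k) mvpoly"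
  proof -
    have z: "mon_eval (\<lambda>_. 0) m = (if m = 0 then 1 else 0 :: 'k)" for m :: "'v \<Rightarrow>\<^sub>0 nat"
    proof (cases "m = 0")
      case False
      then obtain v where "v \<in> Poly_Mapping.keys m" by (metis all_not_in_conv keys_eq_empty)
      then have "(\<Prod>v\<in>Poly_Mapping.keys m. 0 ^ Poly_Mapping.lookup m v) = (0 :: 'k)"
        by (intro prod_zero) (auto simp: in_keys_iff zero_power intro!: bexI[of _ v])
      then show ?thesis using False unfolding mon_eval_def by (simp del: power_0_left)
    qed simp
    have "mv_eval (\<lambda>a. a) (\<lambda>_. 0) p = (\<Sum>m\<in>insert 0 (Poly_Mapping.keys p). Poly_Mapping.lookup p m * (if m = 0 then 1 else 0))"
      using mv_eval_superset[OF id_hom, of "insert 0 (Poly_Mapping.keys p)" p "\<lambda>_. 0"] by (simp add: z subset_insertI)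
    also have "\<dots> = Poly_Mapping.lookup p 0"
      by (simp add: if_distrib[of "\<lambda>x. _ * x"] sum.delta cong: if_cong)
    finally show ?thesis by simp
  qed
  show ?thesis unfolding e by (rule mv_eval_hom[OF id_hom])
qed

lemma restr_empty: "restr {} p = pconst (Poly_Mapping.lookup p 0)"
proof -
  have nz: "Poly_Mapping.single v (1::nat) \<noteq> 0" for v :: 'a
    by (metis lookup_single_eq lookup_zero zero_neq_one)
  interpret l: comm_ring_hom "\<lambda>p :: ('a, 'b) mvpoly. Poly_Mapping.lookup p 0" by (rule lookup_zero_hom)
  interpret c: comm_ring_hom "pconst :: 'b \<Rightarrow> ('a, 'b) mvpoly" by (rule pconst_hom)
  have h: "comm_ring_hom (\<lambda>p :: ('a, 'b) mvpoly. pconst (Poly_Mapping.lookup p 0) :: ('a, 'b) mvpoly)"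
    by unfold_locales (auto simp: hom_distribs)
  show ?thesis
    by (rule comm_ring_homs_eq_on_polys[OF restr_hom h, of _ UNIV])
      (auto simp: restr_pconst restr_pvar, auto simp: pvar_def pconst_def lookup_single nz[simplified])
qed

lemma const_poly_hom: "comm_ring_hom (\<lambda>a :: 'b::comm_ring_1. [:a:])"
  by unfold_locales (auto simp: one_pCons)

lemma const_poly_pconst_hom: "comm_ring_hom (\<lambda>a :: 'k::comm_ring_1. [:pconst a :: ('v, 'k) mvpoly:])"
  by unfold_locales (auto simp: pconst_add pconst_mult one_pCons, auto simp: pconst_def)

text \<open>Reads a polynomial as one in the single variable \<open>x\<close> over the polynomials
  in the others, so that division by a polynomial monic in \<open>x\<close> becomes
  available.\<close>

definition split_var :: "'v \<Rightarrow> ('v, 'k::comm_ring_1) mvpoly \<Rightarrow> ('v, 'k) mvpoly poly"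
  where "split_var x = mv_eval (\<lambda>a. [:pconst a:]) (\<lambda>v. if v = x then [:0, 1:] else [:pvar v:])"

lemma split_var_hom: "comm_ring_hom (split_var x)"
  unfolding split_var_def by (rule mv_eval_hom[OF const_poly_pconst_hom])

lemma split_var_pvar: "split_var x (pvar v) = (if v = x then [:0, 1:] else [:pvar v:])"
  unfolding split_var_def by (simp add: mv_eval_pvar[OF const_poly_pconst_hom])

lemma split_var_pconst: "split_var x (pconst a) = [:pconst a:]"
  unfolding split_var_def by (simp add: mv_eval_pconst[OF const_poly_pconst_hom])

lemma split_var_free: "p \<in> polys S \<Longrightarrow> x \<notin> S \<Longrightarrow> split_var x p = [:p:]"
  by (rule comm_ring_homs_eq_on_polys[OF split_var_hom const_poly_hom]) (auto simp: split_var_pconst split_var_pvar)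

lemma poly_split_var: "poly (split_var x p) (pvar x) = p"
proof -
  interpret s: comm_ring_hom "split_var x" by (rule split_var_hom)
  have h: "comm_ring_hom (\<lambda>p. poly (split_var x p) (pvar x))"
    by unfold_locales (auto simp: hom_distribs)
  show ?thesis
    by (rule comm_ring_homs_eq_on_polys[OF h id_hom, of _ UNIV]) (auto simp: split_var_pconst split_var_pvar)
qed

lemma split_var_coeff: "p \<in> polys (insert x S) \<Longrightarrow> coeff (split_var x p) i \<in> polys S"
proof (induction arbitrary: i rule: polys_induct)
  interpret s: comm_ring_hom "split_var x" by (rule split_var_hom)
  { case (const a) then show ?case by (simp add: split_var_pconst coeff_pCons split: nat.split) }
  { case (var v) then show ?case by (auto simp: split_var_pvar coeff_pCons polys_pvar split: nat.split) }
  { case (add p q) then show ?case by (simp add: hom_distribs polys_add) }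
  { case (mult p q) then show ?case by (auto simp: hom_distribs coeff_mult intro!: polys_sum polys_mult) }
qed

text \<open>Substituting \<open>x_v t\<close> for each variable \<open>x_v\<close> makes the
  coefficient of \<open>t^i\<close> the homogeneous component of degree \<open>i\<close>; its
  behaviour on products comes for free from the evaluation homomorphism.\<close>

definition grade :: "('v, 'k::comm_ring_1) mvpoly \<Rightarrow> ('v, 'k) mvpoly poly"
  where "grade = mv_eval (\<lambda>a. [:pconst a:]) (\<lambda>v. monom (pvar v) 1)"

lemma grade_hom: "comm_ring_hom grade"
  unfolding grade_def by (rule mv_eval_hom[OF const_poly_pconst_hom])

lemma grade_pvar: "grade (pvar v) = monom (pvar v) 1"
  unfolding grade_def by (simp add: mv_eval_pvar[OF const_poly_pconst_hom])

lemma grade_pconst: "grade (pconst a) = [:pconst a:]"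
  unfolding grade_def by (simp add: mv_eval_pconst[OF const_poly_pconst_hom])

lemma grade_coeff: "p \<in> polys S \<Longrightarrow> coeff (grade p) i \<in> polys S"
proof (induction arbitrary: i rule: polys_induct)
  interpret s: comm_ring_hom "grade" by (rule grade_hom)
  { case (const a) then show ?case by (simp add: grade_pconst coeff_pCons split: nat.split) }
  { case (var v) then show ?case by (auto simp: grade_pvar polys_pvar) }
  { case (add p q) then show ?case by (simp add: hom_distribs polys_add) }
  { case (mult p q) then show ?case by (auto simp: hom_distribs coeff_mult intro!: polys_sum polys_mult) }
qed

text \<open>Homogeneity of a generator is expressed by \<open>grade g\<close> being the single term
  \<open>g t^d\<close>; multiplication by it only shifts coefficients and multiplies them by
  \<open>g\<close>.\<close>

lemma idl_grade_coeff:
  assumes "\<And>g. g \<in> G \<Longrightarrow> \<exists>d. grade g = monom g d" "p \<in> idl G"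
  shows "coeff (grade p) i \<in> idl G"
  using assms(2)
proof (induction rule: idl.induct)
  interpret s: comm_ring_hom "grade" by (rule grade_hom)
  { case idl_zero then show ?case by (simp add: idl.idl_zero) }
  { case (idl_step g p q)
    obtain d where d: "grade g = monom g d" using assms(1) idl_step by blast
    have "coeff (grade q * monom g d) i \<in> idl G"
      unfolding mult.commute[of _ "monom g d"] coeff_monom_mult
      using idl_step(1) by (auto intro: idl_mult_right idl_base idl.idl_zero)
    then show ?case using idl_step d by (simp add: hom_distribs idl_add) }
qed

section \<open>Adding a variable to an ideal of blow-up type\<close>

text \<open>A representative of degree below \<open>c\<close> modulo the monic \<open>f\<close>
  inherits the coefficient conditions of \<open>q\<close>. The leading coefficient of
  \<open>g\<close> must cancel a coefficient of \<open>q\<close> of positive index and so lies in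
  \<open>idl k\<close>; moving its term from \<open>g\<close> into \<open>q\<close> spoils nothing,
  because the constant term of \<open>f\<close> carries \<open>idl k\<close> into
  \<open>idl a\<close>.\<close>

lemma monic_reduce:
  fixes f g q :: "'b::comm_ring_1 poly"
  assumes f: "coeff f c = 1" "degree f = c" "c \<ge> 1"
    and A: "\<And>r. r \<in> idl k \<Longrightarrow> coeff f 0 * r \<in> idl a"
    and q: "coeff q 0 \<in> idl a" "\<And>i. i \<ge> 1 \<Longrightarrow> coeff q i \<in> idl k"
    and z: "\<And>i. i \<ge> c \<Longrightarrow> coeff (q + f * g) i = 0"
  shows "coeff (q + f * g) 0 \<in> idl a" "\<And>i. i \<ge> 1 \<Longrightarrow> coeff (q + f * g) i \<in> idl k"
proof -
  have "coeff (q + f * g) 0 \<in> idl a \<and> (\<forall>i\<ge>1. coeff (q + f * g) i \<in> idl k)"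
    if "\<forall>i\<ge>n. coeff g i = 0" "coeff q 0 \<in> idl a" "\<forall>i\<ge>1. coeff q i \<in> idl k"
      "\<forall>i\<ge>c. coeff (q + f * g) i = 0" for n q g
    using that
  proof (induction n arbitrary: q g)
    case 0
    then have "g = 0" by (simp add: poly_eqI)
    then show ?case using 0 by simp
  next
    case (Suc n)
    define x where "x = coeff g n"
    have "coeff (f * g) (c + n) = (\<Sum>i\<le>c + n. if i = c then x else 0)"
      unfolding coeff_mult
    proof (rule sum.cong)
      fix i assume "i \<in> {..c + n}"
      show "coeff f i * coeff g (c + n - i) = (if i = c then x else 0)"
      proof (cases i c rule: linorder_cases)
        case less
        then have "coeff g (c + n - i) = 0" using Suc(2) by (intro Suc(2)[rule_format]) auto
        then show ?thesis using less by simp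
      next
        case equal then show ?thesis by (simp add: f x_def)
      next
        case greater then show ?thesis using f by (simp add: coeff_eq_0)
      qed
    qed simp
    then have "coeff (f * g) (c + n) = x" by (simp add: sum.delta)
    moreover have "coeff (q + f * g) (c + n) = 0" using Suc(5) by simp
    ultimately have "x = - coeff q (c + n)" by (simp add: eq_neg_iff_add_eq_0 add.commute)
    then have x: "x \<in> idl k" using Suc(4) f(3) by (auto intro: idl_uminus)
    define g' where "g' = g - monom x n"
    define q' where "q' = q + f * monom x n"
    have e: "q + f * g = q' + f * g'" by (simp add: g'_def q'_def algebra_simps)
    have c: "coeff (f * monom x n) i = (if i < n then 0 else coeff f (i - n) * x)" for i
      unfolding mult.commute[of f "monom x n"] coeff_monom_mult by (simp add: mult.commute)
    have "coeff g' i = 0" if "i \<ge> n" for i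
      using that Suc(2)[rule_format, of i] by (cases "i = n") (auto simp: g'_def x_def)
    then have "\<forall>i\<ge>n. coeff g' i = 0" by blast
    moreover have "coeff q' 0 \<in> idl a" using Suc(3) A[OF x] by (simp add: q'_def c idl_add)
    moreover have "\<forall>i\<ge>1. coeff q' i \<in> idl k" using Suc(4) x by (simp add: q'_def c idl_add idl_mult)
    moreover have "\<forall>i\<ge>c. coeff (q' + f * g') i = 0" using Suc(5) e by simp
    ultimately show ?case unfolding e by (rule Suc(1))
  qed
  moreover have "\<forall>i\<ge>Suc (degree g). coeff g i = 0" by (simp add: coeff_eq_0)
  ultimately have "coeff (q + f * g) 0 \<in> idl a \<and> (\<forall>i\<ge>1. coeff (q + f * g) i \<in> idl k)"
    using q z by blast
  then show "coeff (q + f * g) 0 \<in> idl a" "\<And>i. i \<ge> 1 \<Longrightarrow> coeff (q + f * g) i \<in> idl k"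
    by blast+
qed

text \<open>The set \<open>P\<close> stands for a subring. Keeping track of it ensures that the
  remainder involves no variable outside a prescribed set.\<close>

lemma monic_division:
  fixes f p :: "'b::comm_ring_1 poly"
  assumes f: "coeff f c = 1" "degree f = c" "c \<ge> 1"
    and P: "\<And>i. coeff f i \<in> P" "\<And>i. coeff p i \<in> P" "0 \<in> P"
      "\<And>a b. a \<in> P \<Longrightarrow> b \<in> P \<Longrightarrow> a - b \<in> P" "\<And>a b. a \<in> P \<Longrightarrow> b \<in> P \<Longrightarrow> a * b \<in> P"
  shows "\<exists>g r. p = f * g + r \<and> (\<forall>i. coeff r i \<in> P) \<and> (\<forall>i\<ge>c. coeff r i = 0)"
proof -
  have "\<exists>g r. p = f * g + r \<and> (\<forall>i. coeff r i \<in> P) \<and> (\<forall>i\<ge>c. coeff r i = 0)"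
    if "\<forall>i\<ge>n. coeff p i = 0" "\<forall>i. coeff p i \<in> P" for n p
    using that
  proof (induction n arbitrary: p)
    case 0
    then show ?case by (intro exI[of _ 0] exI[of _ p]) auto
  next
    case (Suc n)
    show ?case
    proof (cases "n < c")
      case True
      then show ?thesis using Suc by (intro exI[of _ 0] exI[of _ p]) auto
    next
      case False
      let ?x = "coeff p n"
      define p' where "p' = p - f * monom ?x (n - c)"
      have c: "coeff (f * monom ?x (n - c)) i = (if i < n - c then 0 else coeff f (i - (n - c)) * ?x)" for i
        unfolding mult.commute[of f "monom ?x (n - c)"] coeff_monom_mult by (simp add: mult.commute)
      have "coeff p' i = 0" if "i \<ge> n" for i
      proof (cases "i = n")
        case True then show ?thesis using False f by (simp add: p'_def c)
      next
        case False
        then have "i > n" using that by simp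
        then have "coeff p i = 0" "coeff f (i - (n - c)) = 0" using Suc(2) f \<open>\<not> n < c\<close>
          by (auto intro!: coeff_eq_0)
        then show ?thesis using \<open>i > n\<close> by (simp add: p'_def c)
      qed
      moreover have "coeff p' i \<in> P" for i using Suc(3) P(1,3-5) by (auto simp: p'_def c)
      ultimately obtain g r where "p' = f * g + r" "\<forall>i. coeff r i \<in> P" "\<forall>i\<ge>c. coeff r i = 0"
        using Suc(1)[of p'] by blast
      then show ?thesis
        by (intro exI[of _ "g + monom ?x (n - c)"] exI[of _ r]) (auto simp: p'_def algebra_simps)
    qed
  qed
  moreover have "\<forall>i\<ge>Suc (degree p). coeff p i = 0" by (simp add: coeff_eq_0)
  ultimately show ?thesis using P(2) by blast
qed

lemma split_var_poly:
  assumes "\<And>i. coeff q i \<in> polys S" "x \<notin> S"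
  shows "split_var x (poly q (pvar x)) = q"
proof -
  interpret s: comm_ring_hom "split_var x" by (rule split_var_hom)
  have fr: "split_var x (coeff q i) = [:coeff q i:]" for i by (rule split_var_free[OF assms])
  have "split_var x (poly q (pvar x)) = (\<Sum>i\<le>degree q. [:coeff q i:] * [:0, 1:] ^ i)"
    unfolding poly_altdef by (simp add: hom_distribs fr split_var_pvar)
  also have "\<dots> = (\<Sum>i\<le>degree q. monom (coeff q i) i)"
    by (rule sum.cong) (auto simp: monom_altdef)
  finally show ?thesis by (simp add: poly_as_sum_of_monoms)
qed

text \<open>Relations of Feichtner-Yuzvinsky type: with \<open>z G\<close> the sum of the variables
  above \<open>G\<close> and \<open>e\<close> the difference of ranks they present a Chow ring
  without its linear forms as separate generators. The element \<open>b\<close> is a movable bottom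
  whose variable is replaced by one, which is why \<open>z G ^ e b G\<close> has no factor in
  front.\<close>

definition rels :: "('a set \<Rightarrow> 'a set \<Rightarrow> nat) \<Rightarrow> ('a set \<Rightarrow> ('a set, rat) mvpoly) \<Rightarrow> 'a set \<Rightarrow> 'a set set \<Rightarrow> ('a set, rat) mvpoly set"
  where "rels e z b U =
    {pvar H * pvar H' | H H'. H \<in> U \<and> H' \<in> U \<and> \<not> H \<subseteq> H' \<and> \<not> H' \<subseteq> H} \<union>
    {pvar F * z G ^ e F G | F G. F \<in> U \<and> G \<in> U \<and> F \<subset> G} \<union> {z G ^ e b G | G. G \<in> U}"

lemma relsI:
  "H \<in> U \<Longrightarrow> H' \<in> U \<Longrightarrow> \<not> H \<subseteq> H' \<Longrightarrow> \<not> H' \<subseteq> H \<Longrightarrow> pvar H * pvar H' \<in> idl (rels e z b U)"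
  "F \<in> U \<Longrightarrow> G \<in> U \<Longrightarrow> F \<subset> G \<Longrightarrow> pvar F * z G ^ e F G \<in> idl (rels e z b U)"
  "G \<in> U \<Longrightarrow> z G ^ e b G \<in> idl (rels e z b U)"
proof -
  show "H \<in> U \<Longrightarrow> H' \<in> U \<Longrightarrow> \<not> H \<subseteq> H' \<Longrightarrow> \<not> H' \<subseteq> H \<Longrightarrow> pvar H * pvar H' \<in> idl (rels e z b U)"
    by (rule idl_base) (unfold rels_def, blast)
  show "F \<in> U \<Longrightarrow> G \<in> U \<Longrightarrow> F \<subset> G \<Longrightarrow> pvar F * z G ^ e F G \<in> idl (rels e z b U)"
    by (rule idl_base) (unfold rels_def, blast)
  show "G \<in> U \<Longrightarrow> z G ^ e b G \<in> idl (rels e z b U)"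
    by (rule idl_base) (unfold rels_def, blast)
qed

lemma rels_cases:
  assumes "g \<in> rels e z b U"
  obtains H H' where "g = pvar H * pvar H'" "H \<in> U" "H' \<in> U" "\<not> H \<subseteq> H'" "\<not> H' \<subseteq> H"
  | F G where "g = pvar F * z G ^ e F G" "F \<in> U" "G \<in> U" "F \<subset> G"
  | G where "g = z G ^ e b G" "G \<in> U"
  using assms unfolding rels_def by blast

lemma rels_mono: "U \<subseteq> V \<Longrightarrow> p \<in> idl (rels e z b U) \<Longrightarrow> p \<in> idl (rels e z b V)"
  by (erule idl_subset[rotated]) (auto elim!: rels_cases intro: relsI)

lemma idl_power_le: "u * x ^ m \<in> idl G \<Longrightarrow> m \<le> n \<Longrightarrow> u * x ^ n \<in> idl G"
  using idl_mult_right[of "u * x ^ m" G "x ^ (n - m)"] by (simp add: mult.assoc flip: power_add)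

lemma idl_power_le': "x ^ m \<in> idl G \<Longrightarrow> m \<le> n \<Longrightarrow> x ^ n \<in> idl G"
  using idl_power_le[of 1 x m G n] by simp

text \<open>The quotient by \<open>rels d y b U\<close> behaves like the cohomology of an iterated blow-up: adjoining the
  variable of a new minimal element \<open>G\<close> yields a free module with basis the powers of this variable
  below \<open>d b G\<close>. The lemma \<open>blowup_step\<close> is what remains of this freeness in terms of membership.\<close>

locale blowup =
  fixes L :: "'a set set" and T :: "'a set" and d :: "'a set \<Rightarrow> 'a set \<Rightarrow> nat"
  assumes finite_L: "finite L" and empty_notin: "{} \<notin> L" and T_in: "T \<in> L" and le_T: "H \<in> L \<Longrightarrow> H \<subseteq> T"
    and ex_join: "G \<in> L \<Longrightarrow> H \<in> L \<Longrightarrow> \<not> G \<subseteq> H \<Longrightarrow>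
      \<exists>J\<in>L. H \<subset> J \<and> (\<forall>H'\<in>L. J \<subseteq> H' \<longleftrightarrow> G \<subseteq> H' \<and> H \<subseteq> H') \<and>
        (\<forall>b\<in>insert {} L. b \<subset> G \<longrightarrow> b \<subseteq> H \<longrightarrow> d H J \<le> d b G)"
    and tri: "b \<in> insert {} L \<Longrightarrow> G \<in> L \<Longrightarrow> H \<in> L \<Longrightarrow> b \<subset> G \<Longrightarrow> G \<subset> H \<Longrightarrow> d b H \<le> d b G + d G H"
    and d_pos: "b \<in> insert {} L \<Longrightarrow> G \<in> L \<Longrightarrow> b \<subset> G \<Longrightarrow> d b G \<ge> 1"
begin

definition y :: "'a set \<Rightarrow> ('a set, rat) mvpoly"
  where "y G = (\<Sum>H\<in>{H \<in> L. G \<subseteq> H}. pvar H)"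

text \<open>The sets of variables present at some stage of the adjunction from the top downwards.
  Upward closure makes \<open>y H\<close> a polynomial in the variables already adjoined.\<close>

definition upper :: "'a set \<Rightarrow> 'a set set \<Rightarrow> bool"
  where "upper b U \<longleftrightarrow> U \<subseteq> {H \<in> L. b \<subset> H} \<and> (\<forall>H\<in>U. \<forall>H'\<in>L. H \<subseteq> H' \<longrightarrow> H' \<in> U)"

lemma y_polys: "(\<And>H. H \<in> L \<Longrightarrow> G \<subseteq> H \<Longrightarrow> H \<in> S) \<Longrightarrow> y G \<in> polys S"
  unfolding y_def by (auto intro!: polys_sum polys_pvar)

lemma rels_polys: "upper b U \<Longrightarrow> g \<in> rels d y b U \<Longrightarrow> g \<in> polys U"
  by (auto elim!: rels_cases intro!: polys_mult polys_power polys_pvar y_polys simp: upper_def)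

text \<open>The variable of \<open>H\<close> annihilates those of the elements incomparable to
  \<open>H\<close>. As nothing above \<open>G\<close> lies below \<open>H\<close>, only the summands
  above both \<open>G\<close> and \<open>H\<close> survive, and these form the up-set of
  \<open>J\<close>. The freedom in \<open>A\<close> admits sums from which some of the other
  elements above \<open>G\<close> are missing.\<close>

lemma pvar_y_join:
  assumes "upper b U" "G \<in> L" "H \<in> U" "\<not> G \<subseteq> H"
    and J: "\<forall>H'\<in>L. J \<subseteq> H' \<longleftrightarrow> G \<subseteq> H' \<and> H \<subseteq> H'"
    and A: "finite A" "A \<subseteq> {H' \<in> L. G \<subseteq> H'}" "{H' \<in> L. G \<subseteq> H' \<and> H \<subseteq> H'} \<subseteq> A" "A \<subseteq> U"
  shows "pvar H * (\<Sum>H'\<in>A. pvar H') - pvar H * y J \<in> idl (rels d y b U)"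
proof -
  have e: "{H' \<in> L. J \<subseteq> H'} = {H' \<in> L. G \<subseteq> H' \<and> H \<subseteq> H'}" using J by auto
  have "(\<Sum>H'\<in>A. pvar H') - y J = (\<Sum>H'\<in>A - {H' \<in> L. J \<subseteq> H'}. pvar H' :: ('a set, rat) mvpoly)"
    unfolding y_def using A e by (subst sum_diff) auto
  then have "pvar H * (\<Sum>H'\<in>A. pvar H') - pvar H * y J = (\<Sum>H'\<in>A - {H' \<in> L. J \<subseteq> H'}. pvar H * pvar H')"
    by (simp only: right_diff_distrib[symmetric] sum_distrib_left[symmetric])
  also have "\<dots> \<in> idl (rels d y b U)"
  proof (rule idl_sum)
    fix i assume i: "i \<in> A - {H' \<in> L. J \<subseteq> H'}"
    then have "G \<subseteq> i" "i \<in> L" "i \<in> U" using A by blast+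
    then have "\<not> i \<subseteq> H" "\<not> H \<subseteq> i" using i e assms(4) by blast+
    then show "pvar H * pvar i \<in> idl (rels d y b U)" using \<open>i \<in> U\<close> assms(3) relsI(1) by blast
  qed
  finally show ?thesis .
qed

text \<open>With \<open>y G = pvar G + y'\<close> the new power relation is monic in
  \<open>pvar G\<close> of degree \<open>d b G\<close>, and the other new relations are
  \<open>pvar G\<close> times elements of \<open>KK\<close>. The constant term
  \<open>y' ^ d b G\<close> of the monic relation multiplies \<open>KK\<close> into the old
  relations, so that division by it produces no further relation in the constant
  coefficient.\<close>

lemma blowup_step:
  assumes U: "upper b U" and G: "G \<in> L" "b \<subset> G" "G \<notin> U" "\<And>H. H \<in> L \<Longrightarrow> G \<subset> H \<Longrightarrow> H \<in> U"
    and b: "b \<in> insert {} L"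
    and q: "\<And>i. coeff q i \<in> polys (- {G})" "\<And>i. i \<ge> d b G \<Longrightarrow> coeff q i = 0"
    and mem: "poly q (pvar G) \<in> idl (rels d y b (insert G U))"
  defines "KK \<equiv> rels d y b U \<union> {pvar H | H. H \<in> U \<and> \<not> G \<subseteq> H} \<union> {y H ^ d G H | H. H \<in> U \<and> G \<subset> H}"
  shows "coeff q 0 \<in> idl (rels d y b U)" "\<And>i. i \<ge> 1 \<Longrightarrow> coeff q i \<in> idl KK"
proof -
  let ?c = "d b G"
  let ?R = "rels d y b U"
  have UL: "H \<in> L" "b \<subset> H" if "H \<in> U" for H using U that by (auto simp: upper_def)
  have Uup: "H' \<in> U" if "H \<in> U" "H' \<in> L" "H \<subseteq> H'" for H H' using U that by (auto simp: upper_def)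
  have c1: "?c \<ge> 1" using d_pos b G by blast
  define y' where "y' = (\<Sum>H\<in>{H \<in> L. G \<subset> H}. pvar H :: ('a set, rat) mvpoly)"
  have "{H \<in> L. G \<subseteq> H} = insert G {H \<in> L. G \<subset> H}" using G by auto
  then have yG: "y G = pvar G + y'" unfolding y_def y'_def using finite_L by simp
  have y'p: "y' \<in> polys U" unfolding y'_def using G by (auto intro!: polys_sum polys_pvar)
  define f where "f = [:y', 1:] ^ ?c"
  have f: "coeff f ?c = 1" "degree f = ?c" unfolding f_def
    using degree_linear_power[of y' ?c] coeff_linear_power[of y' ?c] by auto
  have f0: "coeff f 0 = y' ^ ?c" by (simp add: f_def flip: poly_0_coeff_0)
  interpret s: comm_ring_hom "split_var G :: ('a set, rat) mvpoly \<Rightarrow> _" by (rule split_var_hom)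
  have fr: "split_var G p = [:p:]" if "p \<in> polys U" for p :: "('a set, rat) mvpoly"
    by (rule split_var_free[OF that G(3)])
  have RK: "p \<in> idl KK" if "p \<in> idl ?R" for p using that by (rule idl_mono[rotated]) (auto simp: KK_def)
  have kill: "y' ^ ?c * r \<in> idl ?R" if "r \<in> idl KK" for r
  proof (rule idl_times[OF _ that])
    fix g assume "g \<in> KK"
    then consider "g \<in> ?R" | H where "g = pvar H" "H \<in> U" "\<not> G \<subseteq> H" | H where "g = y H ^ d G H" "H \<in> U" "G \<subset> H"
      unfolding KK_def by blast
    then show "y' ^ ?c * g \<in> idl ?R"
    proof cases
      case 1 then show ?thesis by (intro idl_mult idl_base)
    next
      case 2
      \<comment> \<open>After multiplication by \<open>pvar H\<close> the sum \<open>y'\<close>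
        turns into \<open>y J\<close>, and the exponent \<open>d H J\<close> needed there is at most
        \<open>?c\<close> by the semimodularity in \<open>ex_join\<close>.\<close>
      obtain J where J: "J \<in> L" "H \<subset> J" "\<forall>H'\<in>L. J \<subseteq> H' \<longleftrightarrow> G \<subseteq> H' \<and> H \<subseteq> H'" "d H J \<le> ?c"
        using ex_join[OF G(1) UL(1)[OF 2(2)] 2(3)] b G(2) UL(2)[OF 2(2)] by blast
      have nHG: "\<not> H \<subseteq> G" using Uup 2 G by blast
      have "pvar H * y' - pvar H * y J \<in> idl ?R" unfolding y'_def
        using G 2 J finite_L nHG by (intro pvar_y_join[OF U G(1) 2(2) 2(3) J(3)]) auto
      then have 1: "pvar H * y' ^ ?c - pvar H * y J ^ ?c \<in> idl ?R" by (rule idl_cong_power)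
      have "pvar H * y J ^ ?c \<in> idl ?R"
        using J 2 Uup by (intro idl_power_le[OF _ J(4)] relsI) auto
      then have "pvar H * y' ^ ?c \<in> idl ?R" using 1 idl_cong_mem by blast
      then show ?thesis using 2 by (simp add: mult.commute)
    next
      case 3
      let ?e = "d G H"
      have e1: "?e \<ge> 1" using d_pos G 3 UL by blast
      \<comment> \<open>In the presence of \<open>y H ^ ?e\<close> the sum \<open>y'\<close> may be
        replaced by \<open>y H\<close>: the summands in which they differ are killed by
        \<open>ex_join\<close> with \<open>G\<close> in the role of the bottom. The power
        \<open>?c + ?e\<close> of \<open>y H\<close> that results is a relation by
        \<open>tri\<close>.\<close>
      have "y H ^ ?e * y' - y H ^ ?e * y H = (\<Sum>H'\<in>{H' \<in> L. G \<subset> H' \<and> \<not> H \<subseteq> H'}. pvar H' * y H ^ ?e)"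
      proof -
        have "{H' \<in> L. G \<subset> H'} - {H' \<in> L. H \<subseteq> H'} = {H' \<in> L. G \<subset> H' \<and> \<not> H \<subseteq> H'}" by auto
        then have "y' - y H = (\<Sum>H'\<in>{H' \<in> L. G \<subset> H' \<and> \<not> H \<subseteq> H'}. pvar H')"
          unfolding y'_def y_def using finite_L 3 by (subst sum_diff[symmetric]) auto
        have "y H ^ ?e * y' - y H ^ ?e * y H = y H ^ ?e * (y' - y H)" by (simp add: right_diff_distrib)
        then show ?thesis unfolding \<open>y' - y H = _\<close> by (simp add: sum_distrib_left mult.commute)
      qed
      also have "\<dots> \<in> idl ?R"
      proof (rule idl_sum)
        fix H' assume "H' \<in> {H' \<in> L. G \<subset> H' \<and> \<not> H \<subseteq> H'}"
        then have H': "H' \<in> L" "G \<subset> H'" "\<not> H \<subseteq> H'" "H' \<in> U" using G by auto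
        obtain J where J: "J \<in> L" "H' \<subset> J" "\<forall>H''\<in>L. J \<subseteq> H'' \<longleftrightarrow> H \<subseteq> H'' \<and> H' \<subseteq> H''" "d H' J \<le> ?e"
          using ex_join[OF UL(1)[OF 3(2)] H'(1,3)] G(1) 3(3) H'(2) by blast
        have "pvar H' * y H - pvar H' * y J \<in> idl ?R" unfolding y_def[of H]
          using 3 H' J finite_L Uup by (intro pvar_y_join[OF U UL(1)[OF 3(2)] H'(4,3) J(3)]) auto
        then have 1: "pvar H' * y H ^ ?e - pvar H' * y J ^ ?e \<in> idl ?R" by (rule idl_cong_power)
        have "pvar H' * y J ^ ?e \<in> idl ?R"
          using J H' Uup by (intro idl_power_le[OF _ J(4)] relsI) auto
        then show "pvar H' * y H ^ ?e \<in> idl ?R" using 1 idl_cong_mem by blast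
      qed
      finally have 1: "y H ^ ?e * y' ^ ?c - y H ^ ?e * y H ^ ?c \<in> idl ?R" by (rule idl_cong_power)
      have "y H ^ (?c + ?e) \<in> idl ?R"
        by (rule idl_power_le'[OF relsI(3)]) (use 3 tri b G UL in auto)
      then have "y H ^ ?e * y H ^ ?c \<in> idl ?R" by (simp add: power_add mult.commute)
      then have "y H ^ ?e * y' ^ ?c \<in> idl ?R" using 1 idl_cong_mem by blast
      then show ?thesis using 3 by (simp add: mult.commute)
    qed
  qed
  let ?M = "{p. \<exists>q g. split_var G p = q + f * g \<and> coeff q 0 \<in> idl ?R \<and> (\<forall>i\<ge>1. coeff q i \<in> idl KK)}"
  have "poly q (pvar G) \<in> ?M"
  proof (rule idl_least[OF mem])
    fix g assume "g \<in> rels d y b (insert G U)"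
    then consider "g \<in> ?R" | h where "g = pvar G * h" "h \<in> polys U" "h \<in> idl KK" | "g = y G ^ ?c"
    proof (cases rule: rels_cases)
      case h: (1 H H')
      consider "H = G" "H' = G" | "H = G" "H' \<in> U" | "H' = G" "H \<in> U" | "H \<in> U" "H' \<in> U" using h by blast
      then show thesis
      proof cases
        case 1
        then show thesis using h by blast
      next
        case 2
        then have "pvar H' \<in> idl KK" "pvar H' \<in> polys U" using h by (auto simp: KK_def intro!: idl_base polys_pvar)
        then show thesis using that(2) h 2 by blast
      next
        case 3
        then have "pvar H \<in> idl KK" "pvar H \<in> polys U" using h by (auto simp: KK_def intro!: idl_base polys_pvar)
        then show thesis using that(2)[of "pvar H"] h 3 by (simp add: mult.commute)
      next
        case 4
        then have "g \<in> ?R" using h unfolding rels_def by blast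
        then show thesis by (rule that(1))
      qed
    next
      case (2 F H)
      show thesis
      proof (cases "F = G")
        case True
        then have "H \<in> U" using 2 by auto
        then have "y H ^ d G H \<in> idl KK" "y H ^ d G H \<in> polys U"
          using 2 True Uup by (auto simp: KK_def intro!: idl_base polys_power y_polys)
        then show thesis using that(2) 2 True by blast
      next
        case False
        then have "F \<in> U" using 2 by auto
        moreover have "H \<in> U" using 2 Uup[OF \<open>F \<in> U\<close>, of G] G(1,3) by auto
        ultimately have "g \<in> ?R" using 2 unfolding rels_def by blast
        then show thesis by (rule that(1))
      qed
    next
      case (3 H)
      then show thesis using that(1,3) unfolding rels_def by blast
    qed
    then show "g \<in> ?M"
    proof cases
      case 1
      then show ?thesis using rels_polys[OF U] RK
        by (intro CollectI exI[of _ "[:g:]"] exI[of _ 0]) (auto simp: fr coeff_pCons idl_base idl_zero split: nat.split)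
    next
      case 2
      then show ?thesis
        by (intro CollectI exI[of _ "[:0, h:]"] exI[of _ 0])
          (auto simp: fr split_var_pvar hom_distribs coeff_pCons idl_base idl_zero split: nat.split)
    next
      case 3
      have "split_var G (y G) = [:y', 1:]" by (simp add: yG hom_distribs split_var_pvar fr y'p)
      then show ?thesis using 3
        by (intro CollectI exI[of _ 0] exI[of _ 1]) (auto simp: hom_distribs f_def idl_zero)
    qed
  next
    show "0 \<in> ?M" by (intro CollectI exI[of _ 0] exI[of _ 0]) (auto simp: idl_zero)
  next
    fix p1 p2 assume "p1 \<in> ?M" "p2 \<in> ?M"
    then obtain q1 g1 q2 g2 where
      "split_var G p1 = q1 + f * g1" "coeff q1 0 \<in> idl ?R" "\<forall>i\<ge>1. coeff q1 i \<in> idl KK"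
      "split_var G p2 = q2 + f * g2" "coeff q2 0 \<in> idl ?R" "\<forall>i\<ge>1. coeff q2 i \<in> idl KK" by auto
    then show "p1 + p2 \<in> ?M"
      by (intro CollectI exI[of _ "q1 + q2"] exI[of _ "g1 + g2"]) (auto simp: hom_distribs algebra_simps intro: idl_add)
  next
    fix p1 r assume "p1 \<in> ?M"
    then obtain q1 g1 where
      q1: "split_var G p1 = q1 + f * g1" "coeff q1 0 \<in> idl ?R" "\<forall>i\<ge>1. coeff q1 i \<in> idl KK" by auto
    \<comment> \<open>The constant coefficient is included because multiplication by a polynomial in
      \<open>pvar G\<close> spreads it over all degrees; this is possible since the old relations
      belong to \<open>KK\<close>.\<close>
    have "coeff q1 i \<in> idl KK" for i using q1 RK by (cases "i = 0") auto
    then have "coeff (split_var G r * q1) i \<in> idl KK" for i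
      by (auto simp: coeff_mult intro!: idl_sum idl_mult)
    moreover have "coeff (split_var G r * q1) 0 \<in> idl ?R" using q1 by (simp add: coeff_mult idl_mult)
    moreover have "split_var G (r * p1) = split_var G r * q1 + f * (split_var G r * g1)"
      using q1 by (simp add: hom_distribs algebra_simps)
    ultimately show "r * p1 \<in> ?M" by blast
  qed
  then obtain q0 g where q0: "q = q0 + f * g" "coeff q0 0 \<in> idl ?R" "\<forall>i\<ge>1. coeff q0 i \<in> idl KK"
    using split_var_poly[OF q(1)] by auto
  have "coeff f 0 * r \<in> idl ?R" if "r \<in> idl KK" for r using kill[OF that] f0 by simp
  from monic_reduce[OF f c1 this q0(2) q0(3)[rule_format], of g] q(2) q0(1)
  show "coeff q 0 \<in> idl (rels d y b U)" "\<And>i. i \<ge> 1 \<Longrightarrow> coeff q i \<in> idl KK" by auto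
qed

end

section \<open>Multiplication by the variable of a coatom\<close>

lemma idl_monom_coeff:
  fixes p :: "'b::comm_ring_1 poly"
  assumes "p \<in> idl {[:0, 1:] ^ n}" "i < n" shows "coeff p i = 0"
proof -
  have "p \<in> {p. \<forall>i<n. coeff p i = 0}"
  proof (rule idl_least[OF assms(1)])
    fix a r :: "'b poly" assume "a \<in> {p. \<forall>i<n. coeff p i = 0}"
    then show "r * a \<in> {p. \<forall>i<n. coeff p i = 0}" by (auto simp: coeff_mult)
  qed (auto simp: coeff_monom_mult simp flip: monom_altdef[of 1, simplified])
  then show ?thesis using assms by blast
qed

text \<open>All mixed terms of the binomial expansion contain \<open>u * v\<close>; for
  \<open>n = 0\<close> the two sides would be 1 and 2.\<close>

lemma power_add_cong:
  fixes u v :: "'b::comm_ring_1"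
  assumes "u * v \<in> idl G" "n \<ge> 1"
  shows "(u + v) ^ n - (u ^ n + v ^ n) \<in> idl G"
  using assms(2)
proof (induction n rule: dec_induct)
  case (step n)
  have "(u + v) ^ Suc n - (u ^ Suc n + v ^ Suc n) =
    (u + v) * ((u + v) ^ n - (u ^ n + v ^ n)) + (u * v) * v ^ (n - 1) + (u * v) * u ^ (n - 1)"
    using step by (cases n) (auto simp: algebra_simps)
  then show ?case using idl_add[OF idl_add[OF idl_mult[OF step.IH] idl_mult_right[OF assms(1)]] idl_mult_right[OF assms(1)]]
    by simp
qed (simp add: idl_zero)

text \<open>Multiplication by the variable of a coatom \<open>K\<close> embeds the ring of the interval below \<open>K\<close>,
  presented by the exponents \<open>e\<close>, into the ring of the whole poset; only the exponent at the top
  element drops.\<close>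

locale blowup_coatom = blowup +
  fixes K :: "'a set"
  assumes K: "K \<in> L" "K \<noteq> T" and coatom: "H \<in> L \<Longrightarrow> K \<subset> H \<Longrightarrow> H = T" and dKT: "d K T = 1"
    and dK1: "b \<in> insert {} L \<Longrightarrow> b \<subset> K \<Longrightarrow> d b T - 1 \<le> d b K"
    and dK2: "b \<in> insert {} L \<Longrightarrow> b \<subset> K \<Longrightarrow> d b K \<le> d b T"
begin

text \<open>In the poset \<open>{K, T}\<close> the relations imply that the power
  \<open>d b T\<close> of \<open>pvar K\<close> vanishes, whether \<open>d b T\<close> equals
  \<open>d b K\<close> or exceeds it by one. Cancelling one factor \<open>pvar K\<close> costs one
  exponent, whence the value at \<open>K\<close>.\<close>

definition e :: "'a set \<Rightarrow> 'a set \<Rightarrow> nat"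
  where "e b H = (if H = K then d b T - 1 else d b H)"

definition z :: "'a set \<Rightarrow> ('a set, rat) mvpoly"
  where "z G = (\<Sum>H\<in>{H \<in> L. G \<subseteq> H \<and> H \<subseteq> K}. pvar H)"

lemma KT: "K \<subset> T" using K le_T by blast

text \<open>Such an \<open>H\<close> is incomparable to \<open>K\<close> or equal to
  \<open>T\<close>, and in the second case \<open>d K T = 1\<close> makes
  \<open>pvar K * y T\<close> a relation.\<close>

lemma pvar_K_mult:
  assumes U: "upper b U" "K \<in> U" and H: "H \<in> U" "\<not> H \<subseteq> K"
  shows "pvar K * pvar H \<in> idl (rels d y b U)"
proof (cases "K \<subseteq> H")
  case True
  then have "H = T" using H U coatom by (auto simp: upper_def)
  moreover have "y T = pvar T"
  proof -
    have "{H \<in> L. T \<subseteq> H} = {T}" using T_in le_T by auto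
    then show ?thesis by (simp add: y_def)
  qed
  ultimately show ?thesis using relsI(2)[of K U T y d b] U H KT dKT by simp
qed (use relsI(1) assms in blast)

lemma y_eq_z_plus: "y G = z G + (\<Sum>H\<in>{H \<in> L. G \<subseteq> H \<and> \<not> H \<subseteq> K}. pvar H)"
proof -
  have "{H \<in> L. G \<subseteq> H} = {H \<in> L. G \<subseteq> H \<and> H \<subseteq> K} \<union> {H \<in> L. G \<subseteq> H \<and> \<not> H \<subseteq> K}" by auto
  then show ?thesis unfolding y_def z_def using finite_L by (simp only:) (subst sum.union_disjoint; auto)
qed

lemma pvar_K_y:
  assumes U: "upper b U" "K \<in> U" and G: "\<And>H. H \<in> L \<Longrightarrow> G \<subseteq> H \<Longrightarrow> H \<in> U"
  shows "pvar K * y G ^ n - pvar K * z G ^ n \<in> idl (rels d y b U)"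
proof (rule idl_cong_power)
  have "pvar K * y G - pvar K * z G = (\<Sum>H\<in>{H \<in> L. G \<subseteq> H \<and> \<not> H \<subseteq> K}. pvar K * pvar H)"
    by (simp add: y_eq_z_plus algebra_simps sum_distrib_left)
  then show "pvar K * y G - pvar K * z G \<in> idl (rels d y b U)"
    using pvar_K_mult[OF U] G by (auto intro!: idl_sum)
qed

lemma z_K: "z K = pvar K"
proof -
  have "{H \<in> L. K \<subseteq> H \<and> H \<subseteq> K} = {K}" using K by auto
  then show ?thesis by (simp add: z_def)
qed

lemma y_K: "y K = pvar K + pvar T"
proof -
  have "{H \<in> L. K \<subseteq> H \<and> \<not> H \<subseteq> K} = {T}" using K T_in coatom KT by blast
  then show ?thesis by (simp add: y_eq_z_plus z_K)
qed

lemma y_T: "y T = pvar T"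
proof -
  have "{H \<in> L. T \<subseteq> H} = {T}" using T_in le_T by auto
  then show ?thesis by (simp add: y_def)
qed

text \<open>Setting \<open>pvar T\<close> to zero leaves a statement about powers of
  \<open>pvar K\<close> and shows that all coefficients of \<open>p\<close> below degree
  \<open>d b K - 1\<close> vanish. The coefficient in that degree is harmless unless
  \<open>d b T = d b K + 1\<close>; then it has to be zero as well, and this is only seen with the
  variable of \<open>T\<close>.\<close>

lemma injective_base:
  assumes b: "b \<in> insert {} L" "b \<subset> K" and U: "upper b {K, T}"
    and p: "p \<in> polys {K}" and mem: "pvar K * p \<in> idl (rels d y b {K, T})"
  shows "p \<in> idl (rels e z b {K})"
proof -
  let ?c = "d b K" and ?R = "rels d y b {K, T}"
  let ?h = "\<lambda>p :: ('a set, rat) mvpoly. split_var K (restr {K} p)"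
  interpret r: comm_ring_hom "restr {K} :: ('a set, rat) mvpoly \<Rightarrow> _" by (rule restr_hom)
  interpret s: comm_ring_hom "split_var K :: ('a set, rat) mvpoly \<Rightarrow> _" by (rule split_var_hom)
  interpret t: comm_ring_hom "split_var T :: ('a set, rat) mvpoly \<Rightarrow> _" by (rule split_var_hom)
  have h: "comm_ring_hom ?h" by unfold_locales (auto simp: hom_distribs)
  have c1: "?c \<ge> 1" and D1: "d b T \<ge> 1" using d_pos b K T_in KT by blast+
  have hx: "?h (pvar K) = [:0, 1:]" "?h (pvar T) = 0" using KT by (auto simp: restr_pvar split_var_pvar)
  have "?h (pvar K * p) \<in> idl {[:0, 1:] ^ ?c}"
  proof (rule idl_hom[OF h _ mem])
    fix g assume "g \<in> ?R"
    then show "?h g \<in> idl {[:0, 1:] ^ ?c}"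
    proof (cases rule: rels_cases)
      case (2 F G)
      then have "F = K" "G = T" using KT by auto
      then show ?thesis using 2 KT dKT hx by (simp add: y_T hom_distribs idl_zero)
    next
      case (3 G)
      then show ?thesis using KT D1 hx
        by (auto simp: y_T y_K hom_distribs idl_zero zero_power idl_base)
    qed (use KT in auto)
  qed
  moreover have q: "?h (pvar K * p) = [:0, 1:] * split_var K p"
    using hx p by (simp add: hom_distribs restr_id)
  ultimately have z: "coeff ([:0, 1:] * split_var K p) i = 0" if "i < ?c" for i using idl_monom_coeff that by metis
  define q where "q = split_var K p"
  have qz: "coeff q i = 0" if "Suc i < ?c" for i using z[OF that] by (simp add: q_def)
  obtain a where a: "coeff q (?c - 1) = pconst a"
  proof -
    have "coeff q (?c - 1) \<in> polys {}" unfolding q_def using split_var_coeff[of p K "{}"] p by simp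
    then have "coeff q (?c - 1) = restr {} (coeff q (?c - 1))" by (simp add: restr_id)
    then show thesis using that by (simp add: restr_empty)
  qed
  have pq: "p = poly q (pvar K)" by (simp add: q_def poly_split_var)
  have "p - pconst a * pvar K ^ (?c - 1) = poly (q - monom (pconst a) (?c - 1)) (pvar K)"
    by (simp add: pq poly_monom)
  also have "\<dots> \<in> idl {pvar K ^ ?c}"
    unfolding poly_altdef
  proof (rule idl_sum)
    fix i
    show "coeff (q - monom (pconst a) (?c - 1)) i * pvar K ^ i \<in> idl {pvar K ^ ?c :: ('a set, rat) mvpoly}"
    proof (cases "i < ?c")
      case True
      then have "coeff (q - monom (pconst a) (?c - 1)) i = 0" using qz[of i] a by (cases "Suc i = ?c") auto
      then show ?thesis by (simp add: idl_zero)
    next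
      case False
      then show ?thesis by (intro idl_mult idl_power_le'[OF idl_base]) auto
    qed
  qed
  finally have pa: "p - pconst a * pvar K ^ (?c - 1) \<in> idl {pvar K ^ ?c}" .
  have eK: "pvar K ^ (d b T - 1) \<in> idl (rels e z b {K})"
    using relsI(3)[of K "{K}" z e b] by (simp add: z_K e_def)
  have Kc: "pvar K ^ ?c \<in> idl (rels e z b {K})" using idl_power_le'[OF eK] dK1 b by blast
  then have pa': "p - pconst a * pvar K ^ (?c - 1) \<in> idl (rels e z b {K})"
    using pa by (elim idl_subset[rotated]) auto
  have "pconst a * pvar K ^ (?c - 1) \<in> idl (rels e z b {K})"
  proof (cases "d b T - 1 \<le> ?c - 1")
    case True
    then show ?thesis using idl_power_le'[OF eK] idl_mult by blast
  next
    case False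
    \<comment> \<open>In the remaining case \<open>pvar K ^ Suc ?c\<close> vanishes, so
      \<open>a\<close> annihilates \<open>pvar K ^ ?c\<close>. The relation for
      \<open>y K = pvar K + pvar T\<close> shows that \<open>a\<close> also annihilates
      \<open>pvar T ^ ?c\<close>, and as \<open>d b T\<close> exceeds \<open>?c\<close> this forces
      \<open>a = 0\<close>.\<close>
    then have D: "d b T = Suc ?c" using dK1[OF b] by linarith
    have KTm: "pvar K * pvar T \<in> idl ?R" using pvar_K_mult[OF U, of T] KT by auto
    have 1: "pvar K * pvar K ^ ?c \<in> idl ?R"
    proof -
      have "pvar K * y K ^ ?c - pvar K * z K ^ ?c \<in> idl ?R"
        using coatom by (intro pvar_K_y[OF U]) auto
      moreover have "pvar K * y K ^ ?c \<in> idl ?R" using relsI(3)[of K "{K,T}" y d b] by (auto intro: idl_mult)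
      ultimately show ?thesis unfolding z_K by (rule idl_cong_mem')
    qed
    have "pvar K * (p - pconst a * pvar K ^ (?c - 1)) \<in> idl ?R"
      using pa by (rule idl_times[rotated]) (use 1 in auto)
    then have 2: "pconst a * pvar K ^ ?c \<in> idl ?R"
    proof -
      assume "pvar K * (p - pconst a * pvar K ^ (?c - 1)) \<in> idl ?R"
      moreover have "pvar K * (p - pconst a * pvar K ^ (?c - 1)) = pvar K * p - pconst a * pvar K ^ ?c"
        using c1 by (cases ?c) (auto simp: algebra_simps)
      ultimately show ?thesis using mem idl_cong_mem' by metis
    qed
    have "(pvar K + pvar T) ^ ?c - (pvar K ^ ?c + pvar T ^ ?c) \<in> idl ?R"
      by (rule power_add_cong[OF KTm c1])
    moreover have "(pvar K + pvar T) ^ ?c \<in> idl ?R" using relsI(3)[of K "{K,T}" y d b] by (simp add: y_K)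
    ultimately have "pvar K ^ ?c + pvar T ^ ?c \<in> idl ?R" by (rule idl_cong_mem')
    then have "pconst a * (pvar K ^ ?c + pvar T ^ ?c) \<in> idl ?R" by (rule idl_mult)
    from idl_diff[OF this 2] have 3: "pconst a * pvar T ^ ?c \<in> idl ?R" by (simp add: algebra_simps)
    have ins: "insert K {T} = {K, T}" by auto
    have U0: "upper b {T}" using U le_T by (auto simp: upper_def)
    \<comment> \<open>Seen as a constant polynomial in \<open>pvar K\<close>, the element already
      lies in the ideal before \<open>K\<close> is adjoined, where the single relation is a power of
      \<open>pvar T\<close>.\<close>
    have c0: "coeff [:pconst a * pvar T ^ ?c:] 0 \<in> idl (rels d y b {T})"
    proof (rule blowup_step(1)[OF U0 K(1) b(2) _ _ b(1)])
      show "K \<notin> {T}" using K by simp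
      show "H \<in> {T}" if "H \<in> L" "K \<subset> H" for H using coatom that by simp
      show "coeff [:pconst a * pvar T ^ ?c:] i \<in> polys (- {K})" for i
        using KT by (auto simp: coeff_pCons split: nat.splits intro!: polys_mult polys_power polys_pvar)
      show "coeff [:pconst a * pvar T ^ ?c:] i = 0" if "i \<ge> ?c" for i
        using that c1 by (cases i) auto
      show "poly [:pconst a * pvar T ^ ?c:] (pvar K) \<in> idl (rels d y b {K, T})" using 3 by simp
    qed
    have "split_var T (pconst a * pvar T ^ ?c) \<in> idl {[:0, 1:] ^ d b T}"
    proof (rule idl_hom[OF split_var_hom _ c0[simplified]])
      fix g assume "g \<in> rels d y b {T}"
      then have "g = y T ^ d b T" by (cases rule: rels_cases) auto
      then show "split_var T g \<in> idl {[:0, 1:] ^ d b T}"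
        by (simp add: y_T hom_distribs split_var_pvar idl_base)
    qed
    then have "coeff (split_var T (pconst a * pvar T ^ ?c)) ?c = 0"
      by (rule idl_monom_coeff) (simp add: D)
    then have "pconst a = (0 :: ('a set, rat) mvpoly)"
      by (simp add: hom_distribs split_var_pvar split_var_pconst coeff_monom_mult flip: monom_altdef)
    then show ?thesis by (simp add: idl_zero)
  qed
  then show ?thesis using pa' idl_cong_mem by blast
qed

text \<open>The bottom \<open>b\<close> varies in the induction. Removing a minimal \<open>G\<close>
  leaves \<open>U - {G}\<close> over the same bottom for the constant coefficient in
  \<open>pvar G\<close>, and the interval above \<open>G\<close> with bottom \<open>G\<close> for
  the coefficients of positive powers.\<close>

lemma injective:
  assumes "b \<in> insert {} L" "b \<subset> K" "upper b U" "K \<in> U" "p \<in> polys {H \<in> U. H \<subseteq> K}"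
    "pvar K * p \<in> idl (rels d y b U)"
  shows "p \<in> idl (rels e z b {H \<in> U. H \<subseteq> K})"
  using assms
proof (induction "card U" arbitrary: b U p rule: less_induct)
  case less
  note b = less.prems(1,2) and U = less.prems(3,4) and p = less.prems(5) and mem = less.prems(6)
  have UL: "H \<in> L" "b \<subset> H" if "H \<in> U" for H using U that by (auto simp: upper_def)
  have Uup: "H' \<in> U" if "H \<in> U" "H' \<in> L" "H \<subseteq> H'" for H H' using U that by (auto simp: upper_def)
  have T: "T \<in> U" using Uup[OF U(2) T_in] KT by auto
  have finU: "finite U" using finite_L UL by (meson finite_subset subsetI)
  show ?case
  proof (cases "U - {K, T} = {}")
    case True
    then have UK: "U = {K, T}" using U T by auto
    have "{H \<in> U. H \<subseteq> K} = {K}" using UK KT by auto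
    then show ?thesis using injective_base[OF b] U p mem UK by simp
  next
    case False
    obtain G where G: "G \<in> U - {K, T}" "\<And>H. H \<in> U - {K, T} \<Longrightarrow> H \<subseteq> G \<Longrightarrow> H = G"
      using finite_has_minimal[OF _ False] finU by (metis finite_Diff)
    have GL: "G \<in> L" "b \<subset> G" using G UL by auto
    have minG: "H = G" if "H \<in> U" "H \<subseteq> G" for H
    proof -
      have "H \<noteq> K" using that coatom[OF GL(1)] G(1) by auto
      moreover have "H \<noteq> T" using that le_T[OF GL(1)] G(1) by auto
      ultimately show ?thesis using that G by blast
    qed
    define V where "V = U - {G}"
    have V: "upper b V" using U minG unfolding upper_def V_def by blast
    have KV: "K \<in> V" using U G by (auto simp: V_def)
    have UV: "U = insert G V" "G \<notin> V" using G by (auto simp: V_def)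
    have cV: "card V < card U" using finU UV by (simp add: card_insert_if)
    have aV: "H \<in> V" if "H \<in> L" "G \<subset> H" for H using that Uup[of G H] G by (auto simp: V_def)
    have c1: "d b G \<ge> 1" using d_pos b GL by blast
    show ?thesis
    proof (cases "G \<subseteq> K")
      case False
      \<comment> \<open>Here \<open>pvar G\<close> does not occur in \<open>pvar K * p\<close>,
        which is thus a constant polynomial in it, and the first part of \<open>blowup_step\<close>
        removes \<open>G\<close>.\<close>
      have e: "{H \<in> U. H \<subseteq> K} = {H \<in> V. H \<subseteq> K}" using False UV by auto
      have "coeff [:pvar K * p:] 0 \<in> idl (rels d y b V)"
      proof (rule blowup_step(1)[OF V GL(1,2) UV(2) _ b(1)])
        have "p \<in> polys (- {G})" by (rule polys_mono[OF _ p]) (use False in auto)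
        moreover have "K \<noteq> G" using False by blast
        ultimately show "coeff [:pvar K * p:] i \<in> polys (- {G})" for i
          by (auto simp: coeff_pCons split: nat.splits intro!: polys_mult polys_pvar)
        show "coeff [:pvar K * p:] i = 0" if "i \<ge> d b G" for i
          using that c1 by (cases i) auto
        show "poly [:pvar K * p:] (pvar G) \<in> idl (rels d y b (insert G V))" using mem UV by simp
      qed (use aV in blast)
      then show ?thesis using less.hyps[OF cV b V KV] p e by simp
    next
      case GK: True
      let ?c = "d b G"
      let ?B = "rels e z b {H \<in> U. H \<subseteq> K}"
      have GK': "G \<subset> K" using GK G by auto
      define S where "S = {H \<in> V. H \<subseteq> K}"
      have US: "{H \<in> U. H \<subseteq> K} = insert G S" using UV GK by (auto simp: S_def)
      have GS: "G \<notin> S" using UV by (auto simp: S_def)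
      define y' where "y' = (\<Sum>H\<in>{H \<in> L. G \<subset> H \<and> H \<subseteq> K}. pvar H :: ('a set, rat) mvpoly)"
      have "{H \<in> L. G \<subseteq> H \<and> H \<subseteq> K} = insert G {H \<in> L. G \<subset> H \<and> H \<subseteq> K}" using GL GK by auto
      then have zG: "z G = pvar G + y'" unfolding z_def y'_def using finite_L by simp
      have y'p: "y' \<in> polys S" unfolding y'_def S_def using aV by (auto intro!: polys_sum polys_pvar)
      define f where "f = [:y', 1:] ^ ?c"
      have f: "coeff f ?c = 1" "degree f = ?c" unfolding f_def
        using degree_linear_power[of y' ?c] coeff_linear_power[of y' ?c] by auto
      have ff: "poly f (pvar G) = z G ^ ?c" by (simp add: f_def zG add.commute)
      have fS: "coeff f i \<in> polys S" for i
      proof -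
        have "coeff ([:y', 1:] ^ n) i \<in> polys S" for n i
          by (induction n arbitrary: i)
            (auto simp: coeff_pCons y'p split: nat.split intro!: polys_add polys_mult)
        then show ?thesis by (simp add: f_def)
      qed
      \<comment> \<open>Division by \<open>z G ^ ?c\<close> brings the degree in
        \<open>pvar G\<close> below \<open>?c\<close>, as \<open>blowup_step\<close> requires. The
        subtracted multiple is harmless on both sides: \<open>z G ^ ?c\<close> is a relation below
        \<open>K\<close>, and after multiplication by \<open>pvar K\<close> it agrees with the
        relation \<open>y G ^ ?c\<close>.\<close>
      have "\<exists>g r. split_var G p = f * g + r \<and> (\<forall>i. coeff r i \<in> polys S) \<and> (\<forall>i\<ge>?c. coeff r i = 0)"
        using p unfolding US
        by (intro monic_division[OF f c1 fS split_var_coeff]) (auto intro: polys_diff polys_mult)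
      then obtain g r where r: "split_var G p = f * g + r" "\<And>i. coeff r i \<in> polys S" "\<And>i. i \<ge> ?c \<Longrightarrow> coeff r i = 0"
        by blast
      have pr: "p = z G ^ ?c * poly g (pvar G) + poly r (pvar G)"
        using poly_split_var[of G p] by (simp add: r(1) ff)
      have zGB: "z G ^ ?c \<in> idl ?B"
      proof -
        have "G \<noteq> K" using GK' by blast
        moreover have "G \<in> {H \<in> U. H \<subseteq> K}" using UV GK by blast
        ultimately show ?thesis using relsI(3)[of G "{H \<in> U. H \<subseteq> K}" z e b] by (simp add: e_def)
      qed
      have "pvar K * z G ^ ?c \<in> idl (rels d y b U)"
      proof (rule idl_cong_mem')
        show "pvar K * y G ^ ?c - pvar K * z G ^ ?c \<in> idl (rels d y b U)"
          using pvar_K_y[OF U] Uup UV by blast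
        show "pvar K * y G ^ ?c \<in> idl (rels d y b U)" using relsI(3)[of G U y d b] UV by (auto intro: idl_mult)
      qed
      then have "pvar K * (z G ^ ?c * poly g (pvar G)) \<in> idl (rels d y b U)"
        using idl_mult_right by (metis mult.assoc)
      then have "pvar K * poly r (pvar G) \<in> idl (rels d y b U)"
    proof -
        have "pvar K * p - pvar K * (z G ^ ?c * poly g (pvar G)) = pvar K * poly r (pvar G)"
          unfolding right_diff_distrib[symmetric] by (subst pr) simp
        then show ?thesis using idl_diff[OF mem \<open>pvar K * (z G ^ ?c * poly g (pvar G)) \<in> _\<close>] by simp
      qed
      then have mem': "poly (smult (pvar K) r) (pvar G) \<in> idl (rels d y b (insert G V))" using UV by simp
      have KS: "K \<in> S" using KV by (auto simp: S_def)
      have qp: "coeff (smult (pvar K) r) i \<in> polys (- {G})" for i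
        using r(2)[of i] GS KS by (auto intro!: polys_mult polys_pvar intro: polys_mono[rotated])
      have qz: "i \<ge> ?c \<Longrightarrow> coeff (smult (pvar K) r) i = 0" for i using r(3) by simp
      have st1: "coeff (smult (pvar K) r) 0 \<in> idl (rels d y b V)"
        by (rule blowup_step(1)[OF V GL(1,2) UV(2) _ b(1) qp _ mem']) (use aV qz in blast)+
      have st2: "coeff (smult (pvar K) r) i \<in> idl (rels d y b V \<union> {pvar H | H. H \<in> V \<and> \<not> G \<subseteq> H} \<union>
        {y H ^ d G H | H. H \<in> V \<and> G \<subset> H})" if "i \<ge> 1" for i
        by (rule blowup_step(2)[OF V GL(1,2) UV(2) _ b(1) qp _ mem' that]) (use aV qz in blast)+
      have "coeff r 0 \<in> idl (rels e z b {H \<in> V. H \<subseteq> K})"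
        by (rule less.hyps[OF cV b V KV]) (use st1 r(2) in \<open>auto simp: S_def\<close>)
      then have r0: "coeff r 0 \<in> idl ?B" by (rule rels_mono[rotated]) (auto simp: UV)
      have ri: "coeff r i * pvar G \<in> idl ?B" if i: "i \<ge> 1" for i
      proof -
        define W where "W = {H \<in> L. G \<subset> H}"
        interpret rW: comm_ring_hom "restr W :: ('a set, rat) mvpoly \<Rightarrow> _" by (rule restr_hom)
        have W: "upper G W" by (auto simp: upper_def W_def)
        have WV: "W \<subseteq> V" using aV by (auto simp: W_def)
        have rp: "restr W (pvar H) = pvar H" if "H \<in> W" for H using that by (simp add: restr_pvar)
        have rc: "restr W (y H) = y H" if "H \<in> W" for H
          using that by (intro restr_id y_polys) (auto simp: W_def)
        \<comment> \<open>Killing the variables not above \<open>G\<close> turns \<open>y H\<close>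
          into the sum above the join of \<open>H\<close> and \<open>G\<close>. The inequality
          between the exponents lets power relations with bottom \<open>b\<close> map to
          consequences of those with bottom \<open>G\<close>.\<close>
        have join: "\<exists>J\<in>W. restr W (y H) = y J \<and> d G J \<le> d b H" if H: "H \<in> V" for H
        proof -
          have HL: "H \<in> L" "b \<subset> H" "\<not> H \<subseteq> G" using H UL minG UV by auto
          obtain J where J: "J \<in> L" "G \<subset> J" "\<forall>H'\<in>L. J \<subseteq> H' \<longleftrightarrow> H \<subseteq> H' \<and> G \<subseteq> H'" "d G J \<le> d b H"
            using ex_join[OF HL(1) GL(1) HL(3)] b GL(2) HL(2) by blast
          have "restr W (y H) = (\<Sum>H'\<in>{H' \<in> L. H \<subseteq> H'}. if H' \<in> W then pvar H' else 0)"
            by (simp add: y_def hom_distribs restr_pvar)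
          also have "\<dots> = (\<Sum>H'\<in>{H' \<in> L. H \<subseteq> H'} \<inter> W. pvar H')"
            using finite_L by (subst sum.inter_restrict) auto
          also have "{H' \<in> L. H \<subseteq> H'} \<inter> W = {H' \<in> L. J \<subseteq> H'}"
            using J(3) HL(3) by (auto simp: W_def)
          finally show ?thesis using J by (auto simp: y_def W_def)
        qed
        have "restr W (coeff (smult (pvar K) r) i) \<in> idl (rels d y G W)"
        proof (rule idl_hom[OF restr_hom _ st2[OF i]])
          fix g assume "g \<in> rels d y b V \<union> {pvar H | H. H \<in> V \<and> \<not> G \<subseteq> H} \<union> {y H ^ d G H | H. H \<in> V \<and> G \<subset> H}"
          then consider "g \<in> rels d y b V" | H where "g = pvar H" "H \<in> V" "\<not> G \<subseteq> H"
            | H where "g = y H ^ d G H" "H \<in> V" "G \<subset> H" by blast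
          then show "restr W g \<in> idl (rels d y G W)"
          proof cases
            case 1
            then show ?thesis
            proof (cases rule: rels_cases)
              case (1 H H')
              then show ?thesis by (auto simp: hom_distribs restr_pvar idl_zero relsI)
            next
              case (2 F H)
              show ?thesis
              proof (cases "F \<in> W")
                case True
                then have "H \<in> W" using 2 UL UV by (auto simp: W_def)
                then show ?thesis using 2 True by (auto simp: hom_distribs rp rc relsI)
              qed (use 2 in \<open>auto simp: hom_distribs restr_pvar idl_zero\<close>)
            next
              case (3 H)
              then obtain J where "J \<in> W" "restr W (y H) = y J" "d G J \<le> d b H" using join by blast
              then show ?thesis using 3 by (auto simp: hom_distribs intro: idl_power_le'[OF relsI(3)])
            qed
          next
            case 2
            then show ?thesis by (auto simp: restr_pvar W_def idl_zero)
          next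
            case 3
            then have "H \<in> W" using UL UV by (auto simp: W_def)
            then show ?thesis using 3 by (auto simp: hom_distribs rc relsI)
          qed
        qed
        moreover have KW: "K \<in> W" using GK' K by (auto simp: W_def)
        ultimately have mW: "pvar K * restr W (coeff r i) \<in> idl (rels d y G W)"
          by (simp add: hom_distribs rp)
        have pW: "restr W (coeff r i) \<in> polys {H \<in> W. H \<subseteq> K}"
          using restr_in_polys[OF r(2)[of i], of W] by (rule polys_mono[rotated]) (auto simp: S_def)
        have cW: "card W < card U" using finU cV card_mono[OF _ WV] UV(1) by simp
        have IH: "restr W (coeff r i) \<in> idl (rels e z G {H \<in> W. H \<subseteq> K})"
          using less.hyps[OF cW _ GK' W KW pW mW] GL by auto
        have GB: "G \<in> {H \<in> U. H \<subseteq> K}" using UV GK by auto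
        \<comment> \<open>A power relation with bottom \<open>G\<close> becomes a relation with
          bottom \<open>b\<close> as soon as the factor \<open>pvar G\<close> is restored.\<close>
        have 1: "pvar G * restr W (coeff r i) \<in> idl ?B"
        proof (rule idl_times[OF _ IH])
          fix g assume "g \<in> rels e z G {H \<in> W. H \<subseteq> K}"
          then show "pvar G * g \<in> idl ?B"
          proof (cases rule: rels_cases)
            case (1 H H')
            then have "pvar H * pvar H' \<in> idl ?B" using WV UV by (intro relsI(1)) auto
            then show ?thesis using 1 by (simp add: idl_mult)
          next
            case (2 F H)
            then have "pvar F * z H ^ e F H \<in> idl ?B" using WV UV by (intro relsI(2)) auto
            then show ?thesis using 2 by (simp add: idl_mult)
          next
            case (3 H)
            then show ?thesis using WV UV GB relsI(2)[OF GB, of H z e b] by (auto simp: W_def)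
          qed
        qed
        \<comment> \<open>The variables lost by the restriction belong to elements incomparable to
          \<open>G\<close>, so \<open>pvar G\<close> annihilates them.\<close>
        have "coeff r i - restr W (coeff r i) \<in> idl (pvar ` (S - W))" by (rule restr_diff[OF r(2)])
        then have 2: "pvar G * (coeff r i - restr W (coeff r i)) \<in> idl ?B"
        proof (rule idl_times[rotated])
          fix g :: "('a set, rat) mvpoly" assume "g \<in> pvar ` (S - W)"
          then obtain H where H: "g = pvar H" "H \<in> S" "H \<notin> W" by blast
          then have "H \<in> U" "H \<subseteq> K" "H \<in> L" "H \<noteq> G" using UV UL GS by (auto simp: S_def)
          moreover have "\<not> G \<subseteq> H" "\<not> H \<subseteq> G" using H calculation minG by (auto simp: W_def)
          ultimately show "pvar G * g \<in> idl ?B" using H GB by (auto intro!: relsI(1))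
        qed
        show ?thesis using idl_add[OF 1 2] by (simp add: algebra_simps)
      qed
      have "poly r (pvar G) \<in> idl ?B"
        unfolding poly_altdef
      proof (rule idl_sum)
        fix i
        show "coeff r i * pvar G ^ i \<in> idl ?B"
        proof (cases i)
          case 0 then show ?thesis using r0 by simp
        next
          case (Suc j)
          then show ?thesis using ri[of i] idl_mult_right[of "coeff r i * pvar G" ?B "pvar G ^ j"] by (simp add: mult.assoc)
        qed
      qed
      then show ?thesis unfolding pr using zGB by (auto intro: idl_add idl_mult_right)
    qed
  qed
qed

end

section \<open>Flats of a matroid\<close>

context matroid
begin

abbreviation rk :: "'a set \<Rightarrow> nat" where "rk \<equiv> matroid_rank indep"
abbreviation is_flat :: "'a set \<Rightarrow> bool" where "is_flat \<equiv> flat E indep"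

lemma finite_indeps: "finite {Y. Y \<subseteq> X \<and> indep Y}"
  by (rule finite_subset[of _ "Pow E"]) (auto dest: indep_subset_ground simp: finite_ground)

lemma indep_finite: "indep Y \<Longrightarrow> finite Y"
  using indep_subset_ground finite_ground finite_subset by blast

lemma rank_ge: "indep Y \<Longrightarrow> Y \<subseteq> X \<Longrightarrow> card Y \<le> rk X"
  unfolding matroid_rank_def using finite_indeps by (intro Max_ge) auto

lemma ex_basis: "\<exists>B\<subseteq>X. indep B \<and> card B = rk X"
proof -
  have "rk X \<in> card ` {Y. Y \<subseteq> X \<and> indep Y}"
    unfolding matroid_rank_def using finite_indeps indep_empty by (intro Max_in) auto
  then show ?thesis by auto
qed

lemma basis_extend:
  assumes "indep Y" "Y \<subseteq> X" shows "\<exists>B. Y \<subseteq> B \<and> B \<subseteq> X \<and> indep B \<and> card B = rk X"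
  using assms
proof (induction "rk X - card Y" arbitrary: Y)
  case 0
  then show ?case using rank_ge[of Y X] by (intro exI[of _ Y]) auto
next
  case (Suc n)
  obtain B where B: "B \<subseteq> X" "indep B" "card B = rk X" using ex_basis by blast
  then obtain b where b: "b \<in> B - Y" "indep (insert b Y)"
  proof -
    have "card Y < card B" using Suc(2) B by linarith
    then show thesis using indep_augment[of Y B] Suc(3) B that by blast
  qed
  then have "n = rk X - card (insert b Y)" using Suc indep_finite by (simp add: card_insert_if)
  then show ?case using Suc(1)[of "insert b Y"] b B Suc(4) by blast
qed

lemma rank_mono: "X \<subseteq> Y \<Longrightarrow> rk X \<le> rk Y"
  using ex_basis[of X] rank_ge[of _ Y] by force

lemma rank_insert_le: "rk (insert e X) \<le> Suc (rk X)"
proof -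
  obtain B where B: "B \<subseteq> insert e X" "indep B" "card B = rk (insert e X)" using ex_basis by blast
  have "indep (B - {e})" "B - {e} \<subseteq> X" using B indep_subset by auto
  from rank_ge[OF this] have "card (B - {e}) \<le> rk X" .
  moreover have "card B \<le> Suc (card (B - {e}))"
    using B indep_finite by (cases "e \<in> B") (auto simp: card_Suc_Diff1)
  ultimately show ?thesis using B by simp
qed

definition cl :: "'a set \<Rightarrow> 'a set"
  where "cl X = {e \<in> E. rk (insert e X) = rk X}"

lemma cl_superset: "X \<subseteq> E \<Longrightarrow> X \<subseteq> cl X"
  by (auto simp: cl_def insert_absorb)

text \<open>An independent set in the closure larger than a basis of \<open>X\<close> would extend
  this basis by an element that, by definition of \<open>cl\<close>, does not raise the
  rank.\<close>

lemma rank_cl: "X \<subseteq> E \<Longrightarrow> rk (cl X) = rk X"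
proof (rule antisym)
  assume X: "X \<subseteq> E"
  show "rk X \<le> rk (cl X)" using rank_mono cl_superset[OF X] .
  show "rk (cl X) \<le> rk X"
  proof (rule ccontr)
    assume "\<not> rk (cl X) \<le> rk X"
    then have less: "rk X < rk (cl X)" by simp
    obtain B where B: "B \<subseteq> X" "indep B" "card B = rk X" using ex_basis by blast
    obtain C where C: "C \<subseteq> cl X" "indep C" "card C = rk (cl X)" using ex_basis by blast
    obtain e where e: "e \<in> C - B" "indep (insert e B)" using indep_augment[of B C] B C less by auto
    have "card (insert e B) \<le> rk (insert e X)" using e B by (intro rank_ge) auto
    moreover have "card (insert e B) = Suc (card B)" using e B indep_finite by auto
    moreover have "rk (insert e X) = rk X" using e C by (auto simp: cl_def)
    ultimately show False using B by simp
  qed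
qed

lemma flat_cl: assumes X: "X \<subseteq> E" shows "is_flat (cl X)"
  unfolding flat_def
proof (intro conjI ballI)
  fix e assume e: "e \<in> E - cl X"
  then have "rk X < rk (insert e X)" using rank_mono[OF subset_insertI, of X e] by (auto simp: cl_def)
  also have "\<dots> \<le> rk (insert e (cl X))" using cl_superset[OF X] by (intro rank_mono) auto
  finally show "rk (cl X) < rk (insert e (cl X))" by (simp add: rank_cl[OF X])
qed (auto simp: cl_def)

lemma flat_subset: "is_flat F \<Longrightarrow> F \<subseteq> E"
  by (simp add: flat_def)

text \<open>If \<open>e\<close> raised the rank of \<open>F\<close>, it would extend a basis of
  \<open>F\<close> that prolongs a basis of \<open>X\<close>, and would raise the rank of
  \<open>X\<close> too.\<close>

lemma cl_least: assumes F: "is_flat F" "X \<subseteq> F" shows "cl X \<subseteq> F"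
proof
  fix e assume e: "e \<in> cl X"
  show "e \<in> F"
  proof (rule ccontr)
    assume "e \<notin> F"
    then have less: "rk F < rk (insert e F)" using F e by (auto simp: flat_def cl_def)
    obtain B where B: "B \<subseteq> X" "indep B" "card B = rk X" using ex_basis by blast
    obtain B' where B': "B \<subseteq> B'" "B' \<subseteq> F" "indep B'" "card B' = rk F"
      using basis_extend[OF B(2), of F] B F by blast
    obtain C where C: "C \<subseteq> insert e F" "indep C" "card C = rk (insert e F)" using ex_basis by blast
    obtain c where c: "c \<in> C - B'" "indep (insert c B')" using indep_augment[of B' C] B' C less by auto
    have "c = e"
    proof (rule ccontr)
      assume "c \<noteq> e"
      then have "insert c B' \<subseteq> F" using c C B' by auto
      from rank_ge[OF c(2) this] show False using B' c indep_finite by auto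
    qed
    then have "indep (insert e B)" using c B' indep_subset by blast
    then have "card (insert e B) \<le> rk (insert e X)" using B by (intro rank_ge) auto
    moreover have "e \<notin> B" using \<open>e \<notin> F\<close> B F by auto
    ultimately show False using e B indep_finite by (auto simp: cl_def)
  qed
qed

lemma flat_rank_less: "is_flat F \<Longrightarrow> is_flat G \<Longrightarrow> F \<subset> G \<Longrightarrow> rk F < rk G"
proof -
  assume F: "is_flat F" "is_flat G" "F \<subset> G"
  then obtain e where e: "e \<in> G - F" by blast
  then have "rk F < rk (insert e F)" using F flat_subset[of G] by (auto simp: flat_def)
  also have "\<dots> \<le> rk G" using e F by (intro rank_mono) auto
  finally show ?thesis .
qed

lemma flat_eqI: "is_flat F \<Longrightarrow> is_flat G \<Longrightarrow> F \<subseteq> G \<Longrightarrow> rk G \<le> rk F \<Longrightarrow> F = G"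
  using flat_rank_less[of F G] by fastforce

definition join :: "'a set \<Rightarrow> 'a set \<Rightarrow> 'a set"
  where "join G H = cl (G \<union> H)"

lemma flat_join: "G \<subseteq> E \<Longrightarrow> H \<subseteq> E \<Longrightarrow> is_flat (join G H)"
  unfolding join_def by (rule flat_cl) auto

lemma join_upper: "G \<subseteq> E \<Longrightarrow> H \<subseteq> E \<Longrightarrow> G \<subseteq> join G H" "G \<subseteq> E \<Longrightarrow> H \<subseteq> E \<Longrightarrow> H \<subseteq> join G H"
  unfolding join_def using cl_superset[of "G \<union> H"] by auto

lemma join_le_iff:
  "G \<subseteq> E \<Longrightarrow> H \<subseteq> E \<Longrightarrow> is_flat F \<Longrightarrow> join G H \<subseteq> F \<longleftrightarrow> G \<subseteq> F \<and> H \<subseteq> F"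
  using join_upper[of G H] cl_least[of F "G \<union> H"] unfolding join_def by blast

lemma rank_union_le: "finite Y \<Longrightarrow> rk (X \<union> Y) \<le> rk X + card Y"
proof (induction Y rule: finite_induct)
  case (insert e Y)
  then show ?case using rank_insert_le[of e "X \<union> Y"] by simp
qed simp

text \<open>Semimodularity, relative to any common subset \<open>b\<close> in place of the
  intersection. A basis of \<open>b\<close> is prolonged to one of \<open>G\<close>; the added
  elements together with \<open>H\<close> already span the join.\<close>

lemma rank_join:
  assumes G: "is_flat G" and H: "is_flat H" and b: "b \<subseteq> G" "b \<subseteq> H"
  shows "rk (join G H) + rk b \<le> rk G + rk H"
proof -
  note GE = flat_subset[OF G] and HE = flat_subset[OF H]
  obtain B where B: "B \<subseteq> b" "indep B" "card B = rk b" using ex_basis by blast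
  obtain C where C: "B \<subseteq> C" "C \<subseteq> G" "indep C" "card C = rk G"
    using basis_extend[OF B(2), of G] B b by blast
  let ?X = "H \<union> (C - B)"
  have XE: "?X \<subseteq> E" using C GE HE by auto
  have "G \<subseteq> cl ?X"
  proof -
    have CX: "C \<subseteq> ?X" using B b by auto
    have CE: "C \<subseteq> E" using C GE by auto
    have "rk G \<le> rk C" using rank_ge[OF C(3), of C] C by simp
    then have "cl C = G" using cl_least[OF G C(2)] flat_cl[OF CE] G
      by (intro flat_eqI) (auto simp: rank_cl[OF CE])
    then show ?thesis using cl_least[OF flat_cl[OF XE], of C] cl_superset[OF XE] CX by auto
  qed
  then have "join G H \<subseteq> cl ?X" using cl_superset[OF XE] flat_cl[OF XE] GE HE by (simp add: join_le_iff)
  then have "rk (join G H) \<le> rk ?X" using rank_mono[of "join G H" "cl ?X"] rank_cl[OF XE] by simp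
  also have "\<dots> \<le> rk H + card (C - B)" using C indep_finite by (intro rank_union_le) auto
  also have "card (C - B) = rk G - rk b" using C B indep_finite by (simp add: card_Diff_subset)
  finally show ?thesis using rank_mono[OF b(1)] by simp
qed

lemma join_singleton:
  assumes F: "is_flat F" and i: "i \<in> E - F"
  shows "rk (join F {i}) = Suc (rk F)" "F \<subset> join F {i}" "i \<in> join F {i}"
proof -
  have FE: "F \<subseteq> E" "{i} \<subseteq> E" using flat_subset[OF F] i by auto
  show sub: "F \<subset> join F {i}" and "i \<in> join F {i}" using join_upper[OF FE] i by auto
  have "rk (join F {i}) \<le> Suc (rk F)"
    unfolding join_def using rank_cl[of "F \<union> {i}"] FE rank_insert_le[of i F] by simp
  moreover have "rk F < rk (join F {i})" using flat_rank_less[OF F flat_join[OF FE] sub] .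
  ultimately show "rk (join F {i}) = Suc (rk F)" by simp
qed

lemma flat_ground: "is_flat E"
  by (simp add: flat_def)

lemma finite_flats: "finite {F. is_flat F}"
  by (rule finite_subset[of _ "Pow E"]) (auto dest: flat_subset simp: finite_ground)

text \<open>A maximal flat between \<open>F\<close> and \<open>G\<close> other than
  \<open>G\<close>: its join with a point of \<open>G\<close> has rank one more and equals
  \<open>G\<close> by maximality.\<close>

lemma ex_coatom:
  assumes F: "is_flat F" "is_flat G" "F \<subset> G"
  obtains F' where "is_flat F'" "F \<subseteq> F'" "F' \<subset> G" "Suc (rk F') = rk G"
proof -
  let ?S = "{F'. is_flat F' \<and> F \<subseteq> F' \<and> F' \<subset> G}"
  have "finite ?S" using finite_flats by simp
  moreover have "F \<in> ?S" using F by simp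
  ultimately obtain M where M: "M \<in> ?S" "\<And>F'. F' \<in> ?S \<Longrightarrow> M \<subseteq> F' \<Longrightarrow> F' = M"
    using finite_has_maximal[of ?S] by (metis (no_types, lifting) empty_iff)
  then obtain i where i: "i \<in> G - M" by blast
  have ME: "M \<subseteq> E" "{i} \<subseteq> E" "i \<in> E - M" using M i flat_subset F by auto
  have "join M {i} \<subseteq> G" using join_le_iff[OF ME(1,2)] M i F by auto
  moreover have "\<not> join M {i} \<subset> G" using M(2)[of "join M {i}"] join_singleton[of M i] M(1) ME flat_join by blast
  ultimately have "join M {i} = G" by blast
  then show thesis using that[of M] M join_singleton[of M i] ME by auto
qed

end

section \<open>Simple matroids and the relations of their Chow rings\<close>

context simple_matroid
begin

lemma indep_singleton: "i \<in> E \<Longrightarrow> indep {i}"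
  using no_loops by (auto simp: matroid_loop_def)

lemma rank_empty: "rk {} = 0"
  using ex_basis[of "{}"] by auto

lemma flat_rank_0: "is_flat F \<Longrightarrow> rk F = 0 \<Longrightarrow> F = {}"
  using rank_ge[OF indep_singleton, of _ F] flat_subset[of F] by force

lemma rank_le_card: "finite X \<Longrightarrow> rk X \<le> card X"
  using rank_union_le[of X "{}"] rank_empty by simp

lemma rank_singleton: "i \<in> E \<Longrightarrow> rk {i} = 1"
  using rank_ge[OF indep_singleton, of i "{i}"] rank_le_card[of "{i}"] by simp

text \<open>The absence of parallel elements enters here. It provides a variable for every point and
  lets the linear relation of \<open>i\<close> be read as the relation at the flat
  \<open>{i}\<close>.\<close>

lemma flat_singleton: "i \<in> E \<Longrightarrow> is_flat {i}"
  unfolding flat_def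
proof (intro conjI ballI)
  fix e assume i: "i \<in> E" and e: "e \<in> E - {i}"
  have "indep {e, i}" using no_parallel[of e i] no_loops e i by (auto simp: matroid_parallel_def)
  from rank_ge[OF this, of "insert e {i}"] show "rk {i} < rk (insert e {i})"
    using e i by (simp add: rank_singleton)
qed simp

lemma flat_empty: "is_flat {}"
  unfolding flat_def using rank_singleton rank_empty by auto

abbreviation flats :: "'a set set" where "flats \<equiv> nonempty_flats E indep"

lemma flats_iff: "F \<in> flats \<longleftrightarrow> is_flat F \<and> F \<noteq> {}"
  by (simp add: nonempty_flats_def)

lemma finite_nonempty_flats: "finite flats"
  using finite_flats by (simp add: nonempty_flats_def)

definition chow_gens :: "('a set, rat) mvpoly set"
  where "chow_gens = {\<Sum>F\<in>{F \<in> flats. i \<in> F}. pvar F | i. i \<in> E} \<union>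
    {pvar F * pvar G | F G. F \<in> flats \<and> G \<in> flats \<and> \<not> F \<subseteq> G \<and> \<not> G \<subseteq> F}"

lemma chow_linear: "i \<in> E \<Longrightarrow> (\<Sum>F\<in>{F \<in> flats. i \<in> F}. pvar F) \<in> idl chow_gens"
  by (rule idl_base) (auto simp: chow_gens_def)

lemma chow_incomparable:
  "F \<in> flats \<Longrightarrow> G \<in> flats \<Longrightarrow> \<not> F \<subseteq> G \<Longrightarrow> \<not> G \<subseteq> F \<Longrightarrow> pvar F * pvar G \<in> idl chow_gens"
  by (rule idl_base) (auto simp: chow_gens_def)

text \<open>In the linear relation of a point \<open>i\<close> outside \<open>F\<close>, no flat
  lies below \<open>F\<close>, and those that are not above \<open>F\<close> are incomparable to it
  and vanish after multiplication by \<open>pvar F\<close>. Some of them may be retained in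
  \<open>A\<close>.\<close>

lemma chow_linear_above:
  assumes F: "F \<in> flats" and i: "i \<in> E - F"
    and A: "{H \<in> flats. F \<subseteq> H \<and> i \<in> H} \<subseteq> A" "A \<subseteq> flats" "\<And>H. H \<in> A \<Longrightarrow> i \<in> H"
  shows "pvar F * (\<Sum>H\<in>A. pvar H) \<in> idl chow_gens"
proof -
  have fin: "finite A" using A(2) finite_nonempty_flats finite_subset by blast
  have "(\<Sum>H\<in>{H \<in> flats. i \<in> H}. pvar H :: ('a set, rat) mvpoly) = (\<Sum>H\<in>A. pvar H) + (\<Sum>H\<in>{H \<in> flats. i \<in> H} - A. pvar H)"
    using A finite_nonempty_flats by (subst sum.subset_diff[of A]) auto
  then have "pvar F * (\<Sum>H\<in>{H \<in> flats. i \<in> H}. pvar H) = pvar F * (\<Sum>H\<in>A. pvar H) + (\<Sum>H\<in>{H \<in> flats. i \<in> H} - A. pvar F * pvar H :: ('a set, rat) mvpoly)"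
    by (simp only: distrib_left sum_distrib_left[of _ _ "{H \<in> flats. i \<in> H} - A", symmetric])
  then have "pvar F * (\<Sum>H\<in>A. pvar H) = pvar F * (\<Sum>H\<in>{H \<in> flats. i \<in> H}. pvar H) - (\<Sum>H\<in>{H \<in> flats. i \<in> H} - A. pvar F * pvar H :: ('a set, rat) mvpoly)"
    by simp
  also have "\<dots> \<in> idl chow_gens"
  proof (rule idl_diff[OF idl_mult idl_sum])
    fix H assume "H \<in> {H \<in> flats. i \<in> H} - A"
    then show "pvar F * pvar H \<in> idl chow_gens" using F i A(1) by (intro chow_incomparable) auto
  qed (use i chow_linear in auto)
  finally show ?thesis .
qed

definition ysum :: "'a set \<Rightarrow> ('a set, rat) mvpoly"
  where "ysum G = (\<Sum>H\<in>{H \<in> flats. G \<subseteq> H}. pvar H)"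

text \<open>The empty flat has no variable. The value 1 makes it a bottom element, so that relations
  with and without a variable in front can be treated alike.\<close>

definition xvar :: "'a set \<Rightarrow> ('a set, rat) mvpoly"
  where "xvar F = (if F = {} then 1 else pvar F)"

lemma flats_above_join:
  assumes F: "is_flat F" and i: "i \<in> E - F"
  shows "{H \<in> flats. join F {i} \<subseteq> H} = {H \<in> flats. F \<subseteq> H \<and> i \<in> H}"
  using join_le_iff[OF flat_subset[OF F], of "{i}"] i by (auto simp: flats_iff)

text \<open>The two sums differ by the flats above \<open>F\<close> that miss \<open>i\<close>, and
  each of their variables annihilates \<open>ysum (join F {i})\<close> by the linear relation of
  \<open>i\<close>.\<close>

lemma ysum_square:
  assumes F: "is_flat F" and i: "i \<in> E - F"
  shows "ysum (join F {i}) * ysum F - ysum (join F {i}) * ysum (join F {i}) \<in> idl chow_gens"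
proof -
  let ?G = "join F {i}"
  note e = flats_above_join[OF assms]
  have "{H \<in> flats. F \<subseteq> H} = {H \<in> flats. F \<subseteq> H \<and> i \<in> H} \<union> {H \<in> flats. F \<subseteq> H \<and> i \<notin> H}" by auto
  then have "ysum F = ysum ?G + (\<Sum>H\<in>{H \<in> flats. F \<subseteq> H \<and> i \<notin> H}. pvar H)"
    unfolding ysum_def e using finite_nonempty_flats by (simp only:) (subst sum.union_disjoint; auto)
  then have "ysum ?G * ysum F - ysum ?G * ysum ?G = (\<Sum>H\<in>{H \<in> flats. F \<subseteq> H \<and> i \<notin> H}. pvar H * ysum ?G)"
    by (simp add: algebra_simps sum_distrib_left)
  also have "\<dots> \<in> idl chow_gens"
  proof (rule idl_sum)
    fix H assume "H \<in> {H \<in> flats. F \<subseteq> H \<and> i \<notin> H}"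
    then show "pvar H * ysum ?G \<in> idl chow_gens"
      unfolding ysum_def e using i by (intro chow_linear_above[of H i]) auto
  qed
  finally show ?thesis .
qed

text \<open>Ascent along a maximal chain. For \<open>F'\<close> covered by \<open>G\<close>,
  repeated use of \<open>ysum_square\<close> gives
  \<open>ysum G * ysum F' ^ n = ysum G ^ Suc n\<close> modulo the relations, so the relation at
  \<open>F'\<close> implies the one at \<open>G\<close>.\<close>

lemma xvar_ysum_power:
  assumes "is_flat F" "is_flat G" "F \<subset> G"
  shows "xvar F * ysum G ^ (rk G - rk F) \<in> idl chow_gens"
  using assms
proof (induction "rk G - rk F" arbitrary: G rule: less_induct)
  case less
  note F = less.prems(1) and G = less.prems(2) and FG = less.prems(3)
  obtain F' where F': "is_flat F'" "F \<subseteq> F'" "F' \<subset> G" "Suc (rk F') = rk G"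
    using ex_coatom[OF F G FG] by blast
  then obtain i where i: "i \<in> G - F'" by blast
  have iE: "i \<in> E - F'" "{i} \<subseteq> E" using i flat_subset[OF G] by auto
  have J: "join F' {i} = G"
    using flat_eqI[OF flat_join[OF flat_subset[OF F'(1)] iE(2)] G] join_le_iff[OF flat_subset[OF F'(1)] iE(2) G]
      join_singleton[OF F'(1) iE(1)] F' i by auto
  show ?case
  proof (cases "F' = F")
    case True
    then have n: "rk G - rk F = 1" using F' by simp
    have "xvar F * ysum G \<in> idl chow_gens"
    proof (cases "F = {}")
      case True
      have "ysum G = (\<Sum>H\<in>{H \<in> flats. i \<in> H}. pvar H)"
        unfolding ysum_def using flats_above_join[OF F'(1) iE(1)] J \<open>F' = F\<close> True by simp
      then show ?thesis using chow_linear[of i] iE True by (simp add: xvar_def)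
    next
      case False
      then have "pvar F * ysum G \<in> idl chow_gens"
        unfolding ysum_def J[symmetric] flats_above_join[OF F'(1) iE(1)]
        using \<open>F' = F\<close> F iE by (intro chow_linear_above[of F i]) (auto simp: flats_iff)
      then show ?thesis using False by (simp add: xvar_def)
    qed
    then show ?thesis by (simp add: n)
  next
    case False
    then have "F \<subset> F'" using F' by auto
    then have rl: "rk F < rk F'" using flat_rank_less F F' by blast
    define n where "n = rk F' - rk F"
    have n: "rk G - rk F = Suc n" using F' rl by (simp add: n_def)
    have IH: "xvar F * ysum F' ^ n \<in> idl chow_gens"
      unfolding n_def by (rule less.hyps) (use F' F rl \<open>F \<subset> F'\<close> in auto)
    have "ysum G * ysum F' ^ n - ysum G * ysum G ^ n \<in> idl chow_gens"
      using idl_cong_power[OF ysum_square[OF F'(1) iE(1)]] unfolding J .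
    then have "xvar F * (ysum G * ysum F' ^ n - ysum G * ysum G ^ n) \<in> idl chow_gens" by (rule idl_mult)
    then have "ysum G * (xvar F * ysum F' ^ n) - xvar F * ysum G ^ Suc n \<in> idl chow_gens"
      by (simp add: algebra_simps)
    from idl_cong_mem'[OF this idl_mult[OF IH]] show ?thesis by (simp add: n)
  qed
qed

end

section \<open>Colon ideals in the Chow ring\<close>

context simple_matroid
begin

definition Igens :: "'a set \<Rightarrow> 'a set \<Rightarrow> ('a set, rat) mvpoly set"
  where "Igens G W = chow_gens \<union> {pvar H | H. H \<in> flats \<and> \<not> H \<subseteq> G} \<union>
    {pvar K | K. K \<in> flats \<and> K \<subset> G \<and> Suc (rk K) = rk G \<and> W \<subseteq> K}"

end

text \<open>The variables of \<open>killed\<close> are those that precede \<open>K\<close> in the list of generators; the remaining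
  flats form a poset of blow-up type with coatom \<open>K\<close>. The exponent \<open>dist\<close> differs from the difference
  of ranks at \<open>T\<close> only, because the flats of rank above \<open>k\<close> in between are gone, and it drops once more
  if \<open>b\<close> lies below a member of \<open>S\<close>.\<close>

locale chow_colon = simple_matroid E indep for E :: "'a set" and indep +
  fixes T F0 :: "'a set" and k :: nat and S :: "'a set set" and K W :: "'a set"
  assumes T: "is_flat T" and k: "1 \<le> k" "k < rk T"
    and S: "H \<in> S \<Longrightarrow> is_flat H \<and> H \<subset> T \<and> rk H = k \<and> \<not> H \<subseteq> F0 \<and> W \<subseteq> H"
    and k1: "k = 1 \<Longrightarrow> S = {} \<and> W = K"
    and K: "is_flat K" "K \<subset> T" "rk K = k" "\<not> K \<subseteq> F0" "K \<notin> S"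
    and W: "W \<subseteq> K"
    and cover: "is_flat K' \<Longrightarrow> K' \<subset> K \<Longrightarrow> Suc (rk K') = k \<Longrightarrow> W \<subseteq> K' \<Longrightarrow> \<exists>H\<in>S. K' \<subseteq> H"
begin

definition killed :: "'a set set"
  where "killed = {H \<in> flats. \<not> H \<subseteq> T} \<union> {H \<in> flats. H \<subset> T \<and> \<not> H \<subseteq> F0 \<and> k < rk H} \<union> S"

definition alive :: "'a set set" where "alive = flats - killed"

definition ind :: "'a set \<Rightarrow> nat" where "ind b = (if \<exists>H\<in>S. b \<subseteq> H then 1 else 0)"

text \<open>From rank \<open>k\<close> a single step leads to \<open>T\<close>, whence
  \<open>k + 1 - rk b\<close>. Below a deleted flat of rank \<open>k\<close> one step less suffices,
  since a join that would be this flat is replaced by \<open>T\<close>.\<close>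

definition dist :: "'a set \<Rightarrow> 'a set \<Rightarrow> nat"
  where "dist b G = (if G = T then if k \<le> rk b then 1 else k + 1 - rk b - ind b else rk G - rk b)"

lemma ind_le: "ind b \<le> 1" by (simp add: ind_def)

lemma ind_mono: "b \<subseteq> G \<Longrightarrow> ind G \<le> ind b" by (auto simp: ind_def)

lemma aliveD: "H \<in> alive \<Longrightarrow> is_flat H \<and> H \<noteq> {} \<and> H \<subseteq> T"
  by (auto simp: alive_def killed_def flats_iff)

lemma alive_above: "H \<in> alive \<Longrightarrow> k < rk H \<Longrightarrow> \<not> H \<subseteq> F0 \<Longrightarrow> H = T"
  by (auto simp: alive_def killed_def)

lemma T_alive: "T \<in> alive"
proof -
  have "T \<noteq> {}" using k rank_empty by auto
  moreover have "T \<notin> S" using S[of T] by blast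
  ultimately show ?thesis using T by (simp add: alive_def killed_def flats_iff)
qed

lemma aliveD': "b \<in> insert {} alive \<Longrightarrow> is_flat b \<and> b \<subseteq> T"
  using aliveD flat_empty by auto

lemma rank_less: "b \<in> insert {} alive \<Longrightarrow> G \<in> alive \<Longrightarrow> b \<subset> G \<Longrightarrow> rk b < rk G"
  using aliveD' flat_rank_less by blast

lemma dist_T_pos: "dist b T \<ge> 1"
  using ind_le[of b] by (auto simp: dist_def)

lemma dist_T_le: "rk b < r \<Longrightarrow> k < r \<Longrightarrow> dist b T \<le> r - rk b"
  by (auto simp: dist_def)

lemma dist_T_mono: "b \<in> insert {} alive \<Longrightarrow> H \<in> insert {} alive \<Longrightarrow> b \<subseteq> H \<Longrightarrow> dist H T \<le> dist b T"
proof (cases "b = H \<or> k \<le> rk H")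
  case True
  then show ?thesis using dist_T_pos[of b] by (auto simp: dist_def)
next
  case False
  assume "b \<in> insert {} alive" "H \<in> insert {} alive" "b \<subseteq> H"
  then have "rk b < rk H" using False flat_rank_less[of b H] aliveD' by auto
  then show ?thesis using False ind_le[of b] by (auto simp: dist_def)
qed

text \<open>The join inside \<open>alive\<close> is the join of flats if that one is alive, and
  \<open>T\<close> otherwise: a deleted flat below \<open>T\<close> has rank at least
  \<open>k\<close> and is not contained in \<open>F0\<close>, so \<open>T\<close> is the only alive
  flat above it. The required inequality of exponents comes from \<open>rank_join\<close>.\<close>

lemma blowup_alive: "blowup alive T dist"
proof
  show "finite alive" using finite_nonempty_flats by (simp add: alive_def)
  show "{} \<notin> alive" using aliveD by blast
  show "T \<in> alive" by (rule T_alive)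
  show "H \<subseteq> T" if "H \<in> alive" for H using that aliveD by blast
next
  fix b G assume "b \<in> insert {} alive" "G \<in> alive" "b \<subset> G"
  then show "1 \<le> dist b G" using rank_less[of b G] dist_T_pos[of b] by (cases "G = T") (auto simp: dist_def)
next
  fix b G H assume h: "b \<in> insert {} alive" "G \<in> alive" "H \<in> alive" "b \<subset> G" "G \<subset> H"
  have r: "rk b < rk G" "rk G < rk H" using h rank_less by blast+
  have GT: "G \<noteq> T" using h aliveD[of H] by auto
  show "dist b H \<le> dist b G + dist G H"
  proof (cases "H = T")
    case True
    have "ind G \<le> ind b" using h by (intro ind_mono) auto
    then show ?thesis using True GT r by (auto simp: dist_def)
  qed (use GT r in \<open>auto simp: dist_def\<close>)
next
  fix G H assume G: "G \<in> alive" and H: "H \<in> alive" and GH: "\<not> G \<subseteq> H"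
  note Gf = aliveD[OF G] and Hf = aliveD[OF H]
  have GE: "G \<subseteq> E" "H \<subseteq> E" using Gf Hf flat_subset by auto
  define J0 where "J0 = join G H"
  have J0: "is_flat J0" "J0 \<subseteq> T" "G \<subseteq> J0" "H \<subset> J0"
    using flat_join[OF GE] join_le_iff[OF GE T] join_upper[OF GE] Gf Hf GH by (auto simp: J0_def)
  have J0le: "J0 \<subseteq> F \<longleftrightarrow> G \<subseteq> F \<and> H \<subseteq> F" if "is_flat F" for F
    using join_le_iff[OF GE that] by (simp add: J0_def)
  have HT: "H \<noteq> T" using GH Gf by auto
  define J where "J = (if J0 \<in> alive then J0 else T)"
  have dead: "\<not> J0 \<subseteq> F0 \<and> (k < rk J0 \<or> J0 \<in> S) \<and> J0 \<noteq> T" if "J0 \<notin> alive"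
    using that J0 S T_alive by (auto simp: alive_def killed_def flats_iff)
  have iff: "J \<subseteq> H' \<longleftrightarrow> G \<subseteq> H' \<and> H \<subseteq> H'" if H': "H' \<in> alive" for H'
  proof (cases "J0 \<in> alive")
    case True
    then show ?thesis using J0le aliveD[OF H'] by (simp add: J_def)
  next
    case False
    have "H' = T" if "J0 \<subseteq> H'"
    proof (rule alive_above[OF H'])
      have "J0 \<subset> H'" using that False H' by auto
      then have "rk J0 < rk H'" using flat_rank_less J0 aliveD[OF H'] by blast
      then show "k < rk H'" using dead[OF False] S[of J0] by auto
      show "\<not> H' \<subseteq> F0" using dead[OF False] that by auto
    qed
    moreover have "J0 \<subseteq> H' \<longleftrightarrow> G \<subseteq> H' \<and> H \<subseteq> H'" using J0le aliveD[OF H'] by blast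
    moreover have "G \<subseteq> T" "H \<subseteq> T" "H' \<subseteq> T" using aliveD[OF H'] Gf Hf by blast+
    moreover have "J = T" using False by (simp add: J_def)
    ultimately show ?thesis using J0(2) by blast
  qed
  have dle: "dist H J \<le> dist b G" if b: "b \<in> insert {} alive" "b \<subset> G" "b \<subseteq> H" for b
  proof (cases "G = T")
    case True
    then have "J0 = T" using J0 by auto
    then show ?thesis using dist_T_mono[of b H] b H True T_alive by (auto simp: J_def)
  next
    case GT: False
    have rj: "rk J0 + rk b \<le> rk G + rk H" unfolding J0_def using b Gf Hf by (intro rank_join) auto
    have rbG: "rk b < rk G" using rank_less b G by blast
    have rHJ: "rk H < rk J0" using flat_rank_less J0 Hf by blast
    have dbG: "dist b G = rk G - rk b" using GT by (simp add: dist_def)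
    show ?thesis
    proof (cases "J = T")
      case False
      then have "J = J0" by (auto simp: J_def split: if_splits)
      then show ?thesis using False rj dbG by (simp add: dist_def)
    next
      case JT: True
      show ?thesis
      proof (cases "J0 \<in> alive \<or> k < rk J0")
        case True
        then have "k < rk J0" using JT k by (auto simp: J_def)
        then show ?thesis using dist_T_le[OF rHJ] JT rj dbG by auto
      next
        case False
        \<comment> \<open>This case is the reason for the term \<open>ind\<close>: the join has rank
          \<open>k\<close> but is deleted, so \<open>T\<close> has to be at distance
          \<open>k - rk H\<close> from \<open>H\<close>.\<close>
        then have "J0 \<in> S" using dead by auto
        then have "ind H = 1" "rk J0 = k" using S J0 by (auto simp: ind_def)
        then show ?thesis using JT dbG rj rHJ by (simp add: dist_def)
      qed
    qed
  qed
  have HJ: "H \<subset> J" using J0 Hf HT by (auto simp: J_def)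
  have JL: "J \<in> alive" using T_alive by (simp add: J_def)
  show "\<exists>J\<in>alive. H \<subset> J \<and> (\<forall>H'\<in>alive. (J \<subseteq> H') = (G \<subseteq> H' \<and> H \<subseteq> H')) \<and>
      (\<forall>b\<in>insert {} alive. b \<subset> G \<longrightarrow> b \<subseteq> H \<longrightarrow> dist H J \<le> dist b G)"
    by (intro bexI[OF _ JL] conjI ballI impI HJ iff dle)
qed

lemma K_alive: "K \<in> alive"
  using K k rank_empty by (auto simp: alive_def killed_def flats_iff)

lemma rank_below_K: "b \<in> insert {} alive \<Longrightarrow> b \<subset> K \<Longrightarrow> rk b < k"
  using rank_less[OF _ K_alive] K by auto

sublocale bl: blowup_coatom alive T dist K
proof -
  interpret blowup alive T dist by (rule blowup_alive)
  show "blowup_coatom alive T dist K"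
  proof
    show "K \<in> alive" "K \<noteq> T" using K_alive K by auto
    show "H = T" if "H \<in> alive" "K \<subset> H" for H
      using that K flat_rank_less[of K H] aliveD[of H] by (intro alive_above) auto
    show "dist K T = 1" using K by (simp add: dist_def)
    fix b assume b: "b \<in> insert {} alive" "b \<subset> K"
    from rank_below_K[OF this] show "dist b T - 1 \<le> dist b K" "dist b K \<le> dist b T"
      using K ind_le[of b] by (auto simp: dist_def)
  qed
qed

lemma alive_below_K: "H \<in> flats \<Longrightarrow> H \<subseteq> K \<Longrightarrow> H \<in> alive"
proof (cases "H = K")
  case False
  assume H: "H \<in> flats" "H \<subseteq> K"
  then have rH: "rk H < k" using flat_rank_less[of H K] K False by (auto simp: flats_iff)
  moreover have "H \<notin> S" using S[of H] rH by auto
  moreover have "H \<subseteq> T" using H K by blast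
  ultimately show ?thesis using H rH by (simp add: alive_def killed_def)
qed (use K_alive in simp)

text \<open>The exponents are rank differences except at \<open>K\<close> for those \<open>F\<close>
  below a member of \<open>S\<close>, where one power less is available. It is saved by a flat
  \<open>K'\<close> covered by \<open>K\<close> and containing \<open>F\<close> and
  \<open>W\<close>: its variable lies in the ideal, and modulo the ideal the sum above
  \<open>K'\<close> reduces to \<open>pvar K\<close>.\<close>

lemma below_K_to_Igens:
  assumes F: "F \<in> insert {} alive" and G: "G \<in> alive" "G \<subseteq> K" "F \<subset> G"
  shows "xvar F * bl.z G ^ bl.e F G \<in> idl (Igens K W)"
proof -
  have chow: "p \<in> idl (Igens K W)" if "p \<in> idl chow_gens" for p
    using that by (rule idl_mono[rotated]) (auto simp: Igens_def)
  have nle: "pvar H \<in> idl (Igens K W)" if "H \<in> flats" "\<not> H \<subseteq> K" for H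
    using that by (intro idl_base) (auto simp: Igens_def)
  have below: "{H \<in> alive. G' \<subseteq> H \<and> H \<subseteq> K} = {H \<in> flats. G' \<subseteq> H \<and> H \<subseteq> K}" for G'
    using alive_below_K by (auto simp: alive_def)
  have zy: "ysum G' - bl.z G' \<in> idl (Igens K W)" for G'
  proof -
    have "{H \<in> flats. G' \<subseteq> H} = {H \<in> flats. G' \<subseteq> H \<and> H \<subseteq> K} \<union> {H \<in> flats. G' \<subseteq> H \<and> \<not> H \<subseteq> K}" by auto
    then have "ysum G' = bl.z G' + (\<Sum>H\<in>{H \<in> flats. G' \<subseteq> H \<and> \<not> H \<subseteq> K}. pvar H)"
      unfolding ysum_def bl.z_def below using finite_nonempty_flats by (simp only:) (subst sum.union_disjoint; auto)
    then show ?thesis using nle by (auto intro!: idl_sum)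
  qed
  have tr: "xvar F * bl.z G ^ n \<in> idl (Igens K W)"
    if "xvar F * ysum G' ^ n \<in> idl chow_gens" "ysum G' - bl.z G \<in> idl (Igens K W)" for G' n
  proof -
    have "xvar F * ysum G' - xvar F * bl.z G = xvar F * (ysum G' - bl.z G)" by (simp add: right_diff_distrib)
    then have "xvar F * ysum G' - xvar F * bl.z G \<in> idl (Igens K W)" using idl_mult[OF that(2)] by simp
    from idl_cong_mem'[OF idl_cong_power[OF this] chow[OF that(1)]] show ?thesis .
  qed
  have Ff: "is_flat F" and Gf: "is_flat G" using F G aliveD' by auto
  show ?thesis
  proof (cases "G = K")
    case False
    then have "bl.e F G = rk G - rk F" using G K by (auto simp: bl.e_def dist_def)
    then show ?thesis using tr[OF _ zy] xvar_ysum_power[OF Ff Gf G(3)] by simp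
  next
    case GK: True
    have rF: "rk F < k" using rank_below_K F G GK by simp
    have e: "bl.e F G = k - rk F - ind F" using GK rF by (simp add: bl.e_def dist_def)
    show ?thesis
    proof (cases "ind F = 0")
      case True
      then show ?thesis using tr[OF _ zy] xvar_ysum_power[OF Ff Gf G(3)] e GK K by simp
    next
      case False
      then obtain H where H: "H \<in> S" "F \<subseteq> H" by (auto simp: ind_def split: if_splits)
      then have i1: "ind F = 1" by (auto simp: ind_def)
      have sub: "F \<subseteq> E" "W \<subseteq> E" using flat_subset[OF Ff] flat_subset[OF K(1)] W by auto
      have JK: "join F W \<subseteq> K" using join_le_iff[OF sub K(1)] W G GK by auto
      have JH: "join F W \<subseteq> H" using join_le_iff[OF sub, of H] H S[OF H(1)] by auto
      \<comment> \<open>Both \<open>K\<close> and \<open>H\<close> contain \<open>F\<close> and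
        \<open>W\<close> and have rank \<open>k\<close>. They differ because \<open>K\<close> is not
        in \<open>S\<close>, so the join is strictly smaller than \<open>K\<close>.\<close>
      have "join F W \<noteq> K"
      proof
        assume "join F W = K"
        then have "K = H" using JH flat_eqI[of K H] K S[OF H(1)] by auto
        then show False using K H by simp
      qed
      then have "join F W \<subset> K" using JK by auto
      then obtain K' where K': "is_flat K'" "join F W \<subseteq> K'" "K' \<subset> K" "Suc (rk K') = k"
        using ex_coatom[OF flat_join[OF sub] K(1)] K(3) by metis
      have FK: "F \<subseteq> K'" "W \<subseteq> K'" using K' join_upper[OF sub] by auto
      \<comment> \<open>An empty \<open>K'\<close> would mean \<open>k = 1\<close>, where
        \<open>S\<close> is empty by \<open>k1\<close>.\<close>
      have "K' \<noteq> {}" using K' k1 H rank_empty by auto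
      then have K'f: "K' \<in> flats" using K' by (simp add: flats_iff)
      have K'I: "pvar K' \<in> idl (Igens K W)"
        using K'f K' FK K by (intro idl_base) (auto simp: Igens_def)
      show ?thesis
      proof (cases "F = K'")
        case True
        then have "xvar F = pvar K'" using \<open>K' \<noteq> {}\<close> by (simp add: xvar_def)
        then show ?thesis using K'I by (simp add: idl_mult_right)
      next
        case False
        then have "F \<subset> K'" using FK by auto
        have n: "bl.e F G = rk K' - rk F" using e i1 K' by simp
        have "{H \<in> flats. K' \<subseteq> H \<and> H \<subseteq> K} = {K', K}"
        proof -
          have "H = K' \<or> H = K" if "H \<in> flats" "K' \<subseteq> H" "H \<subseteq> K" for H
          proof (rule ccontr)
            assume "\<not> (H = K' \<or> H = K)"
            then have "K' \<subset> H" "H \<subset> K" "is_flat H" using that by (auto simp: flats_iff)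
            then have "rk K' < rk H" "rk H < rk K" using flat_rank_less K'(1) K(1) by blast+
            then show False using K' K by simp
          qed
          then show ?thesis using K'f K' K_alive by (auto simp: alive_def)
        qed
        then have "bl.z K' = pvar K' + pvar K" using K' unfolding bl.z_def below by simp
        then have "ysum K' - bl.z K = (ysum K' - bl.z K') + pvar K'" by (simp add: bl.z_K)
        then have "ysum K' - bl.z K \<in> idl (Igens K W)" using idl_add[OF zy[of K'] K'I] by (simp only:)
        then show ?thesis unfolding n using tr[of K'] xvar_ysum_power[OF Ff K'(1) \<open>F \<subset> K'\<close>] GK by simp
      qed
    qed
  qed
qed

text \<open>Deleting the killed variables sends the linear relation of a point \<open>i\<close> of
  \<open>T\<close> to \<open>bl.y {i}\<close>, which is a relation because \<open>{i}\<close> is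
  alive at distance one from the bottom. The hypothesis thus becomes membership in the ideal of the
  poset \<open>alive\<close>, where \<open>bl.injective\<close> applies.\<close>

lemma colon_forward:
  assumes p: "p \<in> polys flats" and mem: "pvar K * p \<in> idl (chow_gens \<union> pvar ` killed)"
  shows "p \<in> idl (Igens K W)"
proof -
  interpret r: comm_ring_hom "restr alive :: ('a set, rat) mvpoly \<Rightarrow> _" by (rule restr_hom)
  define R where "R = rels dist bl.y {} alive"
  have up: "bl.upper {} alive" unfolding bl.upper_def using aliveD by blast
  have "restr alive (pvar K * p) \<in> idl R"
  proof (rule idl_hom[OF restr_hom _ mem])
    fix g :: "('a set, rat) mvpoly" assume "g \<in> chow_gens \<union> pvar ` killed"
    then consider i where "i \<in> E" "g = (\<Sum>F\<in>{F \<in> flats. i \<in> F}. pvar F)"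
      | F G where "F \<in> flats" "G \<in> flats" "g = pvar F * pvar G" "\<not> F \<subseteq> G" "\<not> G \<subseteq> F"
      | F where "F \<in> killed" "g = pvar F" unfolding chow_gens_def by blast
    then show "restr alive g \<in> idl R"
    proof cases
      case 1
      have "restr alive g = (\<Sum>F\<in>{F \<in> flats. i \<in> F}. if F \<in> alive then pvar F else 0)"
        using 1 by (simp add: hom_distribs restr_pvar)
      also have "\<dots> = (\<Sum>F\<in>{F \<in> flats. i \<in> F} \<inter> alive. pvar F)"
        using finite_nonempty_flats by (subst sum.inter_restrict) auto
      also have "{F \<in> flats. i \<in> F} \<inter> alive = {F \<in> alive. {i} \<subseteq> F}" by (auto simp: alive_def)
      finally have e: "restr alive g = bl.y {i}" by (simp add: bl.y_def)
      show ?thesis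
      proof (cases "i \<in> T")
        case True
        have "{i} \<in> alive"
          using flat_singleton[OF 1(1)] rank_singleton[OF 1(1)] True k k1 S
          by (auto simp: alive_def killed_def flats_iff)
        moreover have "dist {} {i} = 1"
          using rank_singleton[OF 1(1)] rank_empty k by (auto simp: dist_def)
        ultimately show ?thesis using relsI(3)[of "{i}" alive bl.y dist "{}"] by (simp add: e R_def)
      next
        case False
        then have z: "{F \<in> alive. {i} \<subseteq> F} = {}" using aliveD by auto
        have "bl.y {i} = 0" unfolding bl.y_def z by simp
        then show ?thesis by (simp add: e idl_zero)
      qed
    next
      case 2
      then show ?thesis unfolding R_def by (auto simp: hom_distribs restr_pvar idl_zero intro!: relsI(1))
    next
      case 3
      then show ?thesis by (simp add: alive_def restr_pvar idl_zero)
    qed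
  qed
  then have 1: "pvar K * restr alive p \<in> idl R" using K_alive by (simp add: hom_distribs restr_pvar)
  define A where "A = {H \<in> alive. H \<subseteq> K}"
  have A: "A = {H \<in> flats. H \<subseteq> K}" using alive_below_K by (auto simp: A_def alive_def)
  have pA: "restr A p \<in> polys A" using restr_in_polys[OF p, of A] by (rule polys_mono[rotated]) auto
  have dA: "p - restr A p \<in> idl (pvar ` (flats - A))" by (rule restr_diff[OF p])
  \<comment> \<open>Alive variables not below \<open>K\<close> are annihilated by
    \<open>pvar K\<close>, so only the part of \<open>p\<close> below \<open>K\<close> enters the
    product.\<close>
  have "pvar K * restr alive (p - restr A p) \<in> idl R"
  proof (rule idl_times)
    show "restr alive (p - restr A p) \<in> idl (pvar ` (alive - A))"
    proof (rule idl_hom[OF restr_hom _ dA])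
      fix g :: "('a set, rat) mvpoly" assume "g \<in> pvar ` (flats - A)"
      then obtain H where H: "g = pvar H" "H \<in> flats - A" by blast
      show "restr alive g \<in> idl (pvar ` (alive - A))"
      proof (cases "H \<in> alive")
        case True
        then show ?thesis using H by (intro idl_base) (auto simp: restr_pvar)
      qed (use H in \<open>simp add: restr_pvar idl_zero\<close>)
    qed
    fix g :: "('a set, rat) mvpoly" assume "g \<in> pvar ` (alive - A)"
    then show "pvar K * g \<in> idl R" unfolding R_def using bl.pvar_K_mult[OF up K_alive] by (auto simp: A_def)
  qed
  moreover have "restr alive (p - restr A p) = restr alive p - restr A p"
    using restr_id[of "restr A p" alive] polys_mono[OF _ pA] by (simp add: hom_distribs A_def)
  ultimately have "pvar K * (restr alive p - restr A p) \<in> idl R" by simp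
  from idl_diff[OF 1 this] have "pvar K * restr A p \<in> idl R" by (simp add: algebra_simps)
  then have B: "restr A p \<in> idl (rels bl.e bl.z {} A)"
    unfolding A_def R_def using bl.injective[of "{}" alive] up K_alive pA aliveD[OF K_alive] by (auto simp: A_def)
  have "restr A p \<in> idl (Igens K W)"
  proof (rule idl_subset[OF _ B])
    fix g assume "g \<in> rels bl.e bl.z {} A"
    then show "g \<in> idl (Igens K W)"
    proof (cases rule: rels_cases)
      case (1 H H')
      then have "pvar H * pvar H' \<in> idl chow_gens" using A chow_incomparable by blast
      then show ?thesis unfolding 1(1) by (rule idl_mono[rotated]) (auto simp: Igens_def)
    next
      case (2 F G)
      then show ?thesis using below_K_to_Igens[of F G] aliveD[of F] by (auto simp: A_def xvar_def)
    next
      case (3 G)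
      then show ?thesis using below_K_to_Igens[of "{}" G] aliveD[of G] by (auto simp: A_def xvar_def)
    qed
  qed
  moreover have "p - restr A p \<in> idl (Igens K W)"
    using dA by (rule idl_mono[rotated]) (auto simp: A Igens_def)
  ultimately show ?thesis using idl_cong_mem by blast
qed

lemma chow_sum_mod_killed:
  assumes F: "F \<in> flats" and i: "i \<in> E - F" and B: "B \<subseteq> {H \<in> flats. F \<subseteq> H \<and> i \<in> H}"
    "{H \<in> flats. F \<subseteq> H \<and> i \<in> H} - B \<subseteq> killed"
  shows "pvar F * (\<Sum>H\<in>B. pvar H) \<in> idl (chow_gens \<union> pvar ` killed)"
proof -
  let ?A = "{H \<in> flats. F \<subseteq> H \<and> i \<in> H}"
  have fin: "finite ?A" using finite_nonempty_flats by simp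
  have 1: "pvar F * (\<Sum>H\<in>?A. pvar H) \<in> idl (chow_gens \<union> pvar ` killed)"
    by (rule idl_mono[OF _ chow_linear_above[OF F i]]) auto
  have "(\<Sum>H\<in>?A - B. pvar H) \<in> idl (chow_gens \<union> pvar ` killed)"
    using B by (intro idl_sum idl_base) auto
  then have 2: "pvar F * (\<Sum>H\<in>?A - B. pvar H) \<in> idl (chow_gens \<union> pvar ` killed)" by (rule idl_mult)
  have "(\<Sum>H\<in>?A. pvar H) - (\<Sum>H\<in>?A - B. pvar H) = (\<Sum>H\<in>B. pvar H :: ('a set, rat) mvpoly)"
    using fin B(1) by (simp add: sum_diff)
  then have "pvar F * (\<Sum>H\<in>B. pvar H) = pvar F * (\<Sum>H\<in>?A. pvar H) - pvar F * (\<Sum>H\<in>?A - B. pvar H :: ('a set, rat) mvpoly)"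
    by (simp only: right_diff_distrib[symmetric])
  then show ?thesis using idl_diff[OF 1 2] by simp
qed

lemma above_rank_k: "H \<in> flats \<Longrightarrow> G \<subset> H \<Longrightarrow> is_flat G \<Longrightarrow> rk G = k \<Longrightarrow> \<not> G \<subseteq> F0 \<Longrightarrow> H \<noteq> T \<Longrightarrow> H \<in> killed"
  using flat_rank_less[of G H] by (auto simp: killed_def flats_iff)

lemma colon_backward:
  assumes mem: "p \<in> idl (Igens K W)"
  shows "pvar K * p \<in> idl (chow_gens \<union> pvar ` killed)"
proof (rule idl_times[OF _ mem])
  let ?M = "chow_gens \<union> pvar ` killed :: ('a set, rat) mvpoly set"
  have chow: "p \<in> idl ?M" if "p \<in> idl chow_gens" for p using that by (rule idl_mono[rotated]) auto
  have kill: "pvar H \<in> idl ?M" if "H \<in> killed" for H using that by (intro idl_base) auto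
  have Kf: "K \<in> flats" using K_alive by (simp add: alive_def)
  have Tf: "T \<in> flats" using T_alive by (simp add: alive_def)
  have TE: "T \<subseteq> E" using T by (rule flat_subset)
  fix g assume "g \<in> Igens K W"
  then consider "g \<in> chow_gens" | H where "H \<in> flats" "\<not> H \<subseteq> K" "g = pvar H"
    | K' where "K' \<in> flats" "K' \<subset> K" "Suc (rk K') = rk K" "W \<subseteq> K'" "g = pvar K'"
    unfolding Igens_def by blast
  then show "pvar K * g \<in> idl ?M"
  proof cases
    case 1
    then show ?thesis by (intro idl_mult idl_base) auto
  next
    case 2
    show ?thesis
    proof (cases "K \<subseteq> H")
      case False
      then show ?thesis using 2 Kf by (auto intro: chow chow_incomparable)
    next
      case True
      then have KH: "K \<subset> H" using 2 by auto
      show ?thesis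
      proof (cases "H = T")
        case False
        then show ?thesis using above_rank_k[OF 2(1) KH] K 2 kill by (auto intro: idl_mult)
      next
        case True
        \<comment> \<open>A flat containing \<open>K\<close> and this point is \<open>T\<close> or
          killed; the linear relation of the point therefore leaves only
          \<open>pvar K * pvar T\<close>.\<close>
        obtain i where i: "i \<in> T - K" using K by blast
        have "pvar K * (\<Sum>H\<in>{T}. pvar H) \<in> idl ?M"
        proof (rule chow_sum_mod_killed[OF Kf, of i])
          show "{H \<in> flats. K \<subseteq> H \<and> i \<in> H} - {T} \<subseteq> killed"
            using above_rank_k[of _ K] K i by blast
        qed (use i TE Tf K in auto)
        then show ?thesis using 2 True by simp
      qed
    qed
  next
    case 3
    have K'f: "is_flat K'" using 3 by (simp add: flats_iff)
    \<comment> \<open>Two linear relations are compared. A point of \<open>H - K'\<close> leaves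
      only \<open>pvar K' * pvar T\<close>, because \<open>H\<close> is killed; a point of
      \<open>K - K'\<close> leaves \<open>pvar K' * pvar K + pvar K' * pvar T\<close>.\<close>
    obtain H where H: "H \<in> S" "K' \<subseteq> H" using cover[OF K'f 3(2) _ 3(4)] 3 K by auto
    note HS = S[OF H(1)]
    have "K' \<subset> H" using H 3 HS K by auto
    then obtain j where j: "j \<in> H - K'" by blast
    obtain i where i: "i \<in> K - K'" using 3 by blast
    have above: "G \<subseteq> F" if "F \<in> flats" "K' \<subseteq> F" "x \<in> F" "x \<in> G - K'" "is_flat G" "rk G = k" "K' \<subset> G" for F G x
    proof -
      have xE: "x \<in> E - K'" "{x} \<subseteq> E" "K' \<subseteq> E" using that flat_subset[of G] flat_subset[OF K'f] by auto
      have "join K' {x} = G"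
        using flat_eqI[OF flat_join[OF xE(3,2)] that(5)] join_le_iff[OF xE(3,2) that(5)] join_singleton[OF K'f xE(1)] that 3 K
        by auto
      then show ?thesis using join_le_iff[OF xE(3,2), of F] that by (auto simp: flats_iff)
    qed
    have 1: "pvar K' * (\<Sum>H\<in>{T}. pvar H) \<in> idl ?M"
    proof (rule chow_sum_mod_killed[OF 3(1), of j])
      show "{F \<in> flats. K' \<subseteq> F \<and> j \<in> F} - {T} \<subseteq> killed"
      proof
        fix F assume F: "F \<in> {F \<in> flats. K' \<subseteq> F \<and> j \<in> F} - {T}"
        then have "H \<subseteq> F" using above[of F j H] j HS \<open>K' \<subset> H\<close> by auto
        then show "F \<in> killed" using above_rank_k[of F H] HS F H by (cases "F = H") (auto simp: killed_def)
      qed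
    qed (use j TE Tf HS \<open>K' \<subset> H\<close> in auto)
    have 2: "pvar K' * (\<Sum>H\<in>{K, T}. pvar H) \<in> idl ?M"
    proof (rule chow_sum_mod_killed[OF 3(1), of i])
      show "{F \<in> flats. K' \<subseteq> F \<and> i \<in> F} - {K, T} \<subseteq> killed"
      proof
        fix F assume F: "F \<in> {F \<in> flats. K' \<subseteq> F \<and> i \<in> F} - {K, T}"
        then have "K \<subset> F" using above[of F i K] i K 3 by auto
        then show "F \<in> killed" using above_rank_k[of F K] K F by auto
      qed
    qed (use i TE Tf Kf K 3 in auto)
    from idl_diff[OF 2 1] K show ?thesis using 3 by (simp add: algebra_simps)
  qed
qed

end

section \<open>Linear quotients\<close>

context simple_matroid
begin

text \<open>The label \<open>(G, W)\<close> stands for the ideal generated by \<open>Igens G W\<close>. For \<open>G\<close> of rank one the only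
  flat covered by \<open>G\<close> is empty and has no variable, whence the normalization \<open>W = G\<close>.\<close>

definition labels :: "('a set \<times> 'a set) set"
  where "labels = {(G, W). is_flat G \<and> is_flat W \<and> W \<subseteq> G \<and> (rk G = 1 \<longrightarrow> W = G)}"

text \<open>Only polynomials in the variables of nonempty flats are tested, because the polynomial
  type has a variable for every set.\<close>

definition colon_ok :: "'a set set \<Rightarrow> 'a set \<Rightarrow> 'a set \<Rightarrow> bool"
  where "colon_ok N K W \<longleftrightarrow> K \<in> flats \<and> (K, W) \<in> labels \<and>
    (\<forall>p\<in>polys flats. pvar K * p \<in> idl (chow_gens \<union> pvar ` N) \<longleftrightarrow> p \<in> idl (Igens K W))"

fun linear_quotients :: "'a set set \<Rightarrow> 'a set list \<Rightarrow> bool"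
  where "linear_quotients N [] \<longleftrightarrow> True"
  | "linear_quotients N (K # ls) \<longleftrightarrow> (\<exists>W. colon_ok N K W) \<and> linear_quotients (insert K N) ls"

lemma linear_quotients_append:
  "linear_quotients N (xs @ ys) \<longleftrightarrow> linear_quotients N xs \<and> linear_quotients (N \<union> set xs) ys"
  by (induction xs arbitrary: N) auto

text \<open>A list may be continued from any set of variables that generates the same ideal, for
  instance one with redundant members. This permits passing from the variables actually listed to
  all those they generate.\<close>

lemma linear_quotients_cong:
  assumes "idl (chow_gens \<union> pvar ` N) = idl (chow_gens \<union> pvar ` N')"
  shows "linear_quotients N ls = linear_quotients N' ls"
  using assms
proof (induction ls arbitrary: N N')
  case (Cons K ls)
  have "idl (chow_gens \<union> pvar ` insert K M) = idl ((chow_gens \<union> pvar ` M) \<union> {pvar K})" for M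
    by (rule arg_cong[where f = idl]) auto
  then have "idl (chow_gens \<union> pvar ` insert K N) = idl (chow_gens \<union> pvar ` insert K N')"
    using idl_union_cong[OF Cons.prems, of "{pvar K}"] by simp
  then have "linear_quotients (insert K N) ls = linear_quotients (insert K N') ls" by (rule Cons.IH)
  moreover have "colon_ok N K = colon_ok N' K" unfolding colon_ok_def Cons.prems ..
  ultimately show ?case by simp
qed simp

lemma colon_okI:
  assumes "chow_colon E indep T F0 k S K W" "(K, W) \<in> labels"
    and "N = {H \<in> flats. \<not> H \<subseteq> T} \<union> {H \<in> flats. H \<subset> T \<and> \<not> H \<subseteq> F0 \<and> k < rk H} \<union> S"
  shows "colon_ok N K W"
proof -
  interpret c: chow_colon E indep T F0 k S K W by (rule assms(1))
  have N: "N = c.killed" using assms(3) by (simp add: c.killed_def)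
  have "K \<in> flats" using c.K_alive by (simp add: c.alive_def)
  then show ?thesis unfolding colon_ok_def N using assms(2) c.colon_forward c.colon_backward by blast
qed

text \<open>The set \<open>killed\<close> without \<open>S\<close>: the state before the flats of
  rank \<open>k\<close> are listed.\<close>

definition above :: "'a set \<Rightarrow> 'a set \<Rightarrow> nat \<Rightarrow> 'a set set"
  where "above T F0 k = {H \<in> flats. \<not> H \<subseteq> T} \<union> {H \<in> flats. H \<subset> T \<and> \<not> H \<subseteq> F0 \<and> k < rk H}"

definition level :: "'a set \<Rightarrow> 'a set \<Rightarrow> nat \<Rightarrow> 'a set \<Rightarrow> 'a set set"
  where "level T F0 k V = {K. is_flat K \<and> K \<subset> T \<and> rk K = k \<and> \<not> K \<subseteq> F0 \<and> V \<subseteq> K}"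

text \<open>The flats of one rank are listed along a flag of flats \<open>V\<close>: first those containing a larger
  member of the flag.\<close>

lemma level_rest:
  assumes T: "is_flat T" "2 \<le> k" "k < rk T" and V: "is_flat V" and e: "e \<in> E - V" "\<not> join V {e} \<subseteq> F0" "join V {e} \<subseteq> T"
    and "level T F0 k (join V {e}) \<subseteq> S" "S \<subseteq> level T F0 k V" "set rs \<subseteq> level T F0 k V - S" "distinct rs"
  shows "linear_quotients (above T F0 k \<union> S) rs"
  using assms(8-)
proof (induction rs arbitrary: S)
  case (Cons K rs)
  let ?V' = "join V {e}"
  have VE: "V \<subseteq> E" "{e} \<subseteq> E" using flat_subset[OF V] e by auto
  have K: "is_flat K" "K \<subset> T" "rk K = k" "\<not> K \<subseteq> F0" "V \<subseteq> K" "K \<notin> S"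
    using Cons.prems(3) by (auto simp: level_def)
  have eK: "e \<notin> K"
  proof
    assume "e \<in> K"
    then have "?V' \<subseteq> K" using join_le_iff[OF VE K(1)] K by auto
    then have "K \<in> level T F0 k ?V'" using K by (auto simp: level_def)
    then show False using Cons.prems(1) K by auto
  qed
  have "chow_colon E indep T F0 k S K V"
  proof
    show "is_flat T" "1 \<le> k" "k < rk T" using T by auto
    show "is_flat H \<and> H \<subset> T \<and> rk H = k \<and> \<not> H \<subseteq> F0 \<and> V \<subseteq> H" if "H \<in> S" for H
      using that Cons.prems(2) by (auto simp: level_def)
    show "k = 1 \<Longrightarrow> S = {} \<and> V = K" using T by simp
    show "\<exists>H\<in>S. K' \<subseteq> H" if K': "is_flat K'" "K' \<subset> K" "Suc (rk K') = k" "V \<subseteq> K'" for K'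
    proof
      \<comment> \<open>The required member of \<open>S\<close> is the join of \<open>K'\<close>
        with \<open>e\<close>: it contains \<open>join V {e}\<close> and so belongs to the part of
        the level listed before.\<close>
      have KE: "K' \<subseteq> E" "e \<in> E - K'" using flat_subset[OF K'(1)] e eK K' by auto
      note j = join_singleton[OF K'(1) KE(2)] and f = flat_join[OF KE(1) VE(2)] and le = join_le_iff[OF KE(1) VE(2)]
      have "?V' \<subseteq> join K' {e}" using join_le_iff[OF VE f] j K' by auto
      moreover have "e \<in> T" using e(3) join_singleton[OF V e(1)] by auto
      then have "join K' {e} \<subseteq> T" using le[OF T(1)] K' K by auto
      then have "join K' {e} \<subset> T" using j K' T(3) by auto
      ultimately have "join K' {e} \<in> level T F0 k ?V'" using j K' f e(2) by (auto simp: level_def)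
      then show "join K' {e} \<in> S" using Cons.prems(1) by auto
      show "K' \<subseteq> join K' {e}" using j by auto
    qed
  qed (use K in auto)
  moreover have "(K, V) \<in> labels" using K V T by (auto simp: labels_def)
  ultimately have "colon_ok (above T F0 k \<union> S) K V" by (rule colon_okI) (simp add: above_def)
  moreover have "linear_quotients (above T F0 k \<union> insert K S) rs"
    using Cons.prems by (intro Cons.IH) auto
  ultimately show ?case by auto
qed simp

lemma finite_level: "finite (level T F0 k V)"
  using finite_flats by (rule finite_subset[rotated]) (auto simp: level_def)

text \<open>The flag grows by one point at a time until it reaches \<open>T\<close>, above which the
  level is empty; the list is then assembled while returning to \<open>V\<close>.\<close>

lemma ex_level:
  assumes T: "is_flat T" "2 \<le> k" "k < rk T" "\<not> T \<subseteq> F0" and V: "is_flat V" "V \<subseteq> T"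
  shows "\<exists>ls. set ls = level T F0 k V \<and> linear_quotients (above T F0 k) ls"
  using V
proof (induction "rk T - rk V" arbitrary: V rule: less_induct)
  case less
  show ?case
  proof (cases "V = T")
    case True
    then have "level T F0 k V = {}" by (auto simp: level_def)
    then show ?thesis by (intro exI[of _ "[]"]) auto
  next
    case False
    \<comment> \<open>The point is chosen such that the next member of the flag is not contained in
      \<open>F0\<close>. Then no flat above it is, so that the joins formed in
      \<open>level_rest\<close> belong to the level.\<close>
    have "\<exists>e. e \<in> T - V \<and> \<not> insert e V \<subseteq> F0" using False T(4) less.prems(2) by blast
    then obtain e where e: "e \<in> T - V" "\<not> insert e V \<subseteq> F0" by blast
    let ?V' = "join V {e}"
    have VE: "V \<subseteq> E" "{e} \<subseteq> E" "e \<in> E - V" using flat_subset[OF less.prems(1)] flat_subset[OF T(1)] e by auto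
    note j = join_singleton[OF less.prems(1) VE(3)]
    have VT: "?V' \<subseteq> T" using join_le_iff[OF VE(1,2) T(1)] less.prems e by auto
    have VF: "\<not> ?V' \<subseteq> F0" using e j by auto
    have "rk ?V' \<le> rk T" using VT by (rule rank_mono)
    then obtain ls where ls: "set ls = level T F0 k ?V'" "linear_quotients (above T F0 k) ls"
      using less.hyps[OF _ flat_join[OF VE(1,2)] VT] j by fastforce
    obtain rs where rs: "set rs = level T F0 k V - level T F0 k ?V'" "distinct rs"
      using finite_distinct_list[of "level T F0 k V - level T F0 k ?V'"] finite_level by auto
    have sub: "level T F0 k ?V' \<subseteq> level T F0 k V" using j by (auto simp: level_def)
    have "linear_quotients (above T F0 k \<union> level T F0 k ?V') rs"
      by (rule level_rest[OF T(1-3) less.prems(1) VE(3) VF VT]) (use sub rs in auto)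
    then show ?thesis using ls rs sub
      by (intro exI[of _ "ls @ rs"]) (auto simp: linear_quotients_append)
  qed
qed

text \<open>At most one atom is listed in each rank one stage, so nothing of its rank precedes it,
  as \<open>k1\<close> demands. The variables of the other atoms follow from linear
  relations.\<close>

lemma atom_ok:
  assumes T: "is_flat T" "1 < rk T" and a: "a \<in> T" "a \<notin> F0"
  shows "linear_quotients (above T F0 1) [{a}]"
proof -
  have aE: "a \<in> E" using flat_subset[OF T(1)] a by auto
  have "{a} \<noteq> T" using rank_singleton[OF aE] T by auto
  then have "chow_colon E indep T F0 1 {} {a} {a}"
    using T a flat_singleton[OF aE] rank_singleton[OF aE] by unfold_locales auto
  moreover have "({a}, {a}) \<in> labels" using flat_singleton[OF aE] by (auto simp: labels_def)
  ultimately have "colon_ok (above T F0 1) {a} {a}" by (rule colon_okI) (simp add: above_def)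
  then show ?thesis by auto
qed

lemma flat_rank_1: "is_flat H \<Longrightarrow> rk H = 1 \<Longrightarrow> b \<in> H \<Longrightarrow> H = {b}"
  using flat_eqI[of "{b}" H] flat_singleton[of b] rank_singleton[of b] flat_subset[of H] by auto

lemma flats_rank: "H \<in> flats \<Longrightarrow> 1 \<le> rk H"
  using flat_rank_0[of H] by (fastforce simp: flats_iff)

lemma linear_relation_mem:
  assumes i: "i \<in> E" and B: "B \<subseteq> {F \<in> flats. i \<in> F}" and M: "\<And>F. F \<in> flats \<Longrightarrow> i \<in> F \<Longrightarrow> F \<notin> B \<Longrightarrow> pvar F \<in> idl (chow_gens \<union> M)"
  shows "(\<Sum>F\<in>B. pvar F) \<in> idl (chow_gens \<union> M)"
proof -
  have "(\<Sum>F\<in>B. pvar F) = (\<Sum>F\<in>{F \<in> flats. i \<in> F}. pvar F) - (\<Sum>F\<in>{F \<in> flats. i \<in> F} - B. pvar F :: ('a set, rat) mvpoly)"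
    using B finite_nonempty_flats by (subst sum_diff) auto
  also have "\<dots> \<in> idl (chow_gens \<union> M)"
    using M by (intro idl_diff idl_sum idl_mono[OF _ chow_linear[OF i]]) auto
  finally show ?thesis .
qed

text \<open>The ranks are listed downwards, leaving out \<open>E\<close> and all atoms but one. The
  linear relation of the listed atom yields the variable of \<open>E\<close>, and those of the other
  points outside \<open>G\<close> then yield the remaining atoms.\<close>

lemma ex_phase1:
  assumes G: "is_flat G"
  shows "\<exists>ls. linear_quotients {} ls \<and>
    idl (chow_gens \<union> pvar ` set ls) = idl (chow_gens \<union> pvar ` {H \<in> flats. \<not> H \<subseteq> G})"
proof (cases "G = E")
  case True
  then have e: "{H \<in> flats. \<not> H \<subseteq> G} = {}" using flat_subset by (auto simp: flats_iff)
  show ?thesis unfolding e by (intro exI[of _ "[]"]) simp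
next
  case False
  have GE: "G \<subset> E" using False flat_subset[OF G] by auto
  have rG: "rk G < rk E" by (rule flat_rank_less[OF G flat_ground GE])
  have aboveE: "above E G k = {H \<in> flats. H \<subset> E \<and> \<not> H \<subseteq> G \<and> k < rk H}" for k
    using flat_subset by (auto simp: above_def flats_iff)
  have ex: "\<exists>ls. set ls = above E G k \<and> linear_quotients {} ls" if "1 \<le> k" for k
    using that
  proof (induction "rk E - k" arbitrary: k rule: less_induct)
    case less
    show ?case
    proof (cases "rk E \<le> Suc k")
      case True
      have "rk H < rk E" if "H \<in> flats" "H \<subset> E" for H
        using that flat_rank_less[OF _ flat_ground] by (auto simp: flats_iff)
      then have "above E G k = {}" using True unfolding aboveE by force
      then show ?thesis by (intro exI[of _ "[]"]) auto
    next
      case False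
      then obtain ls where ls: "set ls = above E G (Suc k)" "linear_quotients {} ls"
        using less.hyps[of "Suc k"] by (auto simp: diff_less_mono2)
      obtain ls' where ls': "set ls' = level E G (Suc k) {}" "linear_quotients (above E G (Suc k)) ls'"
        using ex_level[OF flat_ground, of "Suc k" G "{}"] False less.prems GE flat_empty by auto
      have "above E G (Suc k) \<union> level E G (Suc k) {} = above E G k"
        unfolding aboveE level_def using flats_rank
        by (auto simp: flats_iff)
      then show ?thesis using ls ls'
        by (intro exI[of _ "ls @ ls'"]) (auto simp: linear_quotients_append)
    qed
  qed
  obtain ls where ls: "set ls = above E G 1" "linear_quotients {} ls" using ex[of 1] by auto
  obtain a where a: "a \<in> E" "a \<notin> G" using GE by blast
  show ?thesis
  proof (cases "1 < rk E")
    case True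
    define ls1 where "ls1 = ls @ [{a}]"
    have l1: "linear_quotients {} ls1"
      using ls atom_ok[OF flat_ground True a] by (simp add: ls1_def linear_quotients_append)
    let ?M = "chow_gens \<union> pvar ` set ls1 :: ('a set, rat) mvpoly set"
    have base: "pvar H \<in> idl ?M" if "H \<in> flats" "H \<subset> E" "\<not> H \<subseteq> G" "1 < rk H" for H
      using that by (intro idl_base) (auto simp: ls1_def ls aboveE)
    have pa: "pvar {a} \<in> idl ?M" by (intro idl_base) (auto simp: ls1_def)
    have af: "{a} \<in> flats" "{a} \<noteq> E" using flat_singleton a rank_singleton[OF a(1)] True by (auto simp: flats_iff)
    have Ef: "E \<in> flats" using flat_ground a by (auto simp: flats_iff)
    have other: "pvar F \<in> idl ?M" if "F \<in> flats" "i \<in> F" "i \<notin> G" "F \<notin> {{i}, E}" for F i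
    proof -
      have "rk F \<noteq> 1" using flat_rank_1[of F i] that by (auto simp: flats_iff)
      then have "1 < rk F" using flats_rank[OF that(1)] by simp
      then show ?thesis using that flat_subset[of F] by (intro base) (auto simp: flats_iff)
    qed
    have pE: "pvar E \<in> idl ?M"
    proof -
      have "(\<Sum>F\<in>{{a}, E}. pvar F) \<in> idl ?M"
        using other[of _ a] a af Ef by (intro linear_relation_mem[of a]) auto
      then have "pvar {a} + pvar E \<in> idl ?M" using af by simp
      from idl_diff[OF this pa] show ?thesis by simp
    qed
    have all: "pvar H \<in> idl ?M" if H: "H \<in> flats" "\<not> H \<subseteq> G" for H
    proof -
      obtain b where b: "b \<in> H" "b \<notin> G" using H by blast
      have bE: "b \<in> E" "{b} \<in> flats" "{b} \<noteq> E"
        using b H flat_subset[of H] flat_singleton[of b] rank_singleton[of b] True by (auto simp: flats_iff)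
      have "(\<Sum>F\<in>{{b}, E}. pvar F) \<in> idl ?M"
        using other[of _ b] b bE Ef by (intro linear_relation_mem[of b]) auto
      then have "pvar {b} + pvar E \<in> idl ?M" using bE by simp
      from idl_diff[OF this pE] have "pvar {b} \<in> idl ?M" by simp
      then show ?thesis using other[of H b] H b pE by (cases "H = {b} \<or> H = E") auto
    qed
    have "idl ?M = idl (chow_gens \<union> pvar ` {H \<in> flats. \<not> H \<subseteq> G})"
    proof (intro equalityI subsetI)
      fix p assume "p \<in> idl ?M"
      then show "p \<in> idl (chow_gens \<union> pvar ` {H \<in> flats. \<not> H \<subseteq> G})"
        by (rule idl_mono[rotated]) (use af a in \<open>auto simp: ls1_def ls aboveE\<close>)
    next
      fix p :: "('a set, rat) mvpoly" assume "p \<in> idl (chow_gens \<union> pvar ` {H \<in> flats. \<not> H \<subseteq> G})"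
      then show "p \<in> idl ?M" by (rule idl_subset[rotated]) (use all in \<open>auto intro: idl_base\<close>)
    qed
    then show ?thesis using l1 by blast
  next
    case F: False
    \<comment> \<open>In rank one the linear relation is itself the variable of \<open>E\<close>,
      and the empty list suffices.\<close>
    then have r1: "rk E = 1" using rG by simp
    have "H = E" if "H \<in> flats" for H
      using that flats_rank[OF that] r1 flat_subset[of H] flat_eqI[OF _ flat_ground, of H] by (auto simp: flats_iff)
    moreover have "E \<in> flats" using flat_ground a by (auto simp: flats_iff)
    ultimately have fl: "flats = {E}" by auto
    have e: "{F \<in> flats. a \<in> F} = {E}" using fl a by auto
    have "pvar E \<in> idl chow_gens" using chow_linear[OF a(1)] unfolding e by simp
    then have "idl (chow_gens \<union> pvar ` {H \<in> flats. \<not> H \<subseteq> G}) = idl chow_gens"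
      by (intro idl_absorb) (auto simp: fl)
    then show ?thesis by (intro exI[of _ "[]"]) simp
  qed
qed

text \<open>To a list for the flats not contained in \<open>G\<close> the coatoms of
  \<open>G\<close> above \<open>W\<close> are appended, with \<open>T = G\<close> and
  \<open>F0 = {}\<close>. If the coatoms are atoms, a single one is listed, taken from
  \<open>W\<close> when \<open>W\<close> is not empty.\<close>

lemma ex_linear_quotients:
  assumes "(G, W) \<in> labels"
  shows "\<exists>ls. linear_quotients {} ls \<and> idl (chow_gens \<union> pvar ` set ls) = idl (Igens G W)"
proof -
  have G: "is_flat G" and W: "is_flat W" "W \<subseteq> G" "rk G = 1 \<Longrightarrow> W = G" using assms by (auto simp: labels_def)
  obtain ls where ls: "linear_quotients {} ls"
    "idl (chow_gens \<union> pvar ` set ls) = idl (chow_gens \<union> pvar ` {H \<in> flats. \<not> H \<subseteq> G})"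
    using ex_phase1[OF G] by blast
  show ?thesis
  proof (cases "W = G")
    case True
    then have "Igens G W = chow_gens \<union> pvar ` {H \<in> flats. \<not> H \<subseteq> G}" by (auto simp: Igens_def)
    then show ?thesis using ls by auto
  next
    case False
    then have "rk W < rk G" using W G flat_rank_less by blast
    then have rG: "1 < rk G" using W(3) False by (cases "rk G = 1") auto
    define k where "k = rk G - 1"
    have k: "1 \<le> k" "Suc k = rk G" using rG by (auto simp: k_def)
    \<comment> \<open>As \<open>k = rk G - 1\<close>, no flat strictly below \<open>G\<close> has
      rank above \<open>k\<close>, so the first list leads exactly to the state in which the coatoms
      are listed.\<close>
    have ab: "above G {} k = {H \<in> flats. \<not> H \<subseteq> G}"
    proof -
      have "rk H \<le> k" if "H \<in> flats" "H \<subset> G" for H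
        using that flat_rank_less[OF _ G, of H] k by (fastforce simp: flats_iff)
      then show ?thesis by (force simp: above_def)
    qed
    have fin: ?thesis if "linear_quotients (above G {} k) ls2"
      "idl (chow_gens \<union> pvar ` {H \<in> flats. \<not> H \<subseteq> G} \<union> pvar ` set ls2) = idl (Igens G W)" for ls2
    proof (intro exI conjI)
      have "linear_quotients (set ls) ls2"
        using that(1) linear_quotients_cong[OF ls(2)] ab by simp
      then show "linear_quotients {} (ls @ ls2)" using ls(1) by (simp add: linear_quotients_append)
      have "idl (chow_gens \<union> pvar ` set (ls @ ls2)) = idl (chow_gens \<union> pvar ` set ls \<union> pvar ` set ls2)"
        by (rule arg_cong[where f = idl]) auto
      also have "\<dots> = idl (Igens G W)" using idl_union_cong[OF ls(2)] that(2) by simp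
      finally show "idl (chow_gens \<union> pvar ` set (ls @ ls2)) = idl (Igens G W)" .
    qed
    show ?thesis
    proof (cases "2 \<le> k")
      case True
      have "G \<noteq> {}" using rG rank_empty by auto
      then obtain ls2 where ls2: "set ls2 = level G {} k W" "linear_quotients (above G {} k) ls2"
        using ex_level[OF G True, of "{}" W] k W rG rank_empty by auto
      have "{pvar K' | K'. K' \<in> flats \<and> K' \<subset> G \<and> Suc (rk K') = rk G \<and> W \<subseteq> K'} = (pvar ` level G {} k W :: ('a set, rat) mvpoly set)"
        using k by (auto simp: level_def flats_iff)
      moreover have "{pvar H | H. H \<in> flats \<and> \<not> H \<subseteq> G} = (pvar ` {H \<in> flats. \<not> H \<subseteq> G} :: ('a set, rat) mvpoly set)" by auto
      ultimately have "Igens G W = chow_gens \<union> pvar ` {H \<in> flats. \<not> H \<subseteq> G} \<union> pvar ` set ls2"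
        unfolding Igens_def ls2 by simp
      then show ?thesis by (intro fin[OF ls2(2)]) simp
    next
      case False
      then have k1: "k = 1" "rk G = 2" using k by auto
      have "G \<noteq> {}" using rG rank_empty by auto
      then obtain a where a: "a \<in> G" "W \<noteq> {} \<Longrightarrow> a \<in> W" using W(2) by (cases "W = {}") blast+
      have aE: "a \<in> E" using a flat_subset[OF G] by auto
      have W_a: "W \<subseteq> {a}"
      proof (cases "W = {}")
        case False
        then have "rk W = 1" using \<open>rk W < rk G\<close> k1 flat_rank_0[OF W(1)] by fastforce
        then show ?thesis using flat_rank_1[OF W(1)] a False by auto
      qed simp
      let ?M = "chow_gens \<union> pvar ` {H \<in> flats. \<not> H \<subseteq> G} \<union> pvar ` set [{a}] :: ('a set, rat) mvpoly set"
      have Gf: "G \<in> flats" using G \<open>G \<noteq> {}\<close> by (simp add: flats_iff)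
      have M: "?M = chow_gens \<union> (pvar ` {H \<in> flats. \<not> H \<subseteq> G} \<union> {pvar {a}})" by auto
      \<comment> \<open>These sums, first for the listed atom \<open>a\<close>, yield
        \<open>pvar G\<close> and then the variables of all atoms below \<open>G\<close>, whether or
        not they contain \<open>W\<close>.\<close>
      have two: "pvar {b} + pvar G \<in> idl ?M" if b: "b \<in> G" for b
      proof -
        have bf: "{b} \<in> flats" "{b} \<noteq> G" "b \<in> E"
          using b flat_subset[OF G] flat_singleton[of b] rank_singleton[of b] k1 by (auto simp: flats_iff)
        have "pvar F \<in> idl ?M" if F: "F \<in> flats" "b \<in> F" "F \<notin> {{b}, G}" for F
        proof -
          have "\<not> F \<subseteq> G"
          proof
            assume "F \<subseteq> G"
            then have "rk F < 2" using F flat_rank_less[of F G] G k1 by (auto simp: flats_iff)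
            then have "rk F = 1" using flats_rank[OF F(1)] by simp
            then show False using flat_rank_1[of F b] F by (auto simp: flats_iff)
          qed
          then show ?thesis using F by (intro idl_base) auto
        qed
        then have "(\<Sum>F\<in>{{b}, G}. pvar F) \<in> idl ?M"
          unfolding M using b bf Gf by (intro linear_relation_mem[of b]) auto
        then show ?thesis using bf by simp
      qed
      have pa: "pvar {a} \<in> idl ?M" by (intro idl_base) auto
      have pG: "pvar G \<in> idl ?M" using idl_diff[OF two[OF a(1)] pa] by simp
      have pb: "pvar {b} \<in> idl ?M" if "b \<in> G" for b using idl_diff[OF two[OF that] pG] by simp
      have "idl ?M = idl (Igens G W)"
      proof (intro equalityI subsetI)
        fix p assume "p \<in> idl ?M"
        then show "p \<in> idl (Igens G W)"
        proof (rule idl_mono[rotated])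
          have "{a} \<in> flats" "{a} \<subset> G" "Suc (rk {a}) = rk G"
            using a flat_singleton[OF aE] rank_singleton[OF aE] k1 by (auto simp: flats_iff)
          then show "?M \<subseteq> Igens G W" using W_a by (auto simp: Igens_def)
        qed
      next
        fix p assume "p \<in> idl (Igens G W)"
        then show "p \<in> idl ?M"
        proof (rule idl_subset[rotated])
          fix g assume "g \<in> Igens G W"
          then consider "g \<in> ?M" | K' where "g = pvar K'" "K' \<in> flats" "K' \<subset> G" "Suc (rk K') = rk G"
            unfolding Igens_def by blast
          then show "g \<in> idl ?M"
          proof cases
            case 2
            then obtain b where "b \<in> K'" by (auto simp: flats_iff)
            moreover have "rk K' = 1" using 2 k1 by simp
            ultimately have "K' = {b}" "b \<in> G" using flat_rank_1[of K' b] 2 by (auto simp: flats_iff)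
            then show ?thesis using pb 2 by simp
          qed (rule idl_base)
        qed
      qed
      moreover have "linear_quotients (above G {} k) [{a}]"
        unfolding k1(1) using G k1 a by (intro atom_ok) auto
      ultimately show ?thesis by (intro fin[of "[{a}]"]) auto
    qed
  qed
qed

lemma labels_empty: "({}, {}) \<in> labels"
  using flat_empty rank_empty by (simp add: labels_def)

lemma finite_labels: "finite labels"
  by (rule finite_subset[of _ "{F. is_flat F} \<times> {F. is_flat F}"]) (auto simp: labels_def finite_flats)

end

section \<open>Free modules and comparison of resolutions\<close>

abbreviation mhom where "mhom \<equiv> LinearCombinations.module_hom"

section \<open>Module homomorphisms\<close>

lemma mhomI:
  assumes "\<And>u. u \<in> carrier M \<Longrightarrow> f u \<in> carrier N"
    "\<And>u v. u \<in> carrier M \<Longrightarrow> v \<in> carrier M \<Longrightarrow> f (u \<oplus>\<^bsub>M\<^esub> v) = f u \<oplus>\<^bsub>N\<^esub> f v"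
    "\<And>r u. r \<in> carrier R \<Longrightarrow> u \<in> carrier M \<Longrightarrow> f (r \<odot>\<^bsub>M\<^esub> u) = r \<odot>\<^bsub>N\<^esub> f u"
  shows "f \<in> mhom R M N"
  using assms by (auto simp: LinearCombinations.module_hom_def)

lemma mhom_closed: "f \<in> mhom R M N \<Longrightarrow> u \<in> carrier M \<Longrightarrow> f u \<in> carrier N"
  by (auto simp: LinearCombinations.module_hom_def)

lemma mhom_add: "f \<in> mhom R M N \<Longrightarrow> u \<in> carrier M \<Longrightarrow> v \<in> carrier M \<Longrightarrow> f (u \<oplus>\<^bsub>M\<^esub> v) = f u \<oplus>\<^bsub>N\<^esub> f v"
  by (auto simp: LinearCombinations.module_hom_def)

lemma mhom_smult: "f \<in> mhom R M N \<Longrightarrow> r \<in> carrier R \<Longrightarrow> u \<in> carrier M \<Longrightarrow> f (r \<odot>\<^bsub>M\<^esub> u) = r \<odot>\<^bsub>N\<^esub> f u"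
  by (auto simp: LinearCombinations.module_hom_def)

lemma mhom_comp: "f \<in> mhom R M N \<Longrightarrow> g \<in> mhom R N P \<Longrightarrow> (\<lambda>u. g (f u)) \<in> mhom R M P"
  by (rule mhomI) (auto simp: mhom_closed mhom_add mhom_smult)

lemma mhom_zero:
  assumes "Module.module R M" "Module.module R N" "f \<in> mhom R M N" shows "f \<zero>\<^bsub>M\<^esub> = \<zero>\<^bsub>N\<^esub>"
proof -
  interpret M: Module.module R M by fact
  interpret N: Module.module R N by fact
  have "f (\<zero>\<^bsub>R\<^esub> \<odot>\<^bsub>M\<^esub> \<zero>\<^bsub>M\<^esub>) = \<zero>\<^bsub>R\<^esub> \<odot>\<^bsub>N\<^esub> f \<zero>\<^bsub>M\<^esub>"
    using assms(3) by (intro mhom_smult) auto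
  then show ?thesis using mhom_closed[OF assms(3)] by simp
qed

lemma mhom_minus:
  assumes M: "Module.module R M" and N: "Module.module R N" and f: "f \<in> mhom R M N"
    and u: "u \<in> carrier M" and v: "v \<in> carrier M"
  shows "f (u \<ominus>\<^bsub>M\<^esub> v) = f u \<ominus>\<^bsub>N\<^esub> f v"
proof -
  interpret M: Module.module R M by fact
  interpret N: Module.module R N by fact
  have "f (\<ominus>\<^bsub>M\<^esub> v) \<oplus>\<^bsub>N\<^esub> f v = \<zero>\<^bsub>N\<^esub>"
    using mhom_add[OF f, of "\<ominus>\<^bsub>M\<^esub> v" v] v mhom_zero[OF M N f] by (simp add: M.l_neg)
  then have "f (\<ominus>\<^bsub>M\<^esub> v) = \<ominus>\<^bsub>N\<^esub> f v"
    using v mhom_closed[OF f] by (intro N.minus_equality[symmetric]) auto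
  then show ?thesis using u v by (simp add: a_minus_def mhom_add[OF f])
qed

lemma mhom_diff:
  assumes M: "Module.module R M" and N: "Module.module R N" and f: "f \<in> mhom R M N" and g: "g \<in> mhom R M N"
  shows "(\<lambda>u. f u \<ominus>\<^bsub>N\<^esub> g u) \<in> mhom R M N"
proof (rule mhomI)
  interpret M: Module.module R M by fact
  interpret N: Module.module R N by fact
  fix u v assume u: "u \<in> carrier M" and v: "v \<in> carrier M"
  note c = mhom_closed[OF f u] mhom_closed[OF f v] mhom_closed[OF g u] mhom_closed[OF g v]
  show "f u \<ominus>\<^bsub>N\<^esub> g u \<in> carrier N" using c by simp
  have "f (u \<oplus>\<^bsub>M\<^esub> v) \<ominus>\<^bsub>N\<^esub> g (u \<oplus>\<^bsub>M\<^esub> v) = (f u \<oplus>\<^bsub>N\<^esub> f v) \<ominus>\<^bsub>N\<^esub> (g u \<oplus>\<^bsub>N\<^esub> g v)"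
    using f g u v by (simp add: mhom_add)
  also have "\<dots> = (f u \<ominus>\<^bsub>N\<^esub> g u) \<oplus>\<^bsub>N\<^esub> (f v \<ominus>\<^bsub>N\<^esub> g v)"
    using c by (simp add: a_minus_def N.minus_add N.a_ac)
  finally show "f (u \<oplus>\<^bsub>M\<^esub> v) \<ominus>\<^bsub>N\<^esub> g (u \<oplus>\<^bsub>M\<^esub> v) = (f u \<ominus>\<^bsub>N\<^esub> g u) \<oplus>\<^bsub>N\<^esub> (f v \<ominus>\<^bsub>N\<^esub> g v)" .
  fix r assume r: "r \<in> carrier R"
  show "f (r \<odot>\<^bsub>M\<^esub> u) \<ominus>\<^bsub>N\<^esub> g (r \<odot>\<^bsub>M\<^esub> u) = r \<odot>\<^bsub>N\<^esub> (f u \<ominus>\<^bsub>N\<^esub> g u)"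
    using f g u c r by (simp add: mhom_smult a_minus_def N.smult_r_distr N.smult_r_minus)
qed

lemma mhom_id: "(\<lambda>u. u) \<in> mhom R M M"
  by (rule mhomI) auto

section \<open>Free modules on a set and their universal property\<close>

lemma free_module_simps [simp]:
  "\<zero>\<^bsub>free_module R X\<^esub> = (\<lambda>_. \<zero>\<^bsub>R\<^esub>)"
  "u \<oplus>\<^bsub>free_module R X\<^esub> v = (\<lambda>x. u x \<oplus>\<^bsub>R\<^esub> v x)"
  "r \<odot>\<^bsub>free_module R X\<^esub> u = (\<lambda>x. r \<otimes>\<^bsub>R\<^esub> u x)"
  by (simp_all add: free_module_def)

lemma free_carrier_iff:
  "u \<in> carrier (free_module R X) \<longleftrightarrow> (\<forall>x\<in>X. u x \<in> carrier R) \<and> (\<forall>x. x \<notin> X \<longrightarrow> u x = \<zero>\<^bsub>R\<^esub>) \<and> finite {x. u x \<noteq> \<zero>\<^bsub>R\<^esub>}"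
  by (simp add: free_module_def)

context cring
begin

lemma free_carrierD: "u \<in> carrier (free_module R X) \<Longrightarrow> u x \<in> carrier R"
  by (cases "x \<in> X") (auto simp: free_carrier_iff)

lemma free_abelian_group: "abelian_group (free_module R X)"
proof (rule abelian_groupI)
  fix u v assume u: "u \<in> carrier (free_module R X)" and v: "v \<in> carrier (free_module R X)"
  have "{x. u x \<oplus> v x \<noteq> \<zero>} \<subseteq> {x. u x \<noteq> \<zero>} \<union> {x. v x \<noteq> \<zero>}" by auto
  then have "finite {x. u x \<oplus> v x \<noteq> \<zero>}" by (rule finite_subset) (use u v in \<open>auto simp: free_carrier_iff\<close>)
  then show "u \<oplus>\<^bsub>free_module R X\<^esub> v \<in> carrier (free_module R X)"
    using u v by (auto simp: free_carrier_iff)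
  show "u \<oplus>\<^bsub>free_module R X\<^esub> v = v \<oplus>\<^bsub>free_module R X\<^esub> u"
    using free_carrierD[OF u] free_carrierD[OF v] by (auto simp: a_comm)
  show "\<zero>\<^bsub>free_module R X\<^esub> \<oplus>\<^bsub>free_module R X\<^esub> u = u" using free_carrierD[OF u] by auto
  have "{x. \<ominus> u x \<noteq> \<zero>} = {x. u x \<noteq> \<zero>}" using free_carrierD[OF u] by auto
  then have "(\<lambda>x. \<ominus> u x) \<in> carrier (free_module R X)" using u by (auto simp: free_carrier_iff)
  then show "\<exists>w\<in>carrier (free_module R X). w \<oplus>\<^bsub>free_module R X\<^esub> u = \<zero>\<^bsub>free_module R X\<^esub>"
    using free_carrierD[OF u] by (intro bexI[of _ "\<lambda>x. \<ominus> u x"]) (auto simp: l_neg)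
  fix w assume w: "w \<in> carrier (free_module R X)"
  show "u \<oplus>\<^bsub>free_module R X\<^esub> v \<oplus>\<^bsub>free_module R X\<^esub> w = u \<oplus>\<^bsub>free_module R X\<^esub> (v \<oplus>\<^bsub>free_module R X\<^esub> w)"
    using free_carrierD[OF u] free_carrierD[OF v] free_carrierD[OF w] by (auto simp: a_assoc)
qed (auto simp: free_carrier_iff)

lemma free_module_module: "Module.module R (free_module R X)"
proof (rule moduleI)
  show "cring R" by (rule is_cring)
  show "abelian_group (free_module R X)" by (rule free_abelian_group)
  fix a u assume a: "a \<in> carrier R" and u: "u \<in> carrier (free_module R X)"
  have "{x. a \<otimes> u x \<noteq> \<zero>} \<subseteq> {x. u x \<noteq> \<zero>}" using a by auto
  then have "finite {x. a \<otimes> u x \<noteq> \<zero>}" by (rule finite_subset) (use u in \<open>auto simp: free_carrier_iff\<close>)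
  then show "a \<odot>\<^bsub>free_module R X\<^esub> u \<in> carrier (free_module R X)" using a u by (auto simp: free_carrier_iff)
  fix b assume b: "b \<in> carrier R"
  show "(a \<oplus> b) \<odot>\<^bsub>free_module R X\<^esub> u = a \<odot>\<^bsub>free_module R X\<^esub> u \<oplus>\<^bsub>free_module R X\<^esub> b \<odot>\<^bsub>free_module R X\<^esub> u"
    using a b free_carrierD[OF u] by (auto simp: l_distr)
  show "a \<otimes> b \<odot>\<^bsub>free_module R X\<^esub> u = a \<odot>\<^bsub>free_module R X\<^esub> (b \<odot>\<^bsub>free_module R X\<^esub> u)"
    using a b free_carrierD[OF u] by (auto simp: m_assoc)
next
  fix u assume u: "u \<in> carrier (free_module R X)"
  show "\<one> \<odot>\<^bsub>free_module R X\<^esub> u = u" using free_carrierD[OF u] by auto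
next
  fix a u v assume a: "a \<in> carrier R" and u: "u \<in> carrier (free_module R X)" and v: "v \<in> carrier (free_module R X)"
  show "a \<odot>\<^bsub>free_module R X\<^esub> (u \<oplus>\<^bsub>free_module R X\<^esub> v) = a \<odot>\<^bsub>free_module R X\<^esub> u \<oplus>\<^bsub>free_module R X\<^esub> a \<odot>\<^bsub>free_module R X\<^esub> v"
    using a free_carrierD[OF u] free_carrierD[OF v] by (auto simp: r_distr)
qed

lemma free_basis_carrier: "x \<in> X \<Longrightarrow> free_basis R x \<in> carrier (free_module R X)"
  by (auto simp: free_carrier_iff free_basis_def)

lemma free_minus:
  assumes u: "u \<in> carrier (free_module R X)" and v: "v \<in> carrier (free_module R X)"
  shows "u \<ominus>\<^bsub>free_module R X\<^esub> v = (\<lambda>x. u x \<ominus> v x)"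
proof -
  interpret F: Module.module R "free_module R X" by (rule free_module_module)
  have c: "\<ominus>\<^bsub>free_module R X\<^esub> v \<in> carrier (free_module R X)" using v by simp
  have "(\<lambda>x. (\<ominus>\<^bsub>free_module R X\<^esub> v) x \<oplus> v x) = (\<lambda>_. \<zero>)" using F.l_neg[OF v] by simp
  then have z: "(\<ominus>\<^bsub>free_module R X\<^esub> v) x \<oplus> v x = \<zero>" for x by metis
  have "(\<ominus>\<^bsub>free_module R X\<^esub> v) x = \<ominus> v x" for x
    by (rule minus_equality[symmetric, OF z free_carrierD[OF v] free_carrierD[OF c]])
  then show ?thesis by (simp add: a_minus_def)
qed

lemma free_remove:
  assumes u: "u \<in> carrier (free_module R X)"
  shows "u = u(x := \<zero>) \<oplus>\<^bsub>free_module R X\<^esub> u x \<odot>\<^bsub>free_module R X\<^esub> free_basis R x"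
    "u(x := \<zero>) \<in> carrier (free_module R X)"
proof -
  show "u = u(x := \<zero>) \<oplus>\<^bsub>free_module R X\<^esub> u x \<odot>\<^bsub>free_module R X\<^esub> free_basis R x"
    using free_carrierD[OF u] by (auto simp: free_basis_def fun_eq_iff)
  have "{y. (u(x := \<zero>)) y \<noteq> \<zero>} \<subseteq> {y. u y \<noteq> \<zero>}" by auto
  then have "finite {y. (u(x := \<zero>)) y \<noteq> \<zero>}" by (rule finite_subset) (use u in \<open>auto simp: free_carrier_iff\<close>)
  then show "u(x := \<zero>) \<in> carrier (free_module R X)" using u by (auto simp: free_carrier_iff)
qed

text \<open>The set \<open>I\<close> records where the coefficients lie. With \<open>I\<close> the
  maximal ideal the rule proves that vectors with entries in that ideal are sent to zero.\<close>

lemma free_induct [consumes 1, case_names coeff zero step]: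
  assumes u: "u \<in> carrier (free_module R X)" and I: "\<And>x. x \<in> X \<Longrightarrow> u x \<in> I"
    and zero: "P (\<lambda>_. \<zero>)"
    and step: "\<And>v x r. v \<in> carrier (free_module R X) \<Longrightarrow> x \<in> X \<Longrightarrow> r \<in> carrier R \<Longrightarrow> r \<in> I \<Longrightarrow> v x = \<zero> \<Longrightarrow> P v \<Longrightarrow>
      P (v \<oplus>\<^bsub>free_module R X\<^esub> r \<odot>\<^bsub>free_module R X\<^esub> free_basis R x)"
  shows "P u"
  using u I
proof -
  have "P w" if "w \<in> carrier (free_module R X)" "\<And>x. x \<in> X \<Longrightarrow> w x \<in> insert \<zero> I" "n = card {y. w y \<noteq> \<zero>}" for n w
    using that
  proof (induction n arbitrary: w)
    case 0
    then have "finite {x. w x \<noteq> \<zero>}" by (auto simp: free_carrier_iff)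
    then have "{x. w x \<noteq> \<zero>} = {}" using 0 by simp
    then have "w = (\<lambda>_. \<zero>)" by (auto simp: fun_eq_iff)
    then show ?case using zero by simp
  next
    case (Suc n)
    have fin: "finite {x. w x \<noteq> \<zero>}" using Suc by (auto simp: free_carrier_iff)
    obtain x where x: "w x \<noteq> \<zero>" using Suc(4) by fastforce
    then have xX: "x \<in> X" using Suc by (auto simp: free_carrier_iff)
    have "{y. (w(x := \<zero>)) y \<noteq> \<zero>} = {y. w y \<noteq> \<zero>} - {x}" by auto
    then have n: "n = card {y. (w(x := \<zero>)) y \<noteq> \<zero>}" using Suc(4) fin x by simp
    have "P (w(x := \<zero>))" by (rule Suc(1)[OF free_remove(2)[OF Suc(2), of x] _ n]) (use Suc(3) in auto)
    then have "P (w(x := \<zero>) \<oplus>\<^bsub>free_module R X\<^esub> w x \<odot>\<^bsub>free_module R X\<^esub> free_basis R x)"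
      using free_remove(2)[OF Suc(2), of x] xX x Suc(3)[OF xX] free_carrierD[OF Suc(2)] by (intro step) auto
    then show ?case using free_remove(1)[OF Suc(2), of x] by metis
  qed
  then show ?thesis using u I by blast
qed

lemma free_hom_eq:
  assumes M: "Module.module R M" and f: "f \<in> mhom R (free_module R X) M" and g: "g \<in> mhom R (free_module R X) M"
    and eq: "\<And>x. x \<in> X \<Longrightarrow> f (free_basis R x) = g (free_basis R x)" and u: "u \<in> carrier (free_module R X)"
  shows "f u = g u"
proof -
  interpret F: Module.module R "free_module R X" by (rule free_module_module)
  show ?thesis using u
  proof (induction u rule: free_induct[where I = UNIV])
    case zero
    show ?case using mhom_zero[OF free_module_module M f] mhom_zero[OF free_module_module M g] by simp
  next
    case (step v x r)
    then have c: "r \<odot>\<^bsub>free_module R X\<^esub> free_basis R x \<in> carrier (free_module R X)"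
      by (intro F.smult_closed free_basis_carrier)
    show ?case
      unfolding mhom_add[OF f step(1) c] mhom_add[OF g step(1) c]
        mhom_smult[OF f step(3) free_basis_carrier[OF step(2)]] mhom_smult[OF g step(3) free_basis_carrier[OF step(2)]]
      using step eq by simp
  qed simp
qed

end

text \<open>The linear extension of \<open>\<phi>\<close>, as a sum over the support in the very
  form in which \<open>tensor_map\<close> writes it.\<close>

definition free_lift :: "('r, 'k) ring_scheme \<Rightarrow> ('r, 'b, 'm) module_scheme \<Rightarrow> ('x \<Rightarrow> 'b) \<Rightarrow> ('x \<Rightarrow> 'r) \<Rightarrow> 'b"
  where "free_lift R M \<phi> u = (\<Oplus>\<^bsub>M\<^esub>x\<in>{x. u x \<noteq> \<zero>\<^bsub>R\<^esub>}. u x \<odot>\<^bsub>M\<^esub> \<phi> x)"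

context cring
begin

lemma free_lift_superset:
  assumes M: "Module.module R M" and \<phi>: "\<And>x. x \<in> X \<Longrightarrow> \<phi> x \<in> carrier M" and u: "u \<in> carrier (free_module R X)"
    and A: "finite A" "{x. u x \<noteq> \<zero>} \<subseteq> A" "A \<subseteq> X"
  shows "free_lift R M \<phi> u = (\<Oplus>\<^bsub>M\<^esub>x\<in>A. u x \<odot>\<^bsub>M\<^esub> \<phi> x)"
proof -
  interpret M: Module.module R M by fact
  show ?thesis unfolding free_lift_def
    using A \<phi> free_carrierD[OF u] by (intro M.add.finprod_mono_neutral_cong_left) (auto simp: subset_iff)
qed

lemma free_lift_hom:
  assumes M: "Module.module R M" and \<phi>: "\<And>x. x \<in> X \<Longrightarrow> \<phi> x \<in> carrier M"
  shows "free_lift R M \<phi> \<in> mhom R (free_module R X) M"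
proof (rule mhomI)
  interpret M: Module.module R M by fact
  interpret F: Module.module R "free_module R X" by (rule free_module_module)
  fix u v assume u: "u \<in> carrier (free_module R X)" and v: "v \<in> carrier (free_module R X)"
  let ?A = "{x. u x \<noteq> \<zero>} \<union> {x. v x \<noteq> \<zero>}"
  have A: "finite ?A" "?A \<subseteq> X" using u v by (auto simp: free_carrier_iff)
  note uc = free_carrierD[OF u] and vc = free_carrierD[OF v]
  have fu: "(\<lambda>x. u x \<odot>\<^bsub>M\<^esub> \<phi> x) \<in> ?A \<rightarrow> carrier M" and fv: "(\<lambda>x. v x \<odot>\<^bsub>M\<^esub> \<phi> x) \<in> ?A \<rightarrow> carrier M"
    using A \<phi> uc vc by auto
  have lu: "free_lift R M \<phi> u = (\<Oplus>\<^bsub>M\<^esub>x\<in>?A. u x \<odot>\<^bsub>M\<^esub> \<phi> x)" by (rule free_lift_superset[OF M \<phi> u A(1) _ A(2)]) auto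
  have lv: "free_lift R M \<phi> v = (\<Oplus>\<^bsub>M\<^esub>x\<in>?A. v x \<odot>\<^bsub>M\<^esub> \<phi> x)" by (rule free_lift_superset[OF M \<phi> v A(1) _ A(2)]) auto
  show "free_lift R M \<phi> u \<in> carrier M" unfolding lu using fu by (rule M.finsum_closed)
  have "u \<oplus>\<^bsub>free_module R X\<^esub> v \<in> carrier (free_module R X)" using u v by blast
  then have "free_lift R M \<phi> (u \<oplus>\<^bsub>free_module R X\<^esub> v) = (\<Oplus>\<^bsub>M\<^esub>x\<in>?A. (u \<oplus>\<^bsub>free_module R X\<^esub> v) x \<odot>\<^bsub>M\<^esub> \<phi> x)"
    by (intro free_lift_superset[OF M \<phi> _ A(1) _ A(2)]) auto
  also have "\<dots> = (\<Oplus>\<^bsub>M\<^esub>x\<in>?A. u x \<odot>\<^bsub>M\<^esub> \<phi> x \<oplus>\<^bsub>M\<^esub> v x \<odot>\<^bsub>M\<^esub> \<phi> x)"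
    using A \<phi> uc vc by (intro M.finsum_cong') (auto simp: M.smult_l_distr subset_iff)
  also have "\<dots> = free_lift R M \<phi> u \<oplus>\<^bsub>M\<^esub> free_lift R M \<phi> v"
    unfolding lu lv using fu fv by (rule M.finsum_addf)
  finally show "free_lift R M \<phi> (u \<oplus>\<^bsub>free_module R X\<^esub> v) = free_lift R M \<phi> u \<oplus>\<^bsub>M\<^esub> free_lift R M \<phi> v" .
  fix r assume r: "r \<in> carrier R"
  have "r \<odot>\<^bsub>free_module R X\<^esub> u \<in> carrier (free_module R X)" using u r by blast
  then have "free_lift R M \<phi> (r \<odot>\<^bsub>free_module R X\<^esub> u) = (\<Oplus>\<^bsub>M\<^esub>x\<in>?A. (r \<odot>\<^bsub>free_module R X\<^esub> u) x \<odot>\<^bsub>M\<^esub> \<phi> x)"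
    using r by (intro free_lift_superset[OF M \<phi> _ A(1) _ A(2)]) auto
  also have "\<dots> = (\<Oplus>\<^bsub>M\<^esub>x\<in>?A. r \<odot>\<^bsub>M\<^esub> (u x \<odot>\<^bsub>M\<^esub> \<phi> x))"
    using A \<phi> uc r by (intro M.finsum_cong') (auto simp: M.smult_assoc1 subset_iff)
  also have "\<dots> = r \<odot>\<^bsub>M\<^esub> free_lift R M \<phi> u"
    unfolding lu using M.finsum_smult_ldistr[OF A(1) r fu] by simp
  finally show "free_lift R M \<phi> (r \<odot>\<^bsub>free_module R X\<^esub> u) = r \<odot>\<^bsub>M\<^esub> free_lift R M \<phi> u" .
qed

lemma free_lift_basis:
  assumes M: "Module.module R M" and \<phi>: "\<phi> x \<in> carrier M"
  shows "free_lift R M \<phi> (free_basis R x) = \<phi> x"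
proof -
  interpret M: Module.module R M by fact
  have b: "free_basis R x \<in> carrier (free_module R {x})" by (rule free_basis_carrier) simp
  have "free_lift R M \<phi> (free_basis R x) = (\<Oplus>\<^bsub>M\<^esub>y\<in>{x}. free_basis R x y \<odot>\<^bsub>M\<^esub> \<phi> y)"
    using \<phi> by (intro free_lift_superset[OF M _ b]) (auto simp: free_basis_def split: if_splits)
  also have "\<dots> = \<phi> x" using \<phi> by (simp add: free_basis_def)
  finally show ?thesis .
qed

lemma free_projective:
  assumes M: "Module.module R M" and N: "Module.module R N" and p: "p \<in> mhom R M N" and g: "g \<in> mhom R (free_module R X) N"
    and im: "\<And>x. x \<in> X \<Longrightarrow> g (free_basis R x) \<in> p ` carrier M"
  shows "\<exists>f\<in>mhom R (free_module R X) M. \<forall>u\<in>carrier (free_module R X). p (f u) = g u"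
proof -
  have "\<forall>x\<in>X. \<exists>m\<in>carrier M. p m = g (free_basis R x)" using im by fastforce
  then obtain \<phi> where \<phi>: "\<And>x. x \<in> X \<Longrightarrow> \<phi> x \<in> carrier M \<and> p (\<phi> x) = g (free_basis R x)" by metis
  have f: "free_lift R M \<phi> \<in> mhom R (free_module R X) M" using \<phi> by (intro free_lift_hom[OF M]) auto
  have "p (free_lift R M \<phi> u) = g u" if "u \<in> carrier (free_module R X)" for u
  proof (rule free_hom_eq[OF N mhom_comp[OF f p] g _ that])
    fix x assume "x \<in> X"
    then show "p (free_lift R M \<phi> (free_basis R x)) = g (free_basis R x)"
      using \<phi>[of x] free_lift_basis[OF M, of \<phi> x] by simp
  qed
  then show ?thesis using f by blast
qed

end

lemma (in abelian_group) minus_self: "x \<in> carrier G \<Longrightarrow> x \<ominus> x = \<zero>"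
  by (simp add: a_minus_def r_neg)

lemma (in abelian_group) minus_minus_zero: "x \<in> carrier G \<Longrightarrow> x \<ominus> (x \<ominus> \<zero>) = \<zero>"
proof -
  assume x: "x \<in> carrier G"
  have "\<ominus> \<zero> = \<zero>" by (rule minus_equality) auto
  then have "x \<ominus> \<zero> = x" using x by (simp add: a_minus_def)
  then show "x \<ominus> (x \<ominus> \<zero>) = \<zero>" using minus_self[OF x] by simp
qed

section \<open>Lifting chain maps and homotopies\<close>

context cring
begin

text \<open>Dependent choice, degree by degree. The invariant \<open>?P\<close> contains the image
  condition that the next lift needs; it follows from exactness of the target, while the source,
  apart from being free, only has to be a complex.\<close>

lemma chain_lift:
  fixes X :: "nat \<Rightarrow> 'x set" and Y :: "nat \<Rightarrow> 'y set"
  assumes A: "Module.module R A"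
    and d: "\<And>i. d i \<in> mhom R (free_module R (X (Suc i))) (free_module R (X i))"
    and e: "\<And>i. e i \<in> mhom R (free_module R (Y (Suc i))) (free_module R (Y i))"
    and \<epsilon>: "\<epsilon> \<in> mhom R (free_module R (X 0)) A" and \<eta>: "\<eta> \<in> mhom R (free_module R (Y 0)) A"
    and c0: "\<And>u. u \<in> carrier (free_module R (X 1)) \<Longrightarrow> \<epsilon> (d 0 u) = \<zero>\<^bsub>A\<^esub>"
    and c: "\<And>i u. u \<in> carrier (free_module R (X (Suc (Suc i)))) \<Longrightarrow> d i (d (Suc i) u) = \<zero>\<^bsub>free_module R (X i)\<^esub>"
    and s: "\<epsilon> ` carrier (free_module R (X 0)) \<subseteq> \<eta> ` carrier (free_module R (Y 0))"
    and x0: "\<And>v. v \<in> carrier (free_module R (Y 0)) \<Longrightarrow> \<eta> v = \<zero>\<^bsub>A\<^esub> \<Longrightarrow> v \<in> e 0 ` carrier (free_module R (Y 1))"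
    and x: "\<And>i v. v \<in> carrier (free_module R (Y (Suc i))) \<Longrightarrow> e i v = \<zero>\<^bsub>free_module R (Y i)\<^esub> \<Longrightarrow>
      v \<in> e (Suc i) ` carrier (free_module R (Y (Suc (Suc i))))"
  obtains f where "\<And>i. f i \<in> mhom R (free_module R (X i)) (free_module R (Y i))"
    "\<And>u. u \<in> carrier (free_module R (X 0)) \<Longrightarrow> \<eta> (f 0 u) = \<epsilon> u"
    "\<And>i u. u \<in> carrier (free_module R (X (Suc i))) \<Longrightarrow> e i (f (Suc i) u) = f i (d i u)"
proof -
  let ?F = "\<lambda>i. free_module R (X i)" and ?G = "\<lambda>i. free_module R (Y i)"
  let ?P = "\<lambda>n f. f \<in> mhom R (?F n) (?G n) \<and> (n = 0 \<longrightarrow> (\<forall>u\<in>carrier (?F 0). \<eta> (f u) = \<epsilon> u)) \<and>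
    (\<forall>u\<in>carrier (?F (Suc n)). f (d n u) \<in> e n ` carrier (?G (Suc n)))"
  let ?Q = "\<lambda>n f f'. \<forall>u\<in>carrier (?F (Suc n)). e n (f' u) = f (d n u)"
  have "\<exists>f. \<forall>n. ?P n (f n) \<and> ?Q n (f n) (f (Suc n))"
  proof (rule dependent_nat_choice)
    have "\<epsilon> (free_basis R x) \<in> \<eta> ` carrier (?G 0)" if "x \<in> X 0" for x
      using s free_basis_carrier[OF that] by blast
    from free_projective[OF free_module_module A \<eta> \<epsilon> this]
    obtain f where f: "f \<in> mhom R (?F 0) (?G 0)" "\<forall>u\<in>carrier (?F 0). \<eta> (f u) = \<epsilon> u" by blast
    have "f (d 0 u) \<in> e 0 ` carrier (?G 1)" if "u \<in> carrier (?F 1)" for u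
    proof (rule x0)
      have du: "d 0 u \<in> carrier (?F 0)" using mhom_closed[OF d, of u 0] that by simp
      show "f (d 0 u) \<in> carrier (?G 0)" by (rule mhom_closed[OF f(1) du])
      show "\<eta> (f (d 0 u)) = \<zero>\<^bsub>A\<^esub>" using f(2) du c0[OF that] by simp
    qed
    then show "\<exists>f. ?P 0 f" using f by (intro exI[of _ f]) simp
  next
    fix f n assume P: "?P n f"
    then have f: "f \<in> mhom R (?F n) (?G n)" by simp
    have "f (d n (free_basis R x)) \<in> e n ` carrier (?G (Suc n))" if "x \<in> X (Suc n)" for x
      using P free_basis_carrier[OF that] by blast
    from free_projective[OF free_module_module free_module_module e mhom_comp[OF d f] this]
    obtain f' where f': "f' \<in> mhom R (?F (Suc n)) (?G (Suc n))" "\<forall>u\<in>carrier (?F (Suc n)). e n (f' u) = f (d n u)"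
      by blast
    have "f' (d (Suc n) u) \<in> e (Suc n) ` carrier (?G (Suc (Suc n)))" if u: "u \<in> carrier (?F (Suc (Suc n)))" for u
    proof (rule x)
      have du: "d (Suc n) u \<in> carrier (?F (Suc n))" by (rule mhom_closed[OF d u])
      show "f' (d (Suc n) u) \<in> carrier (?G (Suc n))" by (rule mhom_closed[OF f'(1) du])
      have "e n (f' (d (Suc n) u)) = f (d n (d (Suc n) u))" using f'(2) du by blast
      also have "\<dots> = \<zero>\<^bsub>?G n\<^esub>" unfolding c[OF u] by (rule mhom_zero[OF free_module_module free_module_module f])
      finally show "e n (f' (d (Suc n) u)) = \<zero>\<^bsub>?G n\<^esub>" .
    qed
    then show "\<exists>f'. ?P (Suc n) f' \<and> ?Q n f f'" using f' by (intro exI[of _ f']) simp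
  qed
  then obtain f where all: "\<forall>n. ?P n (f n) \<and> ?Q n (f n) (f (Suc n))" by (rule exE)
  have f: "?P n (f n)" "?Q n (f n) (f (Suc n))" for n
    by (rule conjunct1[OF spec[OF all]], rule conjunct2[OF spec[OF all]])
  show thesis
  proof (rule that)
    show "f i \<in> mhom R (?F i) (?G i)" for i using f(1)[of i] by simp
    show "\<eta> (f 0 u) = \<epsilon> u" if "u \<in> carrier (?F 0)" for u using f(1)[of 0] that by simp
    show "e i (f (Suc i) u) = f i (d i u)" if "u \<in> carrier (?F (Suc i))" for i u using f(2)[of i] that by simp
  qed
qed

text \<open>The same recursion for a chain map that is a boundary in degree zero. The correction
  \<open>s (d n u)\<close> turns the element to be lifted into a cycle, because two successive
  differentials compose to zero.\<close>

lemma chain_homotopy: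
  fixes X :: "nat \<Rightarrow> 'x set" and Y :: "nat \<Rightarrow> 'y set"
  assumes d: "\<And>i. d i \<in> mhom R (free_module R (X (Suc i))) (free_module R (X i))"
    and e: "\<And>i. e i \<in> mhom R (free_module R (Y (Suc i))) (free_module R (Y i))"
    and c: "\<And>i u. u \<in> carrier (free_module R (X (Suc (Suc i)))) \<Longrightarrow> d i (d (Suc i) u) = \<zero>\<^bsub>free_module R (X i)\<^esub>"
    and \<phi>: "\<And>i. \<phi> i \<in> mhom R (free_module R (X i)) (free_module R (Y i))"
    and \<phi>0: "\<And>u. u \<in> carrier (free_module R (X 0)) \<Longrightarrow> \<phi> 0 u \<in> e 0 ` carrier (free_module R (Y 1))"
    and \<phi>c: "\<And>i u. u \<in> carrier (free_module R (X (Suc i))) \<Longrightarrow> e i (\<phi> (Suc i) u) = \<phi> i (d i u)"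
    and x: "\<And>i v. v \<in> carrier (free_module R (Y (Suc i))) \<Longrightarrow> e i v = \<zero>\<^bsub>free_module R (Y i)\<^esub> \<Longrightarrow>
      v \<in> e (Suc i) ` carrier (free_module R (Y (Suc (Suc i))))"
  obtains s where "\<And>i. s i \<in> mhom R (free_module R (X i)) (free_module R (Y (Suc i)))"
    "\<And>u. u \<in> carrier (free_module R (X 0)) \<Longrightarrow> e 0 (s 0 u) = \<phi> 0 u"
    "\<And>i u. u \<in> carrier (free_module R (X (Suc i))) \<Longrightarrow>
       e (Suc i) (s (Suc i) u) = \<phi> (Suc i) u \<ominus>\<^bsub>free_module R (Y (Suc i))\<^esub> s i (d i u)"
proof -
  let ?F = "\<lambda>i. free_module R (X i)" and ?G = "\<lambda>i. free_module R (Y i)"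
  let ?P = "\<lambda>n s. s \<in> mhom R (?F n) (?G (Suc n)) \<and> (n = 0 \<longrightarrow> (\<forall>u\<in>carrier (?F 0). e 0 (s u) = \<phi> 0 u)) \<and>
    (\<forall>u\<in>carrier (?F (Suc n)). \<phi> (Suc n) u \<ominus>\<^bsub>?G (Suc n)\<^esub> s (d n u) \<in> e (Suc n) ` carrier (?G (Suc (Suc n))))"
  let ?Q = "\<lambda>n s s'. \<forall>u\<in>carrier (?F (Suc n)). e (Suc n) (s' u) = \<phi> (Suc n) u \<ominus>\<^bsub>?G (Suc n)\<^esub> s (d n u)"
  note mm = free_module_module
  have "\<exists>s. \<forall>n. ?P n (s n) \<and> ?Q n (s n) (s (Suc n))"
  proof (rule dependent_nat_choice)
    have "\<phi> 0 (free_basis R x) \<in> e 0 ` carrier (?G (Suc 0))" if "x \<in> X 0" for x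
      using \<phi>0[OF free_basis_carrier[OF that]] by simp
    from free_projective[OF mm mm e \<phi> this]
    obtain s where s: "s \<in> mhom R (?F 0) (?G (Suc 0))" "\<forall>u\<in>carrier (?F 0). e 0 (s u) = \<phi> 0 u" by blast
    have "\<phi> (Suc 0) u \<ominus>\<^bsub>?G (Suc 0)\<^esub> s (d 0 u) \<in> e (Suc 0) ` carrier (?G (Suc (Suc 0)))"
      if u: "u \<in> carrier (?F (Suc 0))" for u
    proof (rule x)
      interpret G: Module.module R "?G (Suc 0)" by (rule mm)
      interpret G0: Module.module R "?G 0" by (rule mm)
      have du: "d 0 u \<in> carrier (?F 0)" by (rule mhom_closed[OF d u])
      have c1: "\<phi> (Suc 0) u \<in> carrier (?G (Suc 0))" "s (d 0 u) \<in> carrier (?G (Suc 0))" "\<phi> 0 (d 0 u) \<in> carrier (?G 0)"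
        by (rule mhom_closed[OF \<phi> u], rule mhom_closed[OF s(1) du], rule mhom_closed[OF \<phi> du])
      show "\<phi> (Suc 0) u \<ominus>\<^bsub>?G (Suc 0)\<^esub> s (d 0 u) \<in> carrier (?G (Suc 0))" using c1 by (intro G.minus_closed)
      show "e 0 (\<phi> (Suc 0) u \<ominus>\<^bsub>?G (Suc 0)\<^esub> s (d 0 u)) = \<zero>\<^bsub>?G 0\<^esub>"
        unfolding mhom_minus[OF mm mm e c1(1,2)] \<phi>c[OF u] s(2)[rule_format, OF du]
        by (rule G0.minus_self[OF c1(3)])
    qed
    then show "\<exists>s. ?P 0 s" using s by (intro exI[of _ s]) simp
  next
    fix s n assume P: "?P n s"
    then have s: "s \<in> mhom R (?F n) (?G (Suc n))" by simp
    have h: "(\<lambda>u. \<phi> (Suc n) u \<ominus>\<^bsub>?G (Suc n)\<^esub> s (d n u)) \<in> mhom R (?F (Suc n)) (?G (Suc n))"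
      by (rule mhom_diff[OF mm mm \<phi> mhom_comp[OF d s]])
    have "\<phi> (Suc n) (free_basis R x) \<ominus>\<^bsub>?G (Suc n)\<^esub> s (d n (free_basis R x)) \<in> e (Suc n) ` carrier (?G (Suc (Suc n)))"
      if "x \<in> X (Suc n)" for x
      using P free_basis_carrier[OF that] by blast
    from free_projective[OF mm mm e h this]
    obtain s' where s': "s' \<in> mhom R (?F (Suc n)) (?G (Suc (Suc n)))"
      "\<forall>u\<in>carrier (?F (Suc n)). e (Suc n) (s' u) = \<phi> (Suc n) u \<ominus>\<^bsub>?G (Suc n)\<^esub> s (d n u)" by blast
    have "\<phi> (Suc (Suc n)) u \<ominus>\<^bsub>?G (Suc (Suc n))\<^esub> s' (d (Suc n) u) \<in> e (Suc (Suc n)) ` carrier (?G (Suc (Suc (Suc n))))"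
      if u: "u \<in> carrier (?F (Suc (Suc n)))" for u
    proof (rule x)
      interpret G: Module.module R "?G (Suc (Suc n))" by (rule mm)
      interpret G0: Module.module R "?G (Suc n)" by (rule mm)
      have du: "d (Suc n) u \<in> carrier (?F (Suc n))" by (rule mhom_closed[OF d u])
      have c1: "\<phi> (Suc (Suc n)) u \<in> carrier (?G (Suc (Suc n)))" "s' (d (Suc n) u) \<in> carrier (?G (Suc (Suc n)))"
        "\<phi> (Suc n) (d (Suc n) u) \<in> carrier (?G (Suc n))"
        by (rule mhom_closed[OF \<phi> u], rule mhom_closed[OF s'(1) du], rule mhom_closed[OF \<phi> du])
      show "\<phi> (Suc (Suc n)) u \<ominus>\<^bsub>?G (Suc (Suc n))\<^esub> s' (d (Suc n) u) \<in> carrier (?G (Suc (Suc n)))"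
        using c1 by (intro G.minus_closed)
      have z: "s (d n (d (Suc n) u)) = \<zero>\<^bsub>?G (Suc n)\<^esub>" unfolding c[OF u] by (rule mhom_zero[OF mm mm s])
      show "e (Suc n) (\<phi> (Suc (Suc n)) u \<ominus>\<^bsub>?G (Suc (Suc n))\<^esub> s' (d (Suc n) u)) = \<zero>\<^bsub>?G (Suc n)\<^esub>"
        unfolding mhom_minus[OF mm mm e c1(1,2)] \<phi>c[OF u] s'(2)[rule_format, OF du] z
        by (rule G0.minus_minus_zero[OF c1(3)])
    qed
    then show "\<exists>s'. ?P (Suc n) s' \<and> ?Q n s s'" using s' by (intro exI[of _ s']) simp
  qed
  then obtain s where all: "\<forall>n. ?P n (s n) \<and> ?Q n (s n) (s (Suc n))" by (rule exE)
  have s: "?P n (s n)" "?Q n (s n) (s (Suc n))" for n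
    by (rule conjunct1[OF spec[OF all]], rule conjunct2[OF spec[OF all]])
  show thesis
  proof (rule that)
    show "s i \<in> mhom R (?F i) (?G (Suc i))" for i using s(1)[of i] by simp
    show "e 0 (s 0 u) = \<phi> 0 u" if "u \<in> carrier (?F 0)" for u using s(1)[of 0] that by simp
    show "e (Suc i) (s (Suc i) u) = \<phi> (Suc i) u \<ominus>\<^bsub>?G (Suc i)\<^esub> s i (d i u)" if "u \<in> carrier (?F (Suc i))" for i u
      using s(2)[of i] that by simp
  qed
qed

end

lemma free_resolutionD:
  assumes "free_resolution R A X d \<epsilon>"
  shows "d i \<in> mhom R (free_module R (X (Suc i))) (free_module R (X i))"
    "\<epsilon> \<in> mhom R (free_module R (X 0)) A"
    "\<epsilon> ` carrier (free_module R (X 0)) = carrier A"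
    "u \<in> carrier (free_module R (X 1)) \<Longrightarrow> \<epsilon> (d 0 u) = \<zero>\<^bsub>A\<^esub>"
    "u \<in> carrier (free_module R (X (Suc (Suc i)))) \<Longrightarrow> d i (d (Suc i) u) = \<zero>\<^bsub>free_module R (X i)\<^esub>"
    "v \<in> carrier (free_module R (X 0)) \<Longrightarrow> \<epsilon> v = \<zero>\<^bsub>A\<^esub> \<Longrightarrow> v \<in> d 0 ` carrier (free_module R (X 1))"
    "v \<in> carrier (free_module R (X (Suc i))) \<Longrightarrow> d i v = \<zero>\<^bsub>free_module R (X i)\<^esub> \<Longrightarrow>
      v \<in> d (Suc i) ` carrier (free_module R (X (Suc (Suc i))))"
proof -
  have r: "\<And>i. d i \<in> mhom R (free_module R (X (Suc i))) (free_module R (X i))"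
    "\<epsilon> \<in> mhom R (free_module R (X 0)) A" "\<epsilon> ` carrier (free_module R (X 0)) = carrier A"
    "{u \<in> carrier (free_module R (X 0)). \<epsilon> u = \<zero>\<^bsub>A\<^esub>} = d 0 ` carrier (free_module R (X 1))"
    "\<And>i. {u \<in> carrier (free_module R (X (Suc i))). d i u = \<zero>\<^bsub>free_module R (X i)\<^esub>} =
       d (Suc i) ` carrier (free_module R (X (Suc (Suc i))))"
    using assms unfolding free_resolution_def Let_def a_kernel_def' by blast+
  show "d i \<in> mhom R (free_module R (X (Suc i))) (free_module R (X i))"
    "\<epsilon> \<in> mhom R (free_module R (X 0)) A"
    "\<epsilon> ` carrier (free_module R (X 0)) = carrier A" using r by blast+
  show "u \<in> carrier (free_module R (X 1)) \<Longrightarrow> \<epsilon> (d 0 u) = \<zero>\<^bsub>A\<^esub>"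
    "v \<in> carrier (free_module R (X 0)) \<Longrightarrow> \<epsilon> v = \<zero>\<^bsub>A\<^esub> \<Longrightarrow> v \<in> d 0 ` carrier (free_module R (X 1))"
    using r(4) by blast+
  show "u \<in> carrier (free_module R (X (Suc (Suc i)))) \<Longrightarrow> d i (d (Suc i) u) = \<zero>\<^bsub>free_module R (X i)\<^esub>"
    "v \<in> carrier (free_module R (X (Suc i))) \<Longrightarrow> d i v = \<zero>\<^bsub>free_module R (X i)\<^esub> \<Longrightarrow>
      v \<in> d (Suc i) ` carrier (free_module R (X (Suc (Suc i))))"
    using r(5)[of i] by blast+
qed

context cring
begin

lemma resolution_compare:
  fixes X :: "nat \<Rightarrow> 'x set" and Y :: "nat \<Rightarrow> 'y set"
  assumes A: "Module.module R A" and F: "free_resolution R A X d \<epsilon>" and G: "free_resolution R A Y e \<eta>"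
  obtains f where "\<And>i. f i \<in> mhom R (free_module R (X i)) (free_module R (Y i))"
    "\<And>u. u \<in> carrier (free_module R (X 0)) \<Longrightarrow> \<eta> (f 0 u) = \<epsilon> u"
    "\<And>i u. u \<in> carrier (free_module R (X (Suc i))) \<Longrightarrow> e i (f (Suc i) u) = f i (d i u)"
proof (rule chain_lift[OF A])
  note F = free_resolutionD[OF F] and G = free_resolutionD[OF G]
  show "d i \<in> mhom R (free_module R (X (Suc i))) (free_module R (X i))" for i by (rule F)
  show "e i \<in> mhom R (free_module R (Y (Suc i))) (free_module R (Y i))" for i by (rule G)
  show "\<epsilon> \<in> mhom R (free_module R (X 0)) A" "\<eta> \<in> mhom R (free_module R (Y 0)) A" by (rule F G)+
  show "\<epsilon> (d 0 u) = \<zero>\<^bsub>A\<^esub>" if "u \<in> carrier (free_module R (X 1))" for u by (rule F(4)[OF that])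
  show "d i (d (Suc i) u) = \<zero>\<^bsub>free_module R (X i)\<^esub>" if "u \<in> carrier (free_module R (X (Suc (Suc i))))" for i u
    by (rule F(5)[OF that])
  show "\<epsilon> ` carrier (free_module R (X 0)) \<subseteq> \<eta> ` carrier (free_module R (Y 0))" using F(3) G(3) by simp
  show "v \<in> e 0 ` carrier (free_module R (Y 1))" if "v \<in> carrier (free_module R (Y 0))" "\<eta> v = \<zero>\<^bsub>A\<^esub>" for v
    by (rule G(6)[OF that])
  show "v \<in> e (Suc i) ` carrier (free_module R (Y (Suc (Suc i))))"
    if "v \<in> carrier (free_module R (Y (Suc i)))" "e i v = \<zero>\<^bsub>free_module R (Y i)\<^esub>" for i v
    by (rule G(7)[OF that])
qed (rule that)

lemma resolution_homotopy:
  fixes X :: "nat \<Rightarrow> 'x set"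
  assumes A: "Module.module R A" and F: "free_resolution R A X d \<epsilon>"
    and \<phi>: "\<And>i. \<phi> i \<in> mhom R (free_module R (X i)) (free_module R (X i))"
    and \<phi>0: "\<And>u. u \<in> carrier (free_module R (X 0)) \<Longrightarrow> \<epsilon> (\<phi> 0 u) = \<epsilon> u"
    and \<phi>c: "\<And>i u. u \<in> carrier (free_module R (X (Suc i))) \<Longrightarrow> d i (\<phi> (Suc i) u) = \<phi> i (d i u)"
  obtains s where "\<And>i. s i \<in> mhom R (free_module R (X i)) (free_module R (X (Suc i)))"
    "\<And>u. u \<in> carrier (free_module R (X 0)) \<Longrightarrow> d 0 (s 0 u) = \<phi> 0 u \<ominus>\<^bsub>free_module R (X 0)\<^esub> u"
    "\<And>i u. u \<in> carrier (free_module R (X (Suc i))) \<Longrightarrow>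
       d (Suc i) (s (Suc i) u) = (\<phi> (Suc i) u \<ominus>\<^bsub>free_module R (X (Suc i))\<^esub> u) \<ominus>\<^bsub>free_module R (X (Suc i))\<^esub> s i (d i u)"
proof -
  note r = free_resolutionD[OF F] and mm = free_module_module
  let ?\<psi> = "\<lambda>i u. \<phi> i u \<ominus>\<^bsub>free_module R (X i)\<^esub> u"
  interpret A: Module.module R A by (rule A)
  show thesis
  proof (rule chain_homotopy[where d = d and e = d and X = X and Y = X and \<phi> = ?\<psi>])
    show "d i \<in> mhom R (free_module R (X (Suc i))) (free_module R (X i))"
      "d i \<in> mhom R (free_module R (X (Suc i))) (free_module R (X i))" for i by (rule r(1))+
    show "d i (d (Suc i) u) = \<zero>\<^bsub>free_module R (X i)\<^esub>" if "u \<in> carrier (free_module R (X (Suc (Suc i))))" for i u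
      by (rule r(5)[OF that])
    show "?\<psi> i \<in> mhom R (free_module R (X i)) (free_module R (X i))" for i by (rule mhom_diff[OF mm mm \<phi> mhom_id])
    show "?\<psi> 0 u \<in> d 0 ` carrier (free_module R (X 1))" if u: "u \<in> carrier (free_module R (X 0))" for u
    proof (rule r(6))
      interpret F0: Module.module R "free_module R (X 0)" by (rule mm)
      have c: "\<phi> 0 u \<in> carrier (free_module R (X 0))" by (rule mhom_closed[OF \<phi> u])
      show "?\<psi> 0 u \<in> carrier (free_module R (X 0))" using c u by (intro F0.minus_closed)
      show "\<epsilon> (?\<psi> 0 u) = \<zero>\<^bsub>A\<^esub>"
        unfolding mhom_minus[OF mm A r(2) c u] \<phi>0[OF u]
        by (rule A.minus_self[OF mhom_closed[OF r(2) u]])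
    qed
    show "d i (?\<psi> (Suc i) u) = ?\<psi> i (d i u)" if u: "u \<in> carrier (free_module R (X (Suc i)))" for i u
      unfolding mhom_minus[OF mm mm r(1) mhom_closed[OF \<phi> u] u] \<phi>c[OF u] ..
    show "v \<in> d (Suc i) ` carrier (free_module R (X (Suc (Suc i))))"
      if "v \<in> carrier (free_module R (X (Suc i)))" "d i v = \<zero>\<^bsub>free_module R (X i)\<^esub>" for i v
      by (rule r(7)[OF that])
  qed (rule that)
qed

end

section \<open>Augmented algebras and tensor products\<close>

lemma additive_zero_minus:
  fixes \<theta> :: "'b \<Rightarrow> 'x \<Rightarrow> rat"
  assumes M: "abelian_group M"
    and add: "\<And>a b. a \<in> carrier M \<Longrightarrow> b \<in> carrier M \<Longrightarrow> \<theta> (a \<oplus>\<^bsub>M\<^esub> b) = (\<lambda>x. \<theta> a x + \<theta> b x)"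
  shows "\<theta> \<zero>\<^bsub>M\<^esub> = (\<lambda>_. 0)"
    and "a \<in> carrier M \<Longrightarrow> b \<in> carrier M \<Longrightarrow> \<theta> (a \<ominus>\<^bsub>M\<^esub> b) = (\<lambda>x. \<theta> a x - \<theta> b x)"
proof -
  interpret abelian_group M by fact
  have "\<theta> \<zero>\<^bsub>M\<^esub> x = \<theta> \<zero>\<^bsub>M\<^esub> x + \<theta> \<zero>\<^bsub>M\<^esub> x" for x using fun_cong[OF add[of "\<zero>\<^bsub>M\<^esub>" "\<zero>\<^bsub>M\<^esub>"], of x] by simp
  then show z: "\<theta> \<zero>\<^bsub>M\<^esub> = (\<lambda>_. 0)" by (intro ext) simp
  assume a: "a \<in> carrier M" and b: "b \<in> carrier M"
  have "(a \<ominus>\<^bsub>M\<^esub> b) \<oplus>\<^bsub>M\<^esub> b = a" using a b by (simp add: a_minus_def a_assoc l_neg)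
  then have "\<theta> a x = \<theta> (a \<ominus>\<^bsub>M\<^esub> b) x + \<theta> b x" for x
    using fun_cong[OF add[of "a \<ominus>\<^bsub>M\<^esub> b" b], of x] a b by simp
  then show "\<theta> (a \<ominus>\<^bsub>M\<^esub> b) = (\<lambda>x. \<theta> a x - \<theta> b x)" by (intro ext) simp
qed

text \<open>A value at an arbitrary representative, independent of the choice on the fibres of
  \<open>\<theta>\<close> by \<open>coset_map_fiber\<close>.\<close>

definition coset_map :: "('b \<Rightarrow> 'x \<Rightarrow> rat) \<Rightarrow> 'b set \<Rightarrow> 'x \<Rightarrow> rat"
  where "coset_map \<theta> C = \<theta> (SOME a. a \<in> C)"

text \<open>A map \<open>\<theta>\<close> on a module that identifies its quotient by the kernel of \<open>\<theta>\<close> with a space of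
  functions; \<open>\<chi>\<close> is the action of the scalars on these functions.\<close>

locale kernel_quotient =
  fixes M :: "('r, 'b, 'm) module_scheme" and S :: "'r set" and \<chi> :: "'r \<Rightarrow> rat" and \<theta> :: "'b \<Rightarrow> 'x \<Rightarrow> rat" and N :: "'b set"
  assumes M: "abelian_group M"
    and add: "\<And>a b. a \<in> carrier M \<Longrightarrow> b \<in> carrier M \<Longrightarrow> \<theta> (a \<oplus>\<^bsub>M\<^esub> b) = (\<lambda>x. \<theta> a x + \<theta> b x)"
    and smult: "\<And>r a. r \<in> S \<Longrightarrow> a \<in> carrier M \<Longrightarrow> r \<odot>\<^bsub>M\<^esub> a \<in> carrier M \<and> \<theta> (r \<odot>\<^bsub>M\<^esub> a) = (\<lambda>x. \<chi> r * \<theta> a x)"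
    and N: "N = {a \<in> carrier M. \<theta> a = (\<lambda>_. 0)}"
begin

interpretation M: abelian_group M by (rule M)

abbreviation Q where "Q \<equiv> quot_module M N"

definition fiber :: "'b \<Rightarrow> 'b set" where "fiber a = {b \<in> carrier M. \<theta> b = \<theta> a}"

lemma coset_fiber: assumes a: "a \<in> carrier M" shows "N +>\<^bsub>M\<^esub> a = fiber a"
proof (intro equalityI subsetI)
  fix b assume "b \<in> N +>\<^bsub>M\<^esub> a"
  then obtain n where "n \<in> N" "b = n \<oplus>\<^bsub>M\<^esub> a" by (auto simp: a_r_coset_def')
  then show "b \<in> fiber a" using a by (auto simp: N fiber_def add)
next
  fix b assume "b \<in> fiber a"
  then have b: "b \<in> carrier M" "\<theta> b = \<theta> a" by (auto simp: fiber_def)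
  have "b \<ominus>\<^bsub>M\<^esub> a \<in> N" using a b additive_zero_minus(2)[OF M add, of b a] by (simp add: N)
  moreover have "b = (b \<ominus>\<^bsub>M\<^esub> a) \<oplus>\<^bsub>M\<^esub> a" using a b by (simp add: a_minus_def M.a_assoc M.l_neg)
  ultimately show "b \<in> N +>\<^bsub>M\<^esub> a" by (auto simp: a_r_coset_def')
qed

lemma coset_map_fiber: assumes "a \<in> carrier M" shows "coset_map \<theta> (fiber a) = \<theta> a"
proof -
  have "a \<in> fiber a" using assms by (simp add: fiber_def)
  then have "(SOME b. b \<in> fiber a) \<in> fiber a" by (rule someI)
  then show ?thesis by (simp add: coset_map_def fiber_def)
qed

lemma carrier_Q: "carrier Q = fiber ` carrier M"
  using coset_fiber by (auto simp: quot_module_def A_RCOSETS_def')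

lemma zero_Q: "\<zero>\<^bsub>Q\<^esub> = fiber \<zero>\<^bsub>M\<^esub>"
  using additive_zero_minus(1)[OF M add] by (auto simp: quot_module_def N fiber_def)

lemma add_Q:
  assumes a: "a \<in> carrier M" and b: "b \<in> carrier M"
  shows "fiber a \<oplus>\<^bsub>Q\<^esub> fiber b = fiber (a \<oplus>\<^bsub>M\<^esub> b)"
proof -
  have "fiber a <+>\<^bsub>M\<^esub> fiber b = fiber (a \<oplus>\<^bsub>M\<^esub> b)"
  proof (intro equalityI subsetI)
    fix c assume "c \<in> fiber a <+>\<^bsub>M\<^esub> fiber b"
    then show "c \<in> fiber (a \<oplus>\<^bsub>M\<^esub> b)" using a b by (auto simp: set_add_def' fiber_def add)
  next
    fix c assume "c \<in> fiber (a \<oplus>\<^bsub>M\<^esub> b)"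
    then have c: "c \<in> carrier M" "\<theta> c = (\<lambda>x. \<theta> a x + \<theta> b x)" using a b by (auto simp: fiber_def add)
    have "c \<ominus>\<^bsub>M\<^esub> a \<in> fiber b" using a c additive_zero_minus(2)[OF M add, of c a] by (simp add: fiber_def)
    moreover have "a \<in> fiber a" using a by (simp add: fiber_def)
    moreover have "c = a \<oplus>\<^bsub>M\<^esub> (c \<ominus>\<^bsub>M\<^esub> a)" using a c by (simp add: a_minus_def M.a_comm[of c] M.r_neg M.a_assoc[symmetric])
    ultimately show "c \<in> fiber a <+>\<^bsub>M\<^esub> fiber b" by (auto simp: set_add_def')
  qed
  then show ?thesis by (simp add: quot_module_def)
qed

lemma smult_Q:
  assumes r: "r \<in> S" and a: "a \<in> carrier M"
  shows "r \<odot>\<^bsub>Q\<^esub> fiber a = fiber (r \<odot>\<^bsub>M\<^esub> a)"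
proof -
  have "N +>\<^bsub>M\<^esub> (r \<odot>\<^bsub>M\<^esub> x) = fiber (r \<odot>\<^bsub>M\<^esub> a)" if "x \<in> fiber a" for x
  proof -
    have x: "x \<in> carrier M" "\<theta> x = \<theta> a" using that by (auto simp: fiber_def)
    then show ?thesis using smult[OF r a] smult[OF r x(1)] by (simp add: coset_fiber, simp add: fiber_def)
  qed
  moreover have "a \<in> fiber a" using a by (simp add: fiber_def)
  ultimately have "(\<Union>x\<in>fiber a. N +>\<^bsub>M\<^esub> (r \<odot>\<^bsub>M\<^esub> x)) = fiber (r \<odot>\<^bsub>M\<^esub> a)" by blast
  then show ?thesis by (simp add: quot_module_def)
qed

lemma map_add: "C \<in> carrier Q \<Longrightarrow> D \<in> carrier Q \<Longrightarrow> C \<oplus>\<^bsub>Q\<^esub> D \<in> carrier Q \<and>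
    coset_map \<theta> (C \<oplus>\<^bsub>Q\<^esub> D) = (\<lambda>x. coset_map \<theta> C x + coset_map \<theta> D x)"
  unfolding carrier_Q by (auto simp: add_Q coset_map_fiber add)

lemma map_smult: "r \<in> S \<Longrightarrow> C \<in> carrier Q \<Longrightarrow> r \<odot>\<^bsub>Q\<^esub> C \<in> carrier Q \<and>
    coset_map \<theta> (r \<odot>\<^bsub>Q\<^esub> C) = (\<lambda>x. \<chi> r * coset_map \<theta> C x)"
  unfolding carrier_Q using smult by (auto simp: smult_Q coset_map_fiber)

lemma map_zero: "\<zero>\<^bsub>Q\<^esub> \<in> carrier Q" "coset_map \<theta> \<zero>\<^bsub>Q\<^esub> = (\<lambda>_. 0)"
  using additive_zero_minus(1)[OF M add] by (auto simp: zero_Q carrier_Q coset_map_fiber)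

lemma map_inj: "inj_on (coset_map \<theta>) (carrier Q)"
  unfolding carrier_Q by (auto simp: inj_on_def coset_map_fiber) (auto simp: fiber_def)

lemma map_image: "coset_map \<theta> ` carrier Q = \<theta> ` carrier M"
  unfolding carrier_Q by (auto simp: coset_map_fiber image_image)

end

text \<open>The group laws may be checked after the injective \<open>\<theta>\<close>, where they
  hold pointwise in the rationals.\<close>

lemma abelian_group_transfer:
  fixes \<theta> :: "'b \<Rightarrow> 'x \<Rightarrow> rat"
  assumes add: "\<And>a b. a \<in> carrier M \<Longrightarrow> b \<in> carrier M \<Longrightarrow> a \<oplus>\<^bsub>M\<^esub> b \<in> carrier M \<and> \<theta> (a \<oplus>\<^bsub>M\<^esub> b) = (\<lambda>x. \<theta> a x + \<theta> b x)"
    and zero: "\<zero>\<^bsub>M\<^esub> \<in> carrier M" "\<theta> \<zero>\<^bsub>M\<^esub> = (\<lambda>_. 0)"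
    and neg: "\<And>a. a \<in> carrier M \<Longrightarrow> \<exists>b\<in>carrier M. \<theta> b = (\<lambda>x. - \<theta> a x)"
    and inj: "inj_on \<theta> (carrier M)"
  shows "abelian_group M"
proof (rule abelian_groupI)
  fix a b assume a: "a \<in> carrier M" and b: "b \<in> carrier M"
  show "a \<oplus>\<^bsub>M\<^esub> b \<in> carrier M" using add a b by blast
  show "a \<oplus>\<^bsub>M\<^esub> b = b \<oplus>\<^bsub>M\<^esub> a" using add[OF a b] add[OF b a] by (intro inj_onD[OF inj]) (auto simp: add.commute)
  show "\<zero>\<^bsub>M\<^esub> \<oplus>\<^bsub>M\<^esub> a = a" using add[OF zero(1) a] a zero by (intro inj_onD[OF inj]) auto
  obtain c where c: "c \<in> carrier M" "\<theta> c = (\<lambda>x. - \<theta> a x)" using neg[OF a] by blast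
  have "c \<oplus>\<^bsub>M\<^esub> a = \<zero>\<^bsub>M\<^esub>" using add[OF c(1) a] c zero by (intro inj_onD[OF inj]) auto
  then show "\<exists>y\<in>carrier M. y \<oplus>\<^bsub>M\<^esub> a = \<zero>\<^bsub>M\<^esub>" using c by blast
  fix c assume c: "c \<in> carrier M"
  show "a \<oplus>\<^bsub>M\<^esub> b \<oplus>\<^bsub>M\<^esub> c = a \<oplus>\<^bsub>M\<^esub> (b \<oplus>\<^bsub>M\<^esub> c)"
    using add[OF a b] add[OF b c] add[of "a \<oplus>\<^bsub>M\<^esub> b" c] add[of a "b \<oplus>\<^bsub>M\<^esub> c"] a c
    by (intro inj_onD[OF inj]) (auto simp: add.assoc)
qed (rule zero)

section \<open>Augmented algebras and reduction modulo the maximal ideal\<close>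

definition finfun :: "'x set \<Rightarrow> ('x \<Rightarrow> rat) set"
  where "finfun X = {v. (\<forall>x. x \<notin> X \<longrightarrow> v x = 0) \<and> finite {x. v x \<noteq> 0}}"

text \<open>Isolates what the computation of Tor uses of the Chow ring: an augmentation
  \<open>\<chi>\<close> to the rationals and scalars \<open>\<phi>\<close> that split it.\<close>

locale augmented = cring R for R (structure) +
  fixes \<chi> :: "'a \<Rightarrow> rat" and \<phi> :: "rat \<Rightarrow> 'a"
  assumes chi_add: "r \<in> carrier R \<Longrightarrow> s \<in> carrier R \<Longrightarrow> \<chi> (r \<oplus> s) = \<chi> r + \<chi> s"
    and chi_mult: "r \<in> carrier R \<Longrightarrow> s \<in> carrier R \<Longrightarrow> \<chi> (r \<otimes> s) = \<chi> r * \<chi> s"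
    and chi_one: "\<chi> \<one> = 1"
    and phi_closed: "\<phi> c \<in> carrier R" and chi_phi: "\<chi> (\<phi> c) = c"
    and phi_add: "\<phi> (a + b) = \<phi> a \<oplus> \<phi> b" and phi_one: "\<phi> 1 = \<one>"
begin

definition \<mm> :: "'a set" where "\<mm> = {r \<in> carrier R. \<chi> r = 0}"

abbreviation "FM \<equiv> free_module R"

lemma chi_zero: "\<chi> \<zero> = 0"
  using chi_add[of \<zero> \<zero>] by simp

lemma chi_neg: "r \<in> carrier R \<Longrightarrow> \<chi> (\<ominus> r) = - \<chi> r"
  using chi_add[of "\<ominus> r" r] chi_zero by (simp add: l_neg)

lemma chi_minus: "r \<in> carrier R \<Longrightarrow> s \<in> carrier R \<Longrightarrow> \<chi> (r \<ominus> s) = \<chi> r - \<chi> s"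
  by (simp add: a_minus_def chi_add chi_neg)

lemma phi_zero: "\<phi> 0 = \<zero>"
proof -
  have "\<phi> 0 \<oplus> \<phi> 0 = \<phi> 0" using phi_add[of 0 0] by simp
  then show ?thesis using phi_closed[of 0] by (simp add: add.l_cancel_one)
qed

lemma ideal_m: "ideal \<mm> R"
proof (rule idealI)
  show "ring R" by (rule ring_axioms)
  show "subgroup \<mm> (add_monoid R)"
    by (rule add.subgroupI) (auto simp: \<mm>_def chi_add chi_zero chi_neg simp flip: a_inv_def)
qed (auto simp: \<mm>_def chi_mult)

abbreviation red :: "('x \<Rightarrow> 'a) \<Rightarrow> 'x \<Rightarrow> rat" where "red u \<equiv> (\<lambda>x. \<chi> (u x))"
abbreviation lift :: "('x \<Rightarrow> rat) \<Rightarrow> 'x \<Rightarrow> 'a" where "lift v \<equiv> (\<lambda>x. \<phi> (v x))"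

lemma lift_carrier: "v \<in> finfun X \<Longrightarrow> lift v \<in> carrier (FM X)"
proof -
  assume v: "v \<in> finfun X"
  have "{x. \<phi> (v x) \<noteq> \<zero>} \<subseteq> {x. v x \<noteq> 0}" using phi_zero by auto
  then have "finite {x. \<phi> (v x) \<noteq> \<zero>}" by (rule finite_subset) (use v in \<open>simp add: finfun_def\<close>)
  then show ?thesis using v phi_zero by (auto simp: free_carrier_iff phi_closed finfun_def)
qed

lemma red_finfun: "u \<in> carrier (FM X) \<Longrightarrow> red u \<in> finfun X"
proof -
  assume u: "u \<in> carrier (FM X)"
  have "{x. \<chi> (u x) \<noteq> 0} \<subseteq> {x. u x \<noteq> \<zero>}" using chi_zero by auto
  then have "finite {x. \<chi> (u x) \<noteq> 0}" by (rule finite_subset) (use u in \<open>simp add: free_carrier_iff\<close>)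
  then show ?thesis using u chi_zero by (auto simp: free_carrier_iff finfun_def)
qed

lemma red_lift: "red (lift v) = v"
  by (simp add: chi_phi)

text \<open>A vector with entries in the maximal ideal is a combination of basis vectors with such
  coefficients, and a linear map preserves the coefficients. Hence linear maps of free modules
  descend to the reductions.\<close>

lemma red_hom_zero:
  assumes h: "h \<in> mhom R (FM X) (FM Y)" and u: "u \<in> carrier (FM X)" and z: "red u = (\<lambda>_. 0)"
  shows "red (h u) = (\<lambda>_. 0)"
  using u
proof (induction u rule: free_induct[where I = \<mm>])
  case (coeff x)
  then show ?case using free_carrierD[OF u] fun_cong[OF z, of x] by (simp add: \<mm>_def)
next
  case zero
  then show ?case using mhom_zero[OF free_module_module free_module_module h] by (simp add: chi_zero)
next
  case (step v x r)
  interpret F: Module.module R "FM X" by (rule free_module_module)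
  have b: "free_basis R x \<in> carrier (FM X)" by (rule free_basis_carrier[OF step(2)])
  have c: "r \<odot>\<^bsub>FM X\<^esub> free_basis R x \<in> carrier (FM X)" by (rule F.smult_closed[OF step(3) b])
  have "h (v \<oplus>\<^bsub>FM X\<^esub> r \<odot>\<^bsub>FM X\<^esub> free_basis R x) = (\<lambda>y. h v y \<oplus> r \<otimes> h (free_basis R x) y)"
    unfolding mhom_add[OF h step(1) c] mhom_smult[OF h step(3) b] by simp
  moreover have "h v y \<in> carrier R" "h (free_basis R x) y \<in> carrier R" for y
    using mhom_closed[OF h step(1)] mhom_closed[OF h b] by (auto intro: free_carrierD)
  moreover have "\<chi> (h v y) = 0" for y using step(6) by metis
  ultimately show ?case using step(3,4) by (simp add: chi_add chi_mult \<mm>_def)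
qed

lemma red_hom:
  assumes h: "h \<in> mhom R (FM X) (FM Y)" and u: "u \<in> carrier (FM X)" and v: "v \<in> carrier (FM X)" and eq: "red u = red v"
  shows "red (h u) = red (h v)"
proof -
  interpret F: Module.module R "FM X" by (rule free_module_module)
  note uc = free_carrierD[OF u] and vc = free_carrierD[OF v]
  have c: "u \<ominus>\<^bsub>FM X\<^esub> v \<in> carrier (FM X)" using u v by (rule F.minus_closed)
  have "red (u \<ominus>\<^bsub>FM X\<^esub> v) = (\<lambda>_. 0)"
    unfolding free_minus[OF u v] using fun_cong[OF eq] uc vc by (simp add: chi_minus)
  from red_hom_zero[OF h c this]
  have "red (h u \<ominus>\<^bsub>FM Y\<^esub> h v) = (\<lambda>_. 0)" unfolding mhom_minus[OF free_module_module free_module_module h u v] .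
  then have "\<chi> (h u y) - \<chi> (h v y) = 0" for y
    unfolding free_minus[OF mhom_closed[OF h u] mhom_closed[OF h v]]
    using free_carrierD[OF mhom_closed[OF h u]] free_carrierD[OF mhom_closed[OF h v]]
    by (metis chi_minus)
  then show ?thesis by (intro ext) simp
qed

abbreviation "B \<equiv> quot_ring_module R \<mm>"

definition bar :: "'a set \<Rightarrow> rat" where "bar c = \<chi> (SOME r. r \<in> c)"

lemma coset_m: "r \<in> carrier R \<Longrightarrow> \<mm> +> r = {s \<in> carrier R. \<chi> s = \<chi> r}"
proof (intro equalityI subsetI)
  fix s assume r: "r \<in> carrier R"
  { assume "s \<in> \<mm> +> r"
    then show "s \<in> {s \<in> carrier R. \<chi> s = \<chi> r}" using r by (auto simp: a_r_coset_def' \<mm>_def chi_add) }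
  assume s: "s \<in> {s \<in> carrier R. \<chi> s = \<chi> r}"
  then have "s \<ominus> r \<in> \<mm>" using r by (auto simp: \<mm>_def chi_minus)
  moreover have "s = (s \<ominus> r) \<oplus> r" using r s by (simp add: a_minus_def a_assoc l_neg)
  ultimately show "s \<in> \<mm> +> r" by (auto simp: a_r_coset_def')
qed

lemma bar_coset: "r \<in> carrier R \<Longrightarrow> bar (\<mm> +> r) = \<chi> r"
proof -
  assume r: "r \<in> carrier R"
  then have "r \<in> \<mm> +> r" by (simp add: coset_m)
  then have "(SOME s. s \<in> \<mm> +> r) \<in> \<mm> +> r" by (rule someI)
  then show ?thesis using r by (simp add: bar_def coset_m)
qed

lemma carrier_B: "carrier B = (\<lambda>r. \<mm> +> r) ` carrier R"
  by (auto simp: quot_ring_module_def FactRing_def A_RCOSETS_def')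

lemma add_B: "r \<in> carrier R \<Longrightarrow> s \<in> carrier R \<Longrightarrow> (\<mm> +> r) \<oplus>\<^bsub>B\<^esub> (\<mm> +> s) = \<mm> +> (r \<oplus> s)"
  using abelian_subgroup.a_rcos_sum[OF abelian_subgroupI3, of \<mm> R r s] ideal_m
  by (simp add: quot_ring_module_def FactRing_def ideal.axioms(1) additive_subgroup_def ideal_def is_abelian_group)

lemma smult_B: "r \<in> carrier R \<Longrightarrow> s \<in> carrier R \<Longrightarrow> r \<odot>\<^bsub>B\<^esub> (\<mm> +> s) = \<mm> +> (r \<otimes> s)"
  using ideal.rcoset_mult_add[OF ideal_m, of r s] by (simp add: quot_ring_module_def FactRing_def)

lemma module_B: "Module.module R B"
proof (rule moduleI)
  have z: "\<zero>\<^bsub>B\<^esub> = \<mm> +> \<zero>"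
    by (auto simp: quot_ring_module_def FactRing_def coset_m \<mm>_def chi_zero)
  show "cring R" by (rule is_cring)
  show "abelian_group B"
  proof (rule abelian_groupI)
    show "\<zero>\<^bsub>B\<^esub> \<in> carrier B" by (auto simp: z carrier_B)
    fix a assume "a \<in> carrier B"
    then obtain r where r: "r \<in> carrier R" "a = \<mm> +> r" by (auto simp: carrier_B)
    show "\<zero>\<^bsub>B\<^esub> \<oplus>\<^bsub>B\<^esub> a = a" using r by (simp add: z add_B)
    show "\<exists>y\<in>carrier B. y \<oplus>\<^bsub>B\<^esub> a = \<zero>\<^bsub>B\<^esub>"
      using r by (intro bexI[of _ "\<mm> +> (\<ominus> r)"]) (auto simp: z add_B carrier_B l_neg)
  qed (auto simp: carrier_B add_B a_ac)
qed (auto simp: carrier_B add_B smult_B l_distr r_distr m_assoc)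

end

section \<open>The tensor product of a free module with the residue field\<close>

context augmented
begin

abbreviation TF :: "'x set \<Rightarrow> ('a, ('x \<Rightarrow> 'a) \<times> 'a set \<Rightarrow> 'a) module"
  where "TF X \<equiv> free_module R (carrier (FM X) \<times> carrier B)"

text \<open>The isomorphism from the tensor product to the finitely supported rational functions on
  the basis, written on representatives: \<open>a\<close> tensor \<open>b\<close> goes to the
  reduction of \<open>a\<close> times the residue \<open>b\<close>.\<close>

definition tval :: "(('x \<Rightarrow> 'a) \<times> 'a set \<Rightarrow> 'a) \<Rightarrow> 'x \<Rightarrow> rat"
  where "tval U = (\<lambda>x. \<Sum>p\<in>{p. U p \<noteq> \<zero>}. \<chi> (U p) * (\<chi> (fst p x) * bar (snd p)))"

lemma tval_superset:
  "finite A \<Longrightarrow> {p. U p \<noteq> \<zero>} \<subseteq> A \<Longrightarrow> tval U x = (\<Sum>p\<in>A. \<chi> (U p) * (\<chi> (fst p x) * bar (snd p)))"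
  unfolding tval_def by (rule sum.mono_neutral_left) (auto simp: chi_zero)

lemma tval_add:
  assumes U: "U \<in> carrier (TF X)" and V: "V \<in> carrier (TF X)"
  shows "tval (U \<oplus>\<^bsub>TF X\<^esub> V) = (\<lambda>x. tval U x + tval V x)"
proof
  fix x
  let ?A = "{p. U p \<noteq> \<zero>} \<union> {p. V p \<noteq> \<zero>}"
  have A: "finite ?A" using U V by (auto simp: free_carrier_iff)
  note c = free_carrierD[OF U] free_carrierD[OF V]
  have "tval (U \<oplus>\<^bsub>TF X\<^esub> V) x = (\<Sum>p\<in>?A. \<chi> ((U \<oplus>\<^bsub>TF X\<^esub> V) p) * (\<chi> (fst p x) * bar (snd p)))"
    using A by (rule tval_superset) (use c in auto)
  also have "\<dots> = (\<Sum>p\<in>?A. \<chi> (U p) * (\<chi> (fst p x) * bar (snd p)) + \<chi> (V p) * (\<chi> (fst p x) * bar (snd p)))"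
    using c by (intro sum.cong) (auto simp: chi_add algebra_simps)
  also have "\<dots> = tval U x + tval V x"
    using tval_superset[OF A, of U x] tval_superset[OF A, of V x] by (simp add: sum.distrib)
  finally show "tval (U \<oplus>\<^bsub>TF X\<^esub> V) x = tval U x + tval V x" .
qed

lemma tval_smult:
  assumes r: "r \<in> carrier R" and U: "U \<in> carrier (TF X)"
  shows "tval (r \<odot>\<^bsub>TF X\<^esub> U) = (\<lambda>x. \<chi> r * tval U x)"
proof
  fix x
  let ?A = "{p. U p \<noteq> \<zero>}"
  have A: "finite ?A" using U by (auto simp: free_carrier_iff)
  note c = free_carrierD[OF U]
  have "tval (r \<odot>\<^bsub>TF X\<^esub> U) x = (\<Sum>p\<in>?A. \<chi> ((r \<odot>\<^bsub>TF X\<^esub> U) p) * (\<chi> (fst p x) * bar (snd p)))"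
    using A by (rule tval_superset) (use r in auto)
  also have "\<dots> = (\<Sum>p\<in>?A. \<chi> r * (\<chi> (U p) * (\<chi> (fst p x) * bar (snd p))))"
    using c r by (intro sum.cong) (auto simp: chi_mult algebra_simps)
  also have "\<dots> = \<chi> r * tval U x" unfolding tval_def by (simp add: sum_distrib_left)
  finally show "tval (r \<odot>\<^bsub>TF X\<^esub> U) x = \<chi> r * tval U x" .
qed

lemma tval_basis: "tval (free_basis R (a, b)) = (\<lambda>x. \<chi> (a x) * bar b)"
proof
  fix x
  have "tval (free_basis R (a, b)) x = (\<Sum>p\<in>{(a, b)}. \<chi> (free_basis R (a, b) p) * (\<chi> (fst p x) * bar (snd p)))"
    by (rule tval_superset) (auto simp: free_basis_def)
  then show "tval (free_basis R (a, b)) x = \<chi> (a x) * bar b" by (simp add: free_basis_def chi_one)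
qed

lemma tval_finfun:
  assumes U: "U \<in> carrier (TF X)" shows "tval U \<in> finfun X"
proof -
  let ?A = "{p. U p \<noteq> \<zero>}"
  have A: "finite ?A" "?A \<subseteq> carrier (FM X) \<times> carrier B" using U unfolding free_carrier_iff by blast+
  have fA: "fst p \<in> carrier (FM X)" if "p \<in> ?A" for p using A(2) that by auto
  have "{x. tval U x \<noteq> 0} \<subseteq> (\<Union>p\<in>?A. {x. fst p x \<noteq> \<zero>})"
  proof
    fix x assume "x \<in> {x. tval U x \<noteq> 0}"
    then have "tval U x \<noteq> 0" by simp
    then obtain p where "p \<in> ?A" "\<chi> (U p) * (\<chi> (fst p x) * bar (snd p)) \<noteq> 0"
      unfolding tval_def by (rule sum.not_neutral_contains_not_neutral)
    then show "x \<in> (\<Union>p\<in>?A. {x. fst p x \<noteq> \<zero>})" using chi_zero by (intro UN_I[of p]) auto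
  qed
  moreover have "finite (\<Union>p\<in>?A. {x. fst p x \<noteq> \<zero>})" using A(1) fA by (auto simp: free_carrier_iff)
  ultimately have "finite {x. tval U x \<noteq> 0}" by (rule finite_subset)
  moreover have "tval U x = 0" if "x \<notin> X" for x
    unfolding tval_def using fA that by (intro sum.neutral) (auto simp: free_carrier_iff chi_zero)
  ultimately show ?thesis by (simp add: finfun_def)
qed

lemma tval_zero: "tval \<zero>\<^bsub>TF X\<^esub> = (\<lambda>_. 0)"
  by (simp add: tval_def)

lemma tval_minus:
  assumes U: "U \<in> carrier (TF X)" and V: "V \<in> carrier (TF X)"
  shows "tval (U \<ominus>\<^bsub>TF X\<^esub> V) = (\<lambda>x. tval U x - tval V x)"
  using additive_zero_minus(2)[of "TF X" tval U V] tval_add free_abelian_group U V by blast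

abbreviation E1 :: "('x \<Rightarrow> 'a) \<Rightarrow> 'a set \<Rightarrow> ('x \<Rightarrow> 'a) \<times> 'a set \<Rightarrow> 'a" where "E1 a b \<equiv> free_basis R (a, b)"

lemma E1_carrier: "a \<in> carrier (FM X) \<Longrightarrow> b \<in> carrier B \<Longrightarrow> E1 a b \<in> carrier (TF X)"
  by (rule free_basis_carrier) simp

lemma tensor_relations_carrier: "tensor_relations R (FM X) B \<subseteq> carrier (TF X)"
proof -
  interpret TF: Module.module R "TF X" by (rule free_module_module)
  interpret F: Module.module R "FM X" by (rule free_module_module)
  interpret B: Module.module R B by (rule module_B)
  show ?thesis unfolding tensor_relations_def Let_def
    by (intro Un_least subsetI; elim CollectE exE conjE)
      (simp only:, intro TF.minus_closed TF.add.m_closed TF.smult_closed E1_carrier F.add.m_closed F.smult_closed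
        B.add.m_closed B.smult_closed; assumption)+
qed

abbreviation TK where "TK X \<equiv> tensor_kernel R (FM X) B"

lemma TK_submodule: "LinearCombinations.submodule R (TK X) (TF X)"
  unfolding tensor_kernel_def
  by (rule LinearCombinations.module.span_is_submodule[OF free_module_module tensor_relations_carrier])

lemma TK_rel: "u \<in> tensor_relations R (FM X) B \<Longrightarrow> u \<in> TK X"
  unfolding tensor_kernel_def
  using LinearCombinations.module.in_own_span[OF free_module_module tensor_relations_carrier] by blast

lemma bar_add: "b \<in> carrier B \<Longrightarrow> c \<in> carrier B \<Longrightarrow> bar (b \<oplus>\<^bsub>B\<^esub> c) = bar b + bar c"
  by (auto simp: carrier_B add_B bar_coset chi_add)

lemma bar_smult: "r \<in> carrier R \<Longrightarrow> c \<in> carrier B \<Longrightarrow> bar (r \<odot>\<^bsub>B\<^esub> c) = \<chi> r * bar c"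
  by (auto simp: carrier_B smult_B bar_coset chi_mult)

lemma TK_subset: "U \<in> TK X \<Longrightarrow> U \<in> carrier (TF X) \<and> tval U = (\<lambda>_. 0)"
proof -
  interpret TF: Module.module R "TF X" by (rule free_module_module)
  interpret F: Module.module R "FM X" by (rule free_module_module)
  interpret B: Module.module R B by (rule module_B)
  let ?N = "{U \<in> carrier (TF X). tval U = (\<lambda>_. 0)}"
  have sub: "LinearCombinations.submodule R ?N (TF X)"
  proof (rule LinearCombinations.submodule.intro)
    show "Module.module R (TF X)" by (rule free_module_module)
    show "\<zero>\<^bsub>TF X\<^esub> \<in> ?N" using TF.zero_closed tval_zero by blast
  next
    fix u v assume "u \<in> ?N" "v \<in> ?N"
    then show "u \<oplus>\<^bsub>TF X\<^esub> v \<in> ?N" using TF.add.m_closed[of u v] tval_add[of u X v] by simp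
  next
    fix r u assume "r \<in> carrier R" "u \<in> ?N"
    then show "r \<odot>\<^bsub>TF X\<^esub> u \<in> ?N" using TF.smult_closed[of r u] tval_smult[of r u X] by simp
  qed auto
  have ac: "\<chi> (a x \<oplus> a' x) = \<chi> (a x) + \<chi> (a' x)" if "a \<in> carrier (FM X)" "a' \<in> carrier (FM X)" for a a' x
    using that by (intro chi_add free_carrierD)
  have mc: "\<chi> (r \<otimes> a x) = \<chi> r * \<chi> (a x)" if "r \<in> carrier R" "a \<in> carrier (FM X)" for r a x
    using that(1) free_carrierD[OF that(2)] by (rule chi_mult)
  have "tensor_relations R (FM X) B \<subseteq> ?N"
  proof
    fix u assume u: "u \<in> tensor_relations R (FM X) B"
    then have uc: "u \<in> carrier (TF X)" using tensor_relations_carrier by blast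
    from u consider a a' b where "u = E1 (a \<oplus>\<^bsub>FM X\<^esub> a') b \<ominus>\<^bsub>TF X\<^esub> (E1 a b \<oplus>\<^bsub>TF X\<^esub> E1 a' b)"
        "a \<in> carrier (FM X)" "a' \<in> carrier (FM X)" "b \<in> carrier B"
      | a b b' where "u = E1 a (b \<oplus>\<^bsub>B\<^esub> b') \<ominus>\<^bsub>TF X\<^esub> (E1 a b \<oplus>\<^bsub>TF X\<^esub> E1 a b')"
        "a \<in> carrier (FM X)" "b \<in> carrier B" "b' \<in> carrier B"
      | r a b where "u = E1 (r \<odot>\<^bsub>FM X\<^esub> a) b \<ominus>\<^bsub>TF X\<^esub> r \<odot>\<^bsub>TF X\<^esub> E1 a b"
        "r \<in> carrier R" "a \<in> carrier (FM X)" "b \<in> carrier B"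
      | r a b where "u = E1 a (r \<odot>\<^bsub>B\<^esub> b) \<ominus>\<^bsub>TF X\<^esub> r \<odot>\<^bsub>TF X\<^esub> E1 a b"
        "r \<in> carrier R" "a \<in> carrier (FM X)" "b \<in> carrier B"
      unfolding tensor_relations_def Let_def by blast
    then have "tval u = (\<lambda>_. 0)"
    proof cases
      case 1
      note c = E1_carrier[OF F.add.m_closed[OF 1(2,3)] 1(4)] E1_carrier[OF 1(2,4)] E1_carrier[OF 1(3,4)]
      show ?thesis unfolding 1(1) tval_minus[OF c(1) TF.add.m_closed[OF c(2,3)]] tval_add[OF c(2,3)] tval_basis
        using ac[OF 1(2,3)] by (simp add: algebra_simps)
    next
      case 2
      note c = E1_carrier[OF 2(2) B.add.m_closed[OF 2(3,4)]] E1_carrier[OF 2(2,3)] E1_carrier[OF 2(2,4)]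
      show ?thesis unfolding 2(1) tval_minus[OF c(1) TF.add.m_closed[OF c(2,3)]] tval_add[OF c(2,3)] tval_basis bar_add[OF 2(3,4)]
        by (simp add: algebra_simps)
    next
      case 3
      note c = E1_carrier[OF F.smult_closed[OF 3(2,3)] 3(4)] E1_carrier[OF 3(3,4)]
      show ?thesis unfolding 3(1) tval_minus[OF c(1) TF.smult_closed[OF 3(2) c(2)]] tval_smult[OF 3(2) c(2)] tval_basis
        using mc[OF 3(2,3)] by (simp add: algebra_simps)
    next
      case 4
      note c = E1_carrier[OF 4(3) B.smult_closed[OF 4(2,4)]] E1_carrier[OF 4(3,4)]
      show ?thesis unfolding 4(1) tval_minus[OF c(1) TF.smult_closed[OF 4(2) c(2)]] tval_smult[OF 4(2) c(2)] tval_basis bar_smult[OF 4(2,4)]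
        by (simp add: algebra_simps)
    qed
    then show "u \<in> ?N" using uc by simp
  qed
  from LinearCombinations.module.span_is_subset[OF free_module_module this sub]
  show "U \<in> TK X \<Longrightarrow> U \<in> carrier (TF X) \<and> tval U = (\<lambda>_. 0)" unfolding tensor_kernel_def by blast
qed

text \<open>Equality in the tensor product, for calculations with representatives.\<close>

definition teq :: "'x set \<Rightarrow> (('x \<Rightarrow> 'a) \<times> 'a set \<Rightarrow> 'a) \<Rightarrow> (('x \<Rightarrow> 'a) \<times> 'a set \<Rightarrow> 'a) \<Rightarrow> bool"
  where "teq X U V \<longleftrightarrow> U \<in> carrier (TF X) \<and> V \<in> carrier (TF X) \<and> U \<ominus>\<^bsub>TF X\<^esub> V \<in> TK X"

lemma teq_rules:
  shows teq_refl: "U \<in> carrier (TF X) \<Longrightarrow> teq X U U"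
    and teq_sym: "teq X U V \<Longrightarrow> teq X V U"
    and teq_trans: "teq X U V \<Longrightarrow> teq X V W \<Longrightarrow> teq X U W"
    and teq_add: "teq X U V \<Longrightarrow> teq X U' V' \<Longrightarrow> teq X (U \<oplus>\<^bsub>TF X\<^esub> U') (V \<oplus>\<^bsub>TF X\<^esub> V')"
    and teq_smult: "r \<in> carrier R \<Longrightarrow> teq X U V \<Longrightarrow> teq X (r \<odot>\<^bsub>TF X\<^esub> U) (r \<odot>\<^bsub>TF X\<^esub> V)"
proof -
  interpret TF: Module.module R "TF X" by (rule free_module_module)
  interpret K: LinearCombinations.submodule R "TK X" "TF X" by (rule TK_submodule)
  show "U \<in> carrier (TF X) \<Longrightarrow> teq X U U" unfolding teq_def using TF.minus_self[of U] K.zero_closed by simp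
  show "teq X U V \<Longrightarrow> teq X V U"
  proof -
    assume h: "teq X U V"
    then have c: "U \<in> carrier (TF X)" "V \<in> carrier (TF X)" and k: "U \<ominus>\<^bsub>TF X\<^esub> V \<in> TK X" by (auto simp: teq_def)
    have "(\<ominus> \<one>) \<odot>\<^bsub>TF X\<^esub> (U \<ominus>\<^bsub>TF X\<^esub> V) \<in> TK X" using k by (intro K.smult_closed) auto
    moreover have "(\<ominus> \<one>) \<odot>\<^bsub>TF X\<^esub> (U \<ominus>\<^bsub>TF X\<^esub> V) = V \<ominus>\<^bsub>TF X\<^esub> U"
      unfolding TF.smult_l_minus[OF one_closed TF.minus_closed[OF c]] TF.smult_one[OF TF.minus_closed[OF c]]
      unfolding a_minus_def using c by (simp only: TF.minus_add TF.add.inv_closed TF.minus_minus TF.a_comm)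
    ultimately show ?thesis using c by (simp only: teq_def)
  qed
  show "teq X U V \<Longrightarrow> teq X V W \<Longrightarrow> teq X U W"
  proof -
    assume h: "teq X U V" "teq X V W"
    then have c: "U \<in> carrier (TF X)" "V \<in> carrier (TF X)" "W \<in> carrier (TF X)"
      and k: "U \<ominus>\<^bsub>TF X\<^esub> V \<in> TK X" "V \<ominus>\<^bsub>TF X\<^esub> W \<in> TK X" by (auto simp: teq_def)
    have "(U \<ominus>\<^bsub>TF X\<^esub> V) \<oplus>\<^bsub>TF X\<^esub> (V \<ominus>\<^bsub>TF X\<^esub> W) = U \<ominus>\<^bsub>TF X\<^esub> W"
      unfolding free_minus[OF c(1,2)] free_minus[OF c(2,3)] free_minus[OF c(1,3)]
      using free_carrierD[OF c(1)] free_carrierD[OF c(2)] free_carrierD[OF c(3)]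
      by (auto simp: a_minus_def a_assoc r_neg1)
    then show ?thesis using K.m_closed[OF k] c by (simp only: teq_def)
  qed
  show "teq X U V \<Longrightarrow> teq X U' V' \<Longrightarrow> teq X (U \<oplus>\<^bsub>TF X\<^esub> U') (V \<oplus>\<^bsub>TF X\<^esub> V')"
  proof -
    assume h: "teq X U V" "teq X U' V'"
    then have c: "U \<in> carrier (TF X)" "V \<in> carrier (TF X)" "U' \<in> carrier (TF X)" "V' \<in> carrier (TF X)"
      and k: "U \<ominus>\<^bsub>TF X\<^esub> V \<in> TK X" "U' \<ominus>\<^bsub>TF X\<^esub> V' \<in> TK X" by (auto simp: teq_def)
    note s = TF.add.m_closed[OF c(1,3)] TF.add.m_closed[OF c(2,4)]
    have "(U \<oplus>\<^bsub>TF X\<^esub> U') \<ominus>\<^bsub>TF X\<^esub> (V \<oplus>\<^bsub>TF X\<^esub> V') = (U \<ominus>\<^bsub>TF X\<^esub> V) \<oplus>\<^bsub>TF X\<^esub> (U' \<ominus>\<^bsub>TF X\<^esub> V')"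
      unfolding free_minus[OF c(1,2)] free_minus[OF c(3,4)] free_minus[OF s]
      using free_carrierD[OF c(1)] free_carrierD[OF c(2)] free_carrierD[OF c(3)] free_carrierD[OF c(4)]
      by (auto simp: a_minus_def a_ac minus_add)
    then show ?thesis using K.m_closed[OF k] s by (simp only: teq_def)
  qed
  show "r \<in> carrier R \<Longrightarrow> teq X U V \<Longrightarrow> teq X (r \<odot>\<^bsub>TF X\<^esub> U) (r \<odot>\<^bsub>TF X\<^esub> V)"
  proof -
    assume r: "r \<in> carrier R" and h: "teq X U V"
    then have c: "U \<in> carrier (TF X)" "V \<in> carrier (TF X)" and k: "U \<ominus>\<^bsub>TF X\<^esub> V \<in> TK X" by (auto simp: teq_def)
    note s = TF.smult_closed[OF r c(1)] TF.smult_closed[OF r c(2)]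
    have "r \<odot>\<^bsub>TF X\<^esub> U \<ominus>\<^bsub>TF X\<^esub> r \<odot>\<^bsub>TF X\<^esub> V = r \<odot>\<^bsub>TF X\<^esub> (U \<ominus>\<^bsub>TF X\<^esub> V)"
      unfolding free_minus[OF c] free_minus[OF s] using free_carrierD[OF c(1)] free_carrierD[OF c(2)] r
      by (auto simp: a_minus_def r_distr r_minus)
    then show ?thesis using K.smult_closed[OF r k] s by (simp only: teq_def)
  qed
qed

lemma teq_E1_add:
  assumes "a \<in> carrier (FM X)" "a' \<in> carrier (FM X)" "b \<in> carrier B"
  shows "teq X (E1 (a \<oplus>\<^bsub>FM X\<^esub> a') b) (E1 a b \<oplus>\<^bsub>TF X\<^esub> E1 a' b)"
proof -
  interpret TF: Module.module R "TF X" by (rule free_module_module)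
  interpret F: Module.module R "FM X" by (rule free_module_module)
  have "E1 (a \<oplus>\<^bsub>FM X\<^esub> a') b \<ominus>\<^bsub>TF X\<^esub> (E1 a b \<oplus>\<^bsub>TF X\<^esub> E1 a' b) \<in> TK X"
    by (rule TK_rel) (unfold tensor_relations_def Let_def, use assms in blast)
  then show ?thesis unfolding teq_def
    using assms by (intro conjI TF.add.m_closed E1_carrier F.add.m_closed)
qed

lemma teq_E1_smult:
  assumes "r \<in> carrier R" "a \<in> carrier (FM X)" "b \<in> carrier B"
  shows "teq X (E1 (r \<odot>\<^bsub>FM X\<^esub> a) b) (r \<odot>\<^bsub>TF X\<^esub> E1 a b)" "teq X (E1 a (r \<odot>\<^bsub>B\<^esub> b)) (r \<odot>\<^bsub>TF X\<^esub> E1 a b)"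
proof -
  interpret TF: Module.module R "TF X" by (rule free_module_module)
  interpret F: Module.module R "FM X" by (rule free_module_module)
  interpret B: Module.module R B by (rule module_B)
  have "E1 (r \<odot>\<^bsub>FM X\<^esub> a) b \<ominus>\<^bsub>TF X\<^esub> r \<odot>\<^bsub>TF X\<^esub> E1 a b \<in> TK X"
    by (rule TK_rel) (unfold tensor_relations_def Let_def, use assms in blast)
  then show "teq X (E1 (r \<odot>\<^bsub>FM X\<^esub> a) b) (r \<odot>\<^bsub>TF X\<^esub> E1 a b)" unfolding teq_def
    using assms by (intro conjI TF.smult_closed E1_carrier F.smult_closed)
  have "E1 a (r \<odot>\<^bsub>B\<^esub> b) \<ominus>\<^bsub>TF X\<^esub> r \<odot>\<^bsub>TF X\<^esub> E1 a b \<in> TK X"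
    by (rule TK_rel) (unfold tensor_relations_def Let_def, use assms in blast)
  then show "teq X (E1 a (r \<odot>\<^bsub>B\<^esub> b)) (r \<odot>\<^bsub>TF X\<^esub> E1 a b)" unfolding teq_def
    using assms by (intro conjI TF.smult_closed E1_carrier B.smult_closed)
qed

abbreviation b1 where "b1 \<equiv> \<mm> +> \<one>"

lemma b1: "b1 \<in> carrier B"
  by (auto simp: carrier_B)

lemma teq_null: "U \<in> carrier (TF X) \<Longrightarrow> teq X (\<zero> \<odot>\<^bsub>TF X\<^esub> U) \<zero>\<^bsub>TF X\<^esub>"
proof -
  interpret TF: Module.module R "TF X" by (rule free_module_module)
  assume U: "U \<in> carrier (TF X)"
  show ?thesis unfolding TF.smult_l_null[OF U] by (rule teq_refl[OF TF.zero_closed])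
qed

lemma teq_E1_zero: "b \<in> carrier B \<Longrightarrow> teq X (E1 \<zero>\<^bsub>FM X\<^esub> b) \<zero>\<^bsub>TF X\<^esub>"
proof -
  interpret F: Module.module R "FM X" by (rule free_module_module)
  assume b: "b \<in> carrier B"
  have "teq X (E1 (\<zero> \<odot>\<^bsub>FM X\<^esub> \<zero>\<^bsub>FM X\<^esub>) b) (\<zero> \<odot>\<^bsub>TF X\<^esub> E1 \<zero>\<^bsub>FM X\<^esub> b)"
    by (rule teq_E1_smult(1)[OF zero_closed F.zero_closed b])
  then show ?thesis unfolding F.smult_l_null[OF F.zero_closed]
    by (rule teq_trans) (rule teq_null[OF E1_carrier[OF F.zero_closed b]])
qed

lemma teq_E1_scalar:
  assumes a: "a \<in> carrier (FM X)" and s: "s \<in> carrier R"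
  shows "teq X (E1 a (\<mm> +> s)) (s \<odot>\<^bsub>TF X\<^esub> E1 a b1)"
  using teq_E1_smult(2)[OF s a b1] smult_B[OF s one_closed] s by simp

text \<open>A multiple of a basis vector by \<open>r\<close>, tensored with one, equals the basis
  vector tensored with the class of \<open>r\<close>, and this class is zero for \<open>r\<close> in
  the maximal ideal.\<close>

lemma teq_E1_m:
  assumes a: "a \<in> carrier (FM X)" and z: "red a = (\<lambda>_. 0)"
  shows "teq X (E1 a b1) \<zero>\<^bsub>TF X\<^esub>"
  using a
proof (induction a rule: free_induct[where I = \<mm>])
  case (coeff x)
  then show ?case using free_carrierD[OF a] fun_cong[OF z, of x] by (simp add: \<mm>_def)
next
  case zero
  show ?case using teq_E1_zero[OF b1, of X] by simp
next
  case (step v x r)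
  interpret TF: Module.module R "TF X" by (rule free_module_module)
  interpret F: Module.module R "FM X" by (rule free_module_module)
  have b: "free_basis R x \<in> carrier (FM X)" by (rule free_basis_carrier[OF step(2)])
  have c: "r \<odot>\<^bsub>FM X\<^esub> free_basis R x \<in> carrier (FM X)" by (rule F.smult_closed[OF step(3) b])
  have eq: "\<mm> +> r = \<mm> +> \<zero>" unfolding coset_m[OF step(3)] coset_m[OF zero_closed] using step(4) by (simp add: \<mm>_def chi_zero)
  have "teq X (E1 (r \<odot>\<^bsub>FM X\<^esub> free_basis R x) b1) (r \<odot>\<^bsub>TF X\<^esub> E1 (free_basis R x) b1)"
    by (rule teq_E1_smult(1)[OF step(3) b b1])
  also have "teq X (r \<odot>\<^bsub>TF X\<^esub> E1 (free_basis R x) b1) (E1 (free_basis R x) (\<mm> +> r))"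
    by (rule teq_sym[OF teq_E1_scalar[OF b step(3)]])
  also (teq_trans) have "teq X (E1 (free_basis R x) (\<mm> +> r)) (\<zero> \<odot>\<^bsub>TF X\<^esub> E1 (free_basis R x) b1)"
    unfolding eq by (rule teq_E1_scalar[OF b zero_closed])
  also (teq_trans) have "teq X (\<zero> \<odot>\<^bsub>TF X\<^esub> E1 (free_basis R x) b1) \<zero>\<^bsub>TF X\<^esub>"
    by (rule teq_null[OF E1_carrier[OF b b1]])
  finally (teq_trans) have 1: "teq X (E1 (r \<odot>\<^bsub>FM X\<^esub> free_basis R x) b1) \<zero>\<^bsub>TF X\<^esub>" .
  have "teq X (E1 v b1 \<oplus>\<^bsub>TF X\<^esub> E1 (r \<odot>\<^bsub>FM X\<^esub> free_basis R x) b1) (\<zero>\<^bsub>TF X\<^esub> \<oplus>\<^bsub>TF X\<^esub> \<zero>\<^bsub>TF X\<^esub>)"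
    by (rule teq_add[OF step(6) 1])
  then have "teq X (E1 v b1 \<oplus>\<^bsub>TF X\<^esub> E1 (r \<odot>\<^bsub>FM X\<^esub> free_basis R x) b1) \<zero>\<^bsub>TF X\<^esub>"
    unfolding TF.r_zero[OF TF.zero_closed] .
  with teq_E1_add[OF step(1) c b1] show ?case by (rule teq_trans)
qed

lemma teq_E1_red:
  assumes a: "a \<in> carrier (FM X)" and a': "a' \<in> carrier (FM X)" and eq: "red a = red a'"
  shows "teq X (E1 a b1) (E1 a' b1)"
proof -
  interpret TF: Module.module R "TF X" by (rule free_module_module)
  interpret F: Module.module R "FM X" by (rule free_module_module)
  have c: "a \<ominus>\<^bsub>FM X\<^esub> a' \<in> carrier (FM X)" by (rule F.minus_closed[OF a a'])
  have "red (a \<ominus>\<^bsub>FM X\<^esub> a') = (\<lambda>_. 0)"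
    unfolding free_minus[OF a a'] using fun_cong[OF eq] free_carrierD[OF a] free_carrierD[OF a'] by (simp add: chi_minus)
  then have 1: "teq X (E1 (a \<ominus>\<^bsub>FM X\<^esub> a') b1) \<zero>\<^bsub>TF X\<^esub>" by (rule teq_E1_m[OF c])
  have e: "(a \<ominus>\<^bsub>FM X\<^esub> a') \<oplus>\<^bsub>FM X\<^esub> a' = a"
    unfolding free_minus[OF a a'] using free_carrierD[OF a] free_carrierD[OF a'] by (auto simp: a_minus_def a_assoc l_neg)
  have "teq X (E1 ((a \<ominus>\<^bsub>FM X\<^esub> a') \<oplus>\<^bsub>FM X\<^esub> a') b1) (E1 (a \<ominus>\<^bsub>FM X\<^esub> a') b1 \<oplus>\<^bsub>TF X\<^esub> E1 a' b1)"
    by (rule teq_E1_add[OF c a' b1])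
  also have "teq X (E1 (a \<ominus>\<^bsub>FM X\<^esub> a') b1 \<oplus>\<^bsub>TF X\<^esub> E1 a' b1) (\<zero>\<^bsub>TF X\<^esub> \<oplus>\<^bsub>TF X\<^esub> E1 a' b1)"
    by (rule teq_add[OF 1 teq_refl[OF E1_carrier[OF a' b1]]])
  finally (teq_trans) show ?thesis unfolding e TF.l_zero[OF E1_carrier[OF a' b1]] .
qed

text \<open>Scalars can be moved to the first factor, where only reductions matter. Consequently the
  value under \<open>tval\<close> determines the tensor, which is the nontrivial half of
  \<open>TK_eq\<close>.\<close>

lemma teq_normal:
  assumes U: "U \<in> carrier (TF X)"
  shows "teq X U (E1 (lift (tval U)) b1)"
  using U
proof (induction U rule: free_induct[where I = UNIV])
  case zero
  have "teq X (E1 \<zero>\<^bsub>FM X\<^esub> b1) \<zero>\<^bsub>TF X\<^esub>" by (rule teq_E1_zero[OF b1])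
  from teq_sym[OF this] show ?case using tval_zero[of X] phi_zero by simp
next
  case (step V p r)
  interpret TF: Module.module R "TF X" by (rule free_module_module)
  interpret F: Module.module R "FM X" by (rule free_module_module)
  interpret B: Module.module R B by (rule module_B)
  obtain a s where p: "p = (a, \<mm> +> s)" and a: "a \<in> carrier (FM X)" and s: "s \<in> carrier R"
    using step(2) by (auto simp: carrier_B)
  have bc: "\<mm> +> s \<in> carrier B" using s by (auto simp: carrier_B)
  note Ec = E1_carrier[OF a bc]
  let ?W = "r \<odot>\<^bsub>TF X\<^esub> E1 a (\<mm> +> s)"
  have Wc: "?W \<in> carrier (TF X)" by (rule TF.smult_closed[OF step(3) Ec])
  have rsc: "r \<otimes> s \<in> carrier R" using step(3) s by simp
  have a1: "(r \<otimes> s) \<odot>\<^bsub>FM X\<^esub> a \<in> carrier (FM X)" by (rule F.smult_closed[OF rsc a])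
  have tW: "tval ?W = (\<lambda>x. \<chi> r * (\<chi> (a x) * \<chi> s))"
    unfolding tval_smult[OF step(3) Ec] tval_basis bar_coset[OF s] ..
  have lW: "lift (tval ?W) \<in> carrier (FM X)" by (rule lift_carrier[OF tval_finfun[OF Wc]])
  have lV: "lift (tval V) \<in> carrier (FM X)" by (rule lift_carrier[OF tval_finfun[OF step(1)]])
  have "teq X ?W (r \<odot>\<^bsub>TF X\<^esub> (s \<odot>\<^bsub>TF X\<^esub> E1 a b1))" by (rule teq_smult[OF step(3) teq_E1_scalar[OF a s]])
  also have "teq X (r \<odot>\<^bsub>TF X\<^esub> (s \<odot>\<^bsub>TF X\<^esub> E1 a b1)) (E1 ((r \<otimes> s) \<odot>\<^bsub>FM X\<^esub> a) b1)"
    unfolding TF.smult_assoc1[OF step(3) s E1_carrier[OF a b1], symmetric]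
    by (rule teq_sym[OF teq_E1_smult(1)[OF rsc a b1]])
  also (teq_trans) have "teq X (E1 ((r \<otimes> s) \<odot>\<^bsub>FM X\<^esub> a) b1) (E1 (lift (tval ?W)) b1)"
  proof (rule teq_E1_red[OF a1 lW])
    show "red ((r \<otimes> s) \<odot>\<^bsub>FM X\<^esub> a) = red (lift (tval ?W))"
      unfolding red_lift tW using step(3) s free_carrierD[OF a] by (simp add: chi_mult ac_simps)
  qed
  finally (teq_trans) have 1: "teq X ?W (E1 (lift (tval ?W)) b1)" .
  have e: "lift (tval V) \<oplus>\<^bsub>FM X\<^esub> lift (tval ?W) = lift (tval (V \<oplus>\<^bsub>TF X\<^esub> ?W))"
    unfolding tval_add[OF step(1) Wc] by (simp add: phi_add)
  have "teq X (V \<oplus>\<^bsub>TF X\<^esub> ?W) (E1 (lift (tval V)) b1 \<oplus>\<^bsub>TF X\<^esub> E1 (lift (tval ?W)) b1)"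
    by (rule teq_add[OF step(6) 1])
  also have "teq X (E1 (lift (tval V)) b1 \<oplus>\<^bsub>TF X\<^esub> E1 (lift (tval ?W)) b1) (E1 (lift (tval V) \<oplus>\<^bsub>FM X\<^esub> lift (tval ?W)) b1)"
    by (rule teq_sym[OF teq_E1_add[OF lV lW b1]])
  finally (teq_trans) show ?case unfolding e p .
qed simp

lemma TK_eq: "TK X = {U \<in> carrier (TF X). tval U = (\<lambda>_. 0)}"
proof (intro equalityI subsetI)
  show "U \<in> {U \<in> carrier (TF X). tval U = (\<lambda>_. 0)}" if "U \<in> TK X" for U using TK_subset[OF that] by simp
  fix U assume U: "U \<in> {U \<in> carrier (TF X). tval U = (\<lambda>_. 0)}"
  interpret TF: Module.module R "TF X" by (rule free_module_module)
  have z: "lift (tval U) = \<zero>\<^bsub>FM X\<^esub>" using U phi_zero by simp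
  have "teq X U (E1 \<zero>\<^bsub>FM X\<^esub> b1)" using teq_normal[of U X] U unfolding z by blast
  from teq_trans[OF this teq_E1_zero[OF b1]] have "U \<ominus>\<^bsub>TF X\<^esub> \<zero>\<^bsub>TF X\<^esub> \<in> TK X" by (simp only: teq_def)
  moreover have "U \<ominus>\<^bsub>TF X\<^esub> \<zero>\<^bsub>TF X\<^esub> = U"
    using U free_minus[OF _ TF.zero_closed, of U] free_carrierD[of U] by (auto simp: a_minus_def)
  ultimately show "U \<in> TK X" by simp
qed

lemma tensor_kernel_quotient: "kernel_quotient (TF X) (carrier R) \<chi> tval (TK X)"
proof (rule kernel_quotient.intro)
  interpret TF: Module.module R "TF X" by (rule free_module_module)
  show "abelian_group (TF X)" by (rule free_abelian_group)
  show "TK X = {a \<in> carrier (TF X). tval a = (\<lambda>_. 0)}" by (rule TK_eq)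
  show "tval (a \<oplus>\<^bsub>TF X\<^esub> b) = (\<lambda>x. tval a x + tval b x)" if "a \<in> carrier (TF X)" "b \<in> carrier (TF X)" for a b
    by (rule tval_add[OF that])
  show "r \<odot>\<^bsub>TF X\<^esub> a \<in> carrier (TF X) \<and> tval (r \<odot>\<^bsub>TF X\<^esub> a) = (\<lambda>x. \<chi> r * tval a x)"
    if "r \<in> carrier R" "a \<in> carrier (TF X)" for r a
    using TF.smult_closed[OF that] tval_smult[OF that] by blast
qed

lemma tval_surj: "tval ` carrier (TF X) = finfun X"
proof (intro equalityI subsetI)
  show "v \<in> finfun X" if "v \<in> tval ` carrier (TF X)" for v using that tval_finfun by blast
  fix v assume v: "v \<in> finfun X"
  have "tval (E1 (lift v) b1) = v" unfolding tval_basis by (simp add: bar_coset chi_one chi_phi)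
  moreover have "E1 (lift v) b1 \<in> carrier (TF X)" by (rule E1_carrier[OF lift_carrier[OF v] b1])
  ultimately show "v \<in> tval ` carrier (TF X)" by force
qed

text \<open>Under the identification by \<open>tval\<close>, tensoring \<open>h\<close> with the
  residue field is reducing \<open>h\<close> modulo the maximal ideal.\<close>

lemma tensor_map_value:
  assumes h: "h \<in> mhom R (FM X) (FM Y)" and C: "C \<in> carrier (tensor R (FM X) B)"
  shows "tensor_map R (FM Y) B h C \<in> carrier (tensor R (FM Y) B)"
    "coset_map tval (tensor_map R (FM Y) B h C) = red (h (lift (coset_map tval C)))"
proof -
  interpret QX: kernel_quotient "TF X" "carrier R" \<chi> tval "TK X" by (rule tensor_kernel_quotient)
  interpret QY: kernel_quotient "TF Y" "carrier R" \<chi> tval "TK Y" by (rule tensor_kernel_quotient)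
  interpret TFX: Module.module R "TF X" by (rule free_module_module)
  interpret TFY: Module.module R "TF Y" by (rule free_module_module)
  let ?\<psi> = "\<lambda>p. free_basis R (h (fst p), snd p)"
  let ?D = "free_lift R (TF Y) ?\<psi>"
  have \<psi>: "?\<psi> p \<in> carrier (TF Y)" if "p \<in> carrier (FM X) \<times> carrier B" for p
    using that by (intro E1_carrier mhom_closed[OF h]) auto
  have D: "?D \<in> mhom R (TF X) (TF Y)" by (rule free_lift_hom[OF free_module_module \<psi>])
  have tD: "tval (?D u) = red (h (lift (tval u)))" if u: "u \<in> carrier (TF X)" for u
    using u
  proof (induction u rule: free_induct[where I = UNIV])
    case zero
    have "?D \<zero>\<^bsub>TF X\<^esub> = \<zero>\<^bsub>TF Y\<^esub>" by (rule mhom_zero[OF free_module_module free_module_module D])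
    then have 1: "tval (?D \<zero>\<^bsub>TF X\<^esub>) = (\<lambda>_. 0)" using tval_zero by simp
    have "lift (tval \<zero>\<^bsub>TF X\<^esub>) = \<zero>\<^bsub>FM X\<^esub>" unfolding tval_zero by (simp add: phi_zero)
    moreover have "h \<zero>\<^bsub>FM X\<^esub> = \<zero>\<^bsub>FM Y\<^esub>" by (rule mhom_zero[OF free_module_module free_module_module h])
    ultimately have "red (h (lift (tval \<zero>\<^bsub>TF X\<^esub>))) = (\<lambda>_. 0)" by (simp add: chi_zero)
    with 1 show ?case by simp
  next
    case (step V p r)
    obtain a b where p: "p = (a, b)" and a: "a \<in> carrier (FM X)" and b: "b \<in> carrier B" using step(2) by auto
    note Ec = E1_carrier[OF a b]
    have Wc: "r \<odot>\<^bsub>TF X\<^esub> E1 a b \<in> carrier (TF X)" by (rule TFX.smult_closed[OF step(3) Ec])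
    have hc: "h a \<in> carrier (FM Y)" by (rule mhom_closed[OF h a])
    have Db: "?D (E1 a b) = E1 (h a) b"
      using free_lift_basis[of "TF Y" ?\<psi> "(a, b)", OF free_module_module] E1_carrier[OF hc b] by simp
    have DV: "?D V \<in> carrier (TF Y)" by (rule mhom_closed[OF D step(1)])
    have s2: "r \<odot>\<^bsub>TF Y\<^esub> E1 (h a) b \<in> carrier (TF Y)" by (rule TFY.smult_closed[OF step(3) E1_carrier[OF hc b]])
    have L: "tval (?D (V \<oplus>\<^bsub>TF X\<^esub> r \<odot>\<^bsub>TF X\<^esub> E1 a b)) = (\<lambda>y. \<chi> (h (lift (tval V)) y) + \<chi> r * (\<chi> (h a y) * bar b))"
      unfolding mhom_add[OF D step(1) Wc] mhom_smult[OF D step(3) Ec] Db tval_add[OF DV s2] step(6)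
        tval_smult[OF step(3) E1_carrier[OF hc b]] tval_basis ..
    \<comment> \<open>A lift of the rational factor of \<open>a\<close>: multiplication by it
      commutes with \<open>h\<close> and has the right effect on reductions.\<close>
    define q where "q = \<phi> (\<chi> r * bar b)"
    have qR: "q \<in> carrier R" by (simp add: q_def phi_closed)
    interpret FX: Module.module R "FM X" by (rule free_module_module)
    have qa: "q \<odot>\<^bsub>FM X\<^esub> a \<in> carrier (FM X)" by (rule FX.smult_closed[OF qR a])
    have lV: "lift (tval V) \<in> carrier (FM X)" by (rule lift_carrier[OF tval_finfun[OF step(1)]])
    have lS: "lift (tval (V \<oplus>\<^bsub>TF X\<^esub> r \<odot>\<^bsub>TF X\<^esub> E1 a b)) \<in> carrier (FM X)"
      by (rule lift_carrier[OF tval_finfun[OF TFX.add.m_closed[OF step(1) Wc]]])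
    have "red (lift (tval (V \<oplus>\<^bsub>TF X\<^esub> r \<odot>\<^bsub>TF X\<^esub> E1 a b))) = red (lift (tval V) \<oplus>\<^bsub>FM X\<^esub> q \<odot>\<^bsub>FM X\<^esub> a)"
      unfolding red_lift tval_add[OF step(1) Wc] tval_smult[OF step(3) Ec] tval_basis
      using free_carrierD[OF a] qR by (auto simp: chi_add chi_mult phi_closed chi_phi q_def)
    from red_hom[OF h lS FX.add.m_closed[OF lV qa] this]
    have "red (h (lift (tval (V \<oplus>\<^bsub>TF X\<^esub> r \<odot>\<^bsub>TF X\<^esub> E1 a b)))) = red (h (lift (tval V)) \<oplus>\<^bsub>FM Y\<^esub> q \<odot>\<^bsub>FM Y\<^esub> h a)"
      unfolding mhom_add[OF h lV qa] mhom_smult[OF h qR a] .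
    also have "\<dots> = (\<lambda>y. \<chi> (h (lift (tval V)) y) + \<chi> r * (\<chi> (h a y) * bar b))"
      using free_carrierD[OF mhom_closed[OF h lV]] free_carrierD[OF hc] qR
      by (auto simp: chi_add chi_mult q_def chi_phi phi_closed)
    finally show ?case using L unfolding p by simp
  qed simp
  obtain u where u: "u \<in> carrier (TF X)" "C = QX.fiber u"
    using C by (auto simp: tensor_def QX.carrier_Q)
  have "tensor_map R (FM Y) B h C = (\<Union>v\<in>C. TK Y +>\<^bsub>TF Y\<^esub> ?D v)"
    unfolding tensor_map_def Let_def free_lift_def ..
  also have "\<dots> = QY.fiber (?D u)"
  proof -
    have "TK Y +>\<^bsub>TF Y\<^esub> ?D v = QY.fiber (?D u)" if "v \<in> C" for v
    proof -
      have v: "v \<in> carrier (TF X)" "tval v = tval u" using that u by (auto simp: QX.fiber_def)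
      have "tval (?D v) = tval (?D u)" using tD[OF v(1)] tD[OF u(1)] v(2) by simp
      then show ?thesis using QY.coset_fiber[OF mhom_closed[OF D v(1)]] by (simp add: QY.fiber_def)
    qed
    moreover have "u \<in> C" using u by (simp add: QX.fiber_def)
    ultimately show ?thesis by blast
  qed
  finally have e: "tensor_map R (FM Y) B h C = QY.fiber (?D u)" .
  have Du: "?D u \<in> carrier (TF Y)" by (rule mhom_closed[OF D u(1)])
  show "tensor_map R (FM Y) B h C \<in> carrier (tensor R (FM Y) B)"
    unfolding e tensor_def QY.carrier_Q using Du by blast
  show "coset_map tval (tensor_map R (FM Y) B h C) = red (h (lift (coset_map tval C)))"
  proof -
    have "coset_map tval C = tval u" unfolding u(2) by (rule QX.coset_map_fiber[OF u(1)])
    then show ?thesis using QY.coset_map_fiber[OF Du] tD[OF u(1)] by (simp only: e)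
  qed
qed

end

section \<open>Tor from a minimal resolution\<close>

text \<open>The vector space axioms are pulled back along the bijection \<open>\<Psi>\<close>, and
  so is the basis, which consists of the preimages of the indicator functions.\<close>

lemma dim_finfun:
  fixes V :: "(rat, 'c) module" and \<Psi> :: "'c \<Rightarrow> 'y \<Rightarrow> rat"
  assumes Y: "finite Y"
    and add: "\<And>C D. C \<in> carrier V \<Longrightarrow> D \<in> carrier V \<Longrightarrow> C \<oplus>\<^bsub>V\<^esub> D \<in> carrier V \<and> \<Psi> (C \<oplus>\<^bsub>V\<^esub> D) = (\<lambda>y. \<Psi> C y + \<Psi> D y)"
    and smult: "\<And>c C. C \<in> carrier V \<Longrightarrow> c \<odot>\<^bsub>V\<^esub> C \<in> carrier V \<and> \<Psi> (c \<odot>\<^bsub>V\<^esub> C) = (\<lambda>y. c * \<Psi> C y)"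
    and zero: "\<zero>\<^bsub>V\<^esub> \<in> carrier V" "\<Psi> \<zero>\<^bsub>V\<^esub> = (\<lambda>_. 0)"
    and inj: "inj_on \<Psi> (carrier V)" and im: "\<Psi> ` carrier V = finfun Y"
  shows "vectorspace.dim class_ring V = card Y"
proof -
  have eqI: "C = D" if "C \<in> carrier V" "D \<in> carrier V" "\<And>y. \<Psi> C y = \<Psi> D y" for C D
    using inj_onD[OF inj _ that(1,2)] that(3) by blast
  have ab: "abelian_group V"
  proof (rule abelian_group_transfer[where \<theta> = \<Psi>])
    fix C assume C: "C \<in> carrier V"
    show "\<exists>D\<in>carrier V. \<Psi> D = (\<lambda>y. - \<Psi> C y)" using smult[OF C, of "-1"] by (intro bexI[of _ "(-1) \<odot>\<^bsub>V\<^esub> C"]) auto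
  qed (use add zero inj in auto)
  interpret vectorspace "class_ring :: rat ring" V
  proof (rule vectorspace.intro)
    show "field (class_ring :: rat ring)" by (rule class_field)
    show "Module.module (class_ring :: rat ring) V"
    proof (rule moduleI)
      show "cring (class_ring :: rat ring)" by (rule class_cring.is_cring)
      fix a b :: rat and C D assume C: "C \<in> carrier V" and D: "D \<in> carrier V"
      note s = smult[OF C] and s' = smult[OF D]
      show "a \<odot>\<^bsub>V\<^esub> C \<in> carrier V" using s by blast
      show "(a \<oplus>\<^bsub>class_ring\<^esub> b) \<odot>\<^bsub>V\<^esub> C = a \<odot>\<^bsub>V\<^esub> C \<oplus>\<^bsub>V\<^esub> b \<odot>\<^bsub>V\<^esub> C"
        using s add by (intro eqI) (auto simp: class_ring_simps algebra_simps)
      show "a \<odot>\<^bsub>V\<^esub> (C \<oplus>\<^bsub>V\<^esub> D) = a \<odot>\<^bsub>V\<^esub> C \<oplus>\<^bsub>V\<^esub> a \<odot>\<^bsub>V\<^esub> D"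
        using s s' add[OF C D] add smult by (intro eqI) (auto simp: algebra_simps)
      show "(a \<otimes>\<^bsub>class_ring\<^esub> b) \<odot>\<^bsub>V\<^esub> C = a \<odot>\<^bsub>V\<^esub> (b \<odot>\<^bsub>V\<^esub> C)"
        using s smult by (intro eqI) (auto simp: class_ring_simps algebra_simps)
      show "\<one>\<^bsub>class_ring\<^esub> \<odot>\<^bsub>V\<^esub> C = C" using s C by (intro eqI) (auto simp: class_ring_simps)
    qed (rule ab)
  qed
  have "\<exists>C\<in>carrier V. \<Psi> C = (\<lambda>x. if x = y then 1 else 0)" if "y \<in> Y" for y
  proof -
    have "(\<lambda>x. if x = y then 1 else 0 :: rat) \<in> finfun Y" using that by (auto simp: finfun_def)
    then show ?thesis using im by (metis (no_types, lifting) imageE)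
  qed
  then obtain \<beta> where \<beta>: "\<And>y. y \<in> Y \<Longrightarrow> \<beta> y \<in> carrier V \<and> \<Psi> (\<beta> y) = (\<lambda>x. if x = y then 1 else 0)" by metis
  have \<beta>inj: "inj_on \<beta> Y"
  proof (rule inj_onI)
    fix y y' assume h: "y \<in> Y" "y' \<in> Y" "\<beta> y = \<beta> y'"
    then have "\<Psi> (\<beta> y) y = \<Psi> (\<beta> y') y" by simp
    then show "y = y'" using \<beta>[OF h(1)] \<beta>[OF h(2)] by (auto split: if_splits)
  qed
  let ?A = "\<beta> ` Y"
  have A: "finite ?A" "?A \<subseteq> carrier V" using Y \<beta> by auto
  have fs: "(\<Oplus>\<^bsub>V\<^esub>v\<in>S. a v \<odot>\<^bsub>V\<^esub> v) \<in> carrier V \<and> \<Psi> (\<Oplus>\<^bsub>V\<^esub>v\<in>S. a v \<odot>\<^bsub>V\<^esub> v) = (\<lambda>y. \<Sum>v\<in>S. a v * \<Psi> v y)"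
    if "finite S" "S \<subseteq> carrier V" for S a
    using that
  proof (induction S rule: finite_induct)
    case empty then show ?case using zero by simp
  next
    case (insert w S)
    then have w: "w \<in> carrier V" by simp
    have "(\<Oplus>\<^bsub>V\<^esub>v\<in>insert w S. a v \<odot>\<^bsub>V\<^esub> v) = a w \<odot>\<^bsub>V\<^esub> w \<oplus>\<^bsub>V\<^esub> (\<Oplus>\<^bsub>V\<^esub>v\<in>S. a v \<odot>\<^bsub>V\<^esub> v)"
      using insert smult by (intro M.finsum_insert) auto
    then show ?case using insert add smult[OF w] by auto
  qed
  have \<Psi>lc: "\<Psi> (lincomb a ?A) y = (if y \<in> Y then a (\<beta> y) else 0)" for a y
  proof -
    have "\<Psi> (lincomb a ?A) y = (\<Sum>v\<in>?A. a v * \<Psi> v y)" unfolding lincomb_def using fs[OF A, of a] by simp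
    also have "\<dots> = (\<Sum>x\<in>Y. a (\<beta> x) * \<Psi> (\<beta> x) y)" by (simp add: sum.reindex[OF \<beta>inj])
    also have "\<dots> = (\<Sum>x\<in>Y. if y = x then a (\<beta> x) else 0)" using \<beta> by (intro sum.cong) auto
    also have "\<dots> = (if y \<in> Y then a (\<beta> y) else 0)" using Y by (simp add: sum.delta)
    finally show ?thesis .
  qed
  have "lin_indpt ?A"
  proof (rule finite_lin_indpt2[OF A])
    fix a assume "lincomb a ?A = \<zero>\<^bsub>V\<^esub>"
    then have "(if y \<in> Y then a (\<beta> y) else 0) = 0" for y using \<Psi>lc[of a y] zero by simp
    then show "\<forall>v\<in>?A. a v = \<zero>\<^bsub>class_ring\<^esub>" by (auto simp: class_ring_simps split: if_splits) (metis)
  qed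
  moreover have "gen_set ?A"
  proof
    show "span ?A \<subseteq> carrier V" by (rule span_is_subset2[OF A(2)])
    show "carrier V \<subseteq> span ?A"
    proof
      fix C assume C: "C \<in> carrier V"
      define a where "a = (\<lambda>v. \<Psi> C (the_inv_into Y \<beta> v))"
      have "lincomb a ?A \<in> carrier V" unfolding lincomb_def using fs[OF A, of a] by blast
      moreover have "\<Psi> C y = 0" if "y \<notin> Y" for y using C im that by (auto simp: finfun_def)
      ultimately have "C = lincomb a ?A"
        using C by (intro eqI) (auto simp: \<Psi>lc a_def the_inv_into_f_f[OF \<beta>inj])
      moreover have "a \<in> ?A \<rightarrow> carrier class_ring" by (simp add: class_ring_simps)
      ultimately show "C \<in> span ?A" unfolding span_def using A by blast
    qed
  qed
  ultimately have "basis ?A" using A by (simp add: basis_def)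
  from dim_basis[OF A(1) this] show ?thesis using card_image[OF \<beta>inj] by simp
qed

context augmented
begin

text \<open>The map between rational functions that \<open>h\<close> induces modulo the maximal
  ideal.\<close>

definition rmap :: "(('x \<Rightarrow> 'a) \<Rightarrow> ('y \<Rightarrow> 'a)) \<Rightarrow> ('x \<Rightarrow> rat) \<Rightarrow> 'y \<Rightarrow> rat"
  where "rmap h v = red (h (lift v))"

lemma rmap_finfun: "h \<in> mhom R (FM X) (FM Y) \<Longrightarrow> v \<in> finfun X \<Longrightarrow> rmap h v \<in> finfun Y"
  unfolding rmap_def by (intro red_finfun mhom_closed[OF _ lift_carrier])

lemma rmap_add:
  assumes h: "h \<in> mhom R (FM X) (FM Y)" and v: "v \<in> finfun X" and w: "w \<in> finfun X"
  shows "rmap h (\<lambda>x. v x + w x) = (\<lambda>y. rmap h v y + rmap h w y)"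
proof -
  have "lift (\<lambda>x. v x + w x) = lift v \<oplus>\<^bsub>FM X\<^esub> lift w" by (simp add: phi_add)
  then have "h (lift (\<lambda>x. v x + w x)) = h (lift v) \<oplus>\<^bsub>FM Y\<^esub> h (lift w)"
    using mhom_add[OF h lift_carrier[OF v] lift_carrier[OF w]] by simp
  then show ?thesis unfolding rmap_def
    using free_carrierD[OF mhom_closed[OF h lift_carrier[OF v]]] free_carrierD[OF mhom_closed[OF h lift_carrier[OF w]]]
    by (simp add: chi_add)
qed

lemma rmap_scale:
  assumes h: "h \<in> mhom R (FM X) (FM Y)" and v: "v \<in> finfun X"
  shows "rmap h (\<lambda>x. c * v x) = (\<lambda>y. c * rmap h v y)"
proof -
  interpret F: Module.module R "FM X" by (rule free_module_module)
  have cv: "(\<lambda>x. c * v x) \<in> finfun X"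
  proof -
    have "{x. c * v x \<noteq> 0} \<subseteq> {x. v x \<noteq> 0}" by auto
    then have "finite {x. c * v x \<noteq> 0}" by (rule finite_subset) (use v in \<open>simp add: finfun_def\<close>)
    then show ?thesis using v by (auto simp: finfun_def)
  qed
  note lv = lift_carrier[OF v]
  have "red (h (lift (\<lambda>x. c * v x))) = red (h (\<phi> c \<odot>\<^bsub>FM X\<^esub> lift v))"
    by (rule red_hom[OF h lift_carrier[OF cv] F.smult_closed[OF phi_closed lv]])
      (simp add: chi_phi chi_mult phi_closed)
  also have "\<dots> = (\<lambda>y. c * red (h (lift v)) y)"
    unfolding mhom_smult[OF h phi_closed lv]
    using free_carrierD[OF mhom_closed[OF h lv]] by (simp add: chi_mult phi_closed chi_phi)
  finally show ?thesis by (simp add: rmap_def)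
qed

lemma rmap_red:
  assumes h: "h \<in> mhom R (FM X) (FM Y)" and u: "u \<in> carrier (FM X)"
  shows "rmap h (red u) = red (h u)"
  unfolding rmap_def by (rule red_hom[OF h lift_carrier[OF red_finfun[OF u]] u]) (simp add: chi_phi)

lemma red_minus: "u \<in> carrier (FM X) \<Longrightarrow> v \<in> carrier (FM X) \<Longrightarrow> red (u \<ominus>\<^bsub>FM X\<^esub> v) = (\<lambda>x. \<chi> (u x) - \<chi> (v x))"
  unfolding free_minus by (auto simp: chi_minus free_carrierD)

text \<open>A minimal resolution computes \<open>Tor\<close>: comparing it with the chosen one, the comparison maps
  and their homotopies become mutually inverse after reduction modulo the maximal ideal.\<close>

theorem dim_Tor_minimal:
  fixes Y :: "nat \<Rightarrow> ('a + 'a set) list set"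
  assumes G: "free_resolution R B Y e \<eta>" and fin: "\<And>i. finite (Y i)"
    and minimal: "\<And>i u. u \<in> carrier (FM (Y (Suc i))) \<Longrightarrow> red (e i u) = (\<lambda>_. 0)"
  shows "vectorspace.dim class_ring (restrict_scalars \<phi> (Tor R B B i)) = card (Y i)"
proof -
  \<comment> \<open>The minimal resolution has its bases in the type prescribed for the chosen one,
    so it also witnesses that there is something to choose.\<close>
  have "case (Y, e) of (X, d) \<Rightarrow> \<exists>\<epsilon>. free_resolution R B X d \<epsilon>" using G by auto
  then have ch: "case chosen_resolution R B of (X, d) \<Rightarrow> \<exists>\<epsilon>. free_resolution R B X d \<epsilon>"
    unfolding chosen_resolution_def by (rule someI)
  obtain X d where Xd: "chosen_resolution R B = (X, d)" by (cases "chosen_resolution R B")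
  then obtain \<epsilon> where F: "free_resolution R B X d \<epsilon>" using ch by auto
  note r = free_resolutionD[OF F] and q = free_resolutionD[OF G] and mm = free_module_module
  obtain f where f: "\<And>i. f i \<in> mhom R (FM (X i)) (FM (Y i))"
    "\<And>u. u \<in> carrier (FM (X 0)) \<Longrightarrow> \<eta> (f 0 u) = \<epsilon> u"
    "\<And>i u. u \<in> carrier (FM (X (Suc i))) \<Longrightarrow> e i (f (Suc i) u) = f i (d i u)"
    by (rule resolution_compare[OF module_B F G]) blast
  obtain g where g: "\<And>i. g i \<in> mhom R (FM (Y i)) (FM (X i))"
    "\<And>u. u \<in> carrier (FM (Y 0)) \<Longrightarrow> \<epsilon> (g 0 u) = \<eta> u"
    "\<And>i u. u \<in> carrier (FM (Y (Suc i))) \<Longrightarrow> d i (g (Suc i) u) = g i (e i u)"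
    by (rule resolution_compare[OF module_B G F]) blast
  note fc = mhom_closed[OF f(1)] and gc = mhom_closed[OF g(1)] and dc = mhom_closed[OF r(1)] and ec = mhom_closed[OF q(1)]
  have gf0: "\<epsilon> (g 0 (f 0 u)) = \<epsilon> u" if "u \<in> carrier (FM (X 0))" for u using g(2)[OF fc[OF that]] f(2)[OF that] by simp
  have fg0: "\<eta> (f 0 (g 0 u)) = \<eta> u" if "u \<in> carrier (FM (Y 0))" for u using f(2)[OF gc[OF that]] g(2)[OF that] by simp
  have gfc: "d i (g (Suc i) (f (Suc i) u)) = g i (f i (d i u))" if "u \<in> carrier (FM (X (Suc i)))" for i u
    using g(3)[OF fc[OF that]] f(3)[OF that] by simp
  have fgc: "e i (f (Suc i) (g (Suc i) u)) = f i (g i (e i u))" if "u \<in> carrier (FM (Y (Suc i)))" for i u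
    using f(3)[OF gc[OF that]] g(3)[OF that] by simp
  obtain s where s: "\<And>i. s i \<in> mhom R (FM (X i)) (FM (X (Suc i)))"
    "\<And>u. u \<in> carrier (FM (X 0)) \<Longrightarrow> d 0 (s 0 u) = g 0 (f 0 u) \<ominus>\<^bsub>FM (X 0)\<^esub> u"
    "\<And>i u. u \<in> carrier (FM (X (Suc i))) \<Longrightarrow> d (Suc i) (s (Suc i) u) =
      (g (Suc i) (f (Suc i) u) \<ominus>\<^bsub>FM (X (Suc i))\<^esub> u) \<ominus>\<^bsub>FM (X (Suc i))\<^esub> s i (d i u)"
    by (rule resolution_homotopy[OF module_B F, where \<phi> = "\<lambda>i u. g i (f i u)", OF mhom_comp[OF f(1) g(1)] gf0 gfc]) blast+
  obtain s' where s': "\<And>i. s' i \<in> mhom R (FM (Y i)) (FM (Y (Suc i)))"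
    "\<And>u. u \<in> carrier (FM (Y 0)) \<Longrightarrow> e 0 (s' 0 u) = f 0 (g 0 u) \<ominus>\<^bsub>FM (Y 0)\<^esub> u"
    "\<And>i u. u \<in> carrier (FM (Y (Suc i))) \<Longrightarrow> e (Suc i) (s' (Suc i) u) =
      (f (Suc i) (g (Suc i) u) \<ominus>\<^bsub>FM (Y (Suc i))\<^esub> u) \<ominus>\<^bsub>FM (Y (Suc i))\<^esub> s' i (e i u)"
    by (rule resolution_homotopy[OF module_B G, where \<phi> = "\<lambda>i u. f i (g i u)", OF mhom_comp[OF g(1) f(1)] fg0 fgc]) blast+
  note sc = mhom_closed[OF s(1)] and sc' = mhom_closed[OF s'(1)]
  define TT where "TT i = tensor R (FM (X i)) B" for i
  define D where "D i = tensor_map R (FM (X i)) B (d i)" for i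
  define \<Theta> where "\<Theta> = (coset_map tval :: _ \<Rightarrow> ('a + 'a set) list \<Rightarrow> rat)"
  have Tor: "Tor R B B i = homology TT D i"
    by (simp add: Tor_def Xd TT_def[abs_def] D_def[abs_def])
  have kq: "kernel_quotient (TF (X j)) (carrier R) \<chi> tval (TK (X j))" for j by (rule tensor_kernel_quotient)
  have TTQ: "TT j = quot_module (TF (X j)) (TK (X j))" for j by (simp add: TT_def tensor_def)
  note T_add = kernel_quotient.map_add[OF kq, folded TTQ \<Theta>_def]
    and T_smult = kernel_quotient.map_smult[OF kq, folded TTQ \<Theta>_def]
    and T_zero = kernel_quotient.map_zero[OF kq, folded TTQ \<Theta>_def]
    and T_inj = kernel_quotient.map_inj[OF kq, folded TTQ \<Theta>_def]
    and T_im = kernel_quotient.map_image[OF kq, folded TTQ \<Theta>_def, unfolded tval_surj]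
  have T_fin: "\<Theta> C \<in> finfun (X j)" if "C \<in> carrier (TT j)" for C j using T_im[of j] that by blast
  have T_surj: "\<exists>C\<in>carrier (TT j). \<Theta> C = v" if "v \<in> finfun (X j)" for v j using T_im[of j] that by (metis imageE)
  have Dv: "D j C \<in> carrier (TT j)" "\<Theta> (D j C) = rmap (d j) (\<Theta> C)" if "C \<in> carrier (TT (Suc j))" for j C
    using tensor_map_value[OF r(1)[of j], of C] that unfolding D_def TT_def \<Theta>_def rmap_def by blast+
  define Z where "Z = cycles TT D i"
  have Z_iff: "C \<in> Z \<longleftrightarrow> C \<in> carrier (TT i) \<and> (\<forall>j. i = Suc j \<longrightarrow> rmap (d j) (\<Theta> C) = (\<lambda>_. 0))" for C
  proof (cases i)
    case 0
    then show ?thesis by (simp add: Z_def cycles_def)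
  next
    case (Suc j)
    have "D j C = \<zero>\<^bsub>TT j\<^esub> \<longleftrightarrow> rmap (d j) (\<Theta> C) = (\<lambda>_. 0)" if "C \<in> carrier (TT (Suc j))"
      using inj_onD[OF T_inj[of j], of "D j C" "\<zero>\<^bsub>TT j\<^esub>"] Dv[OF that] T_zero[of j] by auto
    then show ?thesis unfolding Z_def cycles_def Suc a_kernel_def' by auto
  qed
  define M where "M = (TT i)\<lparr>carrier := Z\<rparr>"
  define N where "N = D i ` carrier (TT (Suc i))"
  \<comment> \<open>The reduced comparison map to the minimal resolution. Its kernel on the cycles
    will be the boundaries, and its image all of \<open>finfun (Y i)\<close>, so it identifies the
    homology with that space.\<close>
  define h where "h C = rmap (f i) (\<Theta> C)" for C
  have Msimp: "carrier M = Z" "\<zero>\<^bsub>M\<^esub> = \<zero>\<^bsub>TT i\<^esub>" "C \<oplus>\<^bsub>M\<^esub> C' = C \<oplus>\<^bsub>TT i\<^esub> C'" "x \<odot>\<^bsub>M\<^esub> C = x \<odot>\<^bsub>TT i\<^esub> C" for C C' x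
    by (simp_all add: M_def)
  have Z_add: "C \<oplus>\<^bsub>TT i\<^esub> C' \<in> Z" if "C \<in> Z" "C' \<in> Z" for C C'
  proof -
    have c: "C \<in> carrier (TT i)" "C' \<in> carrier (TT i)" using that Z_iff by blast+
    have "rmap (d j) (\<Theta> (C \<oplus>\<^bsub>TT i\<^esub> C')) = (\<lambda>_. 0)" if ij: "i = Suc j" for j
    proof -
      have "rmap (d j) (\<Theta> C) = (\<lambda>_. 0)" "rmap (d j) (\<Theta> C') = (\<lambda>_. 0)"
        using Z_iff \<open>C \<in> Z\<close> \<open>C' \<in> Z\<close> ij by blast+
      then show ?thesis using rmap_add[OF r(1)[of j], of "\<Theta> C" "\<Theta> C'"] T_fin[OF c(1)] T_fin[OF c(2)] T_add[OF c] ij by simp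
    qed
    then show ?thesis using T_add[OF c] Z_iff by blast
  qed
  have Z_smult: "x \<odot>\<^bsub>TT i\<^esub> C \<in> Z" if "x \<in> carrier R" "C \<in> Z" for C x
  proof -
    have c: "C \<in> carrier (TT i)" using that Z_iff by blast
    have "rmap (d j) (\<Theta> (x \<odot>\<^bsub>TT i\<^esub> C)) = (\<lambda>_. 0)" if ij: "i = Suc j" for j
    proof -
      have "rmap (d j) (\<Theta> C) = (\<lambda>_. 0)" using Z_iff \<open>C \<in> Z\<close> ij by blast
      then show ?thesis using rmap_scale[OF r(1)[of j], of "\<Theta> C" "\<chi> x"] T_fin[OF c] T_smult[OF \<open>x \<in> carrier R\<close> c] ij by simp
    qed
    then show ?thesis using T_smult[OF that(1) c] Z_iff by blast
  qed
  have Z_zero: "\<zero>\<^bsub>TT i\<^esub> \<in> Z"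
  proof -
    have "rmap (d j) (\<lambda>_. 0) = (\<lambda>_. 0)" for j
      using rmap_scale[OF r(1)[of j], of "\<lambda>_. 0" 0] by (simp add: finfun_def)
    then show ?thesis using Z_iff T_zero by simp
  qed
  have ZT: "C \<in> Z \<Longrightarrow> C \<in> carrier (TT i)" for C using Z_iff by blast
  have Mab: "abelian_group M"
  proof (rule abelian_group_transfer[where \<theta> = \<Theta>])
    show "C \<oplus>\<^bsub>M\<^esub> C' \<in> carrier M \<and> \<Theta> (C \<oplus>\<^bsub>M\<^esub> C') = (\<lambda>x. \<Theta> C x + \<Theta> C' x)"
      if "C \<in> carrier M" "C' \<in> carrier M" for C C' using that Z_add T_add[OF ZT ZT] unfolding Msimp by blast
    show "\<zero>\<^bsub>M\<^esub> \<in> carrier M" "\<Theta> \<zero>\<^bsub>M\<^esub> = (\<lambda>_. 0)" unfolding Msimp using Z_zero T_zero by blast+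
    show "inj_on \<Theta> (carrier M)" unfolding Msimp by (rule inj_on_subset[OF T_inj[of i]]) (use ZT in blast)
    fix C assume C: "C \<in> carrier M"
    have "\<chi> (\<ominus> \<one>) = - 1" by (simp add: chi_neg chi_one)
    then show "\<exists>C'\<in>carrier M. \<Theta> C' = (\<lambda>x. - \<Theta> C x)"
      using C Z_smult[of "\<ominus> \<one>" C] T_smult[of "\<ominus> \<one>" C i] ZT[of C] unfolding Msimp
      by (intro bexI[of _ "(\<ominus> \<one>) \<odot>\<^bsub>TT i\<^esub> C"]) auto
  qed
  have Neq: "N = {C \<in> carrier M. h C = (\<lambda>_. 0)}"
  proof (intro equalityI subsetI)
    fix C assume "C \<in> N"
    then obtain W where W: "W \<in> carrier (TT (Suc i))" "C = D i W" by (auto simp: N_def)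
    let ?w = "lift (\<Theta> W)"
    have w: "?w \<in> carrier (FM (X (Suc i)))" by (rule lift_carrier[OF T_fin[OF W(1)]])
    have TC: "\<Theta> C = red (d i ?w)" using Dv(2)[OF W(1)] W(2) by (simp add: rmap_def)
    have "rmap (d j) (\<Theta> C) = (\<lambda>_. 0)" if ij: "i = Suc j" for j
    proof -
      have "rmap (d j) (red (d i ?w)) = red (d j (d i ?w))" using rmap_red[OF r(1)[of j]] dc[OF w] ij by simp
      also have "\<dots> = (\<lambda>_. 0)" using r(5)[of ?w j] w ij by (simp add: chi_zero)
      finally show ?thesis using TC by simp
    qed
    moreover have "h C = (\<lambda>_. 0)"
    proof -
      have "h C = red (f i (d i ?w))" unfolding h_def TC by (rule rmap_red[OF f(1) dc[OF w]])
      also have "\<dots> = red (e i (f (Suc i) ?w))" using f(3)[OF w] by simp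
      also have "\<dots> = (\<lambda>_. 0)" by (rule minimal[OF fc[OF w]])
      finally show ?thesis .
    qed
    ultimately show "C \<in> {C \<in> carrier M. h C = (\<lambda>_. 0)}"
      unfolding Msimp using Z_iff Dv(1)[OF W(1)] W(2) by blast
  next
    fix C assume "C \<in> {C \<in> carrier M. h C = (\<lambda>_. 0)}"
    then have C: "C \<in> Z" and hC: "h C = (\<lambda>_. 0)" unfolding Msimp by blast+
    let ?z = "lift (\<Theta> C)"
    have vf: "\<Theta> C \<in> finfun (X i)" by (rule T_fin[OF ZT[OF C]])
    have z: "?z \<in> carrier (FM (X i))" by (rule lift_carrier[OF vf])
    interpret FX: Module.module R "FM (X i)" by (rule mm)
    have "red (f i ?z) = (\<lambda>_. 0)" using hC by (simp add: h_def rmap_def)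
    then have gfz: "red (g i (f i ?z)) = (\<lambda>_. 0)" by (rule red_hom_zero[OF g(1) fc[OF z]])
    have gfc1: "g i (f i ?z) \<in> carrier (FM (X i))" by (rule gc[OF fc[OF z]])
    \<comment> \<open>On a cycle killed by \<open>h\<close> the homotopy formula reduces to minus
      the identity; the cycle is therefore a boundary, with preimage minus the reduction of
      \<open>s i ?z\<close>.\<close>
    have "red (d i (s i ?z)) = (\<lambda>x. - \<Theta> C x)"
    proof (cases i)
      case 0
      have "d i (s i ?z) = g i (f i ?z) \<ominus>\<^bsub>FM (X i)\<^esub> ?z" using s(2)[of ?z] z unfolding 0 by blast
      then show ?thesis using red_minus[OF gfc1 z] fun_cong[OF gfz] by (simp add: chi_phi)
    next
      case (Suc j)
      have zj: "?z \<in> carrier (FM (X (Suc j)))" using z Suc by simp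
      have "red (d j ?z) = (\<lambda>_. 0)" using Z_iff[of C] C Suc by (simp add: rmap_def)
      then have sd: "red (s j (d j ?z)) = (\<lambda>_. 0)" by (rule red_hom_zero[OF s(1) dc[OF zj]])
      have sdc: "s j (d j ?z) \<in> carrier (FM (X i))" using sc[OF dc[OF zj]] Suc by simp
      have "d i (s i ?z) = (g i (f i ?z) \<ominus>\<^bsub>FM (X i)\<^esub> ?z) \<ominus>\<^bsub>FM (X i)\<^esub> s j (d j ?z)"
        using s(3)[OF zj] unfolding Suc .
      then have "red (d i (s i ?z)) = (\<lambda>x. \<chi> ((g i (f i ?z) \<ominus>\<^bsub>FM (X i)\<^esub> ?z) x) - \<chi> (s j (d j ?z) x))"
        using red_minus[OF FX.minus_closed[OF gfc1 z] sdc] by simp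
      then show ?thesis using fun_cong[OF red_minus[OF gfc1 z]] fun_cong[OF gfz] fun_cong[OF sd] by (simp add: chi_phi)
    qed
    then have "rmap (d i) (red (s i ?z)) = (\<lambda>x. - \<Theta> C x)" using rmap_red[OF r(1) sc[OF z]] by simp
    then have 1: "rmap (d i) (\<lambda>x. (-1) * red (s i ?z) x) = \<Theta> C"
      using rmap_scale[OF r(1) red_finfun[OF sc[OF z]], of "-1"] by simp
    have "(\<lambda>x. (-1) * red (s i ?z) x) \<in> finfun (X (Suc i))"
      using red_finfun[OF sc[OF z]] by (simp add: finfun_def)
    then obtain W where W: "W \<in> carrier (TT (Suc i))" "\<Theta> W = (\<lambda>x. (-1) * red (s i ?z) x)" using T_surj by blast
    have "D i W = C" using Dv[OF W(1)] 1 W(2) ZT[OF C] by (intro inj_onD[OF T_inj[of i]]) auto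
    then show "C \<in> N" using W by (auto simp: N_def)
  qed
  have him: "h ` carrier M = finfun (Y i)"
  proof (intro equalityI subsetI)
    show "v \<in> finfun (Y i)" if "v \<in> h ` carrier M" for v
      using that ZT rmap_finfun[OF f(1)] T_fin unfolding Msimp h_def by blast
    fix v assume v: "v \<in> finfun (Y i)"
    let ?z = "lift v"
    have z: "?z \<in> carrier (FM (Y i))" by (rule lift_carrier[OF v])
    interpret FY: Module.module R "FM (Y i)" by (rule mm)
    obtain C where C: "C \<in> carrier (TT i)" "\<Theta> C = red (g i ?z)" using T_surj[OF red_finfun[OF gc[OF z]]] by blast
    have "rmap (d j) (\<Theta> C) = (\<lambda>_. 0)" if ij: "i = Suc j" for j
    proof -
      have zj: "?z \<in> carrier (FM (Y (Suc j)))" using z ij by simp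
      have "rmap (d j) (\<Theta> C) = red (d j (g i ?z))" unfolding C(2) using rmap_red[OF r(1)[of j]] gc[OF z] ij by simp
      also have "\<dots> = red (g j (e j ?z))" using g(3)[OF zj] ij by simp
      also have "\<dots> = (\<lambda>_. 0)" by (rule red_hom_zero[OF g(1) ec[OF zj] minimal[OF zj]])
      finally show ?thesis .
    qed
    then have CZ: "C \<in> Z" using Z_iff C by blast
    have fgcl: "f i (g i ?z) \<in> carrier (FM (Y i))" by (rule fc[OF gc[OF z]])
    have "red (f i (g i ?z)) = v"
    proof -
      \<comment> \<open>By minimality both homotopy terms reduce to zero, so the composite of the
        comparison maps reduces to the identity on \<open>Y i\<close>.\<close>
      have m0: "red (e i (s' i ?z)) = (\<lambda>_. 0)" by (rule minimal[OF sc'[OF z]])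
      show ?thesis
      proof (cases i)
        case 0
        have "e i (s' i ?z) = f i (g i ?z) \<ominus>\<^bsub>FM (Y i)\<^esub> ?z" using s'(2)[of ?z] z unfolding 0 by blast
        then have "(\<lambda>x. \<chi> (f i (g i ?z) x) - \<chi> (?z x)) = (\<lambda>_. 0)" using red_minus[OF fgcl z] m0 by simp
        then have "\<chi> (f i (g i ?z) x) - \<chi> (?z x) = 0" for x by (simp only: fun_eq_iff)
        then show ?thesis by (intro ext) (simp add: chi_phi)
      next
        case (Suc j)
        have zj: "?z \<in> carrier (FM (Y (Suc j)))" using z Suc by simp
        have sd: "red (s' j (e j ?z)) = (\<lambda>_. 0)" by (rule red_hom_zero[OF s'(1) ec[OF zj] minimal[OF zj]])
        have sdc: "s' j (e j ?z) \<in> carrier (FM (Y i))" using sc'[OF ec[OF zj]] Suc by simp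
        have "e i (s' i ?z) = (f i (g i ?z) \<ominus>\<^bsub>FM (Y i)\<^esub> ?z) \<ominus>\<^bsub>FM (Y i)\<^esub> s' j (e j ?z)"
          using s'(3)[OF zj] unfolding Suc .
        then have "(\<lambda>x. \<chi> ((f i (g i ?z) \<ominus>\<^bsub>FM (Y i)\<^esub> ?z) x) - \<chi> (s' j (e j ?z) x)) = (\<lambda>_. 0)"
          using red_minus[OF FY.minus_closed[OF fgcl z] sdc] m0 by simp
        then have "\<chi> ((f i (g i ?z) \<ominus>\<^bsub>FM (Y i)\<^esub> ?z) x) - \<chi> (s' j (e j ?z) x) = 0" for x by (simp only: fun_eq_iff)
        then have "\<chi> (f i (g i ?z) x) - v x = 0" for x
          using fun_cong[OF red_minus[OF fgcl z], of x] fun_cong[OF sd, of x] by (simp add: chi_phi)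
        then show ?thesis by (intro ext) simp
      qed
    qed
    then have "h C = v" unfolding h_def C(2) using rmap_red[OF f(1) gc[OF z]] by simp
    then show "v \<in> h ` carrier M" using CZ unfolding Msimp by blast
  qed
  interpret H: kernel_quotient M "carrier R" \<chi> h N
  proof (rule kernel_quotient.intro)
    show "h (C \<oplus>\<^bsub>M\<^esub> C') = (\<lambda>x. h C x + h C' x)" if "C \<in> carrier M" "C' \<in> carrier M" for C C'
      using that T_add[OF ZT ZT] rmap_add[OF f(1) T_fin[OF ZT] T_fin[OF ZT]] unfolding Msimp h_def by simp
    show "x \<odot>\<^bsub>M\<^esub> C \<in> carrier M \<and> h (x \<odot>\<^bsub>M\<^esub> C) = (\<lambda>y. \<chi> x * h C y)" if "x \<in> carrier R" "C \<in> carrier M" for x C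
      using that Z_smult T_smult[OF _ ZT] rmap_scale[OF f(1) T_fin[OF ZT]] unfolding Msimp h_def by simp
  qed (rule Mab Neq)+
  have hom: "homology TT D i = quot_module M N" by (simp add: homology_def M_def N_def Z_def)
  define V where "V = restrict_scalars \<phi> (quot_module M N)"
  have Vs: "carrier V = carrier (quot_module M N)" "\<zero>\<^bsub>V\<^esub> = \<zero>\<^bsub>quot_module M N\<^esub>"
    "C \<oplus>\<^bsub>V\<^esub> C' = C \<oplus>\<^bsub>quot_module M N\<^esub> C'" "c \<odot>\<^bsub>V\<^esub> C = \<phi> c \<odot>\<^bsub>quot_module M N\<^esub> C" for C C' c
    by (simp_all add: V_def restrict_scalars_def)
  have "vectorspace.dim class_ring V = card (Y i)"
  proof (rule dim_finfun[where \<Psi> = "coset_map h"])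
    show "finite (Y i)" by (rule fin)
    show "C \<oplus>\<^bsub>V\<^esub> C' \<in> carrier V \<and> coset_map h (C \<oplus>\<^bsub>V\<^esub> C') = (\<lambda>y. coset_map h C y + coset_map h C' y)"
      if "C \<in> carrier V" "C' \<in> carrier V" for C C' using that unfolding Vs by (rule H.map_add)
    show "c \<odot>\<^bsub>V\<^esub> C \<in> carrier V \<and> coset_map h (c \<odot>\<^bsub>V\<^esub> C) = (\<lambda>y. c * coset_map h C y)" if "C \<in> carrier V" for c C
      using H.map_smult[OF phi_closed, of C c] that unfolding Vs by (simp add: chi_phi)
    show "\<zero>\<^bsub>V\<^esub> \<in> carrier V" "coset_map h \<zero>\<^bsub>V\<^esub> = (\<lambda>_. 0)" unfolding Vs by (rule H.map_zero)+
    show "inj_on (coset_map h) (carrier V)" unfolding Vs by (rule H.map_inj)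
    show "coset_map h ` carrier V = finfun (Y i)" unfolding Vs H.map_image him ..
  qed
  then show ?thesis unfolding Tor hom V_def .
qed

end

section \<open>Linear resolutions from families of linear quotients\<close>

text \<open>The order on positions in Schreyer's construction, meant for paths of equal length. The
  newest step is at the head of a list, so comparing tails first gives priority to the oldest
  steps.\<close>

fun path_less :: "nat list \<Rightarrow> nat list \<Rightarrow> bool"
  where "path_less (i # v) (j # w) \<longleftrightarrow> path_less v w \<or> v = w \<and> i < j"
  | "path_less _ _ \<longleftrightarrow> False"

lemma path_less_irrefl: "\<not> path_less v v"
  by (induction v) auto

lemma path_less_trans: "path_less u v \<Longrightarrow> path_less v w \<Longrightarrow> path_less u w"
proof (induction u v arbitrary: w rule: path_less.induct)
  case (1 i v j w w')
  then show ?case by (cases w') auto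
qed auto

lemma path_less_total: "length v = length w \<Longrightarrow> v = w \<or> path_less v w \<or> path_less w v"
  by (induction v w rule: list_induct2) auto

lemma (in cring) finsum_free_apply:
  "finite A \<Longrightarrow> (\<And>v. v \<in> A \<Longrightarrow> f v \<in> carrier (free_module R X)) \<Longrightarrow>
    (\<Oplus>\<^bsub>free_module R X\<^esub>v\<in>A. f v) y = (\<Oplus>v\<in>A. f v y)"
proof (induction A rule: finite_induct)
  case empty
  interpret F: Module.module R "free_module R X" by (rule free_module_module)
  have "(\<Oplus>\<^bsub>free_module R X\<^esub>v\<in>{}. f v) = \<zero>\<^bsub>free_module R X\<^esub>" by (rule F.finsum_empty)
  then show ?case by simp
next
  case (insert v A)
  interpret F: Module.module R "free_module R X" by (rule free_module_module)
  have "(\<Oplus>\<^bsub>free_module R X\<^esub>v\<in>insert v A. f v) = f v \<oplus>\<^bsub>free_module R X\<^esub> (\<Oplus>\<^bsub>free_module R X\<^esub>v\<in>A. f v)"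
    using insert by (intro F.finsum_insert) auto
  then have "(\<Oplus>\<^bsub>free_module R X\<^esub>v\<in>insert v A. f v) y = f v y \<oplus> (\<Oplus>v\<in>A. f v y)" using insert by simp
  also have "\<dots> = (\<Oplus>v\<in>insert v A. f v y)"
    using insert by (intro finsum_insert[symmetric]) (auto intro: free_carrierD)
  finally show ?case .
qed

text \<open>The maps \<open>\<pi>1\<close> and \<open>\<pi>2\<close> stand for the projections to
  degrees one and two, and \<open>pi2_mult\<close> is the only trace of the grading on products. The
  label \<open>col l j\<close> is the end of the \<open>j\<close>-th edge leaving \<open>l\<close>
  in the graph whose paths index the bases.\<close>

locale linear_family = augmented R \<chi> \<phi> for R (structure) and \<chi> \<phi> +
  fixes R1 :: "'a set" and \<pi>1 \<pi>2 :: "'a \<Rightarrow> 'a"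
    and labs :: "'l set" and m0 :: 'l and gs :: "'l \<Rightarrow> 'a list" and col :: "'l \<Rightarrow> nat \<Rightarrow> 'l"
  assumes R1: "a \<in> R1 \<Longrightarrow> a \<in> carrier R \<and> \<chi> a = 0" and R1_zero: "\<zero> \<in> R1"
    and R1_minus: "a \<in> R1 \<Longrightarrow> b \<in> R1 \<Longrightarrow> a \<ominus> b \<in> R1"
    and pi1: "r \<in> carrier R \<Longrightarrow> \<pi>1 r \<in> R1" and pi1_id: "a \<in> R1 \<Longrightarrow> \<pi>1 a = a"
    and pi2_closed: "r \<in> carrier R \<Longrightarrow> \<pi>2 r \<in> carrier R"
    and pi2_add: "r \<in> carrier R \<Longrightarrow> s \<in> carrier R \<Longrightarrow> \<pi>2 (r \<oplus> s) = \<pi>2 r \<oplus> \<pi>2 s"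
    and pi2_mult: "a \<in> R1 \<Longrightarrow> r \<in> carrier R \<Longrightarrow> \<pi>2 (a \<otimes> r) = a \<otimes> \<pi>1 r"
    and m0: "m0 \<in> labs" and finite_labs: "finite labs"
    and gs: "l \<in> labs \<Longrightarrow> j < length (gs l) \<Longrightarrow> gs l ! j \<in> R1"
    and col: "l \<in> labs \<Longrightarrow> j < length (gs l) \<Longrightarrow> col l j \<in> labs"
    and colon: "l \<in> labs \<Longrightarrow> j < length (gs l) \<Longrightarrow> r \<in> carrier R \<Longrightarrow>
      (\<exists>c\<in>UNIV \<rightarrow> carrier R. r \<otimes> gs l ! j = (\<Oplus>i\<in>{..<j}. c i \<otimes> gs l ! i)) \<longleftrightarrow>
      (\<exists>c\<in>UNIV \<rightarrow> carrier R. r = (\<Oplus>i\<in>{..<length (gs (col l j))}. c i \<otimes> gs (col l j) ! i))"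
    and maximal: "r \<in> \<mm> \<Longrightarrow> \<exists>c\<in>UNIV \<rightarrow> carrier R. r = (\<Oplus>i\<in>{..<length (gs m0)}. c i \<otimes> gs m0 ! i)"
begin

abbreviation lin :: "'l \<Rightarrow> nat \<Rightarrow> 'a set"
  where "lin l n \<equiv> {r. \<exists>c\<in>UNIV \<rightarrow> carrier R. r = (\<Oplus>i\<in>{..<n}. c i \<otimes> gs l ! i)}"

fun lab :: "nat list \<Rightarrow> 'l" where "lab [] = m0" | "lab (j # w) = col (lab w) j"

fun paths :: "nat \<Rightarrow> nat list set"
  where "paths 0 = {[]}" | "paths (Suc n) = (\<Union>w\<in>paths n. (\<lambda>j. j # w) ` {..<length (gs (lab w))})"

lemma paths_Suc_iff: "v \<in> paths (Suc n) \<longleftrightarrow> (\<exists>j w. v = j # w \<and> w \<in> paths n \<and> j < length (gs (lab w)))"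
  by auto

lemma lab_labs: "w \<in> paths n \<Longrightarrow> lab w \<in> labs"
  by (induction n arbitrary: w) (auto simp: m0 col)

lemma finite_paths: "finite (paths n)"
  by (induction n) auto

lemma Cons_paths [simp]: "j # w \<in> paths (Suc n) \<longleftrightarrow> w \<in> paths n \<and> j < length (gs (lab w))"
  by auto

lemma length_paths: "w \<in> paths n \<Longrightarrow> length w = n"
  by (induction n arbitrary: w) auto

declare paths.simps(2) [simp del]

text \<open>The entry at \<open>w\<close> itself may vanish; the entries at \<open>w\<close> of the
  elements of a submodule with this property then form an ideal.\<close>

definition top_at :: "(nat list \<Rightarrow> 'a) \<Rightarrow> nat list \<Rightarrow> bool"
  where "top_at z w \<longleftrightarrow> (\<forall>v. path_less w v \<longrightarrow> z v = \<zero>)"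

definition lead :: "nat \<Rightarrow> (nat list \<Rightarrow> 'a) set \<Rightarrow> nat list \<Rightarrow> nat \<Rightarrow> (nat list \<Rightarrow> 'a) \<Rightarrow> bool"
  where "lead n Z w j z \<longleftrightarrow> z \<in> Z \<and> z w = gs (lab w) ! j \<and> top_at z w \<and> (\<forall>v. z v \<in> R1)"

text \<open>The invariant of the construction: the leading coefficients of the elements of \<open>Z\<close> with
  leading position \<open>w\<close> form the ideal with label \<open>lab w\<close>, whose generators lift to elements of
  \<open>Z\<close> with linear entries.\<close>

definition invar :: "nat \<Rightarrow> (nat list \<Rightarrow> 'a) set \<Rightarrow> bool"
  where "invar n Z \<longleftrightarrow> LinearCombinations.submodule R Z (FM (paths n)) \<and>
    (\<forall>z\<in>Z. \<forall>w\<in>paths n. top_at z w \<longrightarrow> z w \<in> lin (lab w) (length (gs (lab w)))) \<and>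
    (\<forall>w\<in>paths n. \<forall>j<length (gs (lab w)). \<exists>z. lead n Z w j z)"

definition column :: "nat \<Rightarrow> (nat list \<Rightarrow> 'a) set \<Rightarrow> nat list \<Rightarrow> nat list \<Rightarrow> 'a"
  where "column n Z v = (SOME z. lead n Z (tl v) (hd v) z)"

definition diff :: "nat \<Rightarrow> (nat list \<Rightarrow> 'a) set \<Rightarrow> (nat list \<Rightarrow> 'a) \<Rightarrow> nat list \<Rightarrow> 'a"
  where "diff n Z = free_lift R (FM (paths n)) (column n Z)"

definition syz :: "nat \<Rightarrow> (nat list \<Rightarrow> 'a) set \<Rightarrow> (nat list \<Rightarrow> 'a) set"
  where "syz n Z = {u \<in> carrier (FM (paths (Suc n))). diff n Z u = \<zero>\<^bsub>FM (paths n)\<^esub>}"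

lemma submodule_minus:
  assumes Z: "LinearCombinations.submodule R Z (FM X)" and "u \<in> Z" "v \<in> Z"
  shows "u \<ominus>\<^bsub>FM X\<^esub> v \<in> Z"
proof -
  interpret F: Module.module R "FM X" by (rule free_module_module)
  interpret Z: LinearCombinations.submodule R Z "FM X" by (rule Z)
  have c: "u \<in> carrier (FM X)" "v \<in> carrier (FM X)" using assms Z.subset by blast+
  have "(\<ominus> \<one>) \<odot>\<^bsub>FM X\<^esub> v \<in> Z" using assms by (intro Z.smult_closed) auto
  then have "\<ominus>\<^bsub>FM X\<^esub> v \<in> Z" unfolding F.smult_l_minus[OF one_closed c(2)] F.smult_one[OF c(2)] .
  then show ?thesis unfolding a_minus_def by (rule Z.m_closed[OF assms(2)])
qed

context
  fixes n Z assumes invar: "invar n Z"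
begin

lemma Z_sub: "LinearCombinations.submodule R Z (FM (paths n))" using invar by (simp add: invar_def)

lemma Z_carrier: "z \<in> Z \<Longrightarrow> z \<in> carrier (FM (paths n))"
  using LinearCombinations.submodule.subset[OF Z_sub] by blast

lemma column: "j # w \<in> paths (Suc n) \<Longrightarrow> lead n Z w j (column n Z (j # w))"
  unfolding column_def list.sel using invar by (intro someI_ex[of "lead n Z w j"]) (simp add: invar_def)

lemma column_carrier: "v \<in> paths (Suc n) \<Longrightarrow> column n Z v \<in> carrier (FM (paths n))"
  using column Z_carrier by (cases v) (auto simp: lead_def paths_Suc_iff)

lemma column_R1: "v \<in> paths (Suc n) \<Longrightarrow> column n Z v w \<in> R1"
  using column by (cases v) (auto simp: lead_def paths_Suc_iff)

lemma diff_hom: "diff n Z \<in> mhom R (FM (paths (Suc n))) (FM (paths n))"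
  unfolding diff_def by (rule free_lift_hom[OF free_module_module column_carrier])

lemma diff_apply:
  assumes u: "u \<in> carrier (FM (paths (Suc n)))"
  shows "diff n Z u w = (\<Oplus>v\<in>paths (Suc n). u v \<otimes> column n Z v w)"
proof -
  interpret F: Module.module R "FM (paths n)" by (rule free_module_module)
  have "diff n Z u = (\<Oplus>\<^bsub>FM (paths n)\<^esub>v\<in>paths (Suc n). u v \<odot>\<^bsub>FM (paths n)\<^esub> column n Z v)"
    unfolding diff_def using u
    by (intro free_lift_superset[OF free_module_module column_carrier u finite_paths])
      (simp_all add: free_carrier_iff, blast)
  then have "diff n Z u w = (\<Oplus>v\<in>paths (Suc n). (u v \<odot>\<^bsub>FM (paths n)\<^esub> column n Z v) w)"
    using F.smult_closed[OF free_carrierD[OF u] column_carrier] finite_paths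
    by (simp only:) (rule finsum_free_apply; simp)
  then show ?thesis by simp
qed

lemma diff_apply_subset:
  assumes u: "u \<in> carrier (FM (paths (Suc n)))" and A: "A \<subseteq> paths (Suc n)"
    "\<And>v. v \<in> paths (Suc n) \<Longrightarrow> v \<notin> A \<Longrightarrow> u v = \<zero> \<or> column n Z v w = \<zero>"
  shows "diff n Z u w = (\<Oplus>v\<in>A. u v \<otimes> column n Z v w)"
  unfolding diff_apply[OF u]
proof (rule add.finprod_mono_neutral_cong_right)
  show "(\<lambda>v. u v \<otimes> column n Z v w) \<in> paths (Suc n) \<rightarrow> carrier R"
    using free_carrierD[OF u] free_carrierD[OF column_carrier] by auto
  fix v assume v: "v \<in> paths (Suc n) - A"
  then show "u v \<otimes> column n Z v w = \<zero>"
    using A(2)[of v] free_carrierD[OF u, of v] free_carrierD[OF column_carrier, of v w] by auto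
qed (use A finite_paths in auto)

lemma diff_fiber:
  assumes u: "u \<in> carrier (FM (paths (Suc n)))" and w: "w \<in> paths n" and k: "k \<le> length (gs (lab w))"
    and z: "\<And>v. v \<in> paths (Suc n) \<Longrightarrow> \<not> (\<exists>j<k. v = j # w) \<Longrightarrow> u v = \<zero> \<or> column n Z v y = \<zero>"
  shows "diff n Z u y = (\<Oplus>j\<in>{..<k}. u (j # w) \<otimes> column n Z (j # w) y)"
proof -
  let ?A = "(\<lambda>j. j # w) ` {..<k}"
  have A: "?A \<subseteq> paths (Suc n)" using w k by auto
  have "diff n Z u y = (\<Oplus>v\<in>?A. u v \<otimes> column n Z v y)" using z by (intro diff_apply_subset[OF u A]) auto
  also have "\<dots> = (\<Oplus>j\<in>{..<k}. u (j # w) \<otimes> column n Z (j # w) y)"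
    using A free_carrierD[OF u] free_carrierD[OF column_carrier]
    by (intro add.finprod_reindex) (simp_all add: inj_on_def Pi_def subset_iff del: Cons_paths)
  finally show ?thesis .
qed

lemma diff_in_Z:
  assumes u: "u \<in> carrier (FM (paths (Suc n)))" shows "diff n Z u \<in> Z"
  using u
proof (induction u rule: free_induct[where I = UNIV])
  case zero
  have "diff n Z \<zero>\<^bsub>FM (paths (Suc n))\<^esub> = \<zero>\<^bsub>FM (paths n)\<^esub>" by (rule mhom_zero[OF free_module_module free_module_module diff_hom])
  then show ?case using LinearCombinations.submodule.zero_closed[OF Z_sub] by simp
next
  case (step v x r)
  interpret F: Module.module R "FM (paths (Suc n))" by (rule free_module_module)
  interpret Z: LinearCombinations.submodule R Z "FM (paths n)" by (rule Z_sub)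
  have b: "free_basis R x \<in> carrier (FM (paths (Suc n)))" by (rule free_basis_carrier[OF step(2)])
  have "diff n Z (free_basis R x) = column n Z x"
    unfolding diff_def
    by (rule free_lift_basis[of "FM (paths n)" "column n Z" x, OF free_module_module column_carrier[OF step(2)]])
  then have "diff n Z (free_basis R x) \<in> Z" using column step(2) by (cases x) (auto simp: lead_def paths_Suc_iff)
  then show ?case
    unfolding mhom_add[OF diff_hom step(1) F.smult_closed[OF step(3) b]] mhom_smult[OF diff_hom step(3) b]
    using step by (intro Z.m_closed Z.smult_closed)
qed simp

text \<open>Leading terms are cancelled from the top: at the largest position of \<open>S\<close>
  the entry is a combination of the generators, hence matched by columns led there, and the
  difference lives on a smaller set. The bound on \<open>tl v\<close> makes this a standard
  representation in the sense of Groebner bases.\<close>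

lemma generates:
  assumes "S \<subseteq> paths n" "\<And>v w. w \<in> S \<Longrightarrow> v \<in> paths n \<Longrightarrow> path_less v w \<Longrightarrow> v \<in> S"
    "z \<in> Z" "\<And>w. w \<notin> S \<Longrightarrow> z w = \<zero>"
  shows "\<exists>u\<in>carrier (FM (paths (Suc n))). diff n Z u = z \<and> (\<forall>v. u v \<noteq> \<zero> \<longrightarrow> tl v \<in> S)"
  using assms
proof (induction "card S" arbitrary: S z)
  case 0
  then have "S = {}" using finite_subset[OF _ finite_paths] by auto
  then have "z = \<zero>\<^bsub>FM (paths n)\<^esub>" using 0 by auto
  moreover have "diff n Z \<zero>\<^bsub>FM (paths (Suc n))\<^esub> = \<zero>\<^bsub>FM (paths n)\<^esub>" by (rule mhom_zero[OF free_module_module free_module_module diff_hom])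
  ultimately show ?case by (intro bexI[of _ "\<zero>\<^bsub>FM (paths (Suc n))\<^esub>"]) (auto simp: free_carrier_iff)
next
  case (Suc m)
  note S = Suc.prems(1,2) and z = Suc.prems(3,4)
  interpret F: Module.module R "FM (paths n)" by (rule free_module_module)
  interpret F': Module.module R "FM (paths (Suc n))" by (rule free_module_module)
  have finS: "finite S" using finite_subset[OF S(1) finite_paths] .
  have "\<exists>w\<in>S. \<forall>v\<in>S. \<not> path_less w v"
  proof (rule ccontr)
    assume "\<not> (\<exists>w\<in>S. \<forall>v\<in>S. \<not> path_less w v)"
    then have h: "\<forall>w\<in>S. \<exists>v\<in>S. path_less w v" by blast
    have "wf {(v, w). v \<in> S \<and> w \<in> S \<and> path_less w v}"
    proof (rule finite_acyclic_wf)
      show "finite {(v, w). v \<in> S \<and> w \<in> S \<and> path_less w v}"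
        by (rule finite_subset[of _ "S \<times> S"]) (use finS in auto)
      have "trans {(v, w). v \<in> S \<and> w \<in> S \<and> path_less w v}" by (auto simp: trans_def intro: path_less_trans)
      then show "acyclic {(v, w). v \<in> S \<and> w \<in> S \<and> path_less w v}"
        by (auto simp: acyclic_def trancl_id path_less_irrefl)
    qed
    moreover have "S \<noteq> {}" using Suc(2) by auto
    ultimately obtain w where "w \<in> S" "\<And>v. (v, w) \<in> {(v, w). v \<in> S \<and> w \<in> S \<and> path_less w v} \<Longrightarrow> v \<notin> S"
      using wfE_min'[of "{(v, w). v \<in> S \<and> w \<in> S \<and> path_less w v}" S] by blast
    then show False using h by blast
  qed
  then obtain w where w: "w \<in> S" "\<And>v. v \<in> S \<Longrightarrow> \<not> path_less w v" by blast
  have wn: "w \<in> paths n" using w S by auto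
  have out: "path_less w v" if "v \<in> paths n" "v \<notin> S" for v
    using path_less_total[of w v] length_paths[OF wn] length_paths[OF that(1)] that w S(2)[OF w(1) that(1)] by auto
  have "top_at z w" unfolding top_at_def using z(2) w(2) by blast
  then have "z w \<in> lin (lab w) (length (gs (lab w)))" using invar z wn by (auto simp: invar_def)
  then obtain c where c: "c \<in> UNIV \<rightarrow> carrier R" "z w = (\<Oplus>i\<in>{..<length (gs (lab w))}. c i \<otimes> gs (lab w) ! i)"
    by auto
  define u0 where "u0 = (\<lambda>v. if v \<in> paths (Suc n) \<and> tl v = w then c (hd v) else \<zero>)"
  have u0: "u0 \<in> carrier (FM (paths (Suc n)))"
    unfolding free_carrier_iff using c finite_paths by (auto simp: u0_def intro: finite_subset[OF _ finite_paths])
  have du0: "diff n Z u0 y = (\<Oplus>j\<in>{..<length (gs (lab w))}. u0 (j # w) \<otimes> column n Z (j # w) y)" for y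
  proof (rule diff_fiber[OF u0 wn])
    fix v assume "v \<in> paths (Suc n)" "\<not> (\<exists>j<length (gs (lab w)). v = j # w)"
    then show "u0 v = \<zero> \<or> column n Z v y = \<zero>" unfolding paths_Suc_iff u0_def by auto
  qed simp
  have du0w: "diff n Z u0 w = z w"
    unfolding du0 c(2)
  proof (rule finsum_cong')
    fix j assume "j \<in> {..<length (gs (lab w))}"
    then have j: "j # w \<in> paths (Suc n)" using wn by auto
    then show "u0 (j # w) \<otimes> column n Z (j # w) w = c j \<otimes> gs (lab w) ! j"
      using column[OF j] by (simp add: u0_def lead_def)
  qed (use c gs[OF lab_labs[OF wn]] R1 in auto)
  have du0o: "diff n Z u0 y = \<zero>" if "path_less w y" for y
  proof -
    have "u0 (j # w) \<otimes> column n Z (j # w) y = \<zero>" if "j \<in> {..<length (gs (lab w))}" for j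
      using column[of j w] that \<open>path_less w y\<close> wn free_carrierD[OF u0] by (auto simp: lead_def top_at_def)
    then show ?thesis unfolding du0 by (intro add.finprod_one_eqI) auto
  qed
  have zc: "z \<in> carrier (FM (paths n))" by (rule Z_carrier[OF z(1)])
  have du0c: "diff n Z u0 \<in> carrier (FM (paths n))" by (rule mhom_closed[OF diff_hom u0])
  define z' where "z' = z \<ominus>\<^bsub>FM (paths n)\<^esub> diff n Z u0"
  have z'Z: "z' \<in> Z" unfolding z'_def by (rule submodule_minus[OF Z_sub z(1) diff_in_Z[OF u0]])
  have z'v: "z' v = z v \<ominus> diff n Z u0 v" for v unfolding z'_def free_minus[OF zc du0c] ..
  have z'0: "z' v = \<zero>" if "v \<notin> S - {w}" for v
  proof (cases "v = w")
    case True
    show ?thesis unfolding z'v du0w True by (rule minus_self[OF free_carrierD[OF zc]])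
  next
    case False
    then have vS: "v \<notin> S" using that by auto
    have "diff n Z u0 v = \<zero>"
      using du0o[OF out[OF _ vS]] du0c by (cases "v \<in> paths n") (auto simp: free_carrier_iff)
    then show ?thesis unfolding z'v z(2)[OF vS] by (simp add: a_minus_def)
  qed
  have "m = card (S - {w})" using Suc(2) finS w by simp
  then have "\<exists>u\<in>carrier (FM (paths (Suc n))). diff n Z u = z' \<and> (\<forall>v. u v \<noteq> \<zero> \<longrightarrow> tl v \<in> S - {w})"
  proof (rule Suc.hyps(1))
    show "v \<in> S - {w}" if "w' \<in> S - {w}" "v \<in> paths n" "path_less v w'" for v w' using S(2) that w by blast
    show "z' v = \<zero>" if "v \<notin> S - {w}" for v by (rule z'0[OF that])
  qed (use S z'Z in auto)
  then obtain u' where u': "u' \<in> carrier (FM (paths (Suc n)))" "diff n Z u' = z'" "\<And>v. u' v \<noteq> \<zero> \<Longrightarrow> tl v \<in> S - {w}" by blast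
  show ?case
  proof (intro bexI conjI allI impI)
    show "u' \<oplus>\<^bsub>FM (paths (Suc n))\<^esub> u0 \<in> carrier (FM (paths (Suc n)))" by (rule F'.add.m_closed[OF u'(1) u0])
    show "diff n Z (u' \<oplus>\<^bsub>FM (paths (Suc n))\<^esub> u0) = z"
      unfolding mhom_add[OF diff_hom u'(1) u0] u'(2) z'_def free_minus[OF zc du0c]
      using free_carrierD[OF zc] free_carrierD[OF du0c] by (auto simp: a_minus_def a_assoc l_neg)
    fix v assume h: "(u' \<oplus>\<^bsub>FM (paths (Suc n))\<^esub> u0) v \<noteq> \<zero>"
    show "tl v \<in> S"
    proof (rule ccontr)
      assume "tl v \<notin> S"
      then have "u' v = \<zero>" "u0 v = \<zero>" using u'(3)[of v] w by (auto simp: u0_def)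
      then show False using h by simp
    qed
  qed
qed

lemma pi2_finsum:
  "finite A \<Longrightarrow> f \<in> A \<rightarrow> carrier R \<Longrightarrow> \<pi>2 (\<Oplus>v\<in>A. f v) = (\<Oplus>v\<in>A. \<pi>2 (f v))"
proof (induction A rule: finite_induct)
  case empty
  have "\<pi>2 \<zero> = \<zero> \<otimes> \<pi>1 \<zero>" using pi2_mult[OF R1_zero zero_closed] by simp
  then show ?case using pi1_id[OF R1_zero] by simp
next
  case (insert a A)
  then have "\<pi>2 (\<Oplus>v\<in>insert a A. f v) = \<pi>2 (f a) \<oplus> \<pi>2 (\<Oplus>v\<in>A. f v)"
    by (simp add: pi2_add Pi_def)
  then show ?case using insert pi2_closed by (simp add: Pi_def)
qed

lemma pi2_R1_mult: "a \<in> R1 \<Longrightarrow> b \<in> R1 \<Longrightarrow> \<pi>2 (a \<otimes> b) = a \<otimes> b"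
  using pi2_mult[of a b] R1 pi1_id by simp

lemma pi1_zero: "\<pi>1 \<zero> = \<zero>"
  by (rule pi1_id[OF R1_zero])

text \<open>The columns have entries in \<open>R1\<close>, so passing to the degree one part of the
  coefficients means passing to the degree two part of the result.\<close>

lemma diff_pi:
  assumes u: "u \<in> carrier (FM (paths (Suc n)))"
  shows "(\<lambda>v. \<pi>1 (u v)) \<in> carrier (FM (paths (Suc n)))" "diff n Z (\<lambda>v. \<pi>1 (u v)) w = \<pi>2 (diff n Z u w)"
proof -
  have uz: "u v = \<zero>" if "v \<notin> paths (Suc n)" for v using u that by (simp add: free_carrier_iff)
  show c: "(\<lambda>v. \<pi>1 (u v)) \<in> carrier (FM (paths (Suc n)))"
    unfolding free_carrier_iff
  proof (intro conjI ballI allI impI)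
    show "\<pi>1 (u v) \<in> carrier R" for v using R1[OF pi1[OF free_carrierD[OF u]]] by blast
    show "\<pi>1 (u v) = \<zero>" if "v \<notin> paths (Suc n)" for v using uz[OF that] pi1_zero by simp
    have "{v. \<pi>1 (u v) \<noteq> \<zero>} \<subseteq> paths (Suc n)" using uz pi1_zero by fastforce
    then show "finite {v. \<pi>1 (u v) \<noteq> \<zero>}" by (rule finite_subset[OF _ finite_paths])
  qed
  have colc: "column n Z v w \<in> carrier R" if "v \<in> paths (Suc n)" for v using R1[OF column_R1[OF that]] by blast
  have "\<pi>2 (diff n Z u w) = (\<Oplus>v\<in>paths (Suc n). \<pi>2 (u v \<otimes> column n Z v w))"
    unfolding diff_apply[OF u] using free_carrierD[OF u] colc by (intro pi2_finsum finite_paths) auto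
  also have "\<dots> = (\<Oplus>v\<in>paths (Suc n). \<pi>1 (u v) \<otimes> column n Z v w)"
  proof (rule finsum_cong')
    show "(\<lambda>v. \<pi>1 (u v) \<otimes> column n Z v w) \<in> paths (Suc n) \<rightarrow> carrier R"
      using free_carrierD[OF c] colc by auto
    fix v assume v: "v \<in> paths (Suc n)"
    have "\<pi>2 (u v \<otimes> column n Z v w) = \<pi>2 (column n Z v w \<otimes> u v)" using free_carrierD[OF u] colc[OF v] by (simp add: m_comm)
    also have "\<dots> = column n Z v w \<otimes> \<pi>1 (u v)" by (rule pi2_mult[OF column_R1[OF v] free_carrierD[OF u]])
    also have "\<dots> = \<pi>1 (u v) \<otimes> column n Z v w" using free_carrierD[OF c] colc[OF v] by (simp add: m_comm)
    finally show "\<pi>2 (u v \<otimes> column n Z v w) = \<pi>1 (u v) \<otimes> column n Z v w" .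
  qed simp
  finally show "diff n Z (\<lambda>v. \<pi>1 (u v)) w = \<pi>2 (diff n Z u w)" unfolding diff_apply[OF c] by simp
qed

lemma syz_submodule: "LinearCombinations.submodule R (syz n Z) (FM (paths (Suc n)))"
proof (rule LinearCombinations.submodule.intro)
  interpret F: Module.module R "FM (paths n)" by (rule free_module_module)
  interpret F': Module.module R "FM (paths (Suc n))" by (rule free_module_module)
  show "Module.module R (FM (paths (Suc n)))" by (rule free_module_module)
  show "syz n Z \<subseteq> carrier (FM (paths (Suc n)))" unfolding syz_def by blast
  show "\<zero>\<^bsub>FM (paths (Suc n))\<^esub> \<in> syz n Z"
    unfolding syz_def using F'.zero_closed mhom_zero[OF free_module_module free_module_module diff_hom] by blast
  show "u \<oplus>\<^bsub>FM (paths (Suc n))\<^esub> v \<in> syz n Z" if "u \<in> syz n Z" "v \<in> syz n Z" for u v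
  proof -
    have c: "u \<in> carrier (FM (paths (Suc n)))" "v \<in> carrier (FM (paths (Suc n)))"
      "diff n Z u = \<zero>\<^bsub>FM (paths n)\<^esub>" "diff n Z v = \<zero>\<^bsub>FM (paths n)\<^esub>" using that by (auto simp: syz_def)
    have "diff n Z (u \<oplus>\<^bsub>FM (paths (Suc n))\<^esub> v) = \<zero>\<^bsub>FM (paths n)\<^esub>"
      unfolding mhom_add[OF diff_hom c(1,2)] c(3,4) by (rule F.r_zero[OF F.zero_closed])
    then show ?thesis unfolding syz_def using F'.add.m_closed[OF c(1,2)] by blast
  qed
  show "r \<odot>\<^bsub>FM (paths (Suc n))\<^esub> u \<in> syz n Z" if "r \<in> carrier R" "u \<in> syz n Z" for r u
  proof -
    have c: "u \<in> carrier (FM (paths (Suc n)))" "diff n Z u = \<zero>\<^bsub>FM (paths n)\<^esub>" using that by (auto simp: syz_def)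
    have "diff n Z (r \<odot>\<^bsub>FM (paths (Suc n))\<^esub> u) = \<zero>\<^bsub>FM (paths n)\<^esub>"
      unfolding mhom_smult[OF diff_hom that(1) c(1)] c(2) by (rule F.smult_r_null[OF that(1)])
    then show ?thesis unfolding syz_def using F'.smult_closed[OF that(1) c(1)] by blast
  qed
qed

text \<open>At the position \<open>w\<close> only the columns \<open>i # w\<close> with
  \<open>i \<le> j\<close> contribute: smaller tails have columns led below \<open>w\<close>, and at
  larger paths \<open>u\<close> vanishes. The vanishing entry at \<open>w\<close> thus puts
  \<open>u v\<close> into the colon ideal.\<close>

lemma syz_leading:
  assumes u: "u \<in> syz n Z" and v: "v \<in> paths (Suc n)" and top: "top_at u v"
  shows "u v \<in> lin (lab v) (length (gs (lab v)))"
proof -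
  obtain j w where vw: "v = j # w" and w: "w \<in> paths n" and j: "j < length (gs (lab w))" using v paths_Suc_iff by auto
  have uc: "u \<in> carrier (FM (paths (Suc n)))" and d0: "diff n Z u w = \<zero>" using u by (auto simp: syz_def)
  have z: "u v' = \<zero> \<or> column n Z v' w = \<zero>" if v': "v' \<in> paths (Suc n)" "\<not> (\<exists>i<Suc j. v' = i # w)" for v'
  proof -
    obtain i w' where i: "v' = i # w'" "w' \<in> paths n" using v'(1) paths_Suc_iff by auto
    have "w' = w \<or> path_less w' w \<or> path_less w w'"
      using path_less_total[of w' w] length_paths[OF w] length_paths[OF i(2)] by auto
    then consider "path_less w' w" | "path_less v v'"
      using v'(2) i(1) vw by (auto simp: less_Suc_eq_le not_le)
    then show ?thesis
    proof cases
      case 1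
      then show ?thesis using column v'(1) unfolding i(1) by (auto simp: lead_def top_at_def)
    qed (use top in \<open>auto simp: top_at_def\<close>)
  qed
  have gc: "gs (lab w) ! i \<in> carrier R" if "i \<le> j" for i using gs[OF lab_labs[OF w]] j R1 that by simp
  have "\<zero> = (\<Oplus>i\<in>{..<Suc j}. u (i # w) \<otimes> column n Z (i # w) w)"
    using diff_fiber[OF uc w _ z] d0 j by simp
  also have "\<dots> = (\<Oplus>i\<in>{..<Suc j}. u (i # w) \<otimes> gs (lab w) ! i)"
  proof (rule finsum_cong')
    fix i assume "i \<in> {..<Suc j}"
    then have "i # w \<in> paths (Suc n)" using w j by auto
    from column[OF this] show "u (i # w) \<otimes> column n Z (i # w) w = u (i # w) \<otimes> gs (lab w) ! i" by (simp add: lead_def)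
  qed (use gc free_carrierD[OF uc] in auto)
  also have "\<dots> = u v \<otimes> gs (lab w) ! j \<oplus> (\<Oplus>i\<in>{..<j}. u (i # w) \<otimes> gs (lab w) ! i)"
    unfolding vw lessThan_Suc using gc free_carrierD[OF uc] by (intro finsum_insert) auto
  finally have e: "u v \<otimes> gs (lab w) ! j \<oplus> (\<Oplus>i\<in>{..<j}. u (i # w) \<otimes> gs (lab w) ! i) = \<zero>" by simp
  have "(\<Oplus>i\<in>{..<j}. (\<ominus> u (i # w)) \<otimes> gs (lab w) ! i) = \<ominus> (\<Oplus>i\<in>{..<j}. u (i # w) \<otimes> gs (lab w) ! i)"
  proof -
    have "(\<Oplus>i\<in>{..<j}. (\<ominus> \<one>) \<otimes> (u (i # w) \<otimes> gs (lab w) ! i)) = (\<ominus> \<one>) \<otimes> (\<Oplus>i\<in>{..<j}. u (i # w) \<otimes> gs (lab w) ! i)"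
      using gc free_carrierD[OF uc] by (intro finsum_rdistr[symmetric]) auto
    moreover have "(\<Oplus>i\<in>{..<j}. (\<ominus> \<one>) \<otimes> (u (i # w) \<otimes> gs (lab w) ! i)) = (\<Oplus>i\<in>{..<j}. (\<ominus> u (i # w)) \<otimes> gs (lab w) ! i)"
      using gc free_carrierD[OF uc] by (intro finsum_cong') (auto simp: l_minus)
    moreover have "(\<Oplus>i\<in>{..<j}. u (i # w) \<otimes> gs (lab w) ! i) \<in> carrier R"
      using gc free_carrierD[OF uc] by (intro finsum_closed) auto
    ultimately show ?thesis by (simp add: l_minus)
  qed
  moreover have "u v \<otimes> gs (lab w) ! j = \<ominus> (\<Oplus>i\<in>{..<j}. u (i # w) \<otimes> gs (lab w) ! i)"
    using minus_equality[OF e] gc free_carrierD[OF uc] by (auto intro!: finsum_closed)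
  ultimately have "u v \<otimes> gs (lab w) ! j = (\<Oplus>i\<in>{..<j}. (\<ominus> u (i # w)) \<otimes> gs (lab w) ! i)" by simp
  moreover have "(\<lambda>i. \<ominus> u (i # w)) \<in> UNIV \<rightarrow> carrier R" using free_carrierD[OF uc] by auto
  ultimately have "\<exists>c\<in>UNIV \<rightarrow> carrier R. u v \<otimes> gs (lab w) ! j = (\<Oplus>i\<in>{..<j}. c i \<otimes> gs (lab w) ! i)"
    by (intro bexI[of _ "\<lambda>i. \<ominus> u (i # w)"])
  then show ?thesis using colon[OF lab_labs[OF w] j free_carrierD[OF uc]] vw by simp
qed

text \<open>A generator of the colon ideal gives a combination of columns over \<open>w\<close>
  whose leading entries cancel. What remains is expressed by columns over smaller positions, and the
  difference of the two expressions is a syzygy led by the generator.\<close>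

lemma syz_lead:
  assumes v: "v \<in> paths (Suc n)" and k: "k < length (gs (lab v))"
  shows "\<exists>t. lead (Suc n) (syz n Z) v k t"
proof -
  interpret F: Module.module R "FM (paths n)" by (rule free_module_module)
  interpret F': Module.module R "FM (paths (Suc n))" by (rule free_module_module)
  obtain j w where vw: "v = j # w" and w: "w \<in> paths n" and j: "j < length (gs (lab w))" using v paths_Suc_iff by auto
  let ?g = "gs (lab v) ! k"
  have gR1: "?g \<in> R1" by (rule gs[OF lab_labs[OF v] k])
  have gc: "?g \<in> carrier R" using R1[OF gR1] by blast
  have glc: "gs (lab v) ! i \<in> carrier R" if "i < length (gs (lab v))" for i using R1[OF gs[OF lab_labs[OF v] that]] by blast
  have gwR1: "gs (lab w) ! i \<in> R1" if "i \<le> j" for i using gs[OF lab_labs[OF w]] j that by simp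
  have gwc: "gs (lab w) ! i \<in> carrier R" if "i \<le> j" for i using R1[OF gwR1[OF that]] by blast
  have "?g = (\<Oplus>i\<in>{..<length (gs (lab v))}. (if i = k then \<one> else \<zero>) \<otimes> gs (lab v) ! i)"
  proof -
    have "(\<Oplus>i\<in>{..<length (gs (lab v))}. (if i = k then \<one> else \<zero>) \<otimes> gs (lab v) ! i) =
      (\<Oplus>i\<in>{..<length (gs (lab v))}. if k = i then gs (lab v) ! i else \<zero>)"
      using glc by (intro finsum_cong') auto
    also have "\<dots> = ?g" using k glc by (intro add.finprod_singleton) auto
    finally show ?thesis by simp
  qed
  moreover have "(\<lambda>i. if i = k then \<one> else \<zero>) \<in> UNIV \<rightarrow> carrier R" by auto
  ultimately have "\<exists>c\<in>UNIV \<rightarrow> carrier R. ?g = (\<Oplus>i\<in>{..<length (gs (lab v))}. c i \<otimes> gs (lab v) ! i)"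
    by (rule bexI[of "\<lambda>c. ?g = (\<Oplus>i\<in>{..<length (gs (lab v))}. c i \<otimes> gs (lab v) ! i)"])
  then have "\<exists>c\<in>UNIV \<rightarrow> carrier R. ?g = (\<Oplus>i\<in>{..<length (gs (col (lab w) j))}. c i \<otimes> gs (col (lab w) j) ! i)"
    by (simp only: vw lab.simps)
  then obtain c where c: "c \<in> UNIV \<rightarrow> carrier R" "?g \<otimes> gs (lab w) ! j = (\<Oplus>i\<in>{..<j}. c i \<otimes> gs (lab w) ! i)"
    using colon[OF lab_labs[OF w] j gc] by blast
  \<comment> \<open>The coefficients of the colon relation are cut down to degree one; as the left
    side has degree two, the relation persists.\<close>
  define a where "a i = \<pi>1 (c i)" for i
  have aR1: "a i \<in> R1" for i unfolding a_def using c by (intro pi1) auto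
  have ac: "a i \<in> carrier R" for i using R1[OF aR1] by blast
  have eq: "?g \<otimes> gs (lab w) ! j = (\<Oplus>i\<in>{..<j}. a i \<otimes> gs (lab w) ! i)"
  proof -
    have "?g \<otimes> gs (lab w) ! j = \<pi>2 (?g \<otimes> gs (lab w) ! j)" using pi2_R1_mult[OF gR1 gwR1] by simp
    also have "\<dots> = (\<Oplus>i\<in>{..<j}. \<pi>2 (c i \<otimes> gs (lab w) ! i))"
      unfolding c(2) using c(1) gwc by (intro pi2_finsum) (auto intro!: m_closed)
    also have "\<dots> = (\<Oplus>i\<in>{..<j}. a i \<otimes> gs (lab w) ! i)"
    proof (rule finsum_cong')
      fix i assume "i \<in> {..<j}"
      then have i: "i \<le> j" by simp
      have cc: "c i \<in> carrier R" using c by auto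
      have "\<pi>2 (c i \<otimes> gs (lab w) ! i) = \<pi>2 (gs (lab w) ! i \<otimes> c i)" using cc gwc[OF i] by (simp add: m_comm)
      also have "\<dots> = a i \<otimes> gs (lab w) ! i"
        using pi2_mult[OF gwR1[OF i] cc] gwc[OF i] ac by (simp add: a_def m_comm)
      finally show "\<pi>2 (c i \<otimes> gs (lab w) ! i) = a i \<otimes> gs (lab w) ! i" .
    qed (use ac gwc in auto)
    finally show ?thesis .
  qed
  define u1 where "u1 = (\<lambda>v'. if v' \<in> paths (Suc n) \<and> tl v' = w then
    (if hd v' = j then ?g else if hd v' < j then \<ominus> a (hd v') else \<zero>) else \<zero>)"
  have na: "\<ominus> a i \<in> R1" for i using R1_minus[OF R1_zero aR1[of i]] ac[of i] by (simp add: a_minus_def)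
  have u1R1: "u1 v' \<in> R1" for v' using gR1 na R1_zero by (simp add: u1_def)
  have u1: "u1 \<in> carrier (FM (paths (Suc n)))"
    unfolding free_carrier_iff
  proof (intro conjI ballI allI impI)
    show "u1 x \<in> carrier R" for x using R1[OF u1R1] by blast
    have "{x. u1 x \<noteq> \<zero>} \<subseteq> paths (Suc n)" by (auto simp: u1_def)
    then show "finite {x. u1 x \<noteq> \<zero>}" by (rule finite_subset[OF _ finite_paths])
  qed (simp add: u1_def)
  have u1v: "u1 v = ?g" using v vw by (simp add: u1_def)
  define y where "y = diff n Z u1"
  have yZ: "y \<in> Z" unfolding y_def by (rule diff_in_Z[OF u1])
  have yc: "y \<in> carrier (FM (paths n))" by (rule Z_carrier[OF yZ])
  have yf: "y x = (\<Oplus>i\<in>{..<Suc j}. u1 (i # w) \<otimes> column n Z (i # w) x)" for x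
    unfolding y_def
  proof (rule diff_fiber[OF u1 w])
    fix v' assume v': "v' \<in> paths (Suc n)" "\<not> (\<exists>i<Suc j. v' = i # w)"
    then obtain i w' where "v' = i # w'" using paths_Suc_iff by auto
    then show "u1 v' = \<zero> \<or> column n Z v' x = \<zero>" using v' by (auto simp: u1_def)
  qed (use j in auto)
  have iw: "i # w \<in> paths (Suc n)" if "i < Suc j" for i using that w j by auto
  have colw: "column n Z (i # w) w = gs (lab w) ! i" if "i < Suc j" for i
    using column[OF iw[OF that]] by (simp add: lead_def)
  have "y w = \<zero>"
  proof -
    have "y w = (\<Oplus>i\<in>{..<Suc j}. u1 (i # w) \<otimes> gs (lab w) ! i)"
      unfolding yf using colw free_carrierD[OF u1] gwc by (intro finsum_cong') auto
    also have "\<dots> = u1 (j # w) \<otimes> gs (lab w) ! j \<oplus> (\<Oplus>i\<in>{..<j}. u1 (i # w) \<otimes> gs (lab w) ! i)"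
      unfolding lessThan_Suc using gwc free_carrierD[OF u1] by (intro finsum_insert) auto
    also have "(\<Oplus>i\<in>{..<j}. u1 (i # w) \<otimes> gs (lab w) ! i) = (\<Oplus>i\<in>{..<j}. (\<ominus> \<one>) \<otimes> (a i \<otimes> gs (lab w) ! i))"
      using iw gwc ac by (intro finsum_cong') (auto simp: u1_def l_minus)
    also have "\<dots> = (\<ominus> \<one>) \<otimes> (\<Oplus>i\<in>{..<j}. a i \<otimes> gs (lab w) ! i)"
      using gwc ac by (intro finsum_rdistr[symmetric]) auto
    also have "(\<Oplus>i\<in>{..<j}. a i \<otimes> gs (lab w) ! i) = ?g \<otimes> gs (lab w) ! j" by (rule eq[symmetric])
    also have "u1 (j # w) = ?g" using u1v vw by simp
    also have "?g \<otimes> gs (lab w) ! j \<oplus> (\<ominus> \<one>) \<otimes> (?g \<otimes> gs (lab w) ! j) = \<zero>"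
      using gc gwc[of j] by (simp add: l_minus r_neg)
    finally show ?thesis .
  qed
  have yabove: "y x = \<zero>" if "path_less w x" for x
  proof -
    have "u1 (i # w) \<otimes> column n Z (i # w) x = \<zero>" if "i \<in> {..<Suc j}" for i
      using column[OF iw, of i] that \<open>path_less w x\<close> free_carrierD[OF u1] by (auto simp: lead_def top_at_def)
    then show ?thesis unfolding yf by (intro add.finprod_one_eqI) auto
  qed
  define S where "S = {x \<in> paths n. path_less x w}"
  have "\<exists>u\<in>carrier (FM (paths (Suc n))). diff n Z u = y \<and> (\<forall>v. u v \<noteq> \<zero> \<longrightarrow> tl v \<in> S)"
  proof (rule generates[OF _ _ yZ])
    show "S \<subseteq> paths n" by (auto simp: S_def)
    show "x \<in> S" if "x' \<in> S" "x \<in> paths n" "path_less x x'" for x x' using that path_less_trans by (auto simp: S_def)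
    fix x assume x: "x \<notin> S"
    show "y x = \<zero>"
    proof (cases "x \<in> paths n")
      case True
      then have "x = w \<or> path_less w x" using x path_less_total[of x w] length_paths[OF True] length_paths[OF w] by (auto simp: S_def)
      then show ?thesis using \<open>y w = \<zero>\<close> yabove by blast
    qed (use yc in \<open>simp add: free_carrier_iff\<close>)
  qed
  then obtain u2 where u2: "u2 \<in> carrier (FM (paths (Suc n)))" "diff n Z u2 = y" "\<And>v. u2 v \<noteq> \<zero> \<Longrightarrow> tl v \<in> S" by blast
  \<comment> \<open>The correction is made linear in the same way: the entries of \<open>y\<close>
    are sums of products of two elements of \<open>R1\<close>, hence fixed by
    \<open>\<pi>2\<close>.\<close>
  define u3 where "u3 = (\<lambda>v. \<pi>1 (u2 v))"
  have u3: "u3 \<in> carrier (FM (paths (Suc n)))" unfolding u3_def by (rule diff_pi(1)[OF u2(1)])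
  have du3: "diff n Z u3 = y"
  proof
    fix x
    have "diff n Z u3 x = \<pi>2 (y x)" unfolding u3_def diff_pi(2)[OF u2(1)] u2(2) ..
    also have "\<dots> = (\<Oplus>i\<in>{..<Suc j}. \<pi>2 (u1 (i # w) \<otimes> column n Z (i # w) x))"
      unfolding yf using free_carrierD[OF u1] R1[OF column_R1[OF iw]] by (intro pi2_finsum) auto
    also have "\<dots> = y x"
      unfolding yf using free_carrierD[OF u1] R1[OF column_R1[OF iw]] pi2_R1_mult[OF u1R1 column_R1[OF iw]]
      by (intro finsum_cong') auto
    finally show "diff n Z u3 x = y x" .
  qed
  define t where "t = u1 \<ominus>\<^bsub>FM (paths (Suc n))\<^esub> u3"
  have tv: "t x = u1 x \<ominus> u3 x" for x unfolding t_def free_minus[OF u1 u3] ..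
  have u3z: "u3 x = \<zero>" if "tl x \<notin> S" for x using u2(3)[of x] that pi1_zero by (cases "u2 x = \<zero>") (auto simp: u3_def)
  have "t \<in> syz n Z"
  proof -
    have "diff n Z t = \<zero>\<^bsub>FM (paths n)\<^esub>"
      unfolding t_def mhom_minus[OF free_module_module free_module_module diff_hom u1 u3] du3 y_def[symmetric]
      by (rule F.minus_self[OF yc])
    then show ?thesis unfolding syz_def t_def using F'.minus_closed[OF u1 u3] by blast
  qed
  moreover have "t v = gs (lab v) ! k"
    unfolding tv u1v using u3z[of v] vw path_less_irrefl gc by (simp add: S_def a_minus_def)
  moreover have "top_at t v"
    unfolding top_at_def
  proof (intro allI impI)
    fix x assume x: "path_less v x"
    then obtain i w' where iw': "x = i # w'" unfolding vw by (cases x) auto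
    have h: "path_less w w' \<or> w = w' \<and> j < i" using x unfolding vw iw' by simp
    have "u1 x = \<zero>" using h path_less_irrefl by (auto simp: u1_def iw')
    moreover have "tl x \<notin> S"
      using h path_less_irrefl[of w] path_less_trans[of w w' w] by (auto simp: S_def iw')
    ultimately show "t x = \<zero>" unfolding tv by (simp add: u3z a_minus_def)
  qed
  moreover have "t x \<in> R1" for x unfolding tv u3_def by (rule R1_minus[OF u1R1 pi1[OF free_carrierD[OF u2(1)]]])
  ultimately show ?thesis by (auto simp: lead_def)
qed

lemma invar_syz: "invar (Suc n) (syz n Z)"
  unfolding invar_def[of "Suc n"] using syz_submodule syz_leading syz_lead by blast

lemma diff_image: "diff n Z ` carrier (FM (paths (Suc n))) = Z"
proof (intro equalityI subsetI)
  show "z \<in> Z" if "z \<in> diff n Z ` carrier (FM (paths (Suc n)))" for z using that diff_in_Z by blast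
  fix z assume z: "z \<in> Z"
  have "\<exists>u\<in>carrier (FM (paths (Suc n))). diff n Z u = z \<and> (\<forall>v. u v \<noteq> \<zero> \<longrightarrow> tl v \<in> paths n)"
    using Z_carrier[OF z] by (intro generates[OF _ _ z]) (auto simp: free_carrier_iff)
  then show "z \<in> diff n Z ` carrier (FM (paths (Suc n)))" by blast
qed

lemma diff_minimal:
  assumes u: "u \<in> carrier (FM (paths (Suc n)))" shows "red (diff n Z u) = (\<lambda>_. 0)"
proof
  fix w
  have "(\<Oplus>v\<in>A. u v \<otimes> column n Z v w) \<in> \<mm>" if "finite A" "A \<subseteq> paths (Suc n)" for A
    using that
  proof (induction A rule: finite_induct)
    case empty
    show ?case by (simp add: \<mm>_def chi_zero)
  next
    case (insert v A)
    have vc: "column n Z v w \<in> carrier R" "\<chi> (column n Z v w) = 0" using R1[OF column_R1, of v w] insert by auto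
    have "column n Z v' w \<in> carrier R" if "v' \<in> A" for v' using R1[OF column_R1, of v' w] insert that by auto
    then have "(\<Oplus>v\<in>insert v A. u v \<otimes> column n Z v w) = u v \<otimes> column n Z v w \<oplus> (\<Oplus>v\<in>A. u v \<otimes> column n Z v w)"
      using insert vc free_carrierD[OF u] by (intro finsum_insert) auto
    then show ?case using insert vc free_carrierD[OF u] by (simp add: \<mm>_def chi_add chi_mult)
  qed
  from this[OF finite_paths] show "\<chi> (diff n Z u w) = 0" unfolding diff_apply[OF u] by (simp add: \<mm>_def)
qed

end

text \<open>\<open>ZZ n\<close> is at once the image of the differential into the free module on
  \<open>paths n\<close> and the kernel of the map leaving it; for \<open>n = 0\<close> the latter
  is the augmentation.\<close>

fun ZZ :: "nat \<Rightarrow> (nat list \<Rightarrow> 'a) set"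
  where "ZZ 0 = {u \<in> carrier (FM (paths 0)). u [] \<in> \<mm>}" | "ZZ (Suc n) = syz n (ZZ n)"

lemma invar_0: "invar 0 (ZZ 0)"
  unfolding invar_def
proof (intro conjI ballI allI impI)
  interpret F: Module.module R "FM (paths 0)" by (rule free_module_module)
  have c: "u [] \<in> carrier R" if "u \<in> carrier (FM (paths 0))" for u by (rule free_carrierD[OF that])
  show "LinearCombinations.submodule R (ZZ 0) (FM (paths 0))"
  proof (rule LinearCombinations.submodule.intro)
    show "\<zero>\<^bsub>FM (paths 0)\<^esub> \<in> ZZ 0"
      unfolding ZZ.simps mem_Collect_eq
    proof
      show "\<zero>\<^bsub>FM (paths 0)\<^esub> \<in> carrier (FM (paths 0))" by (rule F.zero_closed)
      have "(\<zero>\<^bsub>FM (paths 0)\<^esub> :: nat list \<Rightarrow> 'a) [] = \<zero>" by (simp add: free_module_def)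
      then show "\<zero>\<^bsub>FM (paths 0)\<^esub> [] \<in> \<mm>"
        by (simp only: \<mm>_def chi_zero zero_closed mem_Collect_eq simp_thms)
    qed
    show "u \<oplus>\<^bsub>FM (paths 0)\<^esub> v \<in> ZZ 0" if "u \<in> ZZ 0" "v \<in> ZZ 0" for u v
      using that unfolding ZZ.simps mem_Collect_eq
      by (elim conjE, intro conjI, intro F.add.m_closed) (auto simp: \<mm>_def chi_add)
    show "r \<odot>\<^bsub>FM (paths 0)\<^esub> u \<in> ZZ 0" if "r \<in> carrier R" "u \<in> ZZ 0" for r u
      using that unfolding ZZ.simps mem_Collect_eq
      by (elim conjE, intro conjI, intro F.smult_closed) (auto simp: \<mm>_def chi_mult)
  qed (auto intro: free_module_module)
  fix z w assume z: "z \<in> ZZ 0" and w: "w \<in> paths 0"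
  then have "z [] \<in> \<mm>" "w = []" by auto
  then show "z w \<in> lin (lab w) (length (gs (lab w)))" using maximal by simp
next
  interpret F: Module.module R "FM (paths 0)" by (rule free_module_module)
  fix w j assume w: "w \<in> paths 0" and j: "j < length (gs (lab w))"
  then have w0: "w = []" and j0: "j < length (gs m0)" by auto
  have g: "gs m0 ! j \<in> R1" by (rule gs[OF m0 j0])
  let ?z = "\<lambda>v. if v = [] then gs m0 ! j else \<zero>"
  have "{v. ?z v \<noteq> \<zero>} \<subseteq> {[]}" by auto
  then have "finite {v. ?z v \<noteq> \<zero>}" by (rule finite_subset) simp
  then have "?z \<in> carrier (FM (paths 0))" using R1[OF g] unfolding free_carrier_iff by auto
  then have "lead 0 (ZZ 0) w j ?z" using R1[OF g] g R1_zero by (simp add: lead_def w0 top_at_def \<mm>_def)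
  then show "\<exists>z. lead 0 (ZZ 0) w j z" by blast
qed

lemma invar_ZZ: "invar n (ZZ n)"
  by (induction n) (use invar_0 invar_syz in auto)

lemma linear_resolution:
  "free_resolution R B paths (\<lambda>n. diff n (ZZ n)) (\<lambda>u. \<mm> +> u [])"
  unfolding free_resolution_def Let_def a_kernel_def'
proof (intro conjI allI)
  have c: "u [] \<in> carrier R" if "u \<in> carrier (FM (paths 0))" for u by (rule free_carrierD[OF that])
  show "diff i (ZZ i) \<in> mhom R (FM (paths (Suc i))) (FM (paths i))" for i by (rule diff_hom[OF invar_ZZ])
  show "(\<lambda>u. \<mm> +> u []) \<in> mhom R (FM (paths 0)) B"
  proof (rule mhomI)
    fix u v assume u: "u \<in> carrier (FM (paths 0))" and v: "v \<in> carrier (FM (paths 0))"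
    show "\<mm> +> u [] \<in> carrier B" using c[OF u] by (auto simp: carrier_B)
    show "\<mm> +> (u \<oplus>\<^bsub>FM (paths 0)\<^esub> v) [] = (\<mm> +> u []) \<oplus>\<^bsub>B\<^esub> (\<mm> +> v [])" using add_B[OF c[OF u] c[OF v]] by simp
    show "\<mm> +> (r \<odot>\<^bsub>FM (paths 0)\<^esub> u) [] = r \<odot>\<^bsub>B\<^esub> (\<mm> +> u [])" if "r \<in> carrier R" for r
      using smult_B[OF that c[OF u]] by simp
  qed
  show "(\<lambda>u. \<mm> +> u []) ` carrier (FM (paths 0)) = carrier B"
  proof (intro equalityI subsetI)
    fix b assume "b \<in> carrier B"
    then obtain r where r: "r \<in> carrier R" "b = \<mm> +> r" by (auto simp: carrier_B)
    let ?u = "\<lambda>v. if v = [] then r else \<zero>"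
    have "{v. ?u v \<noteq> \<zero>} \<subseteq> {[]}" by auto
    then have "finite {v. ?u v \<noteq> \<zero>}" by (rule finite_subset) simp
    then have "?u \<in> carrier (FM (paths 0))" using r unfolding free_carrier_iff by auto
    then show "b \<in> (\<lambda>u. \<mm> +> u []) ` carrier (FM (paths 0))" using r by (intro image_eqI[of _ _ ?u]) auto
  qed (use c in \<open>auto simp: carrier_B\<close>)
  have zB: "\<zero>\<^bsub>B\<^esub> = \<mm>" by (simp add: quot_ring_module_def FactRing_def)
  have "\<mm> +> r = \<mm> \<longleftrightarrow> r \<in> \<mm>" if "r \<in> carrier R" for r
    unfolding coset_m[OF that] using that zero_closed chi_zero by (force simp: \<mm>_def)
  then have "{x \<in> carrier (FM (paths 0)). \<mm> +> x [] = \<zero>\<^bsub>B\<^esub>} = ZZ 0" unfolding zB using c by auto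
  then show "{x \<in> carrier (FM (paths 0)). \<mm> +> x [] = \<zero>\<^bsub>B\<^esub>} = diff 0 (ZZ 0) ` carrier (FM (paths 1))"
    using diff_image[OF invar_ZZ, of 0] by simp
  show "{x \<in> carrier (FM (paths (Suc i))). diff i (ZZ i) x = \<zero>\<^bsub>FM (paths i)\<^esub>} =
    diff (Suc i) (ZZ (Suc i)) ` carrier (FM (paths (Suc (Suc i))))" for i
    unfolding diff_image[OF invar_ZZ] by (simp add: syz_def)
qed

end

section \<open>Rationality\<close>

text \<open>Gaussian elimination: a pivot \<open>k0\<close> clears the coordinate \<open>l\<close>
  from the other vectors, and its own coefficient is determined at the end.\<close>

lemma ex_linear_dependence:
  fixes M :: "'b \<Rightarrow> 'l \<Rightarrow> 'k :: field"
  assumes "finite L" "finite K" "card L < card K"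
  shows "\<exists>q. (\<exists>k\<in>K. q k \<noteq> 0) \<and> (\<forall>l\<in>L. (\<Sum>k\<in>K. q k * M k l) = 0)"
  using assms
proof (induction L arbitrary: K M rule: finite_induct)
  case empty
  then obtain k where "k \<in> K" by fastforce
  then show ?case by (intro exI[of _ "\<lambda>_. 1"]) auto
next
  case (insert l L)
  show ?case
  proof (cases "\<forall>k\<in>K. M k l = 0")
    case True
    have "card L < card K" using insert by simp
    then obtain q where "\<exists>k\<in>K. q k \<noteq> 0" "\<forall>l\<in>L. (\<Sum>k\<in>K. q k * M k l) = 0"
      using insert.IH[OF insert.prems(1), of M] by blast
    then show ?thesis using True by (intro exI[of _ q]) auto
  next
    case False
    then obtain k0 where k0: "k0 \<in> K" "M k0 l \<noteq> 0" by blast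
    let ?K = "K - {k0}" and ?M = "\<lambda>k l'. M k l' - M k l / M k0 l * M k0 l'"
    have "card L < card ?K" using insert k0 by simp
    then obtain q where q: "\<exists>k\<in>?K. q k \<noteq> 0" "\<And>l. l \<in> L \<Longrightarrow> (\<Sum>k\<in>?K. q k * ?M k l) = 0"
      using insert.IH[of ?K ?M] insert.prems(1) by auto
    define p where "p k = (if k = k0 then - (\<Sum>k\<in>?K. q k * (M k l / M k0 l)) else q k)" for k
    have p: "(\<Sum>k\<in>K. p k * M k l') = (\<Sum>k\<in>?K. q k * ?M k l')" for l'
    proof -
      have "(\<Sum>k\<in>K. p k * M k l') = p k0 * M k0 l' + (\<Sum>k\<in>?K. p k * M k l')"
        using insert.prems(1) k0(1) by (rule sum.remove)
      also have "(\<Sum>k\<in>?K. p k * M k l') = (\<Sum>k\<in>?K. q k * M k l')"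
        by (intro sum.cong) (auto simp: p_def)
      finally show ?thesis
        by (simp add: p_def right_diff_distrib sum_subtractf sum_distrib_right mult.assoc)
    qed
    have "\<exists>k\<in>K. p k \<noteq> 0" using q(1) by (auto simp: p_def)
    moreover have "(\<Sum>k\<in>K. p k * M k l') = 0" if "l' \<in> insert l L" for l'
      unfolding p using that q(2) k0 by auto
    ultimately show ?thesis by blast
  qed
qed

text \<open>The denominator is the characteristic polynomial with its coefficients reversed, so that
  its constant coefficient is \<open>q d\<close>. The recurrence makes all coefficients of the
  product from degree \<open>d\<close> on vanish, which leaves a polynomial numerator.\<close>

lemma rational_fps_recurrence:
  fixes a q :: "nat \<Rightarrow> 'k :: field"
  assumes rec: "\<And>n. (\<Sum>k\<le>d. q k * a (n + k)) = 0" and q: "q d \<noteq> 0"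
  shows "rational_fps (Abs_fps a)"
proof -
  define Q where "Q = (\<Sum>k\<le>d. Polynomial.monom (q k) (d - k))"
  have Qi: "poly.coeff Q i = (if i \<le> d then q (d - i) else 0)" for i
  proof -
    have "poly.coeff Q i = (\<Sum>k\<le>d. if k = d - i \<and> i \<le> d then q k else 0)"
      unfolding Q_def coeff_sum by (intro sum.cong) auto
    also have "\<dots> = (if i \<le> d then q (d - i) else 0)"
      using sum.delta[of "{..d}" "d - i" q] by (auto intro!: sum.neutral)
    finally show ?thesis .
  qed
  let ?A = "Abs_fps a * fps_of_poly Q"
  have z: "fps_nth ?A m = 0" if m: "d \<le> m" for m
  proof -
    have "fps_nth ?A m = (\<Sum>i\<le>m. a (m - i) * poly.coeff Q i)"
      by (subst mult.commute) (simp add: fps_mult_nth atLeast0AtMost mult.commute[of "poly.coeff Q _"])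
    also have "\<dots> = (\<Sum>i\<le>d. a (m - i) * q (d - i))"
      using m by (intro sum.mono_neutral_cong_right) (auto simp: Qi)
    also have "\<dots> = (\<Sum>k\<le>d. q k * a (m - d + k))"
      by (rule sum.reindex_bij_witness[of _ "\<lambda>k. d - k" "\<lambda>k. d - k"]) (use m in auto)
    finally show ?thesis using rec by simp
  qed
  define P where "P = (\<Sum>m<d. Polynomial.monom (fps_nth ?A m) m)"
  have "?A = fps_of_poly P"
  proof (rule fps_ext)
    fix m
    have "poly.coeff P m = (\<Sum>i<d. if i = m then fps_nth ?A i else 0)"
      unfolding P_def coeff_sum by (intro sum.cong) auto
    also have "\<dots> = fps_nth ?A m" using z[of m] by (simp add: sum.delta)
    finally show "fps_nth ?A m = fps_nth (fps_of_poly P) m" by simp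
  qed
  moreover have Q0: "poly.coeff Q 0 \<noteq> 0" using q by (simp add: Qi)
  then have "fps_of_poly Q \<noteq> 0" by auto
  ultimately have "Abs_fps a = fps_of_poly P / fps_of_poly Q"
    using nonzero_mult_div_cancel_right[of "fps_of_poly Q" "Abs_fps a"] by metis
  then show ?thesis unfolding rational_fps_def using Q0 by blast
qed

section \<open>Renaming the bases of a free resolution\<close>

context cring
begin

lemma pull_hom:
  assumes \<iota>: "inj \<iota>"
  shows "(\<lambda>u. u \<circ> \<iota>) \<in> mhom R (free_module R (\<iota> ` X)) (free_module R X)"
proof (rule mhomI)
  fix u assume "u \<in> carrier (free_module R (\<iota> ` X))"
  then show "u \<circ> \<iota> \<in> carrier (free_module R X)"
    using finite_vimageI[OF _ \<iota>, of "{y. u y \<noteq> \<zero>}"] \<iota> by (auto simp: free_carrier_iff inj_image_mem_iff vimage_def)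
qed (auto simp: free_module_def)

definition push :: "('x \<Rightarrow> 'y) \<Rightarrow> ('x \<Rightarrow> 'a) \<Rightarrow> 'y \<Rightarrow> 'a"
  where "push \<iota> u y = (if y \<in> range \<iota> then u (inv_into UNIV \<iota> y) else \<zero>)"

lemma push_apply: "inj \<iota> \<Longrightarrow> push \<iota> u (\<iota> x) = u x"
  by (simp add: push_def)

lemma push_outside: "y \<notin> range \<iota> \<Longrightarrow> push \<iota> u y = \<zero>"
  by (simp add: push_def)

lemma push_carrier:
  assumes \<iota>: "inj \<iota>" and u: "u \<in> carrier (free_module R X)"
  shows "push \<iota> u \<in> carrier (free_module R (\<iota> ` X))"
proof -
  have z: "push \<iota> u y = \<zero>" if "y \<notin> \<iota> ` X" for y
  proof (cases "y \<in> range \<iota>")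
    case True
    then obtain x where x: "y = \<iota> x" by blast
    then have "x \<notin> X" using that by blast
    then show ?thesis using u x by (simp add: push_apply[OF \<iota>] free_carrier_iff)
  qed (simp add: push_outside)
  moreover have "{y. push \<iota> u y \<noteq> \<zero>} \<subseteq> \<iota> ` {x. u x \<noteq> \<zero>}"
  proof
    fix y assume y: "y \<in> {y. push \<iota> u y \<noteq> \<zero>}"
    then obtain x where "y = \<iota> x" using z by blast
    then show "y \<in> \<iota> ` {x. u x \<noteq> \<zero>}" using y by (simp add: push_apply[OF \<iota>])
  qed
  then have "finite {y. push \<iota> u y \<noteq> \<zero>}"
    using u by (elim finite_subset) (simp add: free_carrier_iff)
  ultimately show ?thesis using u by (auto simp: free_carrier_iff push_apply[OF \<iota>])
qed

lemma push_hom: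
  assumes \<iota>: "inj \<iota>"
  shows "push \<iota> \<in> mhom R (free_module R X) (free_module R (\<iota> ` X))"
proof (rule mhomI)
  show "push \<iota> u \<in> carrier (free_module R (\<iota> ` X))" if "u \<in> carrier (free_module R X)" for u
    by (rule push_carrier[OF \<iota> that])
qed (auto simp: free_module_def push_def)

lemma push_pull:
  assumes \<iota>: "inj \<iota>" and u: "u \<in> carrier (free_module R (\<iota> ` X))"
  shows "push \<iota> (u \<circ> \<iota>) = u"
proof
  fix y
  show "push \<iota> (u \<circ> \<iota>) y = u y"
  proof (cases "y \<in> range \<iota>")
    case True
    then show ?thesis using push_apply[OF \<iota>] by auto
  next
    case False
    then have "y \<notin> \<iota> ` X" by blast
    then show ?thesis using u False by (simp add: push_outside free_carrier_iff)
  qed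
qed

lemma pull_push: "inj \<iota> \<Longrightarrow> push \<iota> u \<circ> \<iota> = u"
  by (auto simp: push_apply)

lemma pull_image:
  assumes \<iota>: "inj \<iota>"
  shows "(\<lambda>u. u \<circ> \<iota>) ` carrier (free_module R (\<iota> ` X)) = carrier (free_module R X)"
proof (intro equalityI subsetI)
  fix u assume "u \<in> carrier (free_module R X)"
  then show "u \<in> (\<lambda>u. u \<circ> \<iota>) ` carrier (free_module R (\<iota> ` X))"
    using push_carrier[OF \<iota>] pull_push[OF \<iota>, of u] by (intro image_eqI[of _ _ "push \<iota> u"]) auto
qed (use mhom_closed[OF pull_hom[OF \<iota>]] in auto)

text \<open>Needed to move the bases of paths into the list type that
  \<open>chosen_resolution\<close> prescribes.\<close>

lemma free_resolution_transport:
  fixes \<iota> :: "'x \<Rightarrow> 'y"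
  assumes \<iota>: "inj \<iota>" and F: "free_resolution R A X d \<epsilon>"
  shows "free_resolution R A (\<lambda>i. \<iota> ` X i) (\<lambda>i u. push \<iota> (d i (u \<circ> \<iota>))) (\<lambda>u. \<epsilon> (u \<circ> \<iota>))"
  unfolding free_resolution_def Let_def a_kernel_def'
proof (intro conjI allI)
  note r = F[unfolded free_resolution_def Let_def a_kernel_def']
  have d: "d i \<in> mhom R (free_module R (X (Suc i))) (free_module R (X i))" for i using r by blast
  have e: "\<epsilon> \<in> mhom R (free_module R (X 0)) A" using r by blast
  have im: "(\<lambda>u. push \<iota> (d i (u \<circ> \<iota>))) ` carrier (free_module R (\<iota> ` X (Suc i))) =
      push \<iota> ` d i ` carrier (free_module R (X (Suc i)))" for i
    unfolding pull_image[OF \<iota>, of "X (Suc i)", symmetric] image_image ..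
  have ker: "{u \<in> carrier (free_module R (\<iota> ` Z)). P (u \<circ> \<iota>)} = push \<iota> ` {u \<in> carrier (free_module R Z). P u}"
    for Z and P :: "('x \<Rightarrow> 'a) \<Rightarrow> bool"
  proof (intro equalityI subsetI)
    fix u assume u: "u \<in> {u \<in> carrier (free_module R (\<iota> ` Z)). P (u \<circ> \<iota>)}"
    then have "u = push \<iota> (u \<circ> \<iota>)" using push_pull[OF \<iota>] by auto
    moreover have "u \<circ> \<iota> \<in> {u \<in> carrier (free_module R Z). P u}"
      using u mhom_closed[OF pull_hom[OF \<iota>]] by auto
    ultimately show "u \<in> push \<iota> ` {u \<in> carrier (free_module R Z). P u}" by (rule image_eqI)
  next
    fix u assume "u \<in> push \<iota> ` {u \<in> carrier (free_module R Z). P u}"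
    then show "u \<in> {u \<in> carrier (free_module R (\<iota> ` Z)). P (u \<circ> \<iota>)}"
      using push_carrier[OF \<iota>] pull_push[OF \<iota>] by auto
  qed
  show "(\<lambda>u. push \<iota> (d i (u \<circ> \<iota>))) \<in> mhom R (free_module R (\<iota> ` X (Suc i))) (free_module R (\<iota> ` X i))" for i
    by (intro mhom_comp[OF _ push_hom[OF \<iota>]] mhom_comp[OF pull_hom[OF \<iota>] d])
  show "(\<lambda>u. \<epsilon> (u \<circ> \<iota>)) \<in> mhom R (free_module R (\<iota> ` X 0)) A"
    by (rule mhom_comp[OF pull_hom[OF \<iota>] e])
  show "(\<lambda>u. \<epsilon> (u \<circ> \<iota>)) ` carrier (free_module R (\<iota> ` X 0)) = carrier A"
  proof -
    have "(\<lambda>u. \<epsilon> (u \<circ> \<iota>)) ` carrier (free_module R (\<iota> ` X 0)) = \<epsilon> ` carrier (free_module R (X 0))"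
      unfolding pull_image[OF \<iota>, of "X 0", symmetric] image_image ..
    then show ?thesis using r by simp
  qed
  show "{u \<in> carrier (free_module R (\<iota> ` X 0)). \<epsilon> (u \<circ> \<iota>) = \<zero>\<^bsub>A\<^esub>} =
    (\<lambda>u. push \<iota> (d 0 (u \<circ> \<iota>))) ` carrier (free_module R (\<iota> ` X 1))"
  proof -
    have "{u \<in> carrier (free_module R (X 0)). \<epsilon> u = \<zero>\<^bsub>A\<^esub>} = d 0 ` carrier (free_module R (X 1))" using r by blast
    then show ?thesis unfolding ker[of "X 0" "\<lambda>u. \<epsilon> u = \<zero>\<^bsub>A\<^esub>"] using im[of 0] by simp
  qed
  fix i
  have z: "push \<iota> v = \<zero>\<^bsub>free_module R (\<iota> ` X i)\<^esub> \<longleftrightarrow> v = \<zero>\<^bsub>free_module R (X i)\<^esub>" for v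
  proof
    assume h: "push \<iota> v = \<zero>\<^bsub>free_module R (\<iota> ` X i)\<^esub>"
    have "v x = \<zero>" for x using push_apply[OF \<iota>, of v x] h by (simp add: free_module_def)
    then show "v = \<zero>\<^bsub>free_module R (X i)\<^esub>" by (auto simp: free_module_def)
  qed (auto simp: free_module_def push_def)
  have "{u \<in> carrier (free_module R (X (Suc i))). d i u = \<zero>\<^bsub>free_module R (X i)\<^esub>} = d (Suc i) ` carrier (free_module R (X (Suc (Suc i))))"
    using r by blast
  then show "{u \<in> carrier (free_module R (\<iota> ` X (Suc i))). push \<iota> (d i (u \<circ> \<iota>)) = \<zero>\<^bsub>free_module R (\<iota> ` X i)\<^esub>} =
    (\<lambda>u. push \<iota> (d (Suc i) (u \<circ> \<iota>))) ` carrier (free_module R (\<iota> ` X (Suc (Suc i))))"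
    unfolding z ker[of "X (Suc i)" "\<lambda>u. d i u = \<zero>\<^bsub>free_module R (X i)\<^esub>"] using im[of "Suc i"] by simp
qed

end

section \<open>Counting paths\<close>

context linear_family
begin

text \<open>Counts continuations from the label \<open>l\<close>, adding steps at the start, whereas
  \<open>paths\<close> adds them at the end; \<open>card_paths_add\<close> cuts a path after
  \<open>n\<close> steps.\<close>

fun path_count :: "nat \<Rightarrow> 'l \<Rightarrow> nat"
  where "path_count 0 l = 1" | "path_count (Suc k) l = (\<Sum>j<length (gs l). path_count k (col l j))"

lemma sum_paths_Suc: "(\<Sum>v\<in>paths (Suc n). f v) = (\<Sum>w\<in>paths n. \<Sum>j<length (gs (lab w)). f (j # w))"
proof -
  have "(\<Sum>v\<in>paths (Suc n). f v) = (\<Sum>w\<in>paths n. sum f ((\<lambda>j. j # w) ` {..<length (gs (lab w))}))"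
    unfolding paths.simps(2) by (rule sum.UNION_disjoint) (auto simp: finite_paths)
  also have "\<dots> = (\<Sum>w\<in>paths n. \<Sum>j<length (gs (lab w)). f (j # w))"
    by (intro sum.cong refl, subst sum.reindex) (auto simp: inj_on_def)
  finally show ?thesis .
qed

lemma card_paths_add: "card (paths (n + k)) = (\<Sum>w\<in>paths n. path_count k (lab w))"
proof (induction k arbitrary: n)
  case (Suc k)
  show ?case using Suc[of "Suc n"] sum_paths_Suc[of "\<lambda>w. path_count k (lab w)" n] by simp
qed simp

lemma rational_card_paths: "rational_fps (Abs_fps (\<lambda>n. of_nat (card (paths n)) :: rat))"
proof -
  let ?K = "{..card labs}"
  \<comment> \<open>There are \<open>card labs + 1\<close> vectors of path counts, each with one
    coordinate per label, so they are dependent. The dependence holds at every label, hence after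
    any \<open>n\<close> steps.\<close>
  obtain q where q: "\<exists>k\<in>?K. q k \<noteq> 0" "\<And>l. l \<in> labs \<Longrightarrow> (\<Sum>k\<in>?K. q k * (of_nat (path_count k l) :: rat)) = 0"
    using ex_linear_dependence[of labs ?K "\<lambda>k l. of_nat (path_count k l) :: rat"] finite_labs by auto
  \<comment> \<open>The last nonzero coefficient is taken as the order of the recurrence, since the
    leading coefficient must not vanish.\<close>
  define d where "d = Max {k \<in> ?K. q k \<noteq> 0}"
  have ne: "{k \<in> ?K. q k \<noteq> 0} \<noteq> {}" using q(1) by blast
  have d: "d \<in> {k \<in> ?K. q k \<noteq> 0}" unfolding d_def by (rule Max_in[OF _ ne]) simp
  have above: "q k = 0" if "k \<in> ?K" "d < k" for k
  proof (rule ccontr)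
    assume "q k \<noteq> 0"
    then have "k \<le> d" unfolding d_def using that by (intro Max_ge) auto
    then show False using that by simp
  qed
  have s: "(\<Sum>k\<le>d. q k * f k) = (\<Sum>k\<in>?K. q k * f k)" for f :: "nat \<Rightarrow> rat"
    using d above by (intro sum.mono_neutral_cong_left) (auto simp: not_le)
  show ?thesis
  proof (rule rational_fps_recurrence[where d = d and q = q])
    fix n
    have "(\<Sum>k\<le>d. q k * of_nat (card (paths (n + k)))) = (\<Sum>k\<in>?K. \<Sum>w\<in>paths n. q k * of_nat (path_count k (lab w)))"
      unfolding s card_paths_add by (simp add: sum_distrib_left)
    also have "\<dots> = (\<Sum>w\<in>paths n. \<Sum>k\<in>?K. q k * of_nat (path_count k (lab w)))" by (rule sum.swap)
    also have "\<dots> = 0" using q(2)[OF lab_labs] by (intro sum.neutral) blast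
    finally show "(\<Sum>k\<le>d. q k * of_nat (card (paths (n + k)))) = 0" .
  qed (use d in simp)
qed

theorem rational_poincare: "rational_fps (poincare_series R \<phi> B)"
proof -
  \<comment> \<open>Any injection into the prescribed type serves; a path is coded by the length of
    a constant list.\<close>
  define \<iota> :: "nat list \<Rightarrow> ('a + 'a set) list" where "\<iota> w = replicate (to_nat w) (Inl \<zero>)" for w
  have \<iota>: "inj \<iota>"
  proof (rule injI)
    fix v w assume "\<iota> v = \<iota> w"
    then have "length (\<iota> v) = length (\<iota> w)" by simp
    then show "v = w" by (simp add: \<iota>_def)
  qed
  have "vectorspace.dim class_ring (restrict_scalars \<phi> (Tor R B B i)) = card (\<iota> ` paths i)" for i
  proof (rule dim_Tor_minimal[OF free_resolution_transport[OF \<iota> linear_resolution]])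
    fix i u assume u: "u \<in> carrier (FM (\<iota> ` paths (Suc i)))"
    have "red (diff i (ZZ i) (u \<circ> \<iota>)) = (\<lambda>_. 0)"
      by (rule diff_minimal[OF invar_ZZ mhom_closed[OF pull_hom[OF \<iota>] u]])
    then show "red (push \<iota> (diff i (ZZ i) (u \<circ> \<iota>))) = (\<lambda>_. 0)"
      by (auto simp: push_def chi_zero fun_eq_iff)
  qed (simp add: finite_paths)
  then show ?thesis
    unfolding poincare_series_def using rational_card_paths card_image[OF inj_on_subset[OF \<iota> subset_UNIV]] by simp
qed

end

section \<open>The Chow ring\<close>

lemma poly_ring_simps [simp]:
  "carrier (poly_ring S) = polys S" "monoid.mult (poly_ring S) = (\<lambda>p q. p * q)" "one (poly_ring S) = 1"
  "zero (poly_ring S) = 0" "add (poly_ring S) = (+)"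
  by (simp_all add: poly_ring_def polys_def)

lemma poly_ring_cring: "cring (poly_ring S :: ('v, 'k :: comm_ring_1) mvpoly ring)"
proof (rule cringI)
  show "abelian_group (poly_ring S :: ('v, 'k) mvpoly ring)"
  proof (rule abelian_groupI; simp add: polys_add add_ac)
    show "\<exists>y\<in>polys S. x + y = 0" if "x \<in> polys S" for x :: "('v, 'k) mvpoly"
      using polys_uminus[OF that] by (intro bexI[of _ "- x"]) auto
  qed
  show "Group.comm_monoid (poly_ring S :: ('v, 'k) mvpoly ring)"
    by (rule Group.comm_monoidI) (auto simp: polys_mult mult_ac)
qed (simp add: distrib_right)

lemma poly_ring_minus:
  assumes "p \<in> polys S" "q \<in> polys S"
  shows "p \<ominus>\<^bsub>poly_ring S\<^esub> q = (p - q :: ('v, 'k :: comm_ring_1) mvpoly)"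
proof -
  interpret cring "poly_ring S :: ('v, 'k) mvpoly ring" by (rule poly_ring_cring)
  have "\<ominus>\<^bsub>poly_ring S\<^esub> q = - q" using assms polys_uminus by (intro minus_equality) auto
  then show ?thesis by (simp add: a_minus_def)
qed

text \<open>In \<open>idl\<close> the coefficients may involve arbitrary variables; applying
  \<open>restr S\<close> to a derivation yields one with coefficients in
  \<open>polys S\<close>.\<close>

lemma polys_idl_induct [consumes 3, case_names zero step]:
  assumes "p \<in> idl A" "p \<in> polys S" and A: "A \<subseteq> polys S"
    and P: "P 0" "\<And>g r q. g \<in> A \<Longrightarrow> r \<in> polys S \<Longrightarrow> q \<in> polys S \<Longrightarrow> P q \<Longrightarrow> P (r * g + q)"
  shows "P p"
proof -
  interpret r: comm_ring_hom "restr S" by (rule restr_hom)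
  have c: "restr S q \<in> polys S" for q using restr_in_polys[of q UNIV S] by simp
  have "P (restr S p)" using assms(1)
  proof (induction rule: idl.induct)
    case (idl_step g p q)
    then have "restr S (q * g + p) = restr S q * g + restr S p"
      using A restr_id[of g S] by (auto simp: r.hom_add r.hom_mult)
    then show ?case using P(2)[OF idl_step(1) c c idl_step(3)] by simp
  qed (simp add: P)
  then show ?thesis using restr_id[OF assms(2)] by simp
qed

lemma genideal_poly_ring:
  assumes A: "A \<subseteq> polys S" shows "Idl\<^bsub>poly_ring S\<^esub> A = polys S \<inter> idl A"
proof (intro equalityI subsetI)
  interpret cring "poly_ring S" by (rule poly_ring_cring)
  have I: "ideal (polys S \<inter> idl A) (poly_ring S)"
  proof (rule idealI)
    show "ring (poly_ring S)" by (rule ring_axioms)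
    have m: "\<ominus>\<^bsub>poly_ring S\<^esub> p = - p" if "p \<in> polys S" for p
      using poly_ring_minus[OF polys_zero that] that a_inv_closed[of p] by (simp add: a_minus_def)
    show "subgroup (polys S \<inter> idl A) (add_monoid (poly_ring S))"
    proof (rule add.subgroupI)
      show "polys S \<inter> idl A \<noteq> {}" using polys_zero idl_zero by blast
      show "\<ominus>\<^bsub>poly_ring S\<^esub> p \<in> polys S \<inter> idl A" if "p \<in> polys S \<inter> idl A" for p
        using that m[of p] by (simp add: polys_uminus idl_uminus)
    qed (auto simp: idl_add polys_add)
  qed (auto simp: idl_mult idl_mult_right polys_mult)
  show "p \<in> polys S \<inter> idl A" if "p \<in> Idl\<^bsub>poly_ring S\<^esub> A" for p
    using genideal_minimal[OF I] that A idl_base by blast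
  interpret J: ideal "Idl\<^bsub>poly_ring S\<^esub> A" "poly_ring S" using A by (intro genideal_ideal) simp
  fix p assume p: "p \<in> polys S \<inter> idl A"
  have "A \<subseteq> Idl\<^bsub>poly_ring S\<^esub> A" using A by (intro genideal_self) simp
  then have A': "g \<in> Idl\<^bsub>poly_ring S\<^esub> A" if "g \<in> A" for g using that by blast
  from p have "p \<in> idl A" "p \<in> polys S" by auto
  then show "p \<in> Idl\<^bsub>poly_ring S\<^esub> A" using A
  proof (induction rule: polys_idl_induct)
    case zero show ?case using J.zero_closed by simp
  next
    case (step g r q)
    have "r * g \<in> Idl\<^bsub>poly_ring S\<^esub> A" using J.I_l_closed[OF A'[OF step(1)], of r] step(2) by simp
    then show ?case using J.a_closed[of "r * g" q] step(4) by simp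
  qed
qed

lemma idl_union_pvars:
  assumes "p \<in> idl (G \<union> g ` {..<n :: nat})"
  shows "\<exists>d. p - (\<Sum>i<n. d i * g i) \<in> idl G"
  using assms
proof (induction rule: idl.induct)
  case idl_zero
  show ?case by (intro exI[of _ "\<lambda>_. 0"]) (simp add: idl.idl_zero)
next
  case (idl_step h p q)
  then obtain d where d: "p - (\<Sum>i<n. d i * g i) \<in> idl G" by blast
  from idl_step(1) consider "h \<in> G" | j where "j < n" "h = g j" by auto
  then show ?case
  proof cases
    case 1
    then have "q * h + (p - (\<Sum>i<n. d i * g i)) \<in> idl G" using d by (rule idl.idl_step)
    then show ?thesis by (intro exI[of _ d]) (simp add: add_diff_eq)
  next
    case 2
    have "(\<Sum>i<n. (d i + (if i = j then q else 0)) * g i) = (\<Sum>i<n. d i * g i) + (\<Sum>i<n. if i = j then q * g i else 0)"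
      unfolding sum.distrib[symmetric] by (intro sum.cong) (auto simp: distrib_right)
    then have "q * h + p - (\<Sum>i<n. (d i + (if i = j then q else 0)) * g i) = p - (\<Sum>i<n. d i * g i)"
      using 2 by simp
    then show ?thesis using d by metis
  qed
qed

lemma grade_component: "grade (coeff (grade p) i) = Polynomial.monom (coeff (grade p) i) i"
proof -
  interpret g: comm_ring_hom grade by (rule grade_hom)
  have "p \<in> polys UNIV" by simp
  then show ?thesis
  proof (induction p arbitrary: i rule: polys_induct)
    case (const a)
    show ?case by (cases i) (auto simp: grade_pconst monom_0)
  next
    case (var v)
    show ?case by (auto simp: grade_pvar)
  next
    case (add p q)
    then show ?case by (simp add: g.hom_add add_monom)
  next
    case (mult p q)
    have "grade (coeff (grade (p * q)) i) = (\<Sum>k\<le>i. grade (coeff (grade p) k) * grade (coeff (grade q) (i - k)))"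
      by (simp add: g.hom_mult coeff_mult g.hom_sum)
    also have "\<dots> = (\<Sum>k\<le>i. Polynomial.monom (coeff (grade p) k * coeff (grade q) (i - k)) i)"
      using mult by (intro sum.cong) (auto simp: mult_monom)
    finally show ?case by (simp add: g.hom_mult coeff_mult monom_sum)
  qed
qed

lemma lookup_zero_pvar: "Poly_Mapping.lookup (pvar v) 0 = 0"
proof -
  have "Poly_Mapping.single v (1 :: nat) \<noteq> 0" by (metis lookup_single_eq lookup_zero zero_neq_one)
  then show ?thesis by (simp add: pvar_def lookup_single when_def)
qed

lemma lookup_zero_component:
  fixes p :: "('v, 'k :: comm_ring_1) mvpoly"
  shows "Poly_Mapping.lookup (coeff (grade p) (Suc i)) 0 = 0"
proof -
  interpret g: comm_ring_hom "grade :: ('v, 'k) mvpoly \<Rightarrow> _" by (rule grade_hom)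
  interpret l: comm_ring_hom "\<lambda>p :: ('v, 'k) mvpoly. Poly_Mapping.lookup p 0" by (rule lookup_zero_hom)
  have "p \<in> polys UNIV" by simp
  then show ?thesis
  proof (induction p arbitrary: i rule: polys_induct)
    case (var v)
    show ?case by (simp add: grade_pvar lookup_zero_pvar)
  next
    case (mult p q)
    have "Poly_Mapping.lookup (coeff (grade p) k) 0 * Poly_Mapping.lookup (coeff (grade q) (Suc i - k)) 0 = 0"
      if "k \<le> Suc i" for k
      using mult that by (cases k) (auto simp: Suc_diff_le)
    then show ?case
      unfolding g.hom_mult coeff_mult lookup_sum by (intro sum.neutral) (auto simp: l.hom_mult)
  qed (auto simp: grade_pconst g.hom_add l.hom_add)
qed

section \<open>The Chow ring in terms of polynomials\<close>

context simple_matroid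
begin

abbreviation pr :: "('a set, rat) mvpoly \<Rightarrow> ('a set, rat) mvpoly set"
  where "pr \<equiv> chow_proj E indep"

abbreviation CH :: "('a set, rat) mvpoly set ring" where "CH \<equiv> chow_ring E indep"

lemma chow_gens_polys: "chow_gens \<subseteq> polys flats"
  unfolding chow_gens_def by (auto intro!: polys_sum polys_mult polys_pvar)

lemma chow_ideal_eq: "chow_ideal E indep = polys flats \<inter> idl chow_gens"
proof -
  let ?A = "{\<Sum>F\<in>{F \<in> flats. i \<in> F}. pvar F | i. i \<in> E} :: ('a set, rat) mvpoly set"
  let ?B = "{pvar F * pvar G | F G. F \<in> flats \<and> G \<in> flats \<and> \<not> F \<subseteq> G \<and> \<not> G \<subseteq> F} :: ('a set, rat) mvpoly set"
  have G: "chow_gens = ?A \<union> ?B" by (simp add: chow_gens_def)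
  have AB: "?A \<subseteq> polys flats" "?B \<subseteq> polys flats" using chow_gens_polys G by auto
  have I: "chow_I E indep = polys flats \<inter> idl ?A" "chow_J E indep = polys flats \<inter> idl ?B"
    unfolding chow_I_def chow_J_def by (rule genideal_poly_ring[OF AB(1)], rule genideal_poly_ring[OF AB(2)])
  have s: "chow_ideal E indep = {a + b | a b. a \<in> polys flats \<inter> idl ?A \<and> b \<in> polys flats \<inter> idl ?B}"
    unfolding chow_ideal_def I set_add_def' by auto
  show ?thesis
  proof (intro equalityI subsetI)
    fix p assume "p \<in> chow_ideal E indep"
    then obtain a b where ab: "p = a + b" "a \<in> polys flats" "a \<in> idl ?A" "b \<in> polys flats" "b \<in> idl ?B"
      unfolding s by blast
    have "a \<in> idl chow_gens" "b \<in> idl chow_gens"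
      using ab idl_mono[of ?A chow_gens a] idl_mono[of ?B chow_gens b] unfolding G by auto
    then show "p \<in> polys flats \<inter> idl chow_gens" using ab by (simp add: idl_add polys_add)
  next
    fix p assume "p \<in> polys flats \<inter> idl chow_gens"
    then have "p \<in> idl chow_gens" "p \<in> polys flats" by auto
    then show "p \<in> chow_ideal E indep" using chow_gens_polys
    proof (induction rule: polys_idl_induct)
      case zero
      have "(0 :: ('a set, rat) mvpoly) = 0 + 0" by simp
      then show ?case unfolding s using idl_zero polys_zero by blast
    next
      case (step g r q)
      then obtain a b where ab: "q = a + b" "a \<in> polys flats" "a \<in> idl ?A" "b \<in> polys flats" "b \<in> idl ?B"
        unfolding s by blast
      have rg: "r * g \<in> polys flats" using step chow_gens_polys polys_mult by blast
      show ?case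
      proof (cases "g \<in> ?A")
        case True
        then have "r * g + a \<in> polys flats \<inter> idl ?A" using ab rg by (simp add: polys_add idl.idl_step)
        moreover have "r * g + q = (r * g + a) + b" using ab by (simp add: add.assoc)
        ultimately show ?thesis unfolding s using ab by blast
      next
        case False
        then have "g \<in> ?B" using step(1) G by blast
        then have "r * g + b \<in> polys flats \<inter> idl ?B" using ab rg by (simp add: polys_add idl.idl_step)
        moreover have "r * g + q = a + (r * g + b)" using ab by (simp add: algebra_simps)
        ultimately show ?thesis unfolding s using ab by blast
      qed
    qed
  qed
qed

lemma ideal_chow: "ideal (chow_ideal E indep) (chow_poly_ring E indep)"
proof -
  interpret cring "chow_poly_ring E indep" by (rule poly_ring_cring)
  show ?thesis unfolding chow_ideal_eq genideal_poly_ring[OF chow_gens_polys, symmetric]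
    using chow_gens_polys by (intro genideal_ideal) simp
qed

lemma cring_CH: "cring CH"
  unfolding chow_ring_def by (rule ideal.quotient_is_cring[OF ideal_chow poly_ring_cring])

lemma carrier_CH: "carrier CH = pr ` polys flats"
  by (auto simp: chow_ring_def FactRing_def A_RCOSETS_def' chow_proj_def)

lemma pr_eq_iff: "p \<in> polys flats \<Longrightarrow> q \<in> polys flats \<Longrightarrow> pr p = pr q \<longleftrightarrow> p - q \<in> idl chow_gens"
  using ring.quotient_eq_iff_same_a_r_cos[OF cring.axioms(1)[OF poly_ring_cring] ideal_chow, of p q]
  by (simp add: chow_proj_def poly_ring_minus chow_ideal_eq polys_diff)

lemma pr_add: "p \<in> polys flats \<Longrightarrow> q \<in> polys flats \<Longrightarrow> pr p \<oplus>\<^bsub>CH\<^esub> pr q = pr (p + q)"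
  using ideal.a_rcos_sum[OF ideal_chow, of p q] by (simp add: chow_ring_def FactRing_def chow_proj_def)

lemma pr_mult: "p \<in> polys flats \<Longrightarrow> q \<in> polys flats \<Longrightarrow> pr p \<otimes>\<^bsub>CH\<^esub> pr q = pr (p * q)"
  using ideal.rcoset_mult_add[OF ideal_chow, of p q] by (simp add: chow_ring_def FactRing_def chow_proj_def)

lemma pr_one: "\<one>\<^bsub>CH\<^esub> = pr 1"
  by (simp add: chow_ring_def FactRing_def chow_proj_def)

lemma pr_zero: "\<zero>\<^bsub>CH\<^esub> = pr 0"
proof -
  interpret CH: cring CH by (rule cring_CH)
  have "pr 0 \<in> carrier CH" by (auto simp: carrier_CH)
  then show ?thesis using pr_add[OF polys_zero polys_zero] by (simp add: CH.add.l_cancel_one)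
qed

lemma pr_minus: "p \<in> polys flats \<Longrightarrow> q \<in> polys flats \<Longrightarrow> pr p \<ominus>\<^bsub>CH\<^esub> pr q = pr (p - q)"
proof -
  interpret CH: cring CH by (rule cring_CH)
  assume p: "p \<in> polys flats" and q: "q \<in> polys flats"
  have "\<ominus>\<^bsub>CH\<^esub> pr q = pr (- q)"
    using q polys_uminus[OF q] by (intro CH.minus_equality) (auto simp: pr_add pr_zero carrier_CH)
  then show ?thesis using p q polys_uminus[OF q] by (simp add: a_minus_def pr_add)
qed

lemma pr_sum:
  "finite A \<Longrightarrow> (\<And>i. i \<in> A \<Longrightarrow> f i \<in> polys flats) \<Longrightarrow> (\<Oplus>\<^bsub>CH\<^esub>i\<in>A. pr (f i)) = pr (\<Sum>i\<in>A. f i)"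
proof (induction A rule: finite_induct)
  case (insert i A)
  interpret CH: cring CH by (rule cring_CH)
  have "(\<Oplus>\<^bsub>CH\<^esub>i\<in>insert i A. pr (f i)) = pr (f i) \<oplus>\<^bsub>CH\<^esub> (\<Oplus>\<^bsub>CH\<^esub>i\<in>A. pr (f i))"
    using insert by (intro CH.finsum_insert) (auto simp: carrier_CH)
  then show ?case using insert by (simp add: pr_add polys_sum)
next
  case empty
  interpret CH: cring CH by (rule cring_CH)
  show ?case by (simp add: pr_zero)
qed

text \<open>A chosen polynomial in each class, through which maps on polynomials act on classes.
  Independence of the choice is the content of \<open>aug_pr\<close> and
  \<open>comp_pr\<close>.\<close>

definition rep :: "('a set, rat) mvpoly set \<Rightarrow> ('a set, rat) mvpoly"
  where "rep X = (SOME p. p \<in> polys flats \<and> pr p = X)"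

lemma rep:
  assumes p: "p \<in> polys flats" shows "rep (pr p) \<in> polys flats" "rep (pr p) - p \<in> idl chow_gens"
proof -
  have "rep (pr p) \<in> polys flats \<and> pr (rep (pr p)) = pr p" unfolding rep_def by (rule someI[of _ p]) (simp add: p)
  then show "rep (pr p) \<in> polys flats" "rep (pr p) - p \<in> idl chow_gens" using p pr_eq_iff by auto
qed

lemma chow_gens_grade: "g \<in> chow_gens \<Longrightarrow> \<exists>d. grade g = Polynomial.monom g d"
proof -
  interpret g: comm_ring_hom "grade :: ('a set, rat) mvpoly \<Rightarrow> _" by (rule grade_hom)
  assume "g \<in> chow_gens"
  then consider i where "g = (\<Sum>F\<in>{F \<in> flats. i \<in> F}. pvar F)" | F G where "g = pvar F * pvar G"
    unfolding chow_gens_def by blast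
  then show ?thesis
  proof cases
    case 1
    then show ?thesis by (intro exI[of _ 1]) (simp add: g.hom_sum grade_pvar monom_sum)
  next
    case 2
    then show ?thesis by (intro exI[of _ 2]) (simp add: g.hom_mult grade_pvar mult_monom numeral_2_eq_2)
  qed
qed

lemma chow_const_zero: "p \<in> idl chow_gens \<Longrightarrow> Poly_Mapping.lookup p 0 = 0"
proof -
  interpret l: comm_ring_hom "\<lambda>p :: ('a set, rat) mvpoly. Poly_Mapping.lookup p 0" by (rule lookup_zero_hom)
  assume "p \<in> idl chow_gens"
  then show "Poly_Mapping.lookup p 0 = 0"
  proof (induction rule: idl.induct)
    case (idl_step g p q)
    have "Poly_Mapping.lookup g 0 = 0"
      using idl_step(1) unfolding chow_gens_def by (auto simp: lookup_zero_pvar lookup_sum l.hom_mult)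
    then show ?case using idl_step by (simp add: l.hom_add l.hom_mult)
  qed simp
qed

definition aug :: "('a set, rat) mvpoly set \<Rightarrow> rat"
  where "aug X = Poly_Mapping.lookup (rep X) 0"

definition comp :: "nat \<Rightarrow> ('a set, rat) mvpoly set \<Rightarrow> ('a set, rat) mvpoly set"
  where "comp i X = pr (coeff (grade (rep X)) i)"

lemma aug_pr: "p \<in> polys flats \<Longrightarrow> aug (pr p) = Poly_Mapping.lookup p 0"
  using chow_const_zero[OF rep(2)] by (simp add: aug_def lookup_minus)

lemma comp_pr: "p \<in> polys flats \<Longrightarrow> comp i (pr p) = pr (coeff (grade p) i)"
proof -
  interpret g: comm_ring_hom "grade :: ('a set, rat) mvpoly \<Rightarrow> _" by (rule grade_hom)
  assume p: "p \<in> polys flats"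
  have "coeff (grade (rep (pr p) - p)) i \<in> idl chow_gens"
    by (rule idl_grade_coeff[OF chow_gens_grade rep(2)[OF p]])
  then show ?thesis using p rep(1)[OF p] by (simp add: comp_def g.hom_minus pr_eq_iff grade_coeff)
qed

text \<open>The condition on \<open>grade\<close> says homogeneous of degree one, zero
  included.\<close>

definition linear_part :: "('a set, rat) mvpoly set set"
  where "linear_part = {pr p | p. p \<in> polys flats \<and> grade p = Polynomial.monom p 1}"

text \<open>Links the finite combinations in the Chow ring that \<open>linear_family\<close> speaks
  of to the ideals of polynomials for which the colon ideals were computed.\<close>

lemma pr_span_iff:
  assumes p: "p \<in> polys flats" and ks: "set ks \<subseteq> flats" and n: "n \<le> length ks"
  shows "(\<exists>c\<in>UNIV \<rightarrow> carrier CH. pr p = (\<Oplus>\<^bsub>CH\<^esub>i\<in>{..<n}. c i \<otimes>\<^bsub>CH\<^esub> map (\<lambda>K. pr (pvar K)) ks ! i)) \<longleftrightarrow>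
    p \<in> idl (chow_gens \<union> pvar ` set (take n ks))"
proof -
  interpret CH: cring CH by (rule cring_CH)
  let ?N = "chow_gens \<union> pvar ` set (take n ks) :: ('a set, rat) mvpoly set"
  have k: "pvar (ks ! i) \<in> (polys flats :: ('a set, rat) mvpoly set)" if "i < n" for i
    using that n ks by (intro polys_pvar) auto
  have s: "(\<Oplus>\<^bsub>CH\<^esub>i\<in>{..<n}. pr (d i) \<otimes>\<^bsub>CH\<^esub> map (\<lambda>K. pr (pvar K)) ks ! i) = pr (\<Sum>i<n. d i * pvar (ks ! i))"
    if d: "\<And>i. d i \<in> polys flats" for d
  proof -
    have "(\<Oplus>\<^bsub>CH\<^esub>i\<in>{..<n}. pr (d i) \<otimes>\<^bsub>CH\<^esub> map (\<lambda>K. pr (pvar K)) ks ! i) = (\<Oplus>\<^bsub>CH\<^esub>i\<in>{..<n}. pr (d i * pvar (ks ! i)))"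
      using d k n by (intro CH.finsum_cong') (auto simp: pr_mult carrier_CH polys_mult)
    also have "\<dots> = pr (\<Sum>i<n. d i * pvar (ks ! i))"
      using d k by (intro pr_sum) (auto simp: polys_mult)
    finally show ?thesis .
  qed
  have c: "(\<Sum>i<n. d i * pvar (ks ! i)) \<in> polys flats" if "\<And>i. d i \<in> polys flats" for d :: "nat \<Rightarrow> ('a set, rat) mvpoly"
    using that k by (intro polys_sum polys_mult) auto
  have tk: "pvar ` set (take n ks) = ((\<lambda>i. pvar (ks ! i)) ` {..<n} :: ('a set, rat) mvpoly set)"
    unfolding nth_image[OF n, symmetric] by (simp add: image_image atLeast0LessThan)
  show ?thesis
  proof
    assume "\<exists>c\<in>UNIV \<rightarrow> carrier CH. pr p = (\<Oplus>\<^bsub>CH\<^esub>i\<in>{..<n}. c i \<otimes>\<^bsub>CH\<^esub> map (\<lambda>K. pr (pvar K)) ks ! i)"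
    then obtain c where c': "c \<in> UNIV \<rightarrow> carrier CH" "pr p = (\<Oplus>\<^bsub>CH\<^esub>i\<in>{..<n}. c i \<otimes>\<^bsub>CH\<^esub> map (\<lambda>K. pr (pvar K)) ks ! i)"
      by blast
    have "\<forall>i. \<exists>d. d \<in> polys flats \<and> c i = pr d" using c'(1) by (auto simp: carrier_CH)
    then obtain d where d: "\<And>i. d i \<in> polys flats" "\<And>i. c i = pr (d i)" by metis
    have "p - (\<Sum>i<n. d i * pvar (ks ! i)) \<in> idl chow_gens"
      using c'(2) unfolding d(2) s[OF d(1)] pr_eq_iff[OF p c[OF d(1)]] .
    then have "p - (\<Sum>i<n. d i * pvar (ks ! i)) \<in> idl ?N" by (rule idl_mono[rotated]) simp
    moreover have "(\<Sum>i<n. d i * pvar (ks ! i)) \<in> idl ?N"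
      unfolding tk by (intro idl_sum idl_mult idl_base) auto
    ultimately show "p \<in> idl ?N" by (rule idl_cong_mem)
  next
    assume "p \<in> idl ?N"
    then obtain d where d: "p - (\<Sum>i<n. d i * pvar (ks ! i)) \<in> idl chow_gens"
      using idl_union_pvars[of p chow_gens "\<lambda>i. pvar (ks ! i)" n] unfolding tk by blast
    interpret r: comm_ring_hom "restr flats :: ('a set, rat) mvpoly \<Rightarrow> _" by (rule restr_hom)
    \<comment> \<open>The coefficients supplied by \<open>idl\<close> may contain variables of sets
      that are not flats; \<open>restr flats\<close> removes these and fixes \<open>p\<close> and
      the generators.\<close>
    have "restr flats (p - (\<Sum>i<n. d i * pvar (ks ! i))) \<in> idl chow_gens"
    proof (rule idl_hom[OF restr_hom _ d])
      fix g assume "g \<in> chow_gens"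
      then show "restr flats g \<in> idl chow_gens" using chow_gens_polys restr_id[of g flats] idl_base[of g chow_gens] by auto
    qed
    moreover have "restr flats (p - (\<Sum>i<n. d i * pvar (ks ! i))) = p - (\<Sum>i<n. restr flats (d i) * pvar (ks ! i))"
      using p k by (simp add: r.hom_minus r.hom_sum r.hom_mult restr_id)
    moreover have rc: "restr flats (d i) \<in> polys flats" for i using restr_in_polys[of "d i" UNIV flats] by simp
    ultimately have "pr p = pr (\<Sum>i<n. restr flats (d i) * pvar (ks ! i))"
      using pr_eq_iff[OF p c, of "\<lambda>i. restr flats (d i)"] by simp
    then have "pr p = (\<Oplus>\<^bsub>CH\<^esub>i\<in>{..<n}. pr (restr flats (d i)) \<otimes>\<^bsub>CH\<^esub> map (\<lambda>K. pr (pvar K)) ks ! i)"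
      unfolding s[of "\<lambda>i. restr flats (d i)", OF rc] .
    moreover have "(\<lambda>i. pr (restr flats (d i))) \<in> UNIV \<rightarrow> carrier CH" using rc by (auto simp: carrier_CH)
    ultimately show "\<exists>c\<in>UNIV \<rightarrow> carrier CH. pr p = (\<Oplus>\<^bsub>CH\<^esub>i\<in>{..<n}. c i \<otimes>\<^bsub>CH\<^esub> map (\<lambda>K. pr (pvar K)) ks ! i)"
      by (intro bexI[of _ "\<lambda>i. pr (restr flats (d i))"])
  qed
qed

lemma linear_quotients_nth:
  "linear_quotients N ls \<Longrightarrow> j < length ls \<Longrightarrow> \<exists>W. colon_ok (N \<union> set (take j ls)) (ls ! j) W"
proof (induction ls arbitrary: N j)
  case (Cons K ls)
  show ?case
  proof (cases j)
    case (Suc i)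
    then have "\<exists>W. colon_ok (insert K N \<union> set (take i ls)) (ls ! i) W" using Cons.prems by (intro Cons.IH) auto
    then show ?thesis using Suc by simp
  qed (use Cons in simp)
qed simp

definition gen_list :: "'a set \<times> 'a set \<Rightarrow> 'a set list"
  where "gen_list l = (SOME ls. linear_quotients {} ls \<and> idl (chow_gens \<union> pvar ` set ls) = idl (Igens (fst l) (snd l)))"

definition next_label :: "'a set \<times> 'a set \<Rightarrow> nat \<Rightarrow> 'a set \<times> 'a set"
  where "next_label l j = (gen_list l ! j, SOME W. colon_ok (set (take j (gen_list l))) (gen_list l ! j) W)"

lemma gen_list:
  assumes "l \<in> labels"
  shows "linear_quotients {} (gen_list l)" "idl (chow_gens \<union> pvar ` set (gen_list l)) = idl (Igens (fst l) (snd l))"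
proof -
  have "\<exists>ls. linear_quotients {} ls \<and> idl (chow_gens \<union> pvar ` set ls) = idl (Igens (fst l) (snd l))"
    using ex_linear_quotients[of "fst l" "snd l"] assms by simp
  from someI_ex[OF this] show "linear_quotients {} (gen_list l)"
    "idl (chow_gens \<union> pvar ` set (gen_list l)) = idl (Igens (fst l) (snd l))" unfolding gen_list_def by auto
qed

lemma next_label:
  assumes "l \<in> labels" "j < length (gen_list l)"
  shows "colon_ok (set (take j (gen_list l))) (gen_list l ! j) (snd (next_label l j))"
  using linear_quotients_nth[OF gen_list(1)[OF assms(1)] assms(2)]
  unfolding next_label_def by (auto intro: someI_ex)

lemma gen_list_flats: "l \<in> labels \<Longrightarrow> set (gen_list l) \<subseteq> flats"
proof
  fix K assume l: "l \<in> labels" and "K \<in> set (gen_list l)"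
  then obtain j where j: "j < length (gen_list l)" "K = gen_list l ! j" by (auto simp: in_set_conv_nth)
  then show "K \<in> flats" using next_label[OF l j(1)] by (simp add: colon_ok_def)
qed

lemma augmented_CH: "augmented CH aug (chow_scalar E indep)"
proof (intro augmented.intro augmented_axioms.intro cring_CH)
  interpret l: comm_ring_hom "\<lambda>p :: ('a set, rat) mvpoly. Poly_Mapping.lookup p 0" by (rule lookup_zero_hom)
  fix X Y assume "X \<in> carrier CH" "Y \<in> carrier CH"
  then obtain p q where p: "p \<in> polys flats" "X = pr p" and q: "q \<in> polys flats" "Y = pr q"
    by (auto simp: carrier_CH)
  show "aug (X \<oplus>\<^bsub>CH\<^esub> Y) = aug X + aug Y" "aug (X \<otimes>\<^bsub>CH\<^esub> Y) = aug X * aug Y"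
    unfolding p(2) q(2) using p(1) q(1) by (simp_all add: pr_add pr_mult aug_pr polys_add polys_mult l.hom_add l.hom_mult)
next
  show "aug \<one>\<^bsub>CH\<^esub> = 1" by (simp add: pr_one aug_pr lookup_one)
  show "chow_scalar E indep c \<in> carrier CH" for c by (auto simp: chow_scalar_def carrier_CH)
  show "aug (chow_scalar E indep c) = c" for c by (simp add: chow_scalar_def aug_pr) (simp add: pconst_def)
  show "chow_scalar E indep (a + b) = chow_scalar E indep a \<oplus>\<^bsub>CH\<^esub> chow_scalar E indep b" for a b
    by (simp add: chow_scalar_def pr_add pconst_add)
  show "chow_scalar E indep 1 = \<one>\<^bsub>CH\<^esub>" by (simp add: chow_scalar_def pr_one pconst_def)
qed

lemma const_zero_mem:
  assumes "p \<in> polys flats" "Poly_Mapping.lookup p 0 = 0" shows "p \<in> idl (pvar ` flats)"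
  using restr_diff[OF assms(1), of "{}"] assms(2) by (simp add: restr_empty pconst_def)

text \<open>A homogeneous polynomial of positive degree has no constant coefficient. Conversely, a
  polynomial without constant coefficient lies in the ideal of the variables, and these are
  homogeneous of degree one.\<close>

lemma chow_irrelevant_eq: "chow_irrelevant E indep = {X \<in> carrier CH. aug X = 0}"
proof -
  interpret aug: augmented CH aug "chow_scalar E indep" by (rule augmented_CH)
  let ?S = "{pr p | p d. p \<in> carrier (chow_poly_ring E indep) \<and> homogeneous d p \<and> 0 < d}"
  have S: "?S \<subseteq> carrier CH" by (auto simp: carrier_CH)
  have "?S \<subseteq> {X \<in> carrier CH. aug X = 0}"
  proof
    fix X assume "X \<in> ?S"
    then obtain p d where p: "X = pr p" "p \<in> polys flats" "homogeneous d p" "0 < d" by auto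
    have "0 \<notin> Poly_Mapping.keys p" using p(3,4) by (auto simp: homogeneous_def)
    then show "X \<in> {X \<in> carrier CH. aug X = 0}" using p by (auto simp: carrier_CH aug_pr in_keys_iff)
  qed
  then have "chow_irrelevant E indep \<subseteq> {X \<in> carrier CH. aug X = 0}"
    using aug.genideal_minimal[OF aug.ideal_m] unfolding chow_irrelevant_def aug.\<mm>_def by blast
  moreover have "pr p \<in> chow_irrelevant E indep" if "p \<in> polys flats" "Poly_Mapping.lookup p 0 = 0" for p
  proof -
    interpret I: ideal "chow_irrelevant E indep" CH
      unfolding chow_irrelevant_def by (rule aug.genideal_ideal[OF S])
    have "?S \<subseteq> chow_irrelevant E indep" unfolding chow_irrelevant_def by (rule aug.genideal_self[OF S])
    moreover have "homogeneous 1 (pvar K :: ('a set, rat) mvpoly)" for K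
      by (simp add: homogeneous_def pvar_def)
    ultimately have v: "pr (pvar K) \<in> chow_irrelevant E indep" if "K \<in> flats" for K
      using polys_pvar[OF that] by fastforce
    have "pvar ` flats \<subseteq> (polys flats :: ('a set, rat) mvpoly set)" by (auto intro: polys_pvar)
    with const_zero_mem[OF that] that(1) show ?thesis
    proof (induction rule: polys_idl_induct)
      case zero
      then show ?case using I.zero_closed pr_zero by simp
    next
      case (step g r q)
      then obtain K where K: "K \<in> flats" "g = pvar K" by blast
      have g: "g \<in> polys flats" unfolding K(2) by (rule polys_pvar[OF K(1)])
      have "pr r \<otimes>\<^bsub>CH\<^esub> pr g \<in> chow_irrelevant E indep"
        using I.I_l_closed[OF v[OF K(1)], of "pr r"] K step(2) by (auto simp: carrier_CH)
      then have "pr (r * g) \<oplus>\<^bsub>CH\<^esub> pr q \<in> chow_irrelevant E indep"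
        using I.a_closed step g by (simp add: pr_mult)
      then show ?case using step g by (simp add: pr_add polys_mult)
    qed
  qed
  ultimately show ?thesis by (auto simp: carrier_CH aug_pr)
qed

lemma chow_linear_family:
  "linear_family CH aug (chow_scalar E indep) linear_part (comp 1) (comp 2) labels ({}, {})
    (\<lambda>l. map (\<lambda>K. pr (pvar K)) (gen_list l)) next_label"
proof (intro linear_family.intro linear_family_axioms.intro augmented_CH labels_empty finite_labels)
  interpret aug: augmented CH aug "chow_scalar E indep" by (rule augmented_CH)
  interpret g: comm_ring_hom "grade :: ('a set, rat) mvpoly \<Rightarrow> _" by (rule grade_hom)
  show "X \<in> carrier CH \<and> aug X = 0" if "X \<in> linear_part" for X
  proof -
    obtain p where p: "X = pr p" "p \<in> polys flats" "grade p = Polynomial.monom p 1" using \<open>X \<in> linear_part\<close> by (auto simp: linear_part_def)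
    have "p = coeff (grade p) (Suc 0)" using p(3) by simp
    then have "Poly_Mapping.lookup p 0 = 0" using lookup_zero_component[of p 0] by metis
    then show ?thesis using p by (auto simp: carrier_CH aug_pr)
  qed
  show "\<zero>\<^bsub>CH\<^esub> \<in> linear_part"
    unfolding linear_part_def pr_zero by (intro CollectI exI[of _ 0]) simp
  show "X \<ominus>\<^bsub>CH\<^esub> Y \<in> linear_part" if "X \<in> linear_part" "Y \<in> linear_part" for X Y
  proof -
    obtain p q where p: "X = pr p" "p \<in> polys flats" "grade p = Polynomial.monom p 1"
      and q: "Y = pr q" "q \<in> polys flats" "grade q = Polynomial.monom q 1"
      using \<open>X \<in> linear_part\<close> \<open>Y \<in> linear_part\<close> unfolding linear_part_def by blast
    have "grade (p - q) = Polynomial.monom (p - q) 1" using p q by (simp add: g.hom_minus diff_monom)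
    then show ?thesis using p q by (auto simp: linear_part_def pr_minus intro!: exI[of _ "p - q"] polys_diff)
  qed
  show "comp 1 X \<in> linear_part" if "X \<in> carrier CH" for X
  proof -
    obtain p where p: "X = pr p" "p \<in> polys flats" using \<open>X \<in> carrier CH\<close> by (auto simp: carrier_CH)
    show ?thesis unfolding p(1) comp_pr[OF p(2)] linear_part_def
      using grade_component[of p 1] grade_coeff[OF p(2)] by blast
  qed
  show "comp 1 X = X" if "X \<in> linear_part" for X
    using that by (auto simp: linear_part_def comp_pr)
  show "comp 2 X \<in> carrier CH" if "X \<in> carrier CH" for X
    using that by (auto simp: carrier_CH comp_pr grade_coeff)
  show "comp 2 (X \<oplus>\<^bsub>CH\<^esub> Y) = comp 2 X \<oplus>\<^bsub>CH\<^esub> comp 2 Y" if "X \<in> carrier CH" "Y \<in> carrier CH" for X Y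
    using that by (auto simp: carrier_CH comp_pr pr_add grade_coeff polys_add g.hom_add)
  show "comp 2 (X \<otimes>\<^bsub>CH\<^esub> Y) = X \<otimes>\<^bsub>CH\<^esub> comp 1 Y" if "X \<in> linear_part" "Y \<in> carrier CH" for X Y
  proof -
    obtain p q where p: "X = pr p" "p \<in> polys flats" "grade p = Polynomial.monom p 1"
      and q: "Y = pr q" "q \<in> polys flats"
      using \<open>X \<in> linear_part\<close> \<open>Y \<in> carrier CH\<close> unfolding linear_part_def carrier_CH by blast
    have "coeff (grade (p * q)) 2 = p * coeff (grade q) 1" using p by (simp add: g.hom_mult coeff_monom_mult)
    then show ?thesis unfolding p(1) q(1) using p q by (simp add: pr_mult comp_pr polys_mult grade_coeff)
  qed
  fix l :: "'a set \<times> 'a set" and j assume l: "l \<in> labels" and j': "j < length (map (\<lambda>K. pr (pvar K)) (gen_list l))"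
  then have j: "j < length (gen_list l)" by simp
  let ?K = "gen_list l ! j"
  have K: "?K \<in> flats" using gen_list_flats[OF l] j by auto
  have vK: "pvar ?K \<in> (polys flats :: ('a set, rat) mvpoly set)" by (rule polys_pvar[OF K])
  show "map (\<lambda>K. pr (pvar K)) (gen_list l) ! j \<in> linear_part"
    using j vK grade_pvar[of ?K] by (auto simp: linear_part_def)
  have nl: "next_label l j = (?K, snd (next_label l j))" by (simp add: next_label_def)
  note ok = next_label[OF l j]
  show nlab: "next_label l j \<in> labels" using ok nl by (simp add: colon_ok_def)
  fix X assume "X \<in> carrier CH"
  then obtain p where p: "X = pr p" "p \<in> polys flats" by (auto simp: carrier_CH)
  have "X \<otimes>\<^bsub>CH\<^esub> map (\<lambda>K. pr (pvar K)) (gen_list l) ! j = pr (pvar ?K * p)"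
    using p vK j by (simp add: pr_mult mult.commute)
  then have "(\<exists>c\<in>UNIV \<rightarrow> carrier CH. X \<otimes>\<^bsub>CH\<^esub> map (\<lambda>K. pr (pvar K)) (gen_list l) ! j =
      (\<Oplus>\<^bsub>CH\<^esub>i\<in>{..<j}. c i \<otimes>\<^bsub>CH\<^esub> map (\<lambda>K. pr (pvar K)) (gen_list l) ! i)) \<longleftrightarrow>
    pvar ?K * p \<in> idl (chow_gens \<union> pvar ` set (take j (gen_list l)))"
    using pr_span_iff[OF polys_mult[OF vK p(2)] gen_list_flats[OF l], of j] j by simp
  also have "\<dots> \<longleftrightarrow> p \<in> idl (Igens ?K (snd (next_label l j)))" using ok p(2) by (simp add: colon_ok_def)
  also have "\<dots> \<longleftrightarrow> p \<in> idl (chow_gens \<union> pvar ` set (gen_list (next_label l j)))"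
    unfolding gen_list(2)[OF nlab] using nl by (metis fst_conv)
  also have "\<dots> \<longleftrightarrow> (\<exists>c\<in>UNIV \<rightarrow> carrier CH. X =
      (\<Oplus>\<^bsub>CH\<^esub>i\<in>{..<length (map (\<lambda>K. pr (pvar K)) (gen_list (next_label l j)))}.
        c i \<otimes>\<^bsub>CH\<^esub> map (\<lambda>K. pr (pvar K)) (gen_list (next_label l j)) ! i))"
    using pr_span_iff[OF p(2) gen_list_flats[OF nlab], of "length (gen_list (next_label l j))"] p(1) by simp
  finally show "(\<exists>c\<in>UNIV \<rightarrow> carrier CH. X \<otimes>\<^bsub>CH\<^esub> map (\<lambda>K. pr (pvar K)) (gen_list l) ! j =
      (\<Oplus>\<^bsub>CH\<^esub>i\<in>{..<j}. c i \<otimes>\<^bsub>CH\<^esub> map (\<lambda>K. pr (pvar K)) (gen_list l) ! i)) \<longleftrightarrow>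
    (\<exists>c\<in>UNIV \<rightarrow> carrier CH. X =
      (\<Oplus>\<^bsub>CH\<^esub>i\<in>{..<length (map (\<lambda>K. pr (pvar K)) (gen_list (next_label l j)))}.
        c i \<otimes>\<^bsub>CH\<^esub> map (\<lambda>K. pr (pvar K)) (gen_list (next_label l j)) ! i))" .
next
  interpret aug: augmented CH aug "chow_scalar E indep" by (rule augmented_CH)
  fix X assume "X \<in> aug.\<mm>"
  then obtain p where p: "X = pr p" "p \<in> polys flats" "Poly_Mapping.lookup p 0 = 0"
    by (auto simp: aug.\<mm>_def carrier_CH aug_pr)
  \<comment> \<open>No nonempty flat is contained in \<open>{}\<close>, so all variables belong to
    \<open>Igens {} {}\<close>; this is why the paths start at the label
    \<open>({}, {})\<close>.\<close>
  have "p \<in> idl (Igens {} {})"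
    using const_zero_mem[OF p(2,3)] by (rule idl_mono[rotated]) (auto simp: Igens_def flats_iff)
  then have "p \<in> idl (chow_gens \<union> pvar ` set (gen_list ({}, {})))" using gen_list(2)[OF labels_empty] by simp
  then show "\<exists>c\<in>UNIV \<rightarrow> carrier CH. X =
      (\<Oplus>\<^bsub>CH\<^esub>i\<in>{..<length (map (\<lambda>K. pr (pvar K)) (gen_list ({}, {})))}.
        c i \<otimes>\<^bsub>CH\<^esub> map (\<lambda>K. pr (pvar K)) (gen_list ({}, {})) ! i)"
    using pr_span_iff[OF p(2) gen_list_flats[OF labels_empty], of "length (gen_list ({}, {}))"] p(1) by simp
qed

end

theorem theorem1p2:
  fixes E :: "'a set" and indep :: "'a set \<Rightarrow> bool"
  assumes "simple_matroid E indep"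
  shows "rational_fps (poincare_series (chow_ring E indep) (chow_scalar E indep)
    (chow_residue_field E indep))"
proof -
  interpret simple_matroid E indep by (rule assms)
  interpret linear_family CH aug "chow_scalar E indep" linear_part "comp 1" "comp 2" labels "({}, {})"
    "\<lambda>l. map (\<lambda>K. pr (pvar K)) (gen_list l)" next_label
    by (rule chow_linear_family)
  have "chow_residue_field E indep = quot_ring_module CH \<mm>"
    unfolding chow_residue_field_def chow_irrelevant_eq \<mm>_def ..
  then show ?thesis using rational_poincare by simp
qed

end
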